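(* Let $n\ge 3$, let $P$ be a minimal parabolic subgroup of $G=\mathrm{SL}(n,\mathbb R)$ with unipotent radical $N_P$, and let $dx$ be a non-zero $N_P$-invariant Radon measure on $N_P/(N_P\cap H)$. Then the integral $$\int_{N_P/(N_P\cap H)}\phi(x\cdot H)\,dx$$ is absolutely convergent for every Schwartz function $\phi\in\mathcal C(X_n)$ if and only if $P$ is $\mathfrak h$-compatible.
   Context: Let $n\ge3$, $G=\mathrm{SL}(n,\mathbb R)$, $\mathfrak g=\mathfrak{sl}(n,\mathbb R)$. Let $S$ be the $n\times n$ matrix defined by $Se_1=-e_n$, $Se_n=-e_1$, $Se_j=e_j$ for $2\le j\le n-1$ (standard basis vectors), $\sigma(g)=SgS^{-1}$ (also its differential on $\mathfrak g$), and $H=G^\sigma$, which is conjugate in $G$ to $S(\mathrm{GL}(n-1,\mathbb R)\times\mathrm{GL}(1,\mathbb R))$. Put $X_n=G/H$; write $\mathfrak g=\mathfrak h\oplus\mathfrak q$ for the $\pm1$ eigenspaces of $\sigma$. Let $K=\mathrm{SO}(n)$ and $a_t=\mathrm{diag}(e^t,1,\dots,1,e^{-t})$. Every point of $X_n$ has the form $ka_t\cdot H$ with $k\in K$, $t\in\mathbb R$. Schwartz space: $\mathcal C(X_n)$ is the space of smooth $\phi:X_n\to\mathbb C$ such that for all $u\in U(\mathfrak g)$ (acting by the left regular action) and $m\ge0$, $\sup_{k\in K,t\in\mathbb R}\cosh^{n-1}(t)(1+|t|)^m|(u\phi)(ka_t\cdot H)|<\infty$, with the topology given by these seminorms. A split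 component of a minimal parabolic subgroup $P$ is a maximal connected split subgroup of the center of a Levi subgroup of $P$. Every minimal parabolic $P$ has a $\sigma$-stable split component $A$, unique up to conjugation by $N_P\cap H$; let $\mathfrak a$ be its Lie algebra. The $\sigma$-parabolic rank of $P$ is $\dim(A/(A\cap H))$, which is $0$ or $1$ here. $\Sigma(\mathfrak a)$ is the root system of $\mathfrak a$ in $\mathfrak g$, $\Sigma(\mathfrak a;P)$ is the set of roots $\alpha$ with $\mathfrak g_\alpha\subseteq\mathfrak n_P=\mathrm{Lie}(N_P)$, $\Sigma_{\mathfrak h}(\mathfrak a)=\{\alpha\in\Sigma(\mathfrak a):\mathfrak g_\alpha\cap\mathfrak h\ne\{0\}\}$, and $\rho_{P,\mathfrak h}=\frac12\sum_{\alpha\in\Sigma(\mathfrak a;P)\cap\Sigma_{\mathfrak h}(\mathfrak a)}\alpha$. Let $\langle\cdot,\cdot\rangle$ be the inner product on $\mathfrak a^*$ dual to the restriction of the form $(X,Y)\mapsto\mathrm{tr}(XY)$ to $\mathfrak a$. $P$ is called $\mathfrak h$-compatible if either (a) $P$ has $\sigma$-parabolic rank $1$ and $\langle\alpha,\rho_{P,\mathfrak h}\rangle\ge0$ for all $\alpha\in\Sigma(\mathfrak a;P)$, or (b) $P$ has $\sigma$-parabolic rank $0$ and $\langle\alpha,\rho_{P,\mathfrak h}\rangle>0$ for all $\alpha\in\Sigma(\mathfrak a;P)$. This does not depend on the choice of $A$. *)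

theory Defs
  imports "HOL-Analysis.Analysis" "HOL-Algebra.Left_Coset"
begin

text \<open>The rows and columns of an \<open>n \<times> n\<close> matrix are indexed by a linearly ordered finite type \<open>'n\<close>
  with \<open>n = CARD('n)\<close>; the order is needed to speak of the first and the last basis vector.\<close>

type_synonym 'n sqmat = "((real, 'n) vec, 'n) vec"

definition SL :: "('n::finite) sqmat monoid"
  where "SL = \<lparr>carrier = {g. det g = 1}, mult = (**), one = mat 1\<rparr>"

definition sl :: "('n::finite) sqmat set"
  where "sl = {X. trace X = 0}"

definition lie_bracket :: "('n::finite) sqmat \<Rightarrow> 'n sqmat \<Rightarrow> 'n sqmat"
  where "lie_bracket X Y = X ** Y - Y ** X"

definition mat_power :: "('n::finite) sqmat \<Rightarrow> nat \<Rightarrow> 'n sqmat"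
  where "mat_power X k = (((**) X) ^^ k) (mat 1)"

definition mat_exp :: "('n::finite) sqmat \<Rightarrow> 'n sqmat"
  where "mat_exp X = (\<Sum>k. mat_power X k /\<^sub>R fact k)"

text \<open>This is the Lie algebra only for closed \<open>A\<close>.\<close>

definition lie_algebra :: "('n::finite) sqmat set \<Rightarrow> 'n sqmat set"
  where "lie_algebra A = {X. \<forall>t::real. mat_exp (t *\<^sub>R X) \<in> A}"

definition first_idx :: "'n::{finite,linorder}"
  where "first_idx = Min UNIV"

definition last_idx :: "'n::{finite,linorder}"
  where "last_idx = Max UNIV"

definition S_mat :: "('n::{finite,linorder}) sqmat"
  where "S_mat = (\<chi> i j.
    if j = first_idx then (if i = last_idx then -1 else 0)
    else if j = last_idx then (if i = first_idx then -1 else 0)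
    else if i = j then 1 else 0)"

lemma S_mat_axis:
  fixes j :: "'n::{finite,linorder}"
  shows "S_mat *v axis first_idx 1 = - axis (last_idx :: 'n) 1"
    and "S_mat *v axis last_idx 1 = - axis (first_idx :: 'n) 1"
    and "j \<noteq> first_idx \<Longrightarrow> j \<noteq> last_idx \<Longrightarrow> S_mat *v axis j 1 = axis j 1"
  unfolding matrix_vector_mult_basis
  by (auto simp: vec_eq_iff column_def S_mat_def axis_def)

text \<open>\<open>\<sigma>\<close> is linear, so the same formula gives its differential on \<open>sl\<close>.\<close>

definition sigma_inv :: "'n sqmat \<Rightarrow> ('n::{finite,linorder}) sqmat"
  where "sigma_inv g = S_mat ** g ** matrix_inv S_mat"

definition H_grp :: "('n::{finite,linorder}) sqmat set"
  where "H_grp = {g \<in> carrier SL. sigma_inv g = g}"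

definition h_alg :: "('n::{finite,linorder}) sqmat set"
  where "h_alg = {X \<in> sl. sigma_inv X = X}"

definition SO :: "('n::finite) sqmat set"
  where "SO = {k. orthogonal_matrix k \<and> det k = 1}"

definition a_elt :: "real \<Rightarrow> ('n::{finite,linorder}) sqmat"
  where "a_elt t = (\<chi> i j.
    if i \<noteq> j then 0
    else if i = first_idx then exp t
    else if i = last_idx then exp (- t)
    else 1)"

text \<open>For open \<open>U\<close> only: the derivatives are taken in the ambient space.\<close>

primrec C_k_on :: "nat \<Rightarrow> ('a::real_normed_vector \<Rightarrow> 'b::real_normed_vector) \<Rightarrow> 'a set \<Rightarrow> bool"
  where
    "C_k_on 0 f U \<longleftrightarrow> continuous_on U f"
  | "C_k_on (Suc k) f U \<longleftrightarrow> (\<forall>x\<in>U. f differentiable (at x)) \<and>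
      (\<forall>v. C_k_on k (\<lambda>x. frechet_derivative f (at x) v) U)"

text \<open>Smoothness on the closed submanifold \<open>SL\<close> of the space of matrices: local smooth extendability.\<close>

definition smooth_on_SL :: "(('n::finite) sqmat \<Rightarrow> complex) \<Rightarrow> bool"
  where "smooth_on_SL f \<longleftrightarrow> (\<forall>g\<in>carrier SL. \<exists>U F. open U \<and> g \<in> U \<and>
    (\<forall>k. C_k_on k F U) \<and> (\<forall>x\<in>U \<inter> carrier SL. F x = f x))"

text \<open>Points of \<open>G/H\<close> are left cosets \<open>g <# H\<close>; functions on \<open>G/H\<close> are total functions on sets of
  matrices, of which only the values on left cosets of \<open>H\<close> in \<open>SL\<close> matter.
  Since \<open>G \<rightarrow> G/H\<close> is a surjective submersion, smoothness on \<open>G/H\<close> may be tested on \<open>G\<close>.\<close>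

definition smooth_on_X :: "(('n::{finite,linorder}) sqmat set \<Rightarrow> complex) \<Rightarrow> bool"
  where "smooth_on_X \<phi> \<longleftrightarrow> smooth_on_SL (\<lambda>g. \<phi> (g <#\<^bsub>SL\<^esub> H_grp))"

definition left_deriv ::
    "('n::finite) sqmat \<Rightarrow> ('n sqmat set \<Rightarrow> complex) \<Rightarrow> 'n sqmat set \<Rightarrow> complex"
  where "left_deriv X \<phi> =
    (\<lambda>c. vector_derivative (\<lambda>t. \<phi> (mat_exp (- t *\<^sub>R X) <#\<^bsub>SL\<^esub> c)) (at 0))"

text \<open>The operators by which the elements of the universal enveloping algebra act through the left
  regular representation. As an algebra it is generated by \<open>sl\<close>, hence spanned by the monomials
  \<open>X\<^sub>1 \<cdots> X\<^sub>k\<close> with \<open>X\<^sub>i\<close> in \<open>sl\<close>.\<close>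

inductive_set U_action ::
    "((('n::finite) sqmat set \<Rightarrow> complex) \<Rightarrow> 'n sqmat set \<Rightarrow> complex) set"
  where
    one: "(\<lambda>\<phi>. \<phi>) \<in> U_action"
  | mult: "\<lbrakk>X \<in> sl; u \<in> U_action\<rbrakk> \<Longrightarrow> (\<lambda>\<phi>. left_deriv X (u \<phi>)) \<in> U_action"
  | add: "\<lbrakk>u \<in> U_action; v \<in> U_action\<rbrakk> \<Longrightarrow> (\<lambda>\<phi> c. u \<phi> c + v \<phi> c) \<in> U_action"
  | scale: "u \<in> U_action \<Longrightarrow> (\<lambda>\<phi> c. z * u \<phi> c) \<in> U_action"

definition schwartz :: "(('n::{finite,linorder}) sqmat set \<Rightarrow> complex) \<Rightarrow> bool"
  where "schwartz \<phi> \<longleftrightarrow> smooth_on_X \<phi> \<and>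
    (\<forall>u\<in>U_action. \<forall>m::nat. bdd_above
      ((\<lambda>(k, t). cosh t ^ (CARD('n) - 1) * (1 + \<bar>t\<bar>) ^ m *
          cmod (u \<phi> ((k ** a_elt t) <#\<^bsub>SL\<^esub> H_grp))) ` (SO \<times> (UNIV :: real set))))"

text \<open>The parabolic subgroups of \<open>SL(n,\<real>)\<close> are the stabilizers of flags of subspaces of \<open>\<real>\<^sup>n\<close>; the
  empty flag gives the whole group.\<close>

definition parabolic :: "('n::finite) sqmat set \<Rightarrow> bool"
  where "parabolic P \<longleftrightarrow> (\<exists>F :: (real^'n) set set.
    (\<forall>V\<in>F. subspace V) \<and> (\<forall>V\<in>F. \<forall>W\<in>F. V \<subseteq> W \<or> W \<subseteq> V) \<and>
    P = {g \<in> carrier SL. \<forall>V\<in>F. (\<lambda>v. g *v v) ` V = V})"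

definition minimal_parabolic :: "('n::finite) sqmat set \<Rightarrow> bool"
  where "minimal_parabolic P \<longleftrightarrow>
    parabolic P \<and> (\<forall>Q. parabolic Q \<and> Q \<subseteq> P \<longrightarrow> Q = P)"

definition unipotent :: "('n::finite) sqmat \<Rightarrow> bool"
  where "unipotent x \<longleftrightarrow> (\<exists>k. mat_power (x - mat 1) k = 0)"

text \<open>The largest closed connected normal subgroup consisting of unipotent elements.\<close>

definition unipotent_radical :: "('n::finite) sqmat set \<Rightarrow> 'n sqmat set"
  where "unipotent_radical P =
    \<Union> {N. N \<lhd> SL\<lparr>carrier := P\<rparr> \<and> closed N \<and> connected N \<and> (\<forall>x\<in>N. unipotent x)}"

text \<open>\<open>P\<close> is the semidirect product of \<open>L\<close> and the unipotent radical. Reductivity of \<open>L\<close> follows,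
  since \<open>L\<close> is isomorphic to \<open>P\<close> modulo its unipotent radical.\<close>

definition levi_subgroup :: "('n::finite) sqmat set \<Rightarrow> 'n sqmat set \<Rightarrow> bool"
  where "levi_subgroup L P \<longleftrightarrow> subgroup L SL \<and> L \<subseteq> P \<and> closed L \<and>
    L <#>\<^bsub>SL\<^esub> unipotent_radical P = P \<and> L \<inter> unipotent_radical P = {mat 1}"

definition group_center :: "('n::finite) sqmat set \<Rightarrow> 'n sqmat set"
  where "group_center L = {z \<in> L. \<forall>l\<in>L. z ** l = l ** z}"

text \<open>Split: simultaneously diagonalizable over the reals.\<close>

definition connected_split_subgroup :: "('n::finite) sqmat set \<Rightarrow> bool"
  where "connected_split_subgroup A \<longleftrightarrow> subgroup A SL \<and> connected A \<and>
    (\<exists>g :: 'n sqmat. invertible g \<and>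
      (\<forall>a\<in>A. \<forall>i j. i \<noteq> j \<longrightarrow> (matrix_inv g ** a ** g) $ i $ j = 0))"

definition split_component :: "('n::finite) sqmat set \<Rightarrow> 'n sqmat set \<Rightarrow> bool"
  where "split_component A P \<longleftrightarrow> (\<exists>L. levi_subgroup L P \<and>
    connected_split_subgroup A \<and> A \<subseteq> group_center L \<and>
    (\<forall>B. connected_split_subgroup B \<and> B \<subseteq> group_center L \<and> A \<subseteq> B \<longrightarrow> B = A))"

text \<open>A linear functional on a subspace \<open>\<aa>\<close> is represented by its extension by \<open>0\<close>, so that
  equality of functionals on \<open>\<aa>\<close> is equality of functions.\<close>

definition dual_space :: "('n::finite) sqmat set \<Rightarrow> ('n sqmat \<Rightarrow> real) set"
  where "dual_space \<aa> = {\<alpha>.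
    (\<forall>X\<in>\<aa>. \<forall>Y\<in>\<aa>. \<alpha> (X + Y) = \<alpha> X + \<alpha> Y) \<and>
    (\<forall>c. \<forall>X\<in>\<aa>. \<alpha> (c *\<^sub>R X) = c * \<alpha> X) \<and>
    (\<forall>X. X \<notin> \<aa> \<longrightarrow> \<alpha> X = 0)}"

definition root_space ::
    "('n::finite) sqmat set \<Rightarrow> ('n sqmat \<Rightarrow> real) \<Rightarrow> 'n sqmat set"
  where "root_space \<aa> \<alpha> = {Y \<in> sl. \<forall>X\<in>\<aa>. lie_bracket X Y = \<alpha> X *\<^sub>R Y}"

definition roots :: "('n::finite) sqmat set \<Rightarrow> ('n sqmat \<Rightarrow> real) set"
  where "roots \<aa> = {\<alpha> \<in> dual_space \<aa>. \<alpha> \<noteq> (\<lambda>_. 0) \<and> root_space \<aa> \<alpha> \<noteq> {0}}"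

definition roots_of :: "('n::finite) sqmat set \<Rightarrow> 'n sqmat set \<Rightarrow> ('n sqmat \<Rightarrow> real) set"
  where "roots_of \<aa> P =
    {\<alpha> \<in> roots \<aa>. root_space \<aa> \<alpha> \<subseteq> lie_algebra (unipotent_radical P)}"

definition roots_h ::
    "('n::{finite,linorder}) sqmat set \<Rightarrow> ('n sqmat \<Rightarrow> real) set"
  where "roots_h \<aa> = {\<alpha> \<in> roots \<aa>. root_space \<aa> \<alpha> \<inter> h_alg \<noteq> {0}}"

definition rho_h ::
    "('n::{finite,linorder}) sqmat set \<Rightarrow> 'n sqmat set \<Rightarrow> 'n sqmat \<Rightarrow> real"
  where "rho_h \<aa> P = (\<lambda>X. (1 / 2) * (\<Sum>\<alpha>\<in>roots_of \<aa> P \<inter> roots_h \<aa>. \<alpha> X))"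

text \<open>The inner product on the dual of \<open>\<aa>\<close>, transported from the trace form on \<open>\<aa>\<close>.\<close>

definition trace_form_dual :: "('n::finite) sqmat set \<Rightarrow> ('n sqmat \<Rightarrow> real) \<Rightarrow> 'n sqmat"
  where "trace_form_dual \<aa> \<alpha> = (THE Y. Y \<in> \<aa> \<and> (\<forall>X\<in>\<aa>. \<alpha> X = trace (X ** Y)))"

definition dual_inner ::
    "('n::finite) sqmat set \<Rightarrow> ('n sqmat \<Rightarrow> real) \<Rightarrow> ('n sqmat \<Rightarrow> real) \<Rightarrow> real"
  where "dual_inner \<aa> \<alpha> \<beta> = trace (trace_form_dual \<aa> \<alpha> ** trace_form_dual \<aa> \<beta>)"

text \<open>The dimension of \<open>A/(A \<inter> H)\<close>.\<close>

definition sigma_rank :: "('n::{finite,linorder}) sqmat set \<Rightarrow> nat"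
  where "sigma_rank A = dim (lie_algebra A) - dim (lie_algebra (A \<inter> H_grp))"

text \<open>\<open>\<sigma>\<close>-stable split components exist and are unique up to conjugation by \<open>N \<inter> H\<close>, where
  \<open>N\<close> is the unipotent radical of \<open>P\<close>, so the existential quantifier could equally be universal.\<close>

definition h_compatible :: "('n::{finite,linorder}) sqmat set \<Rightarrow> bool"
  where "h_compatible P \<longleftrightarrow> (\<exists>A. split_component A P \<and> sigma_inv ` A = A \<and>
    (let \<aa> = lie_algebra A in
      (sigma_rank A = 1 \<and> (\<forall>\<alpha>\<in>roots_of \<aa> P. dual_inner \<aa> \<alpha> (rho_h \<aa> P) \<ge> 0)) \<or>
      (sigma_rank A = 0 \<and> (\<forall>\<alpha>\<in>roots_of \<aa> P. dual_inner \<aa> \<alpha> (rho_h \<aa> P) > 0))))"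

definition coset_space :: "('n::finite) sqmat set \<Rightarrow> 'n sqmat set \<Rightarrow> 'n sqmat set set"
  where "coset_space N B = lcosets\<^bsub>SL\<lparr>carrier := N\<rparr>\<^esub> B"

definition coset_topology :: "('n::finite) sqmat set \<Rightarrow> 'n sqmat set \<Rightarrow> 'n sqmat set topology"
  where "coset_topology N B = topology (\<lambda>U. U \<subseteq> coset_space N B \<and>
    openin (top_of_set N) {x \<in> N. x <#\<^bsub>SL\<^esub> B \<in> U})"

lemma openin_coset_topology:
  "openin (coset_topology N B) U \<longleftrightarrow>
    U \<subseteq> coset_space N B \<and> openin (top_of_set N) {x \<in> N. x <#\<^bsub>SL\<^esub> B \<in> U}"
proof -
  have "istopology (\<lambda>U. U \<subseteq> coset_space N B \<and>
      openin (top_of_set N) {x \<in> N. x <#\<^bsub>SL\<^esub> B \<in> U})" (is "istopology ?P")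
    unfolding istopology_def
  proof (intro conjI allI impI)
    fix V W assume "?P V" "?P W"
    moreover have "{x \<in> N. x <#\<^bsub>SL\<^esub> B \<in> V \<inter> W} =
        {x \<in> N. x <#\<^bsub>SL\<^esub> B \<in> V} \<inter> {x \<in> N. x <#\<^bsub>SL\<^esub> B \<in> W}" by blast
    ultimately show "V \<inter> W \<subseteq> coset_space N B"
      and "openin (top_of_set N) {x \<in> N. x <#\<^bsub>SL\<^esub> B \<in> V \<inter> W}"
      by (auto intro: openin_Int)
  next
    fix \<V> assume *: "\<forall>V\<in>\<V>. ?P V"
    then show "\<Union>\<V> \<subseteq> coset_space N B" by blast
    have "{x \<in> N. x <#\<^bsub>SL\<^esub> B \<in> \<Union>\<V>} = (\<Union>V\<in>\<V>. {x \<in> N. x <#\<^bsub>SL\<^esub> B \<in> V})" by blast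
    with * show "openin (top_of_set N) {x \<in> N. x <#\<^bsub>SL\<^esub> B \<in> \<Union>\<V>}"
      by (metis (no_types, lifting) imageE openin_Union)
  qed
  then show ?thesis
    by (simp add: coset_topology_def topology_inverse')
qed

definition radon_measure_on :: "'a topology \<Rightarrow> 'a measure \<Rightarrow> bool"
  where "radon_measure_on T M \<longleftrightarrow>
    space M = topspace T \<and> sets M = sigma_sets (topspace T) {U. openin T U} \<and>
    (\<forall>C. compactin T C \<longrightarrow> emeasure M C < \<infinity>) \<and>
    (\<forall>E\<in>sets M. emeasure M E = (INF U\<in>{U. openin T U \<and> E \<subseteq> U}. emeasure M U)) \<and>
    (\<forall>U. openin T U \<longrightarrow>
      emeasure M U = (SUP C\<in>{C. compactin T C \<and> C \<subseteq> U}. emeasure M C))"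

definition invariant_measure :: "('n::finite) sqmat set \<Rightarrow> 'n sqmat set measure \<Rightarrow> bool"
  where "invariant_measure N M \<longleftrightarrow>
    (\<forall>x\<in>N. \<forall>E\<in>sets M. emeasure M ((\<lambda>c. x <#\<^bsub>SL\<^esub> c) ` E) = emeasure M E)"

end

theory Submission
  imports Defs
begin

text \<open>With \<open>w = e\<^sub>1 + e\<^sub>n\<close> one has \<open>S = 1 - w w\<^sup>T\<close>, so \<open>X\<^sub>n\<close> is the orbit of the idempotent
  \<open>w w\<^sup>T / 2\<close> under conjugation, and the Schwartz decay is decay in the norm \<open>|p| = cosh (2 t)\<close> of
  the idempotent \<open>p\<close>. A minimal parabolic is the stabilizer of a complete flag, and \<open>\<sigma>\<close>-stable split
  components come from bases adapted to the flag in which \<open>w\<close> is \<open>e\<^sub>i + e\<^sub>j\<close> (or \<open>e\<^sub>i\<close>, when \<open>i = j\<close>);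
  computing \<open>\<rho>\<^sub>P\<^sub>,\<^sub>h\<close> there turns \<open>h\<close>-compatibility into inequalities for the positions \<open>i\<close>, \<open>j\<close>.
  On the \<open>N\<^sub>P\<close>-orbit an idempotent \<open>V X\<^sup>T / 2\<close> has as free coordinates the entries of \<open>V\<close> above \<open>i\<close>, those of
  \<open>X\<close> below \<open>j\<close>, and one further parameter if \<open>i \<noteq> j\<close>. By invariance all integer cells in these
  coordinates have the same finite positive measure, so volumes are numbers of lattice points. The
  set \<open>|V| \<le> R\<close>, \<open>|X| \<le> T\<close> has volume at most a constant times \<open>(R T)\<^bsup>(n - 1) / 2\<^esup> (1 + log (R T))\<close> in the
  compatible case, which the Schwartz decay beats on dyadic shells. Otherwise \<open>|V| |X| \<le> C R\<close>
  contains \<open>R\<^sup>D\<close> cells with \<open>D \<ge> n / 2\<close>, and Markov's inequality shows that the Schwartz function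
  \<open>|p|\<^bsup>-(n/2 - 1/4)\<^esup>\<close> is not integrable.\<close>

section \<open>Matrices over a linearly ordered index type\<close>

text \<open>The measure is never compared with a Lebesgue measure: everything rests on shears in the
  unipotent radical that move one coordinate by an integer. The obstacle is the relation X . V = 2.
  For i \<noteq> j it ties V_j to X_i, and translating another coordinate disturbs one of the two. A
  one-parameter group moves V_j by t and X_i by -t, so unit strips in V_j, in -X_i or in a corrected
  V_j have equal measure inside a cell; a box therefore costs only the smaller of its two radii.
  Compatibility keeps the numbers of entries above i and below j within one of each other, which
  balances the powers of R and T. If a position m lies strictly between j and i, there is one
  coordinate too many, and the same relation confines V_m X_m to a hyperbola, whence the logarithm.
  The exponent n/2 - 1/4 sits midway between (n - 1)/2, above which the power of |p| is Schwartz,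
  and n/2, below which R^D cells force divergence. A flag may have several adapted bases;
  integrability is decided by the positions in any one of them, which joins the basis built from the
  flag to the basis built from a stable split component.\<close>

definition wvec :: "(real, 'n::{finite,linorder}) vec"
  where "wvec = axis first_idx 1 + axis last_idx 1"

definition outer :: "(real, 'n::finite) vec \<Rightarrow> (real, 'n) vec \<Rightarrow> 'n sqmat"
  where "outer u v = (\<chi> i j. u $ i * v $ j)"

text \<open>The matrix of \<open>x\<close> in the basis formed by the columns of \<open>b\<close>.
  In a suitable basis the parabolic becomes triangular, its Levi subgroup diagonal and \<sigma>
  conjugation by a monomial matrix.\<close>

definition conj_by :: "('n::finite) sqmat \<Rightarrow> 'n sqmat \<Rightarrow> 'n sqmat"
  where "conj_by b x = matrix_inv b ** x ** b"

definition upper :: "('n::{finite,linorder}) sqmat \<Rightarrow> bool"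
  where "upper x \<longleftrightarrow> (\<forall>k l. l < k \<longrightarrow> x $ k $ l = 0)"

definition unitri :: "('n::{finite,linorder}) sqmat \<Rightarrow> bool"
  where "unitri x \<longleftrightarrow> upper x \<and> (\<forall>k. x $ k $ k = 1)"

definition diag_mat :: "(real, 'n::finite) vec \<Rightarrow> 'n sqmat"
  where "diag_mat x = (\<chi> k l. if k = l then x $ k else 0)"

definition is_diag :: "('n::finite) sqmat \<Rightarrow> bool"
  where "is_diag x \<longleftrightarrow> (\<forall>k l. k \<noteq> l \<longrightarrow> x $ k $ l = 0)"

text \<open>For \<open>v\<close> orthogonal to \<open>u\<close> this is a transvection with inverse
  \<open>shear (- u) v\<close>. Transvections in the unipotent radical later translate the
  coordinates of an orbit point.\<close>

definition shear :: "(real, 'n::finite) vec \<Rightarrow> (real, 'n) vec \<Rightarrow> 'n sqmat"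
  where "shear u v = mat 1 + outer u v"

section \<open>Matrix identities, inverses and conjugation\<close>

lemma mat_mul_component: "((A :: 'n::finite sqmat) ** B) $ i $ j = (\<Sum>k\<in>UNIV. A $ i $ k * B $ k $ j)"
  by (simp add: matrix_matrix_mult_def)

lemma mat_vec_component: "((A :: 'n::finite sqmat) *v x) $ i = (\<Sum>k\<in>UNIV. A $ i $ k * x $ k)"
  by (simp add: matrix_vector_mult_def)

lemma vec_mat_component: "((x::(real,'n::finite) vec) v* A) $ j = (\<Sum>k\<in>UNIV. A $ k $ j * x $ k)"
  by (simp add: vector_matrix_mult_def mult.commute)

lemma mat_component: "(mat c :: 'n::finite sqmat) $ i $ j = (if i = j then c else 0)"
  by (simp add: mat_def)

lemma matrix_diff_ldistrib: "(A :: 'n::finite sqmat) ** (B - C) = A ** B - A ** C"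
  by (simp add: vec_eq_iff mat_mul_component right_diff_distrib sum_subtractf)

lemma matrix_diff_rdistrib: "((B :: 'n::finite sqmat) - C) ** (A :: 'n sqmat) = B ** A - C ** A"
  by (simp add: vec_eq_iff mat_mul_component left_diff_distrib sum_subtractf)

lemma matrix_add_distribs:
  fixes A B C :: "'n::finite sqmat"
  shows "A ** (B + C) = A ** B + A ** C" "(B + C) ** A = B ** A + C ** A"
  by (simp_all add: vec_eq_iff mat_mul_component distrib_left distrib_right sum.distrib)

lemma matrix_scaleR_left: "(c *\<^sub>R (A :: 'n::finite sqmat)) ** B = c *\<^sub>R (A ** B)"
  by (simp add: vec_eq_iff mat_mul_component sum_distrib_left mult.assoc)

lemma matrix_scaleR_right: "(A :: 'n::finite sqmat) ** (c *\<^sub>R B) = c *\<^sub>R (A ** B)"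
  by (simp add: vec_eq_iff mat_mul_component sum_distrib_left mult.left_commute)

lemma outer_left: "A ** outer u v = outer (A *v u) v"
  by (simp add: vec_eq_iff mat_mul_component mat_vec_component outer_def sum_distrib_right mult.assoc)

lemma outer_right: "outer u v ** A = outer u (v v* A)"
  by (simp add: vec_eq_iff mat_mul_component vec_mat_component outer_def sum_distrib_left mult_ac)

lemma outer_vec: "outer u v *v x = (v \<bullet> x) *\<^sub>R u"
  by (simp add: vec_eq_iff mat_vec_component outer_def inner_vec_def sum_distrib_left mult_ac)

lemma vec_outer: "x v* outer u v = (x \<bullet> u) *\<^sub>R v"
  by (simp add: vec_eq_iff vec_mat_component outer_def inner_vec_def sum_distrib_left mult_ac)

lemma inner_vec_mat: "(x v* A) \<bullet> y = x \<bullet> ((A :: 'n::finite sqmat) *v y)"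
  by (metis dot_lmul_matrix)

lemma matrix_inv_eqI:
  fixes A B :: "'n::finite sqmat"
  assumes "A ** B = mat 1" shows "matrix_inv A = B"
proof -
  have BA: "B ** A = mat 1" using assms by (simp add: matrix_left_right_inverse)
  then have "A ** matrix_inv A = mat 1"
    using someI[of "\<lambda>C. A ** C = mat 1 \<and> C ** A = mat 1" B] assms by (simp add: matrix_inv_def)
  then have "B = B ** (A ** matrix_inv A)" by simp
  also have "\<dots> = matrix_inv A" by (simp add: matrix_mul_assoc BA)
  finally show ?thesis by simp
qed

lemma matrix_inv_right: "invertible (A :: 'n::finite sqmat) \<Longrightarrow> A ** matrix_inv A = mat 1"
  using matrix_inv_eqI invertible_def by metis

lemma matrix_inv_left: "invertible (A :: 'n::finite sqmat) \<Longrightarrow> matrix_inv A ** A = mat 1"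
  using matrix_inv_right matrix_left_right_inverse by metis

lemma invertible_matrix_inv: "invertible (A :: 'n::finite sqmat) \<Longrightarrow> invertible (matrix_inv A)"
  using matrix_inv_left matrix_inv_right invertible_def by metis

lemma matrix_inv_matrix_inv: "invertible (A :: 'n::finite sqmat) \<Longrightarrow> matrix_inv (matrix_inv A) = A"
  using matrix_inv_eqI matrix_inv_left by metis

lemma matrix_inv_mult:
  fixes A B :: "'n::finite sqmat"
  assumes "invertible A" "invertible B"
  shows "matrix_inv (A ** B) = matrix_inv B ** matrix_inv A"
proof (rule matrix_inv_eqI)
  have "A ** B ** (matrix_inv B ** matrix_inv A) = A ** (B ** matrix_inv B) ** matrix_inv A"
    by (simp add: matrix_mul_assoc)
  then show "A ** B ** (matrix_inv B ** matrix_inv A) = mat 1"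
    using assms by (simp add: matrix_inv_right)
qed

lemma matrix_inv_one: "matrix_inv (mat 1 :: 'n::finite sqmat) = mat 1"
  by (rule matrix_inv_eqI) simp

lemma SL_invertible: "g \<in> carrier SL \<Longrightarrow> invertible (g :: 'n::finite sqmat)"
  by (simp add: SL_def invertible_det_nz)

lemma matrix_inv_mult_vec: "invertible (A :: 'n::finite sqmat) \<Longrightarrow> matrix_inv A *v (A *v x) = x"
  "invertible (A :: 'n::finite sqmat) \<Longrightarrow> A *v (matrix_inv A *v x) = x"
  by (simp_all add: matrix_vector_mul_assoc matrix_inv_left matrix_inv_right)

lemma vec_mult_matrix_inv: "invertible (A :: 'n::finite sqmat) \<Longrightarrow> (x v* A) v* matrix_inv A = x"
  "invertible (A :: 'n::finite sqmat) \<Longrightarrow> (x v* matrix_inv A) v* A = x"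
  by (simp_all add: vector_matrix_mul_assoc matrix_inv_left matrix_inv_right)

lemma det_matrix_inv: "invertible (A :: 'n::finite sqmat) \<Longrightarrow> det (matrix_inv A) = 1 / det A"
  by (metis det_I det_mul invertible_det_nz matrix_inv_right nonzero_mult_div_cancel_left)

lemma SL_simps: "x \<otimes>\<^bsub>SL\<^esub> y = x ** y" "\<one>\<^bsub>SL\<^esub> = mat 1" "g \<in> carrier SL \<longleftrightarrow> det g = 1"
  by (simp_all add: SL_def)

lemma group_SL: "group (SL :: 'n::finite sqmat monoid)"
proof (rule groupI)
  fix x :: "'n sqmat" assume "x \<in> carrier SL"
  then show "\<exists>y\<in>carrier SL. y \<otimes>\<^bsub>SL\<^esub> x = \<one>\<^bsub>SL\<^esub>"
    using SL_invertible[of x]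
    by (intro bexI[of _ "matrix_inv x"]) (auto simp: SL_simps matrix_inv_left det_matrix_inv)
qed (auto simp: SL_simps det_mul matrix_mul_assoc)

lemma inv_SL: "g \<in> carrier SL \<Longrightarrow> inv\<^bsub>SL\<^esub> g = matrix_inv (g :: 'n::finite sqmat)"
  using SL_invertible[of g]
  by (intro group.inv_equality[OF group_SL])
    (auto simp: SL_simps matrix_inv_left det_matrix_inv)

lemma conj_by_mult: "invertible b \<Longrightarrow> conj_by b (x ** y) = conj_by b x ** conj_by b y"
proof -
  assume b: "invertible b"
  have "conj_by b x ** conj_by b y = matrix_inv b ** x ** (b ** matrix_inv b) ** y ** b"
    by (simp add: conj_by_def matrix_mul_assoc)
  then show ?thesis using b by (simp add: conj_by_def matrix_inv_right matrix_mul_assoc)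
qed

lemma conj_by_one [simp]: "invertible b \<Longrightarrow> conj_by b (mat 1) = mat 1"
  by (simp add: conj_by_def matrix_inv_left)

lemma conj_by_add: "conj_by b (x + y) = conj_by b x + conj_by b y"
  by (simp add: conj_by_def matrix_add_distribs)

lemma conj_by_diff: "conj_by b (x - y) = conj_by b x - conj_by b y"
  by (simp add: conj_by_def matrix_diff_ldistrib matrix_diff_rdistrib)

lemma conj_by_scaleR: "conj_by b (c *\<^sub>R x) = c *\<^sub>R conj_by b x"
  by (simp add: conj_by_def matrix_scaleR_left matrix_scaleR_right)

lemma conj_by_zero [simp]: "conj_by b 0 = 0"
  using conj_by_scaleR[of b 0] by simp

lemma conj_by_cancel: "invertible b \<Longrightarrow> conj_by b (b ** x ** matrix_inv b) = x"
  by (metis conj_by_def matrix_inv_left matrix_mul_assoc matrix_mul_lid matrix_mul_rid)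

lemma conj_by_cancel2: "invertible b \<Longrightarrow> b ** conj_by b x ** matrix_inv b = x"
  by (metis conj_by_def matrix_inv_right matrix_mul_assoc matrix_mul_lid matrix_mul_rid)

lemma conj_by_inject: "invertible b \<Longrightarrow> conj_by b x = conj_by b y \<longleftrightarrow> x = y"
  by (metis conj_by_cancel2)

lemma conj_by_conj_by: "invertible b \<Longrightarrow> invertible u \<Longrightarrow> conj_by (b ** u) x = conj_by u (conj_by b x)"
  by (simp add: conj_by_def matrix_inv_mult matrix_mul_assoc)

lemma det_conj_by: "invertible b \<Longrightarrow> det (conj_by b x) = det x"
  by (simp add: conj_by_def det_mul det_matrix_inv invertible_det_nz)

lemma trace_conj_by: "invertible b \<Longrightarrow> trace (conj_by b x) = trace x"
  by (metis conj_by_def matrix_inv_right matrix_mul_assoc matrix_mul_lid trace_mul_sym)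

lemma invertible_conj_by: "invertible b \<Longrightarrow> invertible (conj_by b x) \<longleftrightarrow> invertible x"
  by (simp add: invertible_det_nz det_conj_by)

lemma conj_by_matrix_inv: "invertible b \<Longrightarrow> invertible x \<Longrightarrow> conj_by b (matrix_inv x) = matrix_inv (conj_by b x)"
  by (metis conj_by_mult conj_by_one matrix_inv_eqI matrix_inv_right)

section \<open>Continuity of matrix operations\<close>

lemma continuous_on_matrix_mult [continuous_intros]:
  fixes f g :: "'a::topological_space \<Rightarrow> 'n::finite sqmat"
  assumes "continuous_on T f" "continuous_on T g"
  shows "continuous_on T (\<lambda>x. f x ** g x)"
  unfolding matrix_matrix_mult_def
  by (intro continuous_on_vec_lambda continuous_on_sum continuous_on_mult
      continuous_on_component assms)

lemma continuous_on_matrix_vector_mult [continuous_intros]: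
  fixes f :: "'a::topological_space \<Rightarrow> 'n::finite sqmat"
  assumes "continuous_on T f" "continuous_on T g"
  shows "continuous_on T (\<lambda>x. f x *v g x)"
  unfolding matrix_vector_mult_def
  by (intro continuous_on_vec_lambda continuous_on_sum continuous_on_mult
      continuous_on_component assms)

lemma continuous_on_vector_matrix_mult [continuous_intros]:
  fixes f :: "'a::topological_space \<Rightarrow> 'n::finite sqmat"
  assumes "continuous_on T f" "continuous_on T g"
  shows "continuous_on T (\<lambda>x. g x v* f x)"
  unfolding vector_matrix_mult_def
  by (intro continuous_on_vec_lambda continuous_on_sum continuous_on_mult
      continuous_on_component assms)

lemma continuous_on_det [continuous_intros]:
  fixes f :: "'a::topological_space \<Rightarrow> 'n::finite sqmat"
  assumes "continuous_on T f"
  shows "continuous_on T (\<lambda>x. det (f x))"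
  unfolding det_def
  by (intro continuous_on_sum continuous_on_mult continuous_on_prod continuous_on_const
      continuous_on_component assms)

lemma continuous_on_conj_by [continuous_intros]:
  "continuous_on T f \<Longrightarrow> continuous_on T (\<lambda>x. conj_by b (f x))"
  unfolding conj_by_def by (intro continuous_intros)

text \<open>Cramer's rule writes every entry of the inverse as a quotient of determinants, hence of
  polynomials in the entries.\<close>

lemma continuous_on_matrix_inv:
  fixes f :: "'a::topological_space \<Rightarrow> 'n::finite sqmat"
  assumes "continuous_on T f" "\<And>x. x \<in> T \<Longrightarrow> invertible (f x)"
  shows "continuous_on T (\<lambda>x. matrix_inv (f x))"
proof -
  define F where "F x = (\<chi> k l. det (\<chi> i j. if j = k then axis l 1 $ i else f x $ i $ j) / det (f x))" for x
  have "matrix_inv (f x) = F x" if "x \<in> T" for x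
  proof -
    have "column l (matrix_inv (f x)) = (\<chi> k. F x $ k $ l)" for l
    proof -
      have "f x *v column l (matrix_inv (f x)) = axis l 1"
        using assms(2)[OF that] by (simp add: matrix_inv_mult_vec flip: matrix_vector_mult_basis)
      then show ?thesis
        using assms(2)[OF that] by (subst (asm) cramer) (auto simp: invertible_det_nz F_def)
    qed
    then show ?thesis by (auto simp: vec_eq_iff column_def)
  qed
  moreover have "continuous_on T F"
    unfolding F_def
  proof (intro continuous_on_vec_lambda continuous_on_divide continuous_on_det assms)
    fix k l i j
    show "continuous_on T (\<lambda>x. if j = k then axis l 1 $ i else f x $ i $ j)"
      by (cases "j = k") (auto intro!: continuous_on_component assms)
  next
    show "\<forall>x\<in>T. det (f x) \<noteq> 0" using assms(2) by (simp add: invertible_det_nz)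
  qed
  ultimately show ?thesis by (simp cong: continuous_on_cong)
qed

section \<open>Triangular, unitriangular and diagonal matrices\<close>

lemma upper_mult:
  assumes "upper x" "upper y" shows "upper (x ** y)"
proof -
  have "x $ k $ m * y $ m $ l = 0" if "l < k" for k l m
    using assms that by (cases "m < k") (auto simp: upper_def)
  then show ?thesis unfolding upper_def mat_mul_component by (intro allI impI sum.neutral) blast
qed

lemma upper_mult_diag:
  assumes "upper x" "upper y" shows "(x ** y) $ k $ k = x $ k $ k * y $ k $ k"
proof -
  have "(\<Sum>l\<in>UNIV. x $ k $ l * y $ l $ k) = (\<Sum>l\<in>{k}. x $ k $ l * y $ l $ k)"
    using assms by (intro sum.mono_neutral_right) (auto simp: upper_def, metis antisym_conv3)
  then show ?thesis by (simp add: mat_mul_component)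
qed

lemma last_nonzero:
  fixes x :: "(real, 'n::{finite,linorder}) vec"
  assumes "x \<noteq> 0"
  obtains m where "x $ m \<noteq> 0" "\<And>l. m < l \<Longrightarrow> x $ l = 0"
proof -
  let ?M = "{k. x $ k \<noteq> 0}"
  have "?M \<noteq> {}" using assms by (auto simp: vec_eq_iff)
  then have "Max ?M \<in> ?M" by (intro Max_in) auto
  moreover have "x $ l = 0" if "Max ?M < l" for l
    using Max_ge[of ?M l] that leD by fastforce
  ultimately show ?thesis using that by blast
qed

lemma upper_mult_last:
  assumes "upper A" "\<And>l. m < l \<Longrightarrow> x $ l = 0"
  shows "(A *v x) $ m = A $ m $ m * x $ m"
proof -
  have "(\<Sum>l\<in>UNIV. A $ m $ l * x $ l) = (\<Sum>l\<in>{m}. A $ m $ l * x $ l)"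
    using assms by (intro sum.mono_neutral_right) (auto simp: upper_def, metis antisym_conv3)
  then show ?thesis by (simp add: mat_vec_component)
qed

lemma upper_mult_beyond:
  assumes "upper A" "\<And>l. m < l \<Longrightarrow> x $ l = 0" "m < k"
  shows "(A *v x) $ k = 0"
proof -
  have "A $ k $ l * x $ l = 0" for l
    using assms by (cases "l \<le> m") (auto simp: upper_def)
  then show ?thesis unfolding mat_vec_component by (intro sum.neutral) blast
qed

text \<open>The largest moved point \<open>m\<close> would satisfy \<open>m < p m\<close>, so
  \<open>p m\<close> would be a fixed point, against injectivity.\<close>

lemma permutes_ge_imp_id:
  fixes p :: "'n::{finite,linorder} \<Rightarrow> 'n"
  assumes "p permutes UNIV" "\<And>i. i \<le> p i"
  shows "p = id"
proof (rule ccontr)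
  assume "p \<noteq> id"
  then have "{i. p i \<noteq> i} \<noteq> {}" by (auto simp: fun_eq_iff)
  then have m: "Max {i. p i \<noteq> i} \<in> {i. p i \<noteq> i}" by (intro Max_in) auto
  define m where "m = Max {i. p i \<noteq> i}"
  have mm: "m < p m" using m assms(2)[of m] by (auto simp: m_def order.strict_iff_order)
  have "x \<le> m" if "p x \<noteq> x" for x using that by (simp add: m_def)
  with mm have "p (p m) = p m" using leD by blast
  then have "p m = m" using permutes_inj[OF assms(1)] by (auto dest: injD)
  with mm show False by simp
qed

text \<open>Only the identity contributes to the Leibniz sum: every other permutation sends some row
  to an earlier column and picks a zero entry.\<close>

lemma det_upper:
  fixes A :: "'n::{finite,linorder} sqmat"
  assumes "upper A"
  shows "det A = (\<Prod>k\<in>UNIV. A $ k $ k)"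
proof -
  let ?f = "\<lambda>p. of_int (sign p) * prod (\<lambda>i. A $ i $ p i) UNIV"
  have "sum ?f {id} = sum ?f {p. p permutes UNIV}"
  proof (rule sum.mono_neutral_left)
    show "\<forall>p\<in>{p. p permutes UNIV} - {id}. ?f p = 0"
    proof
      fix p :: "'n \<Rightarrow> 'n" assume "p \<in> {p. p permutes UNIV} - {id}"
      then obtain i where "p i < i" using permutes_ge_imp_id[of p] leI by blast
      then have "prod (\<lambda>i. A $ i $ p i) UNIV = 0" using assms by (auto simp: upper_def)
      then show "?f p = 0" by simp
    qed
  qed (auto simp: permutes_id)
  then show ?thesis by (simp add: det_def sign_id)
qed

lemma upper_invertible_diag:
  assumes "upper A" "invertible A" shows "A $ k $ k \<noteq> 0"
  using assms by (simp add: invertible_det_nz det_upper)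

text \<open>Column \<open>l\<close> of the inverse solves \<open>A *v x = axis l 1\<close>. The last
  nonzero entry of \<open>x\<close> survives multiplication by a triangular matrix with nonzero
  diagonal, so it sits at \<open>l\<close>.\<close>

lemma upper_matrix_inv:
  assumes "upper A" "invertible A" shows "upper (matrix_inv A)"
  unfolding upper_def
proof (intro allI impI)
  fix k l :: 'a assume "l < k"
  let ?x = "column l (matrix_inv A)"
  have x: "A *v ?x = axis l 1"
    using assms(2) by (simp add: matrix_inv_mult_vec flip: matrix_vector_mult_basis)
  then have "?x \<noteq> 0" by (metis axis_eq_0_iff matrix_vector_mult_0_right zero_neq_one)
  then obtain m where m: "?x $ m \<noteq> 0" "\<And>l. m < l \<Longrightarrow> ?x $ l = 0" using last_nonzero by blast
  have "axis l (1::real) $ m \<noteq> 0"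
    using upper_mult_last[OF assms(1) m(2)] m(1) upper_invertible_diag[OF assms] x by simp
  then have "m = l" by (auto simp: axis_def split: if_splits)
  then show "matrix_inv A $ k $ l = 0" using m(2)[of k] \<open>l < k\<close> by (simp add: column_def)
qed

lemma unitri_det: "unitri x \<Longrightarrow> det x = 1"
  by (simp add: unitri_def det_upper)

lemma unitri_invertible: "unitri x \<Longrightarrow> invertible x"
  by (simp add: unitri_det invertible_det_nz)

lemma unitri_mult: "unitri x \<Longrightarrow> unitri y \<Longrightarrow> unitri (x ** y)"
  by (simp add: unitri_def upper_mult upper_mult_diag)

lemma upper_one: "upper (mat 1)" by (auto simp: upper_def mat_component)

lemma unitri_one: "unitri (mat 1)" by (simp add: unitri_def upper_one mat_component)

lemma unitri_matrix_inv:
  assumes "unitri x" shows "unitri (matrix_inv x)"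
proof -
  have u: "upper x" "invertible x" "upper (matrix_inv x)"
    using assms unitri_invertible upper_matrix_inv by (auto simp: unitri_def)
  have "matrix_inv x $ k $ k = 1" for k
    using upper_mult_diag[OF u(1,3), of k] assms
    by (simp add: matrix_inv_right u(2) mat_component unitri_def)
  with u show ?thesis by (simp add: unitri_def)
qed

lemma is_diag_upper: "is_diag x \<Longrightarrow> upper x" by (auto simp: is_diag_def upper_def)

lemma is_diag_diag_mat: "is_diag (diag_mat x)" by (simp add: is_diag_def diag_mat_def)

lemma is_diag_eq_diag_mat: "is_diag x \<longleftrightarrow> x = diag_mat (\<chi> k. x $ k $ k)"
  by (auto simp: is_diag_def diag_mat_def vec_eq_iff)

lemma diag_mat_mult_left: "(diag_mat x ** (A :: 'n::finite sqmat)) $ k $ l = x $ k * A $ k $ l"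
proof -
  have "(diag_mat x ** A) $ k $ l = (\<Sum>m\<in>UNIV. if k = m then x $ k * A $ m $ l else 0)"
    unfolding mat_mul_component diag_mat_def by (intro sum.cong) auto
  then show ?thesis by simp
qed

lemma diag_mat_mult_right: "((A :: 'n::finite sqmat) ** diag_mat x) $ k $ l = A $ k $ l * x $ l"
proof -
  have "(A ** diag_mat x) $ k $ l = (\<Sum>m\<in>UNIV. if m = l then A $ k $ m * x $ l else 0)"
    unfolding mat_mul_component diag_mat_def by (intro sum.cong) auto
  then show ?thesis by simp
qed

lemma diag_mat_diag_mat: "diag_mat x ** diag_mat y = diag_mat (\<chi> k. x $ k * y $ k)"
  by (simp add: vec_eq_iff diag_mat_mult_left) (simp add: diag_mat_def)

lemma diag_mat_vec: "diag_mat d *v x = (\<chi> k. d $ k * x $ k)"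
proof -
  have "(diag_mat d *v x) $ k = (\<Sum>m\<in>UNIV. if k = m then d $ k * x $ k else 0)" for k
    unfolding mat_vec_component diag_mat_def by (intro sum.cong) auto
  then show ?thesis by (simp add: vec_eq_iff)
qed

lemma vec_diag_mat: "x v* diag_mat d = (\<chi> k. x $ k * d $ k)"
proof -
  have "transpose (diag_mat d) = diag_mat d" by (auto simp: transpose_def diag_mat_def vec_eq_iff)
  then have "x v* diag_mat d = diag_mat d *v x" by (metis vector_transpose_matrix)
  then show ?thesis by (simp add: diag_mat_vec mult.commute)
qed

lemma det_diag_mat: "det (diag_mat x) = (\<Prod>k\<in>UNIV. x $ k)"
  by (subst det_diagonal) (auto simp: diag_mat_def)

lemma trace_diag_mat: "trace (diag_mat x) = (\<Sum>k\<in>UNIV. x $ k)"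
  by (simp add: trace_def diag_mat_def)

lemma diag_mat_one: "diag_mat (\<chi> k. 1) = mat 1" by (simp add: diag_mat_def mat_def vec_eq_iff)

lemma matrix_inv_diag_mat:
  assumes "\<And>k. x $ k \<noteq> 0" shows "matrix_inv (diag_mat x) = diag_mat (\<chi> k. inverse (x $ k))"
  by (rule matrix_inv_eqI) (use assms in \<open>simp add: diag_mat_diag_mat flip: diag_mat_one\<close>)

lemma is_diag_mult: "is_diag x \<Longrightarrow> is_diag y \<Longrightarrow> is_diag (x ** y)"
  by (metis diag_mat_diag_mat is_diag_diag_mat is_diag_eq_diag_mat)

lemma is_diag_matrix_inv:
  assumes "is_diag x" "invertible x" shows "is_diag (matrix_inv x)"
proof -
  obtain d where d: "x = diag_mat d" using assms(1) is_diag_eq_diag_mat by blast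
  then have "\<And>k. d $ k \<noteq> 0" using assms(2) by (auto simp: invertible_det_nz det_diag_mat)
  then show ?thesis by (simp add: d matrix_inv_diag_mat is_diag_diag_mat)
qed

lemma is_diag_commute: "is_diag x \<Longrightarrow> is_diag y \<Longrightarrow> x ** y = y ** x"
proof -
  assume "is_diag x" "is_diag y"
  then obtain u v where "x = diag_mat u" "y = diag_mat v" by (metis is_diag_eq_diag_mat)
  then show ?thesis by (simp add: diag_mat_diag_mat mult.commute)
qed

lemma is_diag_unitri: "is_diag x \<Longrightarrow> unitri x \<Longrightarrow> x = mat 1"
  by (auto simp: is_diag_def unitri_def vec_eq_iff mat_component)

section \<open>Transvections\<close>

lemma shear_vec: "shear u v *v x = x + (v \<bullet> x) *\<^sub>R u"
  by (simp add: shear_def matrix_vector_mult_add_rdistrib outer_vec)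

lemma vec_shear: "x v* shear u v = x + (x \<bullet> u) *\<^sub>R v"
  by (simp add: shear_def vector_matrix_mult_add_rdistrib vec_outer)

lemma shear_inverse:
  assumes "v \<bullet> u = 0" shows "shear u v ** shear (- u) v = mat 1"
proof -
  have "(shear u v ** shear (- u) v) *v x = mat 1 *v x" for x
    using assms by (simp add: shear_vec inner_diff_right flip: matrix_vector_mul_assoc)
  then show ?thesis using matrix_eq by blast
qed

lemma matrix_inv_shear:
  assumes "v \<bullet> u = 0" shows "matrix_inv (shear u v) = shear (- u) v"
  by (rule matrix_inv_eqI) (rule shear_inverse[OF assms])

lemma unitri_shear:
  assumes "\<And>p q. u $ p \<noteq> 0 \<Longrightarrow> v $ q \<noteq> 0 \<Longrightarrow> p < q"
  shows "unitri (shear u v)"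
proof -
  have "u $ p * v $ q = 0" if "q \<le> p" for p q
    using assms[of p q] that leD by auto
  then show ?thesis
    by (auto simp: unitri_def upper_def shear_def mat_component outer_def)
qed

section \<open>The involution as a reflection along \<open>wvec\<close>\<close>

lemma first_last:
  assumes "CARD('n::{finite,linorder}) \<ge> 2"
  shows "(first_idx :: 'n) \<noteq> last_idx"
proof
  assume "(first_idx :: 'n) = last_idx"
  then have "x = (first_idx :: 'n)" for x
    using Min_le[of UNIV x] Max_ge[of UNIV x] unfolding first_idx_def last_idx_def
    by (intro antisym) simp_all
  then have "(UNIV :: 'n set) \<subseteq> {first_idx}" by blast
  then have "CARD('n) \<le> 1" using card_mono[of "{first_idx :: 'n}" UNIV] by simp
  with assms show False by simp
qed

lemma wvec_component: "CARD('n::{finite,linorder}) \<ge> 2 \<Longrightarrow>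
  (wvec :: (real,'n) vec) $ k = (if k = first_idx \<or> k = last_idx then 1 else 0)"
  using first_last[where 'n='n] by (auto simp: wvec_def axis_def)

lemma wvec_inner:
  assumes "CARD('n::{finite,linorder}) \<ge> 2"
  shows "(wvec :: (real,'n) vec) \<bullet> wvec = 2"
  using first_last[OF assms]
  by (simp add: wvec_def inner_add_left inner_add_right inner_axis_axis)

lemma S_mat_eq:
  assumes "CARD('n::{finite,linorder}) \<ge> 2"
  shows "(S_mat :: 'n sqmat) = mat 1 - outer wvec wvec"
  using first_last[OF assms]
  by (auto simp: vec_eq_iff S_mat_def outer_def wvec_component[OF assms] mat_component)

lemma S_mat_vec:
  assumes "CARD('n::{finite,linorder}) \<ge> 2"
  shows "(S_mat :: 'n sqmat) *v x = x - (wvec \<bullet> x) *\<^sub>R wvec"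
  by (simp add: S_mat_eq[OF assms] matrix_vector_mult_diff_rdistrib outer_vec)

lemma S_mat_square:
  assumes "CARD('n::{finite,linorder}) \<ge> 2"
  shows "(S_mat :: 'n sqmat) ** S_mat = mat 1"
proof -
  have "(S_mat ** S_mat :: 'n sqmat) *v x = mat 1 *v x" for x
    by (simp add: S_mat_vec[OF assms] inner_diff_right wvec_inner[OF assms] flip: matrix_vector_mul_assoc)
  then show ?thesis using matrix_eq by blast
qed

lemma S_mat_inv:
  assumes "CARD('n::{finite,linorder}) \<ge> 2"
  shows "matrix_inv (S_mat :: 'n sqmat) = S_mat" "invertible (S_mat :: 'n sqmat)"
  using S_mat_square[OF assms] matrix_inv_eqI invertible_def by blast+

lemma sigma_fix_iff:
  assumes "CARD('n::{finite,linorder}) \<ge> 2"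
  shows "sigma_inv (g :: 'n sqmat) = g \<longleftrightarrow> S_mat ** g = g ** S_mat"
  unfolding sigma_inv_def S_mat_inv[OF assms]
  by (metis S_mat_square[OF assms] matrix_mul_assoc matrix_mul_rid)

text \<open>Commuting with \<open>S_mat\<close> is the same as commuting with the rank one matrix
  \<open>outer wvec wvec\<close>.\<close>

lemma sigma_fix_iff_outer:
  assumes "CARD('n::{finite,linorder}) \<ge> 2"
  shows "sigma_inv (g :: 'n sqmat) = g \<longleftrightarrow> outer (g *v wvec) wvec = outer wvec (wvec v* g)"
  unfolding sigma_fix_iff[OF assms] S_mat_eq[OF assms]
  by (auto simp: matrix_diff_ldistrib matrix_diff_rdistrib outer_left outer_right)

section \<open>The matrix exponential\<close>

lemma has_vector_derivative_iff_quotient: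
  "(f has_vector_derivative D) (at x) \<longleftrightarrow> ((\<lambda>t. (f t - f x) /\<^sub>R (t - x)) \<longlongrightarrow> D) (at x)"
proof -
  have "norm ((f t - f x - (t - x) *\<^sub>R D) /\<^sub>R norm (t - x)) = norm ((f t - f x) /\<^sub>R (t - x) - D)"
    if "t \<noteq> x" for t
  proof -
    have "(f t - f x) /\<^sub>R (t - x) - D = (f t - f x - (t - x) *\<^sub>R D) /\<^sub>R (t - x)"
      using that by (simp add: scaleR_diff_right)
    then show ?thesis by simp
  qed
  then have "((\<lambda>t. norm ((f t - f x - (t - x) *\<^sub>R D) /\<^sub>R norm (t - x))) \<longlongrightarrow> 0) (at x)
      \<longleftrightarrow> ((\<lambda>t. norm ((f t - f x) /\<^sub>R (t - x) - D)) \<longlongrightarrow> 0) (at x)"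
    by (intro tendsto_cong) (auto simp: eventually_at_filter)
  then show ?thesis
    unfolding has_vector_derivative_def has_derivative_at_within tendsto_norm_zero_iff
    by (simp add: bounded_linear_scaleR_left Lim_null[of _ D])
qed

lemma mat_power_simps: "mat_power X 0 = mat 1" "mat_power X (Suc k) = X ** mat_power X k"
  by (simp_all add: mat_power_def)

lemma mat_power_scaleR: "mat_power (t *\<^sub>R X) k = t ^ k *\<^sub>R mat_power X k"
  by (induction k) (simp_all add: mat_power_simps matrix_scaleR_left matrix_scaleR_right mult.commute)

lemma mat_power_bound:
  fixes X :: "'n::finite sqmat"
  obtains M where "\<And>k i j. \<bar>mat_power X k $ i $ j\<bar> \<le> M ^ k"
proof -
  define m where "m = (\<Sum>i\<in>UNIV. \<Sum>j\<in>UNIV. \<bar>X $ i $ j\<bar>)"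
  have m: "\<bar>X $ i $ j\<bar> \<le> m" for i j
  proof -
    have "\<bar>X $ i $ j\<bar> \<le> (\<Sum>j\<in>UNIV. \<bar>X $ i $ j\<bar>)" by (intro member_le_sum) auto
    also have "\<dots> \<le> m" unfolding m_def by (intro member_le_sum) (auto intro: sum_nonneg)
    finally show ?thesis .
  qed
  have m0: "0 \<le> m" using m[of undefined undefined] by linarith
  \<comment> \<open>One more factor \<open>X\<close> gives a sum of \<open>CARD('n)\<close> terms,
    each enlarged by at most \<open>m\<close>.\<close>
  have "\<bar>mat_power X k $ i $ j\<bar> \<le> (of_nat CARD('n) * m) ^ k" for k i j
  proof (induction k arbitrary: i j)
    case 0
    then show ?case by (simp add: mat_power_simps mat_component)
  next
    case (Suc k)
    have "\<bar>mat_power X (Suc k) $ i $ j\<bar> \<le> (\<Sum>l\<in>UNIV. \<bar>X $ i $ l\<bar> * \<bar>mat_power X k $ l $ j\<bar>)"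
      by (simp add: mat_power_simps mat_mul_component sum_abs flip: abs_mult)
    also have "\<dots> \<le> (\<Sum>l\<in>(UNIV::'n set). m * (of_nat CARD('n) * m) ^ k)"
      using m Suc m0 by (intro sum_mono mult_mono) auto
    finally show ?case by simp
  qed
  then show ?thesis using that by blast
qed

lemma mat_power_summable:
  fixes X :: "'n::finite sqmat"
  shows "summable (\<lambda>k. mat_power X k $ i $ j / fact k * t ^ k)"
proof -
  obtain M where M: "\<And>k i j. \<bar>mat_power X k $ i $ j\<bar> \<le> M ^ k" using mat_power_bound[of X] by blast
  show ?thesis
  proof (rule summable_comparison_test')
    show "summable (\<lambda>k. (M * \<bar>t\<bar>) ^ k /\<^sub>R fact k)" by (rule summable_exp_generic)
    show "norm (mat_power X k $ i $ j / fact k * t ^ k) \<le> (M * \<bar>t\<bar>) ^ k /\<^sub>R fact k" for k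
      using mult_right_mono[OF M, of "\<bar>t\<bar> ^ k / fact k" k i j]
      by (simp add: abs_mult power_abs power_mult_distrib field_simps)
  qed
qed

text \<open>Each entry becomes a scalar power series in \<open>t\<close>, to which termwise
  differentiation applies.\<close>

lemma mat_exp_scaleR_component:
  fixes X :: "'n::finite sqmat"
  shows "mat_exp (t *\<^sub>R X) $ i $ j = (\<Sum>k. mat_power X k $ i $ j / fact k * t ^ k)"
proof -
  define E :: "'n sqmat" where "E = (\<chi> i j. \<Sum>k. mat_power X k $ i $ j / fact k * t ^ k)"
  have "(\<lambda>k. mat_power (t *\<^sub>R X) k /\<^sub>R fact k) sums E"
    unfolding sums_def
  proof (intro vec_tendstoI)
    fix i j
    have "(\<lambda>k. mat_power X k $ i $ j / fact k * t ^ k) sums (E $ i $ j)"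
      unfolding E_def using summable_sums[OF mat_power_summable] by simp
    then show "(\<lambda>n. (\<Sum>k<n. mat_power (t *\<^sub>R X) k /\<^sub>R fact k) $ i $ j) \<longlonglongrightarrow> E $ i $ j"
      unfolding sums_def by (simp add: mat_power_scaleR field_simps)
  qed
  then have "mat_exp (t *\<^sub>R X) = E" unfolding mat_exp_def by (rule sums_unique[symmetric])
  then show ?thesis by (simp add: E_def)
qed

lemma mat_exp_component:
  fixes X :: "'n::finite sqmat"
  shows "mat_exp X $ i $ j = (\<Sum>k. mat_power X k $ i $ j / fact k)"
  using mat_exp_scaleR_component[of 1 X i j] by simp

lemma mat_exp_zero: "mat_exp (0 :: 'n::finite sqmat) = mat 1"
proof -
  have "mat_exp (0 :: 'n sqmat) $ i $ j = mat 1 $ i $ j" for i j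
    using mat_exp_scaleR_component[of 0 "0 :: 'n sqmat" i j, unfolded powser_zero]
    by (simp add: mat_power_simps)
  then show ?thesis by (simp add: vec_eq_iff)
qed

lemma mat_exp_DERIV:
  fixes X :: "'n::finite sqmat"
  shows "((\<lambda>t. mat_exp (t *\<^sub>R X) $ i $ j) has_real_derivative X $ i $ j) (at 0)"
proof -
  have "((\<lambda>t. \<Sum>k. mat_power X k $ i $ j / fact k * t ^ k) has_real_derivative
      (\<Sum>k. diffs (\<lambda>k. mat_power X k $ i $ j / fact k) k * 0 ^ k)) (at 0)"
    by (rule termdiffs_strong_converges_everywhere) (rule mat_power_summable)
  then show ?thesis
    unfolding mat_exp_scaleR_component powser_zero by (simp add: diffs_def mat_power_simps)
qed

lemma mat_exp_has_vector_derivative: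
  fixes X :: "'n::finite sqmat"
  shows "((\<lambda>t. mat_exp (t *\<^sub>R X)) has_vector_derivative X) (at 0)"
proof -
  have "((\<lambda>t. (mat_exp (t *\<^sub>R X) $ i $ j - mat_exp (0 *\<^sub>R X) $ i $ j) / (t - 0)) \<longlongrightarrow> X $ i $ j) (at 0)" for i j
    using mat_exp_DERIV[of X i j] unfolding has_field_derivative_iff by simp
  then have "((\<lambda>t. (mat_exp (t *\<^sub>R X) - mat_exp (0 *\<^sub>R X)) /\<^sub>R (t - 0)) \<longlongrightarrow> X) (at 0)"
    by (intro vec_tendstoI) (simp add: divide_inverse mult.commute)
  then show ?thesis
    unfolding has_vector_derivative_iff_quotient .
qed

lemma mat_exp_square_zero:
  fixes X :: "'n::finite sqmat"
  assumes "X ** X = 0" shows "mat_exp (t *\<^sub>R X) = mat 1 + t *\<^sub>R X"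
proof -
  have z: "mat_power X (Suc (Suc k)) = 0" for k
  proof -
    have "mat_power X (Suc (Suc k)) = X ** X ** mat_power X k" by (simp add: mat_power_simps matrix_mul_assoc)
    also have "\<dots> = 0" using assms by (simp add: vec_eq_iff mat_mul_component)
    finally show ?thesis .
  qed
  have "mat_exp (t *\<^sub>R X) $ i $ j = (\<Sum>k<2. mat_power X k $ i $ j / fact k * t ^ k)" for i j
    unfolding mat_exp_scaleR_component
  proof (rule suminf_finite)
    fix k :: nat assume "k \<notin> {..<2}"
    then obtain m where "k = Suc (Suc m)" by (metis add_2_eq_Suc less_eqE lessThan_iff not_less)
    then show "mat_power X k $ i $ j / fact k * t ^ k = 0" by (simp add: z del: fact_Suc)
  qed simp
  then show ?thesis
    by (simp add: vec_eq_iff numeral_2_eq_2 mat_power_simps mult.commute)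
qed

lemma mat_power_conj_by: "invertible b \<Longrightarrow> mat_power (conj_by b X) k = conj_by b (mat_power X k)"
  by (induction k) (simp_all add: mat_power_simps conj_by_mult)

lemma conj_by_component: "conj_by b X $ i $ j = (\<Sum>k\<in>UNIV. \<Sum>l\<in>UNIV. matrix_inv b $ i $ l * b $ k $ j * X $ l $ k)"
  by (simp add: conj_by_def mat_mul_component sum_distrib_right sum_distrib_left mult_ac)

lemma mat_exp_conj_by:
  fixes X :: "'n::finite sqmat"
  assumes "invertible b" shows "mat_exp (conj_by b X) = conj_by b (mat_exp X)"
proof -
  have s: "summable (\<lambda>k. c * (mat_power X k $ l $ m / fact k))" for c l m
    using mat_power_summable[of X l m 1] by (intro summable_mult) simp
  have "mat_exp (conj_by b X) $ i $ j = conj_by b (mat_exp X) $ i $ j" for i j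
  proof -
    have "mat_exp (conj_by b X) $ i $ j = (\<Sum>k. \<Sum>m\<in>UNIV. \<Sum>l\<in>UNIV.
        matrix_inv b $ i $ l * b $ m $ j * (mat_power X k $ l $ m / fact k))"
      by (simp add: mat_exp_component mat_power_conj_by[OF assms] conj_by_component sum_divide_distrib)
    also have "\<dots> = (\<Sum>m\<in>UNIV. \<Sum>k. \<Sum>l\<in>UNIV.
        matrix_inv b $ i $ l * b $ m $ j * (mat_power X k $ l $ m / fact k))"
      by (intro suminf_sum summable_sum s)
    also have "\<dots> = (\<Sum>m\<in>UNIV. \<Sum>l\<in>UNIV. \<Sum>k.
        matrix_inv b $ i $ l * b $ m $ j * (mat_power X k $ l $ m / fact k))"
      by (intro sum.cong refl suminf_sum s)
    also have "\<dots> = conj_by b (mat_exp X) $ i $ j"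
      using mat_power_summable[of X _ _ 1]
      by (subst suminf_mult) (simp_all add: conj_by_component mat_exp_component)
    finally show ?thesis .
  qed
  then show ?thesis by (simp add: vec_eq_iff)
qed

lemma mat_power_diag_mat: "mat_power (diag_mat x) k = diag_mat (\<chi> i. x $ i ^ k)"
  by (induction k) (simp_all add: mat_power_simps diag_mat_diag_mat diag_mat_one)

lemma mat_exp_diag_mat: "mat_exp (diag_mat x) = diag_mat (\<chi> i. exp (x $ i))"
proof -
  have "mat_exp (diag_mat x) $ i $ j = diag_mat (\<chi> i. exp (x $ i)) $ i $ j" for i j
    by (simp add: mat_exp_component mat_power_diag_mat)
      (simp add: diag_mat_def exp_def divide_inverse mult.commute)
  then show ?thesis by (simp add: vec_eq_iff)
qed

text \<open>With E = exp (t X), the difference quotient of the inverse is minus the inverse of E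
  times (E - 1) / t. Continuity of inversion at the identity then gives the limit, without the group
  law of the exponential; invertibility near 0 comes from continuity of the determinant.\<close>

lemma mat_exp_inv_has_vector_derivative:
  fixes X :: "'n::finite sqmat"
  shows "((\<lambda>t. matrix_inv (mat_exp (t *\<^sub>R X))) has_vector_derivative - X) (at 0)"
    and "\<forall>\<^sub>F t in at 0. invertible (mat_exp (t *\<^sub>R X))"
proof -
  let ?E = "\<lambda>t. mat_exp (t *\<^sub>R X)"
  have E: "(?E has_vector_derivative X) (at 0)" by (rule mat_exp_has_vector_derivative)
  then have "isCont ?E 0" by (rule has_vector_derivative_continuous)
  then have lim: "(?E \<longlongrightarrow> mat 1) (at 0)" by (simp add: isCont_def mat_exp_zero)
  have "isCont (det :: 'n sqmat \<Rightarrow> real) (mat 1)"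
    using continuous_on_det[of UNIV "\<lambda>x::'n sqmat. x"] continuous_on_eq_continuous_at by auto
  then have "((\<lambda>t. det (?E t)) \<longlongrightarrow> 1) (at 0)"
    using isCont_tendsto_compose lim by fastforce
  then have "\<forall>\<^sub>F t in at 0. det (?E t) \<noteq> 0" by (rule tendsto_imp_eventually_ne) simp
  then show inv: "\<forall>\<^sub>F t in at 0. invertible (?E t)" by (simp add: invertible_det_nz)
  have "continuous_on {A :: 'n sqmat. det A \<noteq> 0} matrix_inv"
    by (intro continuous_on_matrix_inv) (auto simp: invertible_det_nz continuous_on_id)
  moreover have "open {A :: 'n sqmat. det A \<noteq> 0}"
    by (intro open_Collect_neq continuous_intros)
  ultimately have "isCont matrix_inv (mat 1 :: 'n sqmat)"
    by (subst (asm) continuous_on_eq_continuous_at) auto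
  then have G: "((\<lambda>t. matrix_inv (?E t)) \<longlongrightarrow> mat 1) (at 0)"
    using isCont_tendsto_compose[OF _ lim] by (fastforce simp: matrix_inv_one)
  have q: "((\<lambda>t. (?E t - mat 1) /\<^sub>R t) \<longlongrightarrow> X) (at 0)"
    using E unfolding has_vector_derivative_iff_quotient by (simp add: mat_exp_zero)
  have tm: "((\<lambda>t. f t ** g t) \<longlongrightarrow> A ** B) (at 0)"
    if "(f \<longlongrightarrow> A) (at 0)" "(g \<longlongrightarrow> B) (at 0)" for f g :: "real \<Rightarrow> 'n sqmat" and A B
    unfolding matrix_matrix_mult_def by (intro tendsto_intros that)
  have "((\<lambda>t. - (matrix_inv (?E t) ** ((?E t - mat 1) /\<^sub>R t))) \<longlongrightarrow> - (mat 1 ** X)) (at 0)"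
    by (intro tendsto_minus tm G q)
  moreover have "\<forall>\<^sub>F t in at 0. - (matrix_inv (?E t) ** ((?E t - mat 1) /\<^sub>R t)) = (matrix_inv (?E t) - mat 1) /\<^sub>R t"
    using inv
  proof eventually_elim
    case (elim t)
    have "matrix_inv (?E t) ** (?E t - mat 1) = mat 1 - matrix_inv (?E t)"
      using elim by (simp add: matrix_diff_ldistrib matrix_inv_left)
    then show ?case by (simp add: matrix_scaleR_right flip: scaleR_minus_right)
  qed
  ultimately have "((\<lambda>t. (matrix_inv (?E t) - mat 1) /\<^sub>R t) \<longlongrightarrow> - X) (at 0)"
    by (simp add: tendsto_cong)
  then show "((\<lambda>t. matrix_inv (?E t)) has_vector_derivative - X) (at 0)"
    unfolding has_vector_derivative_iff_quotient by (simp add: mat_exp_zero matrix_inv_one)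
qed

section \<open>Minimal parabolic subgroups as flag stabilizers\<close>

text \<open>The columns of \<open>b\<close>, in the order of the index type, span the members of a
  complete flag; being upper triangular in this basis means stabilizing that flag.\<close>

definition P_of :: "('n::{finite,linorder}) sqmat \<Rightarrow> 'n sqmat set"
  where "P_of b = {g \<in> carrier SL. upper (conj_by b g)}"

definition N_of :: "('n::{finite,linorder}) sqmat \<Rightarrow> 'n sqmat set"
  where "N_of b = {g. unitri (conj_by b g)}"

definition L_of :: "('n::{finite,linorder}) sqmat \<Rightarrow> 'n sqmat set"
  where "L_of b = {g \<in> carrier SL. is_diag (conj_by b g)}"

definition A_of :: "('n::{finite,linorder}) sqmat \<Rightarrow> 'n sqmat set"
  where "A_of b = {g \<in> L_of b. \<forall>k. conj_by b g $ k $ k > 0}"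

definition pos :: "'n::{finite,linorder} \<Rightarrow> nat"
  where "pos k = card {l. l < k}"

definition eps :: "'n \<Rightarrow> 'n \<Rightarrow> (real, 'n::finite) vec"
  where "eps i j = (\<chi> k. if k = i \<or> k = j then 1 else 0)"

text \<open>Forced by \<open>wvec \<bullet> wvec = 2\<close>: the row \<open>wvec v* b\<close>
  paired with \<open>eps i j\<close> must give 2, and \<open>eps i j\<close> has squared length 1 if
  \<open>i = j\<close> and 2 otherwise.\<close>

definition frame_scale :: "'n \<Rightarrow> 'n \<Rightarrow> real"
  where "frame_scale i j = (if i = j then 2 else 1)"

text \<open>Both the vector \<open>wvec\<close> and the functional it defines are supported on the
  positions \<open>i\<close> and \<open>j\<close>. Then \<open>S_mat\<close> is monomial in this
  basis: it exchanges the two basis vectors up to sign, or negates the one vector if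
  \<open>i = j\<close>.\<close>

definition frame :: "('n::{finite,linorder}) sqmat \<Rightarrow> 'n \<Rightarrow> 'n \<Rightarrow> bool"
  where "frame b i j \<longleftrightarrow> invertible b \<and> j \<le> i \<and> b *v eps i j = wvec \<and>
    wvec v* b = frame_scale i j *\<^sub>R eps i j"

section \<open>Positions and the subgroups attached to a basis\<close>

lemma pos_less: "k < l \<Longrightarrow> pos k < pos l"
  unfolding pos_def by (rule psubset_card_mono) auto

lemma pos_less_iff: "pos k < pos l \<longleftrightarrow> k < l"
  using pos_less by (metis linorder_neq_iff not_less_iff_gr_or_eq)

lemma pos_le_iff: "pos k \<le> pos l \<longleftrightarrow> k \<le> l"
  using pos_less_iff by (metis not_less)

lemma pos_eq_iff: "pos k = pos l \<longleftrightarrow> k = l"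
  using pos_le_iff by (metis antisym order_refl)

lemma pos_bound: "pos (k :: 'n::{finite,linorder}) < CARD('n)"
  unfolding pos_def by (rule psubset_card_mono) auto

lemma pos_surj:
  assumes "m < CARD('n)" obtains k :: "'n::{finite,linorder}" where "pos k = m"
proof -
  have "inj (pos :: 'n \<Rightarrow> nat)" by (simp add: inj_on_def pos_eq_iff)
  then have "card (range (pos :: 'n \<Rightarrow> nat)) = card {..<CARD('n)}"
    by (simp add: card_image)
  then have "range (pos :: 'n \<Rightarrow> nat) = {..<CARD('n)}"
    by (intro card_subset_eq) (auto simp: pos_bound)
  then show ?thesis using assms that by (metis imageE lessThan_iff)
qed

lemma subgroup_SLI:
  fixes G :: "'n::finite sqmat set"
  assumes "\<And>g. g \<in> G \<Longrightarrow> det g = 1" "mat 1 \<in> G"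
    "\<And>g h. g \<in> G \<Longrightarrow> h \<in> G \<Longrightarrow> g ** h \<in> G" "\<And>g. g \<in> G \<Longrightarrow> matrix_inv g \<in> G"
  shows "subgroup G SL"
proof (rule group.subgroupI[OF group_SL])
  show "G \<subseteq> carrier SL" "G \<noteq> {}" using assms by (auto simp: SL_simps)
qed (use assms in \<open>auto simp: SL_simps inv_SL\<close>)

lemma subgroup_SLD:
  fixes G :: "'n::finite sqmat set"
  assumes "subgroup G SL"
  shows "g \<in> G \<Longrightarrow> det g = 1" "mat 1 \<in> G" "g \<in> G \<Longrightarrow> h \<in> G \<Longrightarrow> g ** h \<in> G"
    "g \<in> G \<Longrightarrow> matrix_inv g \<in> G"
proof -
  interpret subgroup G SL by fact
  show "g \<in> G \<Longrightarrow> det g = 1" using subset by (auto simp: SL_simps)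
  show "mat 1 \<in> G" using one_closed by (simp add: SL_simps)
  show "g \<in> G \<Longrightarrow> h \<in> G \<Longrightarrow> g ** h \<in> G" using m_closed by (simp add: SL_simps)
  show "g \<in> G \<Longrightarrow> matrix_inv g \<in> G"
    using group.m_inv_consistent[OF group_SL assms] m_inv_closed
    by (metis inv_SL mem_carrier)
qed

lemma P_of_subgroup: "invertible b \<Longrightarrow> subgroup (P_of b) SL"
proof (rule subgroup_SLI)
  assume b: "invertible b"
  show "det g = 1" if "g \<in> P_of b" for g using that by (simp add: P_of_def SL_simps)
  show "mat 1 \<in> P_of b" using b by (simp add: P_of_def SL_simps upper_one)
  show "g ** h \<in> P_of b" if "g \<in> P_of b" "h \<in> P_of b" for g h
    using that b by (simp add: P_of_def SL_simps upper_mult conj_by_mult det_mul)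
  show "matrix_inv g \<in> P_of b" if "g \<in> P_of b" for g
  proof -
    have "invertible g" using that by (auto simp: P_of_def SL_invertible)
    then show ?thesis
      using that b by (simp add: P_of_def SL_simps conj_by_matrix_inv upper_matrix_inv invertible_conj_by det_matrix_inv)
  qed
qed

lemma N_of_det: "invertible b \<Longrightarrow> g \<in> N_of b \<Longrightarrow> det g = 1"
  using unitri_det det_conj_by by (fastforce simp: N_of_def)

lemma N_of_subgroup: "invertible b \<Longrightarrow> subgroup (N_of b) SL"
proof (rule subgroup_SLI)
  assume b: "invertible b"
  show "det g = 1" if "g \<in> N_of b" for g using that b N_of_det by blast
  show "mat 1 \<in> N_of b" using b by (simp add: N_of_def unitri_one)
  show "g ** h \<in> N_of b" if "g \<in> N_of b" "h \<in> N_of b" for g h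
    using that b by (simp add: N_of_def unitri_mult conj_by_mult)
  show "matrix_inv g \<in> N_of b" if "g \<in> N_of b" for g
  proof -
    have "invertible g" using N_of_det[OF b that] by (simp add: invertible_det_nz)
    then show ?thesis
      using that b by (simp add: N_of_def conj_by_matrix_inv unitri_matrix_inv)
  qed
qed

lemma N_of_subset_P_of: "invertible b \<Longrightarrow> N_of b \<subseteq> P_of b"
  using N_of_det by (auto simp: N_of_def P_of_def unitri_def SL_simps)

lemma upper_mat_power: "upper x \<Longrightarrow> upper (mat_power x m) \<and> mat_power x m $ k $ k = (x $ k $ k) ^ m"
  by (induction m) (auto simp: mat_power_simps upper_one mat_component upper_mult upper_mult_diag)

text \<open>Each factor \<open>x - mat 1\<close> moves the column position up by at least one, so
  entry \<open>p\<close>, \<open>q\<close> of the m-th power vanishes unless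
  \<open>pos p + m \<le> pos q\<close>.\<close>

lemma unitri_nilpotent:
  fixes x :: "'n::{finite,linorder} sqmat"
  assumes "unitri x" shows "mat_power (x - mat 1) CARD('n) = 0"
proof -
  have x: "(x - mat 1) $ p $ l = 0" if "pos l \<le> pos p" for p l
    using assms that by (cases "p = l") (auto simp: unitri_def upper_def mat_component pos_le_iff)
  have "mat_power (x - mat 1) m $ p $ q = 0" if "pos q < pos p + m" for m p q
    using that
  proof (induction m arbitrary: p)
    case 0
    then show ?case by (auto simp: mat_power_simps mat_component)
  next
    case (Suc m)
    have "(x - mat 1) $ p $ l * mat_power (x - mat 1) m $ l $ q = 0" for l
      using x[of l p] Suc.IH[of l] Suc.prems by (cases "pos l \<le> pos p") auto
    then show ?case unfolding mat_power_simps mat_mul_component by (intro sum.neutral) blast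
  qed
  then have "mat_power (x - mat 1) CARD('n) $ p $ q = 0" for p q
    using pos_bound[of q] by (simp add: trans_less_add2)
  then show ?thesis by (simp add: vec_eq_iff)
qed

lemma N_of_closed: "closed (N_of b)"
proof -
  have c: "closed {g. conj_by b g $ k $ l = c}" for k l c
    by (intro closed_Collect_eq continuous_on_component continuous_on_conj_by continuous_intros)
  have "N_of b = (\<Inter>k. \<Inter>l\<in>{l. l < k}. {g. conj_by b g $ k $ l = 0}) \<inter> (\<Inter>k. {g. conj_by b g $ k $ k = 1})"
    by (auto simp: N_of_def unitri_def upper_def)
  then show ?thesis using c by (auto intro!: closed_INT closed_Int)
qed

lemma N_of_convex: "convex (N_of b)"
  unfolding convex_def
  by (auto simp: N_of_def unitri_def upper_def conj_by_add conj_by_scaleR)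

text \<open>A unipotent upper triangular matrix has ones on the diagonal, so every subgroup in the
  union lies in \<open>N_of b\<close>. Conversely \<open>N_of b\<close> is itself a candidate: it is
  normal, closed, and connected because it is convex.\<close>

lemma unipotent_radical_P_of:
  assumes b: "invertible b" shows "unipotent_radical (P_of b) = N_of b"
proof
  show "unipotent_radical (P_of b) \<subseteq> N_of b"
  proof
    fix x assume "x \<in> unipotent_radical (P_of b)"
    then obtain N where N: "N \<lhd> SL\<lparr>carrier := P_of b\<rparr>" "x \<in> N" "unipotent x"
      by (auto simp: unipotent_radical_def)
    then have "x \<in> P_of b"
      by (metis normal_imp_subgroup partial_object.select_convs(1) partial_object.surjective
          partial_object.update_convs(1) subgroup.subset subsetD)
    then have u: "upper (conj_by b x)" by (simp add: P_of_def)
    obtain m where m: "mat_power (x - mat 1) m = 0" using N(3) by (auto simp: unipotent_def)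
    then have "mat_power (conj_by b x - mat 1) m = 0"
      using mat_power_conj_by[OF b, of "x - mat 1" m] b by (simp add: conj_by_diff)
    moreover have "upper (conj_by b x - mat 1)" using u upper_one by (auto simp: upper_def)
    ultimately have "(conj_by b x - mat 1) $ k $ k ^ m = 0" for k
      using upper_mat_power[of "conj_by b x - mat 1" m k] by simp
    then have "conj_by b x $ k $ k = 1" for k by (simp add: mat_component)
    with u show "x \<in> N_of b" by (simp add: N_of_def unitri_def)
  qed
next
  interpret P: group "SL\<lparr>carrier := P_of b\<rparr>"
    using group.subgroup_imp_group[OF group_SL P_of_subgroup[OF b]] .
  have inv: "inv\<^bsub>SL\<lparr>carrier := P_of b\<rparr>\<^esub> x = matrix_inv x" if "x \<in> P_of b" for x
    using group.m_inv_consistent[OF group_SL P_of_subgroup[OF b] that] that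
    by (simp add: inv_SL P_of_def)
  have "N_of b \<lhd> SL\<lparr>carrier := P_of b\<rparr>"
    unfolding P.normal_inv_iff
  proof (intro conjI ballI)
    show "subgroup (N_of b) (SL\<lparr>carrier := P_of b\<rparr>)"
      using group.subgroup_incl[OF group_SL N_of_subgroup[OF b] P_of_subgroup[OF b] N_of_subset_P_of[OF b]] .
    fix x h assume x: "x \<in> carrier (SL\<lparr>carrier := P_of b\<rparr>)" and h: "h \<in> N_of b"
    then have x: "upper (conj_by b x)" "invertible x" "x \<in> P_of b" by (auto simp: P_of_def SL_invertible)
    have h: "upper (conj_by b h)" "\<And>k. conj_by b h $ k $ k = 1" using h by (auto simp: N_of_def unitri_def)
    have xi: "upper (conj_by b (matrix_inv x))" "conj_by b x ** conj_by b (matrix_inv x) = mat 1"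
      using x b by (simp_all add: conj_by_matrix_inv upper_matrix_inv invertible_conj_by matrix_inv_right)
    then have "conj_by b x $ k $ k * conj_by b (matrix_inv x) $ k $ k = 1" for k
      using upper_mult_diag[OF x(1) xi(1), of k] by (simp add: mat_component)
    then have "unitri (conj_by b (x ** h ** matrix_inv x))"
      using x(1) h xi(1) by (simp add: conj_by_mult[OF b] unitri_def upper_mult upper_mult_diag)
    then show "x \<otimes>\<^bsub>SL\<lparr>carrier := P_of b\<rparr>\<^esub> h \<otimes>\<^bsub>SL\<lparr>carrier := P_of b\<rparr>\<^esub> inv\<^bsub>SL\<lparr>carrier := P_of b\<rparr>\<^esub> x \<in> N_of b"
      by (simp add: inv[OF x(3)] N_of_def SL_simps)
  qed
  moreover have "unipotent x" if "x \<in> N_of b" for x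
  proof -
    have "conj_by b (mat_power (x - mat 1) CARD('a)) = mat_power (conj_by b x - mat 1) CARD('a)"
      using b by (simp add: conj_by_diff flip: mat_power_conj_by)
    also have "\<dots> = conj_by b 0" using that unitri_nilpotent by (simp add: N_of_def)
    finally have "mat_power (x - mat 1) CARD('a) = 0" using conj_by_inject[OF b] by blast
    then show ?thesis by (auto simp: unipotent_def)
  qed
  ultimately show "N_of b \<subseteq> unipotent_radical (P_of b)"
    unfolding unipotent_radical_def
    using N_of_closed[of b] convex_connected[OF N_of_convex[of b]] by blast
qed

text \<open>Grow the flag one dimension at a time. The new vector is taken from a member of least
  dimension among those not yet contained in \<open>U\<close> (or from the whole space), which keeps
  the enlarged space comparable with every member of \<open>F\<close>.\<close>

lemma chain_refine:
  fixes F :: "(real, 'n::finite) vec set set"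
  assumes F: "\<And>V. V \<in> F \<Longrightarrow> subspace V" "\<And>V W. V \<in> F \<Longrightarrow> W \<in> F \<Longrightarrow> V \<subseteq> W \<or> W \<subseteq> V"
  obtains U where "\<And>k. subspace (U k)" "\<And>k. k \<le> CARD('n) \<Longrightarrow> dim (U k) = k"
    "\<And>k. U k \<subseteq> U (Suc k)" "\<And>V. V \<in> F \<Longrightarrow> V = U (dim V)"
proof -
  \<comment> \<open>The sequence is indexed by all natural numbers; the minimum lets it stay
    constant once the whole space is reached.\<close>
  define Q where "Q k U \<longleftrightarrow> subspace U \<and> dim U = min k CARD('n) \<and> (\<forall>V\<in>F. V \<subseteq> U \<or> U \<subseteq> V)"
    for k and U :: "(real, 'n) vec set"
  have "\<exists>U. \<forall>k. Q k (U k) \<and> U k \<subseteq> U (Suc k)"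
  proof (rule dependent_nat_choice)
    show "\<exists>U. Q 0 U"
      by (rule exI[of _ "{0}"]) (auto simp: Q_def subspace_0 F)
  next
    fix U k assume U: "Q k U"
    then have sU: "subspace U" by (simp add: Q_def)
    show "\<exists>U'. Q (Suc k) U' \<and> U \<subseteq> U'"
    proof (cases "k < CARD('n)")
      case False
      then show ?thesis using U by (intro exI[of _ U]) (auto simp: Q_def)
    next
      case True
      then have dU: "dim U = k" using U by (simp add: Q_def)
      let ?G = "\<lambda>V. V \<in> insert UNIV F \<and> \<not> V \<subseteq> U"
      have "U \<noteq> UNIV" using dU True by (auto simp: dim_UNIV)
      then have "?G UNIV" by auto
      then obtain V where V: "?G V" "\<And>W. ?G W \<Longrightarrow> dim V \<le> dim W"
        using ex_has_least_nat[of ?G UNIV dim] by blast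
      then obtain x where x: "x \<in> V" "x \<notin> U" by blast
      have sV: "subspace V" using V(1) F by auto
      define U' where "U' = span (insert x U)"
      have "dim U' = Suc k"
        using x(2) dU sU by (simp add: U'_def dim_insert span_eq_iff[THEN iffD2])
      moreover have "W \<subseteq> U' \<or> U' \<subseteq> W" if W: "W \<in> F" for W
      proof (cases "W \<subseteq> U")
        case True
        then show ?thesis unfolding U'_def by (meson order_trans span_superset subset_insertI)
      next
        case False
        then have "U \<subseteq> W" using U W by (auto simp: Q_def)
        have "dim V \<le> dim W" using V(2)[of W] W False by blast
        moreover have "V \<subseteq> W \<or> W \<subseteq> V" using V(1) W F(2) by auto
        ultimately have "V \<subseteq> W" using subspace_dim_equal[of W V] F(1)[OF W] sV by auto
        then have "U' \<subseteq> W" unfolding U'_def using x \<open>U \<subseteq> W\<close> F(1)[OF W]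
          by (intro span_minimal) auto
        then show ?thesis ..
      qed
      ultimately have "Q (Suc k) U'" using True by (auto simp: Q_def U'_def)
      moreover have "U \<subseteq> U'" unfolding U'_def by (meson order_trans span_superset subset_insertI)
      ultimately show ?thesis by blast
    qed
  qed
  then obtain U where U: "\<And>k. Q k (U k)" "\<And>k. U k \<subseteq> U (Suc k)" by blast
  have "V = U (dim V)" if V: "V \<in> F" for V
  proof -
    have "dim V \<le> CARD('n)" using dim_subset_UNIV_cart[of V] by simp
    then have "dim (U (dim V)) = dim V" "V \<subseteq> U (dim V) \<or> U (dim V) \<subseteq> V" "subspace (U (dim V))"
      using U(1)[of "dim V"] V by (auto simp: Q_def)
    then show ?thesis using subspace_dim_equal[of V "U (dim V)"] subspace_dim_equal[of "U (dim V)" V] F(1)[OF V]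
      by auto
  qed
  then show ?thesis using that[of U] U by (auto simp: Q_def)
qed

text \<open>Here \<open>i\<close> is the first step at which \<open>w\<close> enters the flag and
  \<open>j\<close> the first step at which the functional \<open>w \<bullet> _\<close> is nonzero.
  Since \<open>w \<bullet> w = 2\<close>, the functional is nonzero as soon as \<open>w\<close> has
  entered, whence \<open>j \<le> i\<close>.\<close>

lemma flag_basis:
  fixes U :: "nat \<Rightarrow> (real, 'n::finite) vec set" and w :: "(real, 'n) vec"
  assumes U: "\<And>k. subspace (U k)" "\<And>k. k \<le> CARD('n) \<Longrightarrow> dim (U k) = k" "\<And>k. U k \<subseteq> U (Suc k)"
    and w: "w \<bullet> w = 2"
  obtains y j i where "\<forall>k<CARD('n). y k \<in> U (Suc k) - U k" "j \<le> i" "i < CARD('n)"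
    "w = (if i = j then y i else y i + y j)"
    "\<forall>k<CARD('n). w \<bullet> y k = (if k = i \<or> k = j then (if i = j then 2 else 1) else 0)"
proof -
  have mono: "U k \<subseteq> U l" if "k \<le> l" for k l using that U(3) by (rule lift_Suc_mono_le[rotated])
  have U0: "U 0 = {0}" using U(1)[of 0] U(2)[of 0] by (auto simp: subspace_0)
  have "U CARD('n) = UNIV" using U(1,2)[of "CARD('n)"] by (metis dim_UNIV dim_eq_full le_refl span_eq_iff DIM_cart DIM_real mult.right_neutral)
  then have wn: "w \<in> U (Suc (CARD('n) - 1))" by simp
  define i where "i = (LEAST k. w \<in> U (Suc k))"
  have wi: "w \<in> U (Suc i)" unfolding i_def using wn by (rule LeastI)
  have "i \<le> CARD('n) - 1" unfolding i_def using wn by (rule Least_le)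
  moreover have "0 < CARD('n)" by simp
  ultimately have i_lt: "i < CARD('n)" by linarith
  have w0: "w \<noteq> 0" using w by auto
  have wi': "w \<notin> U i"
  proof (cases i)
    case 0 then show ?thesis using w0 U0 by simp
  next
    case (Suc k)
    then have "k < i" by simp
    then have "w \<notin> U (Suc k)" unfolding i_def by (rule not_less_Least)
    then show ?thesis by (simp add: Suc)
  qed
  define R where "R k \<longleftrightarrow> (\<exists>x\<in>U (Suc k). w \<bullet> x \<noteq> 0)" for k
  define j where "j = (LEAST k. R k)"
  have exi: "R i" using wi w unfolding R_def by (intro bexI[of _ w]) auto
  then have "R j" unfolding j_def by (rule LeastI)
  then obtain u where u: "u \<in> U (Suc j)" "w \<bullet> u \<noteq> 0" unfolding R_def by blast
  have ji: "j \<le> i" unfolding j_def using exi by (rule Least_le)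
  have below: "w \<bullet> x = 0" if "x \<in> U k" "k \<le> j" for x k
  proof (cases k)
    case 0 then show ?thesis using that U0 by simp
  next
    case (Suc l)
    then have "l < j" using that by simp
    then have "\<not> R l" unfolding j_def by (rule not_less_Least)
    then show ?thesis using that Suc by (simp add: R_def)
  qed
  have uj: "u \<notin> U j" using below[of u j] u by auto
  have "\<exists>x. x \<in> U (Suc k) - U k" if "k < CARD('n)" for k
  proof (rule ccontr)
    assume "\<not> ?thesis"
    then have "U (Suc k) = U k" using U(3) by blast
    then show False using U(2)[of k] U(2)[of "Suc k"] that by simp
  qed
  then obtain x where x: "\<And>k. k < CARD('n) \<Longrightarrow> x k \<in> U (Suc k) - U k" by metis
  \<comment> \<open>Normalised to pair with \<open>w\<close> to \<open>c\<close>: the value 2 is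
    dictated if \<open>w\<close> itself is taken, and 1 leaves
    \<open>w \<bullet> (w - yj) = 1\<close> for the partner.\<close>
  define yj where "yj = (if i = j then w else u /\<^sub>R (w \<bullet> u))"
  define c where "c = (if i = j then 2 else 1 :: real)"
  \<comment> \<open>Below \<open>j\<close> the functional vanishes already; above \<open>j\<close> a
    multiple of \<open>yj\<close> is subtracted to make it vanish, which does not change the class
    modulo the preceding space.\<close>
  define y where "y k = (if k = j then yj else if k = i then w - yj
     else if k < j then x k else x k - ((w \<bullet> x k) / c) *\<^sub>R yj)" for k
  have yj: "yj \<in> U (Suc j) - U j" "w \<bullet> yj = c"
  proof -
    show "w \<bullet> yj = c" using u w by (simp add: yj_def c_def)
    have "yj \<in> U (Suc j)" using u wi U(1) by (auto simp: yj_def subspace_scale)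
    moreover have "yj \<notin> U j"
      using below[of yj j] \<open>w \<bullet> yj = c\<close> by (auto simp: c_def split: if_splits)
    ultimately show "yj \<in> U (Suc j) - U j" by blast
  qed
  show ?thesis
  proof (rule that[of y j i]; (intro allI impI)?)
    fix k assume k: "k < CARD('n)"
    show "y k \<in> U (Suc k) - U k"
    proof -
      consider "k = j" | "k = i" "k \<noteq> j" | "k < j" "k \<noteq> i" | "j < k" "k \<noteq> i" by linarith
      then show ?thesis
      proof cases
        case 1 then show ?thesis using yj by (simp add: y_def)
      next
        case 2
        then have "yj \<in> U i" using ji yj mono[of "Suc j" i] by auto
        then have "w - yj \<in> U (Suc i)" "w - yj \<notin> U i"
          using wi wi' U(1) mono[of i "Suc i"] subspace_diff[of "U (Suc i)" w yj] subspace_add[of "U i" "w - yj" yj] by auto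
        with 2 show ?thesis by (simp add: y_def)
      next
        case 3 then show ?thesis using x[OF k] by (simp add: y_def)
      next
        case 4
        define a where "a = ((w \<bullet> x k) / c) *\<^sub>R yj"
        have "a \<in> U k" using 4 yj mono[of "Suc j" k] U(1) by (auto simp: a_def subspace_scale)
        then have "x k - a \<in> U (Suc k)" "x k - a \<notin> U k"
          using x[OF k] U(1) mono[of k "Suc k"] subspace_diff[of "U (Suc k)" "x k" a] subspace_add[of "U k" "x k - a" a] by auto
        with 4 show ?thesis by (simp add: y_def a_def)
      qed
    qed
    show "w \<bullet> y k = (if k = i \<or> k = j then (if i = j then 2 else 1) else 0)"
      using yj(2) w below[of "x k" "Suc k"] x[OF k] by (auto simp: y_def c_def inner_diff_right)
  next
    show "w = (if i = j then y i else y i + y j)" by (simp add: y_def yj_def)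
  qed (use ji i_lt in auto)
qed

text \<open>As \<open>y k\<close> lies in the next space but not in the current one, it spans the
  step; hence each member of the flag is a coordinate subspace for the basis
  \<open>b\<close>.\<close>

lemma flag_coordinates:
  fixes U :: "nat \<Rightarrow> (real, 'n::{finite,linorder}) vec set"
  assumes U: "\<And>k. subspace (U k)" "\<And>k. k \<le> CARD('n) \<Longrightarrow> dim (U k) = k" "\<And>k. U k \<subseteq> U (Suc k)"
    and y: "\<And>k. k < CARD('n) \<Longrightarrow> y k \<in> U (Suc k) - U k"
  defines "b \<equiv> (\<chi> r c. y (pos c) $ r) :: 'n sqmat"
  shows "m \<le> CARD('n) \<Longrightarrow> U m = (\<lambda>x. b *v x) ` {x. \<forall>l. m \<le> pos l \<longrightarrow> x $ l = 0}" and "invertible b"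
proof -
  have bx: "b *v axis l 1 = y (pos l)" for l
    by (simp add: matrix_vector_mult_basis column_def b_def vec_eq_iff)
  have sub: "subspace ((\<lambda>x. b *v x) ` {x. \<forall>l. m \<le> pos l \<longrightarrow> x $ l = 0})" for m
    by (intro linear_subspace_image) (auto simp: subspace_def)
  show A: "U m = (\<lambda>x. b *v x) ` {x. \<forall>l. m \<le> pos l \<longrightarrow> x $ l = 0}" if "m \<le> CARD('n)" for m
    using that
  proof (induction m)
    case 0
    have "U 0 = {0}" using U(1)[of 0] U(2)[of 0] by (auto simp: subspace_0)
    moreover have "{x :: (real,'n) vec. \<forall>l. 0 \<le> pos l \<longrightarrow> x $ l = 0} = {0}" by (auto simp: vec_eq_iff)
    ultimately show ?case by simp
  next
    case (Suc m)
    let ?C = "\<lambda>m. {x :: (real,'n) vec. \<forall>l. m \<le> pos l \<longrightarrow> x $ l = 0}"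
    have "m < CARD('n)" using Suc.prems by simp
    then obtain l :: 'n where l: "pos l = m" by (rule pos_surj)
    have ym: "y m \<in> U (Suc m)" "y m \<notin> U m" using y[of m] Suc.prems by auto
    have sp: "span (insert (y m) (U m)) \<subseteq> U (Suc m)"
      using U(3)[of m] U(1) ym by (intro span_minimal) auto
    have "dim (span (insert (y m) (U m))) = Suc m"
      using ym U(1,2)[of m] Suc.prems by (simp add: dim_insert span_eq_iff[THEN iffD2])
    then have eq: "span (insert (y m) (U m)) = U (Suc m)"
      using subspace_dim_equal[OF _ U(1) sp] U(2)[of "Suc m"] Suc.prems by simp
    show ?case
    proof
      have "y m \<in> (\<lambda>x. b *v x) ` ?C (Suc m)"
        using bx[of l] l by (intro image_eqI[of _ _ "axis l 1"]) (auto simp: axis_def)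
      moreover have "?C m \<subseteq> ?C (Suc m)" by auto
      then have "U m \<subseteq> (\<lambda>x. b *v x) ` ?C (Suc m)" using Suc by auto
      ultimately show "U (Suc m) \<subseteq> (\<lambda>x. b *v x) ` ?C (Suc m)"
        unfolding eq[symmetric] by (intro span_minimal sub) auto
    next
      show "(\<lambda>x. b *v x) ` ?C (Suc m) \<subseteq> U (Suc m)"
      proof
        fix z assume "z \<in> (\<lambda>x. b *v x) ` ?C (Suc m)"
        then obtain x where x: "z = b *v x" "x \<in> ?C (Suc m)" by blast
        define x' where "x' = x - x $ l *\<^sub>R axis l 1"
        have "x' \<in> ?C m"
        proof -
          have "x' $ k = 0" if "m \<le> pos k" for k
          proof (cases "k = l")
            case False
            then have "Suc m \<le> pos k" using that l by (metis le_neq_implies_less pos_eq_iff Suc_leI)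
            then show ?thesis using x(2) False by (simp add: x'_def axis_def)
          qed (simp add: x'_def)
          then show ?thesis by simp
        qed
        then have "b *v x' \<in> U (Suc m)" using Suc U(3)[of m] by auto
        moreover have "z = b *v x' + x $ l *\<^sub>R y m"
          using bx[of l] l by (simp add: x(1) x'_def matrix_vector_mult_diff_distrib matrix_vector_mult_scaleR)
        ultimately show "z \<in> U (Suc m)" using ym U(1)[of "Suc m"] by (simp add: subspace_add subspace_scale)
      qed
    qed
  qed
  have "U CARD('n) = UNIV" using U(1,2)[of "CARD('n)"] by (metis dim_UNIV dim_eq_full le_refl span_eq_iff DIM_cart DIM_real mult.right_neutral)
  then have "surj (\<lambda>x. b *v x)" using A[of "CARD('n)"] by blast
  then show "invertible b" using invertible_right_inverse matrix_right_invertible_surjective by blast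
qed

text \<open>The stabilizer of a complete flag refining the given one is a parabolic subgroup inside
  \<open>P\<close>, so minimality makes it equal to \<open>P\<close>. The basis adapted to that flag
  and to \<open>wvec\<close> is the frame.\<close>

lemma minimal_parabolic_frame:
  fixes P :: "'n::{finite,linorder} sqmat set"
  assumes n: "CARD('n) \<ge> 2" and P: "minimal_parabolic P"
  obtains b i j where "frame b i j" "P = P_of b"
proof -
  have "parabolic P" using P by (simp add: minimal_parabolic_def)
  then obtain F :: "(real,'n) vec set set" where F0: "\<forall>V\<in>F. subspace V"
    "\<forall>V\<in>F. \<forall>W\<in>F. V \<subseteq> W \<or> W \<subseteq> V"
    "P = {g \<in> carrier SL. \<forall>V\<in>F. (\<lambda>v. g *v v) ` V = V}"
    unfolding parabolic_def by (elim exE conjE)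
  have F: "\<And>V. V \<in> F \<Longrightarrow> subspace V" "\<And>V W. V \<in> F \<Longrightarrow> W \<in> F \<Longrightarrow> V \<subseteq> W \<or> W \<subseteq> V"
    using F0 by blast+
  obtain U where U: "\<And>k. subspace (U k)" "\<And>k. k \<le> CARD('n) \<Longrightarrow> dim (U k) = k"
    "\<And>k. U k \<subseteq> U (Suc k)" "\<And>V. V \<in> F \<Longrightarrow> V = U (dim V)"
    using chain_refine[OF F(1,2)] by blast
  define Q :: "'n sqmat set" where "Q = {g \<in> carrier SL. \<forall>V\<in>U ` {..CARD('n)}. (\<lambda>v. g *v v) ` V = V}"
  have mono: "U k \<subseteq> U l" if "k \<le> l" for k l using that U(3) by (rule lift_Suc_mono_le[rotated])
  have "parabolic Q"
    unfolding parabolic_def Q_def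
  proof (intro exI conjI)
    show "\<forall>V\<in>U ` {..CARD('n)}. subspace V" using U(1) by blast
    show "\<forall>V\<in>U ` {..CARD('n)}. \<forall>W\<in>U ` {..CARD('n)}. V \<subseteq> W \<or> W \<subseteq> V"
      using mono by (metis imageE nle_le)
  qed simp
  moreover have "Q \<subseteq> P"
  proof -
    have V: "V \<in> U ` {..CARD('n)}" if "V \<in> F" for V
      using U(4)[OF that] dim_subset_UNIV_cart[of V] by (metis atMost_iff image_eqI)
    show ?thesis
    proof
      fix g assume "g \<in> Q"
      then have "g \<in> carrier SL" "\<forall>V\<in>U ` {..CARD('n)}. (\<lambda>v. g *v v) ` V = V"
        unfolding Q_def by blast+
      moreover from this(2) have "\<forall>V\<in>F. (\<lambda>v. g *v v) ` V = V"
        using V by (intro ballI) (rule bspec)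
      ultimately show "g \<in> P" unfolding F0(3) by simp
    qed
  qed
  ultimately have PQ: "P = Q" using P unfolding minimal_parabolic_def by blast
  obtain y j i where y0: "\<forall>k<CARD('n). y k \<in> U (Suc k) - U k" and ij: "j \<le> i" "i < CARD('n)"
    "(wvec :: (real,'n) vec) = (if i = j then y i else y i + y j)"
    "\<forall>k<CARD('n). wvec \<bullet> y k = (if k = i \<or> k = j then (if i = j then 2 else 1) else 0)"
    by (rule flag_basis[where U = U and w = "wvec :: (real,'n) vec"])
      (use U in simp, use U in simp, use U in simp, use wvec_inner[OF n] in simp, rule that)
  have y: "\<And>k. k < CARD('n) \<Longrightarrow> y k \<in> U (Suc k) - U k" using y0 by blast
  define b :: "'n sqmat" where "b = (\<chi> r c. y (pos c) $ r)"
  have Um: "U m = (\<lambda>x. b *v x) ` {x. \<forall>l. m \<le> pos l \<longrightarrow> x $ l = 0}" if "m \<le> CARD('n)" for m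
    using flag_coordinates(1)[OF U(1-3) y that] by (simp add: b_def)
  have b: "invertible b" using flag_coordinates(2)[OF U(1-3) y] by (simp add: b_def)
  have bx: "b *v axis l 1 = y (pos l)" for l
    by (simp add: matrix_vector_mult_basis column_def b_def vec_eq_iff)
  obtain i' j' :: 'n where ij': "pos i' = i" "pos j' = j" using ij pos_surj[where 'n='n] by (meson le_less_trans)
  have "frame b i' j'"
    unfolding frame_def
  proof (intro conjI b)
    show "j' \<le> i'" using ij ij' by (simp flip: pos_le_iff)
    have "eps i' j' = (if i' = j' then axis i' 1 else axis i' 1 + axis j' 1)"
      by (auto simp: eps_def axis_def vec_eq_iff)
    then show "b *v eps i' j' = wvec" using ij(3) ij' by (auto simp: matrix_vector_right_distrib bx pos_eq_iff)
    have "(wvec v* b) $ k = wvec \<bullet> y (pos k)" for k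
      by (simp add: vec_mat_component b_def inner_vec_def mult.commute)
    then show "wvec v* b = frame_scale i' j' *\<^sub>R eps i' j'"
      using ij' ij(4)[rule_format, OF pos_bound] by (auto simp: vec_eq_iff frame_scale_def eps_def pos_eq_iff)
  qed
  moreover have "Q = P_of b"
  proof (intro equalityI subsetI)
    fix g assume g: "g \<in> Q"
    have "conj_by b g $ r $ c = 0" if "c < r" for r c
    proof -
      have "b *v axis c 1 \<in> U (Suc (pos c))"
        using Um[of "Suc (pos c)"] pos_bound[of c] by (auto simp: axis_def Suc_le_eq)
      moreover have "(\<lambda>v. g *v v) ` U (Suc (pos c)) = U (Suc (pos c))"
        using g pos_bound[of c] by (auto simp: Q_def Suc_le_eq)
      ultimately have "g *v (b *v axis c 1) \<in> U (Suc (pos c))" by blast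
      then obtain x where x: "g *v (b *v axis c 1) = b *v x" "\<And>l. Suc (pos c) \<le> pos l \<Longrightarrow> x $ l = 0"
        using Um[of "Suc (pos c)"] pos_bound[of c] by (auto simp: Suc_le_eq)
      have "conj_by b g *v axis c 1 = matrix_inv b *v (g *v (b *v axis c 1))"
        by (simp add: conj_by_def flip: matrix_vector_mul_assoc)
      also have "\<dots> = x" by (simp add: x(1) matrix_inv_mult_vec b)
      finally have "conj_by b g $ r $ c = x $ r" by (auto simp: matrix_vector_mult_basis column_def)
      then show ?thesis using x(2)[of r] that by (simp add: Suc_le_eq pos_less_iff)
    qed
    then show "g \<in> P_of b" using g by (auto simp: P_of_def Q_def upper_def)
  next
    fix g assume g: "g \<in> P_of b"
    have "(\<lambda>v. g *v v) ` U m = U m" if m: "m \<le> CARD('n)" for m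
    proof -
      have "(\<lambda>v. g *v v) ` U m \<subseteq> U m"
      proof
        fix z assume "z \<in> (\<lambda>v. g *v v) ` U m"
        then obtain x where x: "z = g *v (b *v x)" "\<And>l. m \<le> pos l \<Longrightarrow> x $ l = 0"
          using Um[OF m] by auto
        have "z = b *v (conj_by b g *v x)"
          by (simp add: x(1) conj_by_def matrix_inv_mult_vec b flip: matrix_vector_mul_assoc)
        moreover have "(conj_by b g *v x) $ l = 0" if "m \<le> pos l" for l
        proof -
          have "conj_by b g $ l $ k * x $ k = 0" for k
            using g x(2)[of k] that pos_less_iff[of k l]
            by (cases "m \<le> pos k") (auto simp: P_of_def upper_def)
          then show ?thesis unfolding mat_vec_component by (intro sum.neutral) blast
        qed
        ultimately show "z \<in> U m" using Um[OF m] by blast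
      qed
      moreover have "subspace ((\<lambda>v. g *v v) ` U m)" using U(1) by (intro linear_subspace_image) auto
      \<comment> \<open>A matrix in \<open>P_of b\<close> is invertible, so the inclusion of the
        image is an equality by dimension.\<close>
      moreover have "dim ((\<lambda>v. g *v v) ` U m) = dim (U m)"
        using inj_on_subset[OF inj_matrix_vector_mult[of g] subset_UNIV] g
        by (intro dim_image_eq) (auto simp: P_of_def SL_invertible)
      ultimately show ?thesis using subspace_dim_equal[of "(\<lambda>v. g *v v) ` U m" "U m"] U(1) by simp
    qed
    then show "g \<in> Q" using g by (auto simp: P_of_def Q_def)
  qed
  ultimately show ?thesis using that PQ by blast
qed

section \<open>Split components\<close>

definition diag_conj :: "('n::finite) sqmat \<Rightarrow> (real, 'n) vec \<Rightarrow> 'n sqmat"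
  where "diag_conj b x = b ** diag_mat x ** matrix_inv b"

lemma conj_by_diag_conj [simp]: "invertible b \<Longrightarrow> conj_by b (diag_conj b x) = diag_mat x"
  by (simp add: diag_conj_def conj_by_cancel)

lemma is_diag_conj_by_iff: "invertible b \<Longrightarrow> is_diag (conj_by b g) \<longleftrightarrow> (\<exists>d. g = diag_conj b d)"
  by (metis conj_by_diag_conj conj_by_inject is_diag_diag_mat is_diag_eq_diag_mat)

lemma det_diag_conj: "invertible b \<Longrightarrow> det (diag_conj b x) = (\<Prod>k\<in>UNIV. x $ k)"
  by (metis conj_by_diag_conj det_conj_by det_diag_mat)

lemma trace_diag_conj: "invertible b \<Longrightarrow> trace (diag_conj b x) = (\<Sum>k\<in>UNIV. x $ k)"
  by (metis conj_by_diag_conj trace_conj_by trace_diag_mat)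

lemma diag_conj_L_of: "invertible b \<Longrightarrow> diag_conj b d \<in> L_of b \<longleftrightarrow> (\<Prod>k\<in>UNIV. d $ k) = 1"
  by (simp add: L_of_def SL_simps det_diag_conj is_diag_diag_mat)

lemma L_of_diag_conj: "invertible b \<Longrightarrow> g \<in> L_of b \<Longrightarrow> \<exists>d. g = diag_conj b d \<and> (\<Prod>k\<in>UNIV. d $ k) = 1"
  using is_diag_conj_by_iff diag_conj_L_of unfolding L_of_def by fastforce

lemma prod_one_nonzero:
  fixes d :: "(real, 'n::finite) vec"
  assumes "(\<Prod>k\<in>UNIV. d $ k) = 1" shows "d $ k \<noteq> 0"
  using assms prod_zero[of "UNIV :: 'n set" "\<lambda>k. d $ k"] by force

lemma diag_mat_component: "diag_mat d $ k $ l = (if k = l then d $ k else 0)"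
  by (simp add: diag_mat_def)

lemma A_of_exp:
  assumes "invertible b"
  shows "A_of b = (\<lambda>x. diag_conj b (\<chi> k. exp (x $ k))) ` {x. (\<Sum>k\<in>UNIV. x $ k) = 0}"
proof (intro equalityI subsetI)
  fix g assume "g \<in> A_of b"
  then have g: "g \<in> L_of b" "\<And>k. conj_by b g $ k $ k > 0" by (auto simp: A_of_def)
  then obtain d where d: "g = diag_conj b d" "(\<Prod>k\<in>UNIV. d $ k) = 1" using L_of_diag_conj[OF assms] by blast
  have dp: "d $ k > 0" for k using g(2)[of k] assms by (simp add: d diag_mat_component)
  let ?x = "\<chi> k. ln (d $ k)"
  have "exp (\<Sum>k\<in>UNIV. ?x $ k) = 1" using d dp by (simp add: exp_sum)
  then have "(\<Sum>k\<in>UNIV. ?x $ k) = 0" by simp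
  moreover have "g = diag_conj b (\<chi> k. exp (?x $ k))" using d dp by (simp add: diag_conj_def)
  ultimately show "g \<in> (\<lambda>x. diag_conj b (\<chi> k. exp (x $ k))) ` {x. (\<Sum>k\<in>UNIV. x $ k) = 0}" by blast
next
  fix g assume "g \<in> (\<lambda>x. diag_conj b (\<chi> k. exp (x $ k))) ` {x. (\<Sum>k\<in>UNIV. x $ k) = 0}"
  then obtain x where x: "g = diag_conj b (\<chi> k. exp (x $ k))" "(\<Sum>k\<in>UNIV. x $ k) = 0" by blast
  have "(\<Prod>k\<in>UNIV. exp (x $ k)) = 1" using x(2) by (simp flip: exp_sum)
  then show "g \<in> A_of b" using assms by (simp add: A_of_def x(1) diag_conj_L_of diag_mat_component)
qed

lemma A_of_connected:
  assumes "invertible b" shows "connected (A_of b)"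
proof -
  have "continuous_on {x. (\<Sum>k\<in>UNIV. x $ k) = 0} (\<lambda>x. diag_conj b (\<chi> k. exp (x $ k)))"
  proof -
    have "continuous_on T (\<lambda>x. diag_mat (\<chi> k. exp (x $ k)))" for T :: "(real,'a) vec set"
      unfolding diag_mat_def
    proof (intro continuous_on_vec_lambda)
      fix k l show "continuous_on T (\<lambda>x. if k = l then (\<chi> k. exp (x $ k)) $ k else 0)"
        by (cases "k = l") (auto intro!: continuous_intros)
    qed
    then show ?thesis unfolding diag_conj_def by (intro continuous_intros)
  qed
  moreover have "convex {x :: (real,'a) vec. (\<Sum>k\<in>UNIV. x $ k) = 0}"
    by (simp add: convex_def sum.distrib flip: sum_distrib_left)
  ultimately show ?thesis
    unfolding A_of_exp[OF assms] by (intro connected_continuous_image convex_connected)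
qed

lemma L_of_subgroup: "invertible b \<Longrightarrow> subgroup (L_of b) SL"
proof (rule subgroup_SLI)
  assume b: "invertible b"
  show "det g = 1" if "g \<in> L_of b" for g using that by (simp add: L_of_def SL_simps)
  show "mat 1 \<in> L_of b" using b by (simp add: L_of_def SL_simps is_diag_def mat_component)
  show "g ** h \<in> L_of b" if "g \<in> L_of b" "h \<in> L_of b" for g h
    using that b by (simp add: L_of_def SL_simps is_diag_mult conj_by_mult det_mul)
  show "matrix_inv g \<in> L_of b" if "g \<in> L_of b" for g
  proof -
    have "invertible g" using that by (auto simp: L_of_def SL_invertible)
    then show ?thesis
      using that b by (simp add: L_of_def SL_simps conj_by_matrix_inv is_diag_matrix_inv invertible_conj_by det_matrix_inv)
  qed
qed

lemma A_of_subgroup: "invertible b \<Longrightarrow> subgroup (A_of b) SL"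
proof (rule subgroup_SLI)
  assume b: "invertible b"
  note L = subgroup_SLD[OF L_of_subgroup[OF b]]
  have diag: "g \<in> L_of b \<Longrightarrow> upper (conj_by b g)" for g by (simp add: L_of_def is_diag_upper)
  show "det g = 1" if "g \<in> A_of b" for g using that L by (auto simp: A_of_def)
  show "mat 1 \<in> A_of b" using b L by (simp add: A_of_def mat_component)
  show "g ** h \<in> A_of b" if "g \<in> A_of b" "h \<in> A_of b" for g h
    using that L diag by (simp add: A_of_def conj_by_mult[OF b] upper_mult_diag)
  show "matrix_inv g \<in> A_of b" if "g \<in> A_of b" for g
  proof -
    have g: "g \<in> L_of b" "invertible g" "matrix_inv g \<in> L_of b" "\<And>k. conj_by b g $ k $ k > 0"
      using that L by (auto simp: A_of_def L_of_def SL_invertible)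
    have "conj_by b g $ k $ k * conj_by b (matrix_inv g) $ k $ k = 1" for k
      using upper_mult_diag[OF diag diag, OF g(1,3), of k] b g(2)
      by (simp add: matrix_inv_right mat_component flip: conj_by_mult)
    then have "conj_by b (matrix_inv g) $ k $ k > 0" for k
      using g(4)[of k] by (metis zero_less_mult_pos zero_less_one)
    then show ?thesis using g by (simp add: A_of_def)
  qed
qed

text \<open>A diagonal entry is continuous and never zero on \<open>L_of b\<close>, and it is 1 at
  the identity; on a connected set it stays positive by the intermediate value theorem.\<close>

lemma connected_subset_A_of:
  assumes b: "invertible b" and B: "B \<subseteq> L_of b" "mat 1 \<in> B" "connected B"
  shows "B \<subseteq> A_of b"
proof
  fix g assume g: "g \<in> B"
  have "conj_by b g $ k $ k > 0" for k
  proof (rule ccontr)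
    assume "\<not> ?thesis"
    then have neg: "conj_by b g $ k $ k \<le> 0" by simp
    have "connected ((\<lambda>g. conj_by b g $ k $ k) ` B)"
      by (intro connected_continuous_image B continuous_on_component continuous_intros)
    moreover have "conj_by b g $ k $ k \<in> (\<lambda>g. conj_by b g $ k $ k) ` B" using g by blast
    moreover have "1 \<in> (\<lambda>g. conj_by b g $ k $ k) ` B"
      using B(2) b by (intro image_eqI[of _ _ "mat 1"]) (simp_all add: mat_component)
    ultimately have "0 \<in> (\<lambda>g. conj_by b g $ k $ k) ` B"
      using connected_contains_Icc[of "(\<lambda>g. conj_by b g $ k $ k) ` B" "conj_by b g $ k $ k" 1] neg by auto
    then obtain h where h: "h \<in> B" "conj_by b h $ k $ k = 0" by auto
    then obtain d where d: "h = diag_conj b d" "(\<Prod>k\<in>UNIV. d $ k) = 1" using L_of_diag_conj[OF b] B by blast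
    then show False using h(2) b by (auto simp: diag_mat_component dest: prod_one_nonzero[of _ k])
  qed
  then show "g \<in> A_of b" using g B by (auto simp: A_of_def)
qed

lemma L_of_commute: "invertible b \<Longrightarrow> g \<in> L_of b \<Longrightarrow> h \<in> L_of b \<Longrightarrow> g ** h = h ** g"
  by (metis (no_types, lifting) L_of_def conj_by_inject conj_by_mult is_diag_commute mem_Collect_eq)

lemma L_of_closed: "closed (L_of b)"
proof -
  have "L_of b = (\<Inter>k. \<Inter>l\<in>{l. k \<noteq> l}. {g. conj_by b g $ k $ l = 0}) \<inter> {g. det g = 1}"
    by (auto simp: L_of_def is_diag_def SL_simps)
  moreover have "closed {g. conj_by b g $ k $ l = 0}" for k l
    by (intro closed_Collect_eq continuous_on_component continuous_on_conj_by continuous_intros)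
  moreover have "closed {g :: 'a sqmat. det g = 1}"
    by (intro closed_Collect_eq continuous_intros)
  ultimately show ?thesis by (auto intro!: closed_INT closed_Int)
qed

lemma connected_split_A_of: "invertible b \<Longrightarrow> connected_split_subgroup (A_of b)"
  unfolding connected_split_subgroup_def
proof (intro conjI exI[of _ b])
  assume b: "invertible b"
  show "\<forall>a\<in>A_of b. \<forall>i j. i \<noteq> j \<longrightarrow> (matrix_inv b ** a ** b) $ i $ j = 0"
    by (auto simp: A_of_def L_of_def is_diag_def conj_by_def)
qed (auto intro: A_of_subgroup A_of_connected)

lemma mem_set_mult_SL: "g \<in> A <#>\<^bsub>SL\<^esub> B \<longleftrightarrow> (\<exists>x\<in>A. \<exists>y\<in>B. g = x ** y)"
  by (auto simp: set_mult_def SL_simps)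

text \<open>The diagonal subgroup is a commutative Levi subgroup. Its connected subgroups have
  positive diagonal entries, so \<open>A_of b\<close> is the largest of them.\<close>

lemma split_component_A_of:
  assumes b: "invertible b" shows "split_component (A_of b) (P_of b)"
  unfolding split_component_def
proof (intro exI[of _ "L_of b"] conjI allI impI)
  show "levi_subgroup (L_of b) (P_of b)"
    unfolding levi_subgroup_def unipotent_radical_P_of[OF b]
  proof (intro conjI)
    show "L_of b \<subseteq> P_of b" by (auto simp: L_of_def P_of_def is_diag_upper)
    show "L_of b \<inter> N_of b = {mat 1}"
    proof (intro equalityI subsetI)
      fix g assume "g \<in> L_of b \<inter> N_of b"
      then have "conj_by b g = conj_by b (mat 1)"
        using b by (simp add: L_of_def N_of_def is_diag_unitri)
      then show "g \<in> {mat 1}" using conj_by_inject[OF b] by blast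
    qed (use subgroup_SLD(2)[OF L_of_subgroup[OF b]] subgroup_SLD(2)[OF N_of_subgroup[OF b]] in auto)
    show "L_of b <#>\<^bsub>SL\<^esub> N_of b = P_of b"
    proof (intro equalityI subsetI)
      fix g assume "g \<in> L_of b <#>\<^bsub>SL\<^esub> N_of b"
      then obtain l n where "g = l ** n" "l \<in> L_of b" "n \<in> N_of b"
        by (auto simp: set_mult_def SL_simps)
      then show "g \<in> P_of b"
        using subgroup_SLD(3)[OF P_of_subgroup[OF b]] N_of_subset_P_of[OF b]
        by (auto simp: L_of_def P_of_def is_diag_upper)
    next
      fix g assume g: "g \<in> P_of b"
      \<comment> \<open>Dividing by the diagonal part leaves a unitriangular factor, which is the
        decomposition of \<open>P_of b\<close>.\<close>
      define d where "d = (\<chi> k. conj_by b g $ k $ k)"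
      have u: "upper (conj_by b g)" "det g = 1" using g by (auto simp: P_of_def SL_simps)
      then have prod: "(\<Prod>k\<in>UNIV. d $ k) = 1" using det_upper[OF u(1)] by (simp add: d_def det_conj_by b)
      then have d0: "d $ k \<noteq> 0" for k by (rule prod_one_nonzero)
      have l: "diag_conj b d \<in> L_of b" using prod b by (simp add: diag_conj_L_of)
      have li: "invertible (diag_conj b d)" using prod b by (simp add: invertible_det_nz det_diag_conj)
      have "unitri (diag_mat (\<chi> k. inverse (d $ k)) ** conj_by b g)"
        using u d0 by (simp add: unitri_def upper_mult is_diag_upper is_diag_diag_mat upper_mult_diag)
          (simp add: diag_mat_component d_def)
      then have "matrix_inv (diag_conj b d) ** g \<in> N_of b"
        using b d0 li by (simp add: N_of_def conj_by_mult conj_by_matrix_inv matrix_inv_diag_mat)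
      moreover have "g = diag_conj b d ** (matrix_inv (diag_conj b d) ** g)"
        using li by (simp add: matrix_mul_assoc matrix_inv_right)
      ultimately show "g \<in> L_of b <#>\<^bsub>SL\<^esub> N_of b" using l by (auto simp: set_mult_def SL_simps)
    qed
  qed (use L_of_subgroup[OF b] L_of_closed in auto)
  show "connected_split_subgroup (A_of b)" using b by (rule connected_split_A_of)
  show "A_of b \<subseteq> group_center (L_of b)"
    using L_of_commute[OF b] by (auto simp: group_center_def A_of_def)
  fix B assume B: "connected_split_subgroup B \<and> B \<subseteq> group_center (L_of b) \<and> A_of b \<subseteq> B"
  then have "B \<subseteq> A_of b"
    using subgroup_SLD(2)[of B]
    by (intro connected_subset_A_of b) (auto simp: connected_split_subgroup_def group_center_def)
  with B show "B = A_of b" by blast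
qed

section \<open>All split components come from adapted bases\<close>

lemma upper_conj_by: "upper u \<Longrightarrow> invertible u \<Longrightarrow> upper (conj_by u x) \<longleftrightarrow> upper x"
  unfolding conj_by_def
  by (metis conj_by_cancel2 conj_by_def upper_matrix_inv upper_mult)

lemma P_of_upper:
  assumes "invertible b" "upper u" "invertible u" shows "P_of (b ** u) = P_of b"
  using assms by (auto simp: P_of_def conj_by_conj_by upper_conj_by)

lemma A_of_diag_mat:
  assumes "invertible b" "\<And>k. c $ k \<noteq> 0" shows "A_of (b ** diag_mat c) = A_of b"
proof -
  have c: "invertible (diag_mat c)" using assms(2) by (simp add: invertible_det_nz det_diag_mat)
  have diag: "conj_by (diag_mat c) (diag_mat d) = diag_mat d" for d
    using assms(2) by (simp add: conj_by_def matrix_inv_diag_mat diag_mat_diag_mat field_simps)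
  have "is_diag (conj_by (diag_mat c) y) \<longleftrightarrow> is_diag y" for y
    using diag is_diag_eq_diag_mat is_diag_diag_mat conj_by_inject[OF c] by metis
  then have eq: "is_diag y \<and> P (conj_by (diag_mat c) y) \<longleftrightarrow> is_diag y \<and> P y" for y P
    using diag is_diag_eq_diag_mat by metis
  have "is_diag (conj_by (diag_mat c) y) \<and> (\<forall>k. conj_by (diag_mat c) y $ k $ k > 0) \<longleftrightarrow> is_diag y \<and> (\<forall>k. y $ k $ k > 0)" for y
    using eq[of y "\<lambda>y. \<forall>k. y $ k $ k > 0"] \<open>\<And>y. is_diag (conj_by (diag_mat c) y) \<longleftrightarrow> is_diag y\<close> by blast
  then show ?thesis using assms(1) c by (auto simp: A_of_def L_of_def conj_by_conj_by)
qed

text \<open>Distinct positive entries with product 1: subtracting the mean of the positions in the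
  exponent normalises the determinant.\<close>

definition regular_vec :: "(real, 'n::{finite,linorder}) vec"
  where "regular_vec = (\<chi> k. exp (real (pos k) - (\<Sum>l\<in>(UNIV::'n set). real (pos l)) / real CARD('n)))"

lemma regular_vec:
  shows "regular_vec $ k = regular_vec $ l \<longleftrightarrow> k = (l :: 'n::{finite,linorder})" "regular_vec $ k > 0"
    "(\<Prod>k\<in>(UNIV::'n set). regular_vec $ k) = 1"
proof -
  show "regular_vec $ k = regular_vec $ l \<longleftrightarrow> k = l" by (simp add: regular_vec_def pos_eq_iff)
  show "regular_vec $ k > 0" by (simp add: regular_vec_def)
  show "(\<Prod>k\<in>(UNIV::'n set). regular_vec $ k) = 1"
    by (simp add: regular_vec_def sum_subtractf flip: exp_sum)
qed

text \<open>An eigenvector for the eigenvalue \<open>y $ k $ k\<close> has its last nonzero entry at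
  \<open>k\<close>, because the diagonal entries are distinct. Scaled to 1 there, the eigenvectors
  form a unitriangular matrix.\<close>

lemma diagonalize_upper:
  fixes y :: "'n::{finite,linorder} sqmat"
  assumes y: "upper y" and dist: "\<And>k l. y $ k $ k = y $ l $ l \<longleftrightarrow> k = l"
  obtains u where "unitri u" "is_diag (conj_by u y)" "\<And>k. conj_by u y $ k $ k = y $ k $ k"
proof -
  have "\<exists>x. y *v x = (y $ k $ k) *\<^sub>R x \<and> x $ k = 1 \<and> (\<forall>l. k < l \<longrightarrow> x $ l = 0)" for k
  proof -
    let ?z = "y - mat (y $ k $ k)"
    have z: "upper ?z" using y by (auto simp: upper_def mat_component)
    have "?z $ k $ k = 0" by (simp add: mat_component)
    then have "det ?z = 0" unfolding det_upper[OF z] by (intro prod_zero) auto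
    then have "\<not> (\<exists>B. B ** ?z = mat 1)" using invertible_det_nz invertible_left_inverse by metis
    then obtain x where x: "?z *v x = 0" "x \<noteq> 0" using matrix_left_invertible_ker by metis
    have "mat c *v x = c *\<^sub>R x" for c
    proof -
      have "(mat c *v x) $ p = (\<Sum>q\<in>UNIV. if p = q then c * x $ q else 0)" for p
        unfolding mat_vec_component mat_component by (intro sum.cong) auto
      then show ?thesis by (simp add: vec_eq_iff)
    qed
    then have yx: "y *v x = (y $ k $ k) *\<^sub>R x" using x(1) by (simp add: matrix_vector_mult_diff_rdistrib)
    obtain m where m: "x $ m \<noteq> 0" "\<And>l. m < l \<Longrightarrow> x $ l = 0" using last_nonzero[OF x(2)] by blast
    have "(y *v x) $ m = y $ m $ m * x $ m" by (rule upper_mult_last[OF y]) (rule m(2))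
    then have "y $ m $ m * x $ m = y $ k $ k * x $ m" unfolding yx by auto
    then have mk: "m = k" using m(1) dist by simp
    show ?thesis
      using m yx unfolding mk
      by (intro exI[of _ "inverse (x $ k) *\<^sub>R x"]) (simp add: matrix_vector_mult_scaleR)
  qed
  then obtain X where X: "\<And>k. y *v X k = (y $ k $ k) *\<^sub>R X k" "\<And>k. X k $ k = 1"
    "\<And>k l. k < l \<Longrightarrow> X k $ l = 0" by metis
  define u where "u = (\<chi> r c. X c $ r)"
  have u: "unitri u" using X by (simp add: unitri_def upper_def u_def)
  have "(y ** u) $ r $ c = (u ** diag_mat (\<chi> k. y $ k $ k)) $ r $ c" for r c
  proof -
    have "(y ** u) $ r $ c = (y *v X c) $ r" by (simp add: mat_mul_component mat_vec_component u_def)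
    then show ?thesis by (simp add: X(1) diag_mat_mult_right u_def mult.commute)
  qed
  then have "y ** u = u ** diag_mat (\<chi> k. y $ k $ k)" by (simp add: vec_eq_iff)
  then have "conj_by u y = diag_mat (\<chi> k. y $ k $ k)"
    unfolding conj_by_def using matrix_inv_left[OF unitri_invertible[OF u]]
    by (metis matrix_mul_assoc matrix_mul_lid)
  then show ?thesis using that[OF u] by (simp add: is_diag_diag_mat diag_mat_component)
qed

lemma commute_regular_diag:
  assumes "is_diag y" "\<And>k l. y $ k $ k = y $ l $ l \<longleftrightarrow> k = l" "x ** y = y ** x"
  shows "is_diag x"
  unfolding is_diag_def
proof (intro allI impI)
  fix k l :: 'a assume "k \<noteq> l"
  obtain d where d: "y = diag_mat d" using assms(1) is_diag_eq_diag_mat by blast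
  have "x $ k $ l * d $ l = d $ k * x $ k $ l"
    using assms(3) unfolding d vec_eq_iff by (metis diag_mat_mult_left diag_mat_mult_right)
  moreover have "d $ k \<noteq> d $ l" using assms(2)[of k l] \<open>k \<noteq> l\<close> by (simp add: d diag_mat_component)
  ultimately show "x $ k $ l = 0" by (simp add: mult.commute)
qed

text \<open>An arbitrary Levi subgroup \<open>L\<close> is commutative and contains an element with
  distinct eigenvalues. Diagonalizing that element by a unitriangular change of basis diagonalizes
  all of \<open>L\<close>, and maximality of \<open>A\<close> then identifies it with the positive
  diagonal group of the new basis.\<close>

lemma split_component_cases:
  fixes b :: "'n::{finite,linorder} sqmat"
  assumes b: "invertible b" and A: "split_component A (P_of b)"
  obtains u where "unitri u" "A = A_of (b ** u)"
proof -
  obtain L where L: "subgroup L SL" "L \<subseteq> P_of b" "L <#>\<^bsub>SL\<^esub> N_of b = P_of b" "L \<inter> N_of b = {mat 1}"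
    and A': "connected_split_subgroup A" "A \<subseteq> group_center L"
    "\<And>B. connected_split_subgroup B \<Longrightarrow> B \<subseteq> group_center L \<Longrightarrow> A \<subseteq> B \<Longrightarrow> B = A"
    using A unfolding split_component_def levi_subgroup_def unipotent_radical_P_of[OF b] by metis
  note Lg = subgroup_SLD[OF L(1)]
  note Pg = subgroup_SLD[OF P_of_subgroup[OF b]]
  have inv: "invertible g" if "g \<in> P_of b" for g using that by (auto simp: P_of_def SL_invertible)
  have up: "upper (conj_by b g)" if "g \<in> P_of b" for g using that by (auto simp: P_of_def)
  have diag_mult: "conj_by b (g ** h) $ k $ k = conj_by b g $ k $ k * conj_by b h $ k $ k"
    if "g \<in> P_of b" "h \<in> P_of b" for g h k
    using that by (simp add: conj_by_mult b upper_mult_diag up)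
  have comm: "g ** h = h ** g" if g: "g \<in> L" and h: "h \<in> L" for g h
  proof -
    let ?gi = "matrix_inv g" and ?hi = "matrix_inv h"
    have mem: "g \<in> P_of b" "h \<in> P_of b" "?gi \<in> L" "?hi \<in> L" "?gi \<in> P_of b" "?hi \<in> P_of b"
      using g h L(2) Lg(4) by auto
    have ii: "g ** ?gi = mat 1" "h ** ?hi = mat 1" using inv mem by (simp_all add: matrix_inv_right)
    have d: "conj_by b g $ k $ k * conj_by b ?gi $ k $ k = 1" "conj_by b h $ k $ k * conj_by b ?hi $ k $ k = 1" for k
      using diag_mult[of g ?gi k] diag_mult[of h ?hi k] mem ii b by (simp_all add: mat_component)
    \<comment> \<open>The commutator has ones on the diagonal, so it lies in \<open>N_of b\<close>,
      which meets \<open>L\<close> in the identity only.\<close>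
    let ?c = "g ** h ** (?gi ** ?hi)"
    have cP: "g ** h \<in> P_of b" "?gi ** ?hi \<in> P_of b" using mem Pg(3) by auto
    have "conj_by b ?c $ k $ k = 1" for k
      using d[of k] diag_mult[OF cP, of k] diag_mult[OF mem(1,2), of k] diag_mult[OF mem(5,6), of k]
      by (simp add: algebra_simps)
    moreover have "?c \<in> P_of b" using cP Pg(3) by auto
    ultimately have "?c \<in> N_of b" by (simp add: N_of_def unitri_def up)
    moreover have "?c \<in> L" using g h mem Lg(3) by auto
    ultimately have c1: "?c = mat 1" using L(4) by blast
    have "?c ** (h ** g) = g ** h ** (?gi ** (?hi ** h) ** g)"
      by (simp add: matrix_mul_assoc)
    also have "\<dots> = g ** h" using inv mem by (simp add: matrix_inv_left)
    finally show ?thesis using c1 by simp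
  qed
  \<comment> \<open>The unipotent factor has ones on the diagonal, so the factor in \<open>L\<close>
    inherits the distinct diagonal entries.\<close>
  have "diag_conj b regular_vec \<in> P_of b"
    using b regular_vec(3)[where 'n='n] by (simp add: P_of_def SL_simps det_diag_conj is_diag_upper is_diag_diag_mat)
  then obtain l n where ln: "diag_conj b regular_vec = l ** n" "l \<in> L" "n \<in> N_of b"
    unfolding L(3)[symmetric] mem_set_mult_SL by blast
  have lP: "l \<in> P_of b" using ln(2) L(2) by blast
  have "conj_by b l $ k $ k = regular_vec $ k" for k
    using diag_mult[of l n k] ln(1,3) lP N_of_subset_P_of[OF b] b
    by (auto simp: N_of_def unitri_def diag_mat_component dest!: arg_cong[where f="\<lambda>x. conj_by b x $ k $ k"])
  then have ld: "conj_by b l $ k $ k = conj_by b l $ m $ m \<longleftrightarrow> k = m" for k m by (simp add: regular_vec)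
  obtain u where u: "unitri u" "is_diag (conj_by u (conj_by b l))" "\<And>k. conj_by u (conj_by b l) $ k $ k = conj_by b l $ k $ k"
    using diagonalize_upper[OF up[OF lP] ld] by blast
  define b' where "b' = b ** u"
  have ui: "invertible u" using u(1) by (rule unitri_invertible)
  have b': "invertible b'" using b ui by (simp add: b'_def invertible_mult)
  have cj': "conj_by b' x = conj_by u (conj_by b x)" for x by (simp add: b'_def conj_by_conj_by b ui)
  have LL: "L \<subseteq> L_of b'"
  proof
    fix g assume g: "g \<in> L"
    have "conj_by b' g ** conj_by b' l = conj_by b' l ** conj_by b' g"
      using comm[OF g ln(2)] by (simp flip: conj_by_mult[OF b'])
    then have "is_diag (conj_by b' g)"
      by (rule commute_regular_diag[rotated -1]) (use u ld in \<open>auto simp: cj'\<close>)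
    then show "g \<in> L_of b'" using Lg(1)[OF g] by (simp add: L_of_def SL_simps)
  qed
  have PP: "P_of b' = P_of b" unfolding b'_def using b u(1) ui by (intro P_of_upper) (auto simp: unitri_def)
  then have NN: "N_of b' = N_of b" using unipotent_radical_P_of b b' by metis
  \<comment> \<open>If \<open>a\<close> is \<open>l ** n\<close>, then \<open>n\<close> is a
    quotient of two elements diagonal in the new basis and is also unitriangular, hence the
    identity.\<close>
  have AL: "A_of b' \<subseteq> L"
  proof
    fix a assume a: "a \<in> A_of b'"
    then have aL: "a \<in> L_of b'" by (simp add: A_of_def)
    then have "a \<in> P_of b" unfolding PP[symmetric] by (auto simp: L_of_def P_of_def is_diag_upper)
    then obtain l n where ln: "a = l ** n" "l \<in> L" "n \<in> N_of b"
      unfolding L(3)[symmetric] mem_set_mult_SL by blast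
    have "l \<in> L_of b'" using ln LL by blast
    then have "matrix_inv l ** a \<in> L_of b'" using aL subgroup_SLD[OF L_of_subgroup[OF b']] by blast
    moreover have "matrix_inv l ** a = n"
      using ln inv L(2) by (auto simp: matrix_mul_assoc matrix_inv_left)
    ultimately have "is_diag (conj_by b' n)" "n \<in> N_of b'" using ln(3) NN by (simp_all add: L_of_def)
    then have "conj_by b' n = mat 1" by (simp add: N_of_def is_diag_unitri)
    then have "n = mat 1" using conj_by_inject[OF b', of n "mat 1"] b' by simp
    then show "a \<in> L" using ln by simp
  qed
  have "A \<subseteq> A_of b'"
    using A'(1,2) LL subgroup_SLD(2)[of A]
    by (intro connected_subset_A_of b') (auto simp: connected_split_subgroup_def group_center_def)
  moreover have "A_of b' \<subseteq> group_center L" using AL comm by (auto simp: group_center_def)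
  ultimately have "A_of b' = A" using A'(3) connected_split_A_of[OF b'] by blast
  then show ?thesis using that u(1) b'_def by blast
qed

text \<open>Stability says that conjugation by \<open>M\<close>, the matrix of \<open>S_mat\<close>,
  keeps a regular diagonal matrix diagonal. Distinct entries then allow at most one nonzero entry in
  each row and column of \<open>M\<close>, while \<open>M\<close> differs from the identity by a
  rank one matrix. Together these restrict \<open>\<omega>\<close> and \<open>\<eta>\<close> to one
  or two positions.\<close>

lemma sigma_stable_frame:
  fixes b :: "'n::{finite,linorder} sqmat"
  assumes n: "CARD('n) \<ge> 2" and b: "invertible b" and st: "sigma_inv ` A_of b = A_of b"
  obtains c i j where "\<And>k. c $ k \<noteq> 0" "frame (b ** diag_mat c) i j"
proof -
  define M where "M = conj_by b S_mat"
  define \<omega> where "\<omega> = matrix_inv b *v wvec"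
  define \<eta> where "\<eta> = wvec v* b"
  have M: "M = mat 1 - outer \<omega> \<eta>"
    using b by (simp add: M_def S_mat_eq[OF n] conj_by_diff)
      (simp add: conj_by_def outer_left outer_right \<omega>_def \<eta>_def)
  have M_comp: "M $ p $ q = (if p = q then 1 else 0) - \<omega> $ p * \<eta> $ q" for p q
    by (simp add: M mat_component outer_def)
  have MM: "M ** M = mat 1"
    unfolding M_def using b by (simp add: S_mat_square[OF n] flip: conj_by_mult)
  have dot: "\<eta> \<bullet> \<omega> = 2"
    unfolding \<eta>_def \<omega>_def inner_vec_mat using b by (simp add: matrix_inv_mult_vec wvec_inner[OF n])
  have reg: "diag_conj b regular_vec \<in> A_of b"
    using b regular_vec[where 'n='n] by (simp add: A_of_def diag_conj_L_of diag_mat_component)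
  then have "sigma_inv (diag_conj b regular_vec) \<in> A_of b" using st by blast
  then obtain d' where d': "sigma_inv (diag_conj b regular_vec) = diag_conj b d'"
    using L_of_diag_conj[OF b] unfolding A_of_def by blast
  have "conj_by b (sigma_inv (diag_conj b regular_vec)) = M ** diag_mat regular_vec ** M"
    unfolding sigma_inv_def S_mat_inv[OF n] M_def using b by (simp add: conj_by_mult)
  then have MdM: "M ** diag_mat regular_vec ** M = diag_mat d'" using d' b by simp
  have eq1: "M ** diag_mat regular_vec = diag_mat d' ** M"
    using MdM MM by (metis matrix_mul_assoc matrix_mul_rid)
  have eq2: "diag_mat regular_vec ** M = M ** diag_mat d'"
    using MdM MM by (metis matrix_mul_assoc matrix_mul_lid)
  have row: "M $ p $ q \<noteq> 0 \<Longrightarrow> regular_vec $ q = d' $ p" for p q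
    using arg_cong[OF eq1, of "\<lambda>x. x $ p $ q"] by (simp add: diag_mat_mult_left diag_mat_mult_right)
  have col: "M $ p $ q \<noteq> 0 \<Longrightarrow> regular_vec $ p = d' $ q" for p q
    using arg_cong[OF eq2, of "\<lambda>x. x $ p $ q"] by (simp add: diag_mat_mult_left diag_mat_mult_right)
  have row_unique: "M $ p $ q \<noteq> 0 \<Longrightarrow> M $ p $ q' \<noteq> 0 \<Longrightarrow> q = q'" for p q q'
    using row[of p q] row[of p q'] regular_vec(1)[of q q'] by simp
  have col_unique: "M $ p $ q \<noteq> 0 \<Longrightarrow> M $ p' $ q \<noteq> 0 \<Longrightarrow> p = p'" for p p' q
    using col[of p q] col[of p' q] regular_vec(1)[of p p'] by simp
  have dot': "(\<Sum>k\<in>UNIV. \<eta> $ k * \<omega> $ k) = 2" using dot by (simp add: inner_vec_def)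
  then obtain p where p: "\<omega> $ p * \<eta> $ p \<noteq> 0"
    by (metis (no_types, lifting) mult.commute sum.neutral zero_neq_numeral)
  have bw: "b *v \<omega> = wvec" using b by (simp add: \<omega>_def matrix_inv_mult_vec)
  show ?thesis
  \<comment> \<open>If \<open>\<eta>\<close> is supported at \<open>p\<close> alone, the frame has
    \<open>i = j\<close>; otherwise a second position \<open>q\<close> appears and the diagonal
    entry of \<open>M\<close> at \<open>p\<close> must vanish.\<close>
  proof (cases "\<exists>q. q \<noteq> p \<and> \<eta> $ q \<noteq> 0")
    case False
    then have e0: "\<eta> $ q = 0" if "q \<noteq> p" for q using that by blast
    have "(\<Sum>k\<in>UNIV. \<eta> $ k * \<omega> $ k) = (\<Sum>k\<in>{p}. \<eta> $ k * \<omega> $ k)"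
      by (intro sum.mono_neutral_right) (auto simp: e0)
    then have p2: "\<eta> $ p * \<omega> $ p = 2" using dot' by simp
    have o0: "\<omega> $ q = 0" if "q \<noteq> p" for q
    proof (rule ccontr)
      assume "\<omega> $ q \<noteq> 0"
      then have "M $ q $ p \<noteq> 0" "M $ q $ q \<noteq> 0" using that p e0[OF that] by (auto simp: M_comp)
      then show False using row_unique that by blast
    qed
    \<comment> \<open>Rescaling the basis vector at \<open>p\<close> turns the coordinate vector of
      \<open>wvec\<close> into \<open>eps p p\<close>.\<close>
    define c where "c = (\<chi> k. if k = p then \<omega> $ p else 1)"
    have c: "c $ k \<noteq> 0" for k using p by (auto simp: c_def)
    have "frame (b ** diag_mat c) p p"
      unfolding frame_def
    proof (intro conjI)
      show "invertible (b ** diag_mat c)" using b c by (intro invertible_mult) (auto simp: invertible_det_nz det_diag_mat)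
      have "diag_mat c *v eps p p = \<omega>" using o0 by (auto simp: diag_mat_vec eps_def c_def vec_eq_iff)
      then show "(b ** diag_mat c) *v eps p p = wvec" using bw by (simp flip: matrix_vector_mul_assoc)
      have "\<eta> v* diag_mat c = frame_scale p p *\<^sub>R eps p p"
        using e0 p2 by (auto simp: vec_diag_mat eps_def c_def vec_eq_iff frame_scale_def)
      then show "wvec v* (b ** diag_mat c) = frame_scale p p *\<^sub>R eps p p" by (simp add: \<eta>_def flip: vector_matrix_mul_assoc)
    qed simp
    then show ?thesis using that c by blast
  next
    case True
    then obtain q where q: "q \<noteq> p" "\<eta> $ q \<noteq> 0" by blast
    have Mpq: "M $ p $ q \<noteq> 0" using q p by (auto simp: M_comp)
    have "M $ p $ p = 0" using row_unique[of p q p] Mpq q by blast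
    then have p1: "\<omega> $ p * \<eta> $ p = 1" by (simp add: M_comp)
    have e0: "\<eta> $ r = 0" if "r \<noteq> p" "r \<noteq> q" for r
    proof (rule ccontr)
      assume "\<eta> $ r \<noteq> 0"
      then have "M $ p $ r \<noteq> 0" using that p by (auto simp: M_comp)
      then show False using row_unique[of p r q] Mpq that by blast
    qed
    have "(\<Sum>k\<in>UNIV. \<eta> $ k * \<omega> $ k) = (\<Sum>k\<in>{p,q}. \<eta> $ k * \<omega> $ k)"
      by (intro sum.mono_neutral_right) (auto simp: e0)
    then have q1: "\<omega> $ q * \<eta> $ q = 1" using dot' q(1) p1 by (simp add: mult.commute)
    then have "M $ q $ p \<noteq> 0" using p q by (auto simp: M_comp)
    have o0: "\<omega> $ r = 0" if "r \<noteq> p" "r \<noteq> q" for r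
    proof (rule ccontr)
      assume "\<omega> $ r \<noteq> 0"
      then have "M $ r $ p \<noteq> 0" using that p by (auto simp: M_comp)
      then show False using col_unique[of r p q] \<open>M $ q $ p \<noteq> 0\<close> that by blast
    qed
    define c where "c = (\<chi> k. if k = p \<or> k = q then \<omega> $ k else 1)"
    have c: "c $ k \<noteq> 0" for k using p q1 by (auto simp: c_def)
    have inv: "invertible (b ** diag_mat c)" using b c by (intro invertible_mult) (auto simp: invertible_det_nz det_diag_mat)
    have "diag_mat c *v eps p q = \<omega>" using o0 by (auto simp: diag_mat_vec eps_def c_def vec_eq_iff)
    then have e1: "(b ** diag_mat c) *v eps p q = wvec" using bw by (simp flip: matrix_vector_mul_assoc)
    have "\<eta> v* diag_mat c = frame_scale p q *\<^sub>R eps p q"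
      using e0 p1 q1 q(1) by (auto simp: vec_diag_mat eps_def c_def vec_eq_iff frame_scale_def mult.commute)
    then have e2: "wvec v* (b ** diag_mat c) = frame_scale p q *\<^sub>R eps p q" by (simp add: \<eta>_def flip: vector_matrix_mul_assoc)
    \<comment> \<open>The two positions enter symmetrically, so they can be named in the order that
      \<open>frame\<close> prescribes.\<close>
    have sym: "eps p q = eps q p" "frame_scale p q = frame_scale q p" by (auto simp: eps_def frame_scale_def vec_eq_iff)
    have "frame (b ** diag_mat c) p q \<or> frame (b ** diag_mat c) q p"
      unfolding frame_def using inv e1 e2 sym by (metis nle_le)
    then show ?thesis using that c by blast
  qed
qed

section \<open>Roots and compatibility\<close>

text \<open>The function \<open>pos\<close> counts from \<open>0\<close>. This is \<open>h\<close>-compatibility in an adapted basis.\<close>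

definition good :: "'n::{finite,linorder} \<Rightarrow> 'n \<Rightarrow> bool"
  where "good i j \<longleftrightarrow> (if i = j then 2 * pos i + 1 = CARD('n)
    else 2 * pos i \<le> CARD('n) + 1 \<and> CARD('n) \<le> 2 * pos j + 3)"

text \<open>The root that subtracts the l-th diagonal entry from the k-th, extended by 0 outside the
  Lie algebra as elements of \<open>dual_space\<close> are.\<close>

definition root_form :: "('n::{finite,linorder}) sqmat \<Rightarrow> 'n \<Rightarrow> 'n \<Rightarrow> 'n sqmat \<Rightarrow> real"
  where "root_form b k l = (\<lambda>X. if is_diag (conj_by b X) \<and> trace X = 0 then conj_by b X $ k $ k - conj_by b X $ l $ l else 0)"

definition unit_vec :: "('n::finite) sqmat \<Rightarrow> 'n \<Rightarrow> 'n \<Rightarrow> 'n sqmat"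
  where "unit_vec b k l = b ** outer (axis k 1) (axis l 1) ** matrix_inv b"

lemma conj_by_unit_vec [simp]: "invertible b \<Longrightarrow> conj_by b (unit_vec b k l) = outer (axis k 1) (axis l 1)"
  by (simp add: unit_vec_def conj_by_cancel)

lemma outer_axis_component: "outer (axis k 1) (axis l 1) $ p $ q = (if p = k \<and> q = l then 1 else 0)"
  by (simp add: outer_def axis_def)

section \<open>The involution in a frame\<close>

lemma frameD:
  assumes "frame b i j"
  shows "invertible b" "j \<le> i" "matrix_inv b *v wvec = eps i j" "wvec v* b = frame_scale i j *\<^sub>R eps i j"
  using assms matrix_inv_mult_vec(1)[of b "eps i j"] by (auto simp: frame_def)

lemma frame_scale_pos: "frame_scale i j > 0" by (simp add: frame_scale_def)

lemma sigma_fix_frame: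
  fixes X :: "'n::{finite,linorder} sqmat"
  assumes n: "CARD('n) \<ge> 2" and f: "frame b i j"
  shows "sigma_inv X = X \<longleftrightarrow> outer (conj_by b X *v eps i j) (eps i j) = outer (eps i j) (eps i j v* conj_by b X)"
proof -
  note b = frameD[OF f]
  let ?J = "outer wvec wvec :: 'n sqmat"
  have J: "conj_by b ?J = frame_scale i j *\<^sub>R outer (eps i j) (eps i j)"
    by (simp add: conj_by_def outer_left outer_right b) (simp add: outer_def vec_eq_iff)
  have "sigma_inv X = X \<longleftrightarrow> X ** ?J = ?J ** X"
    by (simp add: sigma_fix_iff_outer[OF n] outer_left outer_right)
  also have "\<dots> \<longleftrightarrow> conj_by b X ** conj_by b ?J = conj_by b ?J ** conj_by b X"
    using b(1) by (simp add: conj_by_inject flip: conj_by_mult)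
  also have "\<dots> \<longleftrightarrow> outer (conj_by b X *v eps i j) (eps i j) = outer (eps i j) (eps i j v* conj_by b X)"
    unfolding J matrix_scaleR_left matrix_scaleR_right
    using frame_scale_pos[of i j] by (simp add: outer_left outer_right)
  finally show ?thesis .
qed

lemma eps_component: "eps i j $ k = (if k = i \<or> k = j then 1 else 0)"
  by (simp add: eps_def)

lemma sigma_fix_diag:
  assumes n: "CARD('n::{finite,linorder}) \<ge> 2" and f: "frame b i j"
  shows "sigma_inv (diag_conj b d :: 'n sqmat) = diag_conj b d \<longleftrightarrow> d $ i = d $ j"
  unfolding sigma_fix_frame[OF n f]
  using frameD(1)[OF f] by (auto simp: vec_eq_iff outer_def diag_mat_vec vec_diag_mat eps_component)

text \<open>In a frame \<open>S_mat\<close> is a monomial matrix for the transposition of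
  \<open>i\<close> and \<open>j\<close>, so conjugation by it permutes diagonal entries
  accordingly.\<close>

lemma sigma_diag_conj:
  assumes n: "CARD('n::{finite,linorder}) \<ge> 2" and f: "frame b i j"
  shows "sigma_inv (diag_conj b d :: 'n sqmat) = diag_conj b (\<chi> k. d $ (Transposition.transpose i j k))"
proof -
  note b = frameD[OF f]
  define M where "M = conj_by b S_mat"
  have M: "M = mat 1 - frame_scale i j *\<^sub>R outer (eps i j) (eps i j)"
    using b by (simp add: M_def S_mat_eq[OF n] conj_by_diff)
      (simp add: conj_by_def outer_left outer_right b, simp add: outer_def vec_eq_iff)
  have M0: "M $ k $ l = 0" if "l \<noteq> Transposition.transpose i j k" for k l
    using that by (auto simp: M mat_component outer_def eps_component frame_scale_def transpose_def split: if_splits)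
  have MM: "M ** M = mat 1"
    unfolding M_def using b by (simp add: S_mat_square[OF n] flip: conj_by_mult)
  let ?d = "\<chi> k. d $ (Transposition.transpose i j k)"
  have "(M ** diag_mat d) $ k $ l = (diag_mat ?d ** M) $ k $ l" for k l
    using M0[of l k] by (cases "l = Transposition.transpose i j k") (simp_all add: diag_mat_mult_left diag_mat_mult_right mult.commute)
  then have "M ** diag_mat d = diag_mat ?d ** M" by (simp add: vec_eq_iff)
  then have "M ** diag_mat d ** M = diag_mat ?d" by (metis MM matrix_mul_assoc matrix_mul_rid)
  moreover have "conj_by b (sigma_inv (diag_conj b d)) = M ** diag_mat d ** M"
    unfolding sigma_inv_def S_mat_inv[OF n] M_def using b by (simp add: conj_by_mult)
  ultimately have "conj_by b (sigma_inv (diag_conj b d)) = conj_by b (diag_conj b ?d)" using b by simp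
  then show ?thesis using conj_by_inject b by blast
qed

lemma sigma_stable_A_of:
  assumes n: "CARD('n::{finite,linorder}) \<ge> 2" and f: "frame b i j"
  shows "sigma_inv ` A_of b = (A_of b :: 'n sqmat set)"
proof -
  note b = frameD[OF f]
  let ?t = "Transposition.transpose i j"
  have sub: "sigma_inv g \<in> A_of b \<and> sigma_inv (sigma_inv g) = g" if g: "g \<in> A_of b" for g
  proof -
    obtain d where d: "g = diag_conj b d" "(\<Prod>k\<in>UNIV. d $ k) = 1" using g L_of_diag_conj[OF b(1)] by (auto simp: A_of_def)
    have "(\<Prod>k\<in>UNIV. d $ (?t k)) = (\<Prod>k\<in>UNIV. d $ k)"
      by (rule prod.reindex_bij_betw) (rule bij_betw_transpose_iff, simp)
    moreover have "d $ k > 0" for k using g b by (auto simp: A_of_def d diag_mat_component)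
    ultimately show ?thesis using b d
      by (simp add: sigma_diag_conj[OF n f] A_of_def diag_conj_L_of diag_mat_component)
  qed
  show ?thesis
  proof (intro equalityI subsetI)
    fix g assume g: "g \<in> A_of b"
    then show "g \<in> sigma_inv ` A_of b" using sub[of g] by (metis image_eqI)
  qed (use sub in blast)
qed

lemma mat_exp_diag_conj:
  assumes b: "invertible b" shows "mat_exp (t *\<^sub>R diag_conj b x) = diag_conj b (\<chi> k. exp (t * x $ k))"
proof -
  have "t *\<^sub>R diag_mat x = diag_mat (\<chi> k. t * x $ k)" by (simp add: diag_mat_def vec_eq_iff)
  then have "conj_by b (mat_exp (t *\<^sub>R diag_conj b x)) = conj_by b (diag_conj b (\<chi> k. exp (t * x $ k)))"
    using mat_exp_conj_by[OF b, of "t *\<^sub>R diag_conj b x"] b by (simp add: conj_by_scaleR mat_exp_diag_mat)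
  then show ?thesis using conj_by_inject[OF b] by blast
qed

text \<open>Off the diagonal the curve of exponentials is constantly zero in the basis
  \<open>b\<close>, hence so is its derivative at 0. For diagonal \<open>X\<close> the determinant
  of the exponential is the exponential of the trace.\<close>

lemma lie_algebra_A_of:
  assumes b: "invertible b"
  shows "lie_algebra (A_of b) = {X. is_diag (conj_by b X) \<and> trace X = 0}"
proof (intro equalityI subsetI)
  fix X assume "X \<in> lie_algebra (A_of b)"
  then have X: "mat_exp (t *\<^sub>R X) \<in> A_of b" for t by (simp add: lie_algebra_def)
  have "is_diag (conj_by b X)"
    unfolding is_diag_def
  proof (intro allI impI)
    fix k l :: 'a assume "k \<noteq> l"
    have "mat_exp (t *\<^sub>R conj_by b X) $ k $ l = 0" for t
      using X[of t] \<open>k \<noteq> l\<close> by (auto simp: A_of_def L_of_def is_diag_def mat_exp_conj_by[OF b] simp flip: conj_by_scaleR)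
    then have "((\<lambda>t. 0) has_real_derivative conj_by b X $ k $ l) (at 0)"
      using mat_exp_DERIV[of "conj_by b X" k l] by simp
    then show "conj_by b X $ k $ l = 0" using DERIV_const DERIV_unique by blast
  qed
  then obtain x where x: "X = diag_conj b x" using is_diag_conj_by_iff[OF b] by blast
  have "conj_by b (mat_exp X) = diag_mat (\<chi> k. exp (x $ k))"
    using mat_exp_conj_by[OF b, of X] b by (simp add: x mat_exp_diag_mat)
  then have "det (mat_exp X) = exp (\<Sum>k\<in>UNIV. x $ k)" 
    using det_conj_by[OF b, of "mat_exp X"] by (simp add: det_diag_mat exp_sum)
  moreover have "det (mat_exp X) = 1" using X[of 1] by (simp add: A_of_def L_of_def SL_simps)
  ultimately have "(\<Sum>k\<in>UNIV. x $ k) = 0" by simp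
  then show "X \<in> {X. is_diag (conj_by b X) \<and> trace X = 0}" using b by (simp add: x is_diag_diag_mat trace_diag_conj)
next
  fix X assume "X \<in> {X. is_diag (conj_by b X) \<and> trace X = 0}"
  then obtain x where x: "X = diag_conj b x" "(\<Sum>k\<in>UNIV. x $ k) = 0"
    using is_diag_conj_by_iff[OF b] trace_diag_conj[OF b] by auto
  have "mat_exp (t *\<^sub>R X) \<in> A_of b" for t
  proof -
    have "mat_exp (t *\<^sub>R X) = diag_conj b (\<chi> k. exp ((\<chi> k. t * x $ k) $ k))"
      using mat_exp_diag_conj[OF b] by (simp add: x)
    moreover have "(\<Sum>k\<in>UNIV. (\<chi> k. t * x $ k) $ k) = 0" using x(2) by (simp flip: sum_distrib_left)
    ultimately show ?thesis unfolding A_of_exp[OF b] by blast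
  qed
  then show "X \<in> lie_algebra (A_of b)" by (simp add: lie_algebra_def)
qed

lemma lie_algebra_A_of_diag_conj:
  assumes b: "invertible b"
  shows "X \<in> lie_algebra (A_of b) \<longleftrightarrow> (\<exists>x. X = diag_conj b x \<and> (\<Sum>k\<in>UNIV. x $ k) = 0)"
  unfolding lie_algebra_A_of[OF b] using is_diag_conj_by_iff[OF b] trace_diag_conj[OF b] by auto

lemma lie_algebra_A_of_H:
  assumes n: "CARD('n::{finite,linorder}) \<ge> 2" and f: "frame b i j"
  shows "lie_algebra (A_of b \<inter> H_grp) = {X :: 'n sqmat. X \<in> lie_algebra (A_of b) \<and> conj_by b X $ i $ i = conj_by b X $ j $ j}"
proof -
  note b = frameD[OF f]
  have "diag_conj b x \<in> lie_algebra (A_of b \<inter> H_grp) \<longleftrightarrow> x $ i = x $ j"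
    if "diag_conj b x \<in> lie_algebra (A_of b)" for x
  proof -
    have "diag_conj b x \<in> lie_algebra (A_of b \<inter> H_grp) \<longleftrightarrow> (\<forall>t. mat_exp (t *\<^sub>R diag_conj b x) \<in> H_grp)"
      using that by (simp add: lie_algebra_def)
    also have "\<dots> \<longleftrightarrow> (\<forall>t. exp (t * x $ i) = exp (t * x $ j))"
    proof -
      have "mat_exp (t *\<^sub>R diag_conj b x) \<in> carrier SL" for t
        using that by (simp add: lie_algebra_def A_of_def L_of_def)
      then show ?thesis by (simp add: H_grp_def mat_exp_diag_conj[OF b(1)] sigma_fix_diag[OF n f])
    qed
    also have "\<dots> \<longleftrightarrow> x $ i = x $ j" by (simp, metis mult_1)
    finally show ?thesis .
  qed
  moreover have "lie_algebra (A_of b \<inter> H_grp) \<subseteq> lie_algebra (A_of b)"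
    by (auto simp: lie_algebra_def)
  ultimately have "X \<in> lie_algebra (A_of b \<inter> H_grp) \<longleftrightarrow>
      X \<in> lie_algebra (A_of b) \<and> conj_by b X $ i $ i = conj_by b X $ j $ j" for X
    using b(1) lie_algebra_A_of_diag_conj[OF b(1), of X]
    by (cases "X \<in> lie_algebra (A_of b)") (auto simp: diag_mat_component)
  then show ?thesis by blast
qed

text \<open>The Lie algebra of the intersection with \<open>H_grp\<close> is cut out by equality of
  the entries at \<open>i\<close> and \<open>j\<close>; for \<open>i \<noteq> j\<close> the diagonal
  matrix with 1 at \<open>i\<close> and -1 at \<open>j\<close> spans a complement.\<close>

lemma sigma_rank_A_of:
  assumes n: "CARD('n::{finite,linorder}) \<ge> 2" and f: "frame b i j"
  shows "sigma_rank (A_of b :: 'n sqmat set) = (if i = j then 0 else 1)"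
proof (cases "i = j")
  case True
  then show ?thesis using lie_algebra_A_of_H[OF n f] by (simp add: sigma_rank_def)
next
  case False
  note b = frameD[OF f]
  let ?a = "lie_algebra (A_of b)" and ?h = "lie_algebra (A_of b \<inter> H_grp)"
  have sa: "subspace ?a"
    unfolding lie_algebra_A_of[OF b(1)] subspace_def
    by (auto simp: is_diag_def conj_by_add conj_by_scaleR sum.distrib trace_def simp flip: sum_distrib_left)
  have sh: "subspace ?h"
    unfolding lie_algebra_A_of_H[OF n f] using sa unfolding subspace_def
    by (auto simp: conj_by_add conj_by_scaleR)
  define z where "z = (axis i 1 - axis j 1 :: (real, 'n) vec)"
  define Z where "Z = diag_conj b z"
  have Za: "Z \<in> ?a"
    unfolding lie_algebra_A_of_diag_conj[OF b(1)] Z_def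
    by (intro exI[of _ z]) (simp add: z_def sum_subtractf axis_def)
  have cZ: "conj_by b Z = diag_mat z" using b by (simp add: Z_def)
  have Zh: "Z \<notin> ?h"
    unfolding lie_algebra_A_of_H[OF n f] using False by (simp add: cZ diag_mat_component z_def axis_def)
  have "?a = span (insert Z ?h)"
  proof (intro equalityI subsetI)
    fix X assume X: "X \<in> ?a"
    define c where "c = (conj_by b X $ i $ i - conj_by b X $ j $ j) / 2"
    have "X - c *\<^sub>R Z \<in> ?h"
      unfolding lie_algebra_A_of_H[OF n f]
      using X Za sa False by (auto simp: subspace_diff subspace_scale conj_by_diff conj_by_scaleR cZ diag_mat_component z_def axis_def c_def field_simps)
    then show "X \<in> span (insert Z ?h)" by (auto simp: span_insert intro: span_base)
  next
    fix X assume X: "X \<in> span (insert Z ?h)"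
    have "span (insert Z ?h) \<subseteq> ?a"
      using Za sa by (intro span_minimal) (auto simp: lie_algebra_A_of_H[OF n f])
    with X show "X \<in> ?a" by blast
  qed
  then have "dim ?a = dim ?h + 1"
    using Zh sh by (simp add: dim_insert span_eq_iff[THEN iffD2])
  then show ?thesis using False by (simp add: sigma_rank_def)
qed

section \<open>Roots and root spaces\<close>

lemma root_form_diag_conj:
  fixes b :: "'n::{finite,linorder} sqmat"
  assumes "invertible b" "(\<Sum>k\<in>UNIV. x $ k) = 0"
  shows "root_form b k l (diag_conj b x) = x $ k - x $ l"
  using assms by (simp add: root_form_def is_diag_diag_mat trace_diag_conj diag_mat_component)

lemma sum_zero_diff: "(\<Sum>m\<in>UNIV. (axis k 1 - axis l 1 :: (real, 'n::finite) vec) $ m) = 0"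
  by (simp add: sum_subtractf axis_def)

text \<open>Evaluate at \<open>axis k 1 - axis l 1\<close>: the left side is 2, a value that the
  right side attains only for \<open>p = k\<close> and \<open>q = l\<close>.\<close>

lemma weight_unique:
  fixes k l p q :: "'n::finite"
  assumes "k \<noteq> l" "\<And>x :: (real, 'n) vec. (\<Sum>m\<in>UNIV. x $ m) = 0 \<Longrightarrow> x $ k - x $ l = x $ p - x $ q"
  shows "p = k \<and> q = l"
  using assms(2)[OF sum_zero_diff[of k l]] assms(1) by (auto simp: axis_def split: if_splits)

lemma root_form_inject:
  fixes b :: "'n::{finite,linorder} sqmat"
  assumes b: "invertible b" and "k \<noteq> l" "root_form b k l = root_form b p q"
  shows "p = k \<and> q = l"
proof (rule weight_unique[OF assms(2)])
  fix x :: "(real, 'n) vec" assume "(\<Sum>m\<in>UNIV. x $ m) = 0"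
  then show "x $ k - x $ l = x $ p - x $ q" using root_form_diag_conj[OF b] assms(3) by metis
qed

lemma bracket_component:
  "(diag_mat x ** Y - Y ** diag_mat x) $ p $ q = (x $ p - x $ q) * Y $ p $ q"
  by (simp add: diag_mat_mult_left diag_mat_mult_right algebra_simps)

lemma root_space_iff:
  assumes b: "invertible b"
  shows "Y \<in> root_space (lie_algebra (A_of b)) \<alpha> \<longleftrightarrow> trace Y = 0 \<and>
    (\<forall>x p q. (\<Sum>m\<in>UNIV. x $ m) = 0 \<longrightarrow> conj_by b Y $ p $ q \<noteq> 0 \<longrightarrow> \<alpha> (diag_conj b x) = x $ p - x $ q)"
proof -
  have "lie_bracket (diag_conj b x) Y = \<alpha> (diag_conj b x) *\<^sub>R Y \<longleftrightarrow>
    (\<forall>p q. conj_by b Y $ p $ q \<noteq> 0 \<longrightarrow> \<alpha> (diag_conj b x) = x $ p - x $ q)" for x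
  proof -
    have "lie_bracket (diag_conj b x) Y = \<alpha> (diag_conj b x) *\<^sub>R Y \<longleftrightarrow>
        diag_mat x ** conj_by b Y - conj_by b Y ** diag_mat x = \<alpha> (diag_conj b x) *\<^sub>R conj_by b Y"
      unfolding conj_by_inject[OF b, of "lie_bracket (diag_conj b x) Y" "\<alpha> (diag_conj b x) *\<^sub>R Y", symmetric]
      using b by (simp add: lie_bracket_def conj_by_diff conj_by_mult conj_by_scaleR)
    also have "\<dots> \<longleftrightarrow> (\<forall>p q. (x $ p - x $ q) * conj_by b Y $ p $ q = \<alpha> (diag_conj b x) * conj_by b Y $ p $ q)"
      by (simp add: vec_eq_iff bracket_component flip: vector_minus_component)
    finally show ?thesis by (metis mult_cancel_right)
  qed
  then show ?thesis
    unfolding root_space_def sl_def lie_algebra_A_of_diag_conj[OF b] mem_Collect_eq Ball_def by blast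
qed

lemma root_space_root_form:
  fixes b :: "'n::{finite,linorder} sqmat"
  assumes b: "invertible b" and kl: "k \<noteq> l"
  shows "root_space (lie_algebra (A_of b)) (root_form b k l) = range (\<lambda>c. c *\<^sub>R unit_vec b k l)"
proof (intro equalityI subsetI)
  fix Y assume "Y \<in> root_space (lie_algebra (A_of b)) (root_form b k l)"
  then have Y: "(\<Sum>m\<in>UNIV. x $ m) = 0 \<Longrightarrow> conj_by b Y $ p $ q \<noteq> 0 \<Longrightarrow> x $ k - x $ l = x $ p - x $ q" for x :: "(real, 'n) vec" and p q
    unfolding root_space_iff[OF b] using root_form_diag_conj[OF b] by metis
  have "conj_by b Y $ p $ q = 0" if "\<not> (p = k \<and> q = l)" for p q
    using weight_unique[OF kl, of p q] Y that by blast
  then have "conj_by b Y = conj_by b ((conj_by b Y $ k $ l) *\<^sub>R unit_vec b k l)"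
    using b by (auto simp: conj_by_scaleR vec_eq_iff outer_axis_component)
  then show "Y \<in> range (\<lambda>c. c *\<^sub>R unit_vec b k l)" using conj_by_inject[OF b] by blast
next
  fix Y assume "Y \<in> range (\<lambda>c. c *\<^sub>R unit_vec b k l)"
  then obtain c where Y: "Y = c *\<^sub>R unit_vec b k l" by blast
  then have cY: "conj_by b Y = c *\<^sub>R outer (axis k 1) (axis l 1)" using b by (simp add: conj_by_scaleR)
  have "trace Y = trace (conj_by b Y)" using trace_conj_by[OF b] by simp
  also have "\<dots> = 0" unfolding cY trace_def using kl by (intro sum.neutral) (auto simp: outer_axis_component)
  finally show "Y \<in> root_space (lie_algebra (A_of b)) (root_form b k l)"
    unfolding root_space_iff[OF b] cY using root_form_diag_conj[OF b] by (auto simp: outer_axis_component)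
qed

lemma unit_vec_nonzero: "invertible b \<Longrightarrow> unit_vec b k l \<noteq> 0"
proof
  assume b: "invertible b" and "unit_vec b k l = 0"
  then have "outer (axis k 1) (axis l 1) $ k $ l = (0 :: real)"
    using conj_by_unit_vec[OF b, of k l] by (metis conj_by_zero zero_index)
  then show False by (simp add: outer_axis_component)
qed

lemma roots_A_of:
  assumes b: "invertible b"
  shows "roots (lie_algebra (A_of b)) = {root_form b k l | k l. k \<noteq> l}"
proof (intro equalityI subsetI)
  fix \<alpha> assume "\<alpha> \<in> roots (lie_algebra (A_of b))"
  then have \<alpha>: "\<alpha> \<in> dual_space (lie_algebra (A_of b))" "\<alpha> \<noteq> (\<lambda>_. 0)"
    "root_space (lie_algebra (A_of b)) \<alpha> \<noteq> {0}" by (auto simp: roots_def)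
  have "0 \<in> root_space (lie_algebra (A_of b)) \<alpha>" unfolding root_space_iff[OF b] by (simp add: trace_def)
  then obtain Y where Y: "Y \<in> root_space (lie_algebra (A_of b)) \<alpha>" "Y \<noteq> 0" using \<alpha>(3) by blast
  have "conj_by b Y \<noteq> 0" using Y(2) conj_by_inject[OF b, of Y 0] by simp
  then obtain p q where pq: "conj_by b Y $ p $ q \<noteq> 0" by (auto simp: vec_eq_iff)
  have eq: "\<alpha> (diag_conj b x) = x $ p - x $ q" if "(\<Sum>m\<in>UNIV. x $ m) = 0" for x
    using Y(1) that pq unfolding root_space_iff[OF b] by blast
  have "\<alpha> X = root_form b p q X" for X
  proof (cases "X \<in> lie_algebra (A_of b)")
    case True
    then show ?thesis using eq root_form_diag_conj[OF b] unfolding lie_algebra_A_of_diag_conj[OF b] by auto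
  next
    case False
    then have "\<alpha> X = 0" using \<alpha>(1) by (simp add: dual_space_def)
    then show ?thesis using False by (auto simp: root_form_def lie_algebra_A_of[OF b])
  qed
  then have "\<alpha> = root_form b p q" by blast
  moreover have "p \<noteq> q" using \<alpha>(2) calculation by (auto simp: root_form_def)
  ultimately show "\<alpha> \<in> {root_form b k l | k l. k \<noteq> l}" by blast
next
  fix \<alpha> assume "\<alpha> \<in> {root_form b k l | k l. k \<noteq> l}"
  then obtain k l where kl: "\<alpha> = root_form b k l" "k \<noteq> l" by blast
  have "root_form b k l \<in> dual_space (lie_algebra (A_of b))"
    unfolding dual_space_def lie_algebra_A_of[OF b]
  proof (intro CollectI conjI ballI allI impI)
    fix X Y assume "X \<in> {X. is_diag (conj_by b X) \<and> trace X = 0}" "Y \<in> {X. is_diag (conj_by b X) \<and> trace X = 0}"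
    moreover from this have "is_diag (conj_by b (X + Y))" "trace (X + Y) = 0" by (auto simp: is_diag_def conj_by_add trace_add)
    ultimately show "root_form b k l (X + Y) = root_form b k l X + root_form b k l Y" by (simp add: root_form_def conj_by_add)
  next
    fix c X assume "X \<in> {X. is_diag (conj_by b X) \<and> trace X = 0}"
    moreover from this have "is_diag (conj_by b (c *\<^sub>R X))" "trace (c *\<^sub>R X) = 0"
      by (auto simp: is_diag_def conj_by_scaleR trace_def simp flip: sum_distrib_left)
    ultimately show "root_form b k l (c *\<^sub>R X) = c * root_form b k l X" by (simp add: root_form_def conj_by_scaleR right_diff_distrib)
  qed (auto simp: root_form_def)
  moreover have "root_form b k l \<noteq> (\<lambda>_. 0)"
  proof
    assume "root_form b k l = (\<lambda>_. 0)"
    then have "root_form b k l = root_form b k k" by (auto simp: root_form_def)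
    then show False using root_form_inject[OF b kl(2)] kl(2) by blast
  qed
  moreover have "root_space (lie_algebra (A_of b)) (root_form b k l) \<noteq> {0}"
  proof -
    have "1 *\<^sub>R unit_vec b k l \<in> root_space (lie_algebra (A_of b)) (root_form b k l)"
      unfolding root_space_root_form[OF b kl(2)] by blast
    then show ?thesis using unit_vec_nonzero[OF b, of k l] by auto
  qed
  ultimately show "\<alpha> \<in> roots (lie_algebra (A_of b))" by (simp add: roots_def kl)
qed

lemma roots_of_A_of:
  assumes b: "invertible b"
  shows "roots_of (lie_algebra (A_of b)) (P_of b) = {root_form b k l | k l. k < l}"
proof -
  have "root_space (lie_algebra (A_of b)) (root_form b k l) \<subseteq> lie_algebra (N_of b) \<longleftrightarrow> k < l" if kl: "k \<noteq> l" for k l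
  proof -
    \<comment> \<open>A root vector squares to zero, so its exponential is the linear expression,
      whose triangularity can be read off.\<close>
    have cjE: "conj_by b (mat_exp (t *\<^sub>R unit_vec b k l)) = mat 1 + t *\<^sub>R outer (axis k 1) (axis l 1)" for t
    proof -
      have "outer (axis k 1) (axis l 1) ** outer (axis k 1) (axis l 1) = (0 :: 'a sqmat)"
        unfolding vec_eq_iff mat_mul_component
        using kl by (intro allI, subst sum.neutral) (auto simp: outer_axis_component)
      from mat_exp_square_zero[OF this, of t] show ?thesis
        using mat_exp_conj_by[OF b, of "t *\<^sub>R unit_vec b k l"] b by (simp add: conj_by_scaleR)
    qed
    have u: "unitri (mat 1 + c *\<^sub>R outer (axis k 1) (axis l 1))" if "k < l" for c
      using that by (auto simp: unitri_def upper_def mat_component outer_axis_component)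
    show ?thesis
    proof
      assume "root_space (lie_algebra (A_of b)) (root_form b k l) \<subseteq> lie_algebra (N_of b)"
      then have "1 *\<^sub>R unit_vec b k l \<in> lie_algebra (N_of b)" unfolding root_space_root_form[OF b kl] by blast
      then have "\<forall>t. mat_exp (t *\<^sub>R 1 *\<^sub>R unit_vec b k l) \<in> N_of b" unfolding lie_algebra_def by (rule CollectD)
      from this[rule_format, of 1] have "upper (mat 1 + outer (axis k 1) (axis l 1) :: 'a sqmat)"
        using cjE[of 1] by (simp add: N_of_def unitri_def)
      then have "l < k \<longrightarrow> (mat 1 + outer (axis k 1) (axis l 1) :: 'a sqmat) $ k $ l = 0"
        unfolding upper_def by blast
      then show "k < l" using kl by (auto simp: mat_component outer_axis_component)
    next
      assume "k < l"
      then show "root_space (lie_algebra (A_of b)) (root_form b k l) \<subseteq> lie_algebra (N_of b)"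
        unfolding root_space_root_form[OF b kl] using u by (auto simp: lie_algebra_def N_of_def cjE)
    qed
  qed
  then have star: "k \<noteq> l \<and> root_space (lie_algebra (A_of b)) (root_form b k l) \<subseteq> lie_algebra (N_of b) \<longleftrightarrow> k < l" for k l
    by (metis less_irrefl)
  show ?thesis
    unfolding roots_of_def roots_A_of[OF b] unipotent_radical_P_of[OF b] star[symmetric] by blast
qed

text \<open>Root spaces are lines, so a root belongs to the set exactly when its root vector is
  fixed by \<sigma>. That vector commutes with \<open>outer (eps i j) (eps i j)\<close> only if it
  kills \<open>eps i j\<close> from both sides.\<close>

lemma roots_h_A_of:
  assumes n: "CARD('n::{finite,linorder}) \<ge> 2" and f: "frame b i j"
  shows "roots_h (lie_algebra (A_of b :: 'n sqmat set)) =
    {root_form b k l | k l. k \<noteq> l \<and> k \<notin> {i, j} \<and> l \<notin> {i, j}}"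
proof -
  note b = frameD[OF f]
  have "root_space (lie_algebra (A_of b)) (root_form b k l) \<inter> h_alg \<noteq> {0} \<longleftrightarrow> k \<notin> {i,j} \<and> l \<notin> {i,j}"
    if kl: "k \<noteq> l" for k l
  proof -
    let ?R = "root_space (lie_algebra (A_of b)) (root_form b k l)"
    have fixE: "sigma_inv (c *\<^sub>R unit_vec b k l) = c *\<^sub>R unit_vec b k l \<longleftrightarrow> c = 0 \<or> (k \<notin> {i,j} \<and> l \<notin> {i,j})" for c
    proof -
      let ?E = "c *\<^sub>R outer (axis k 1) (axis l 1) :: 'n sqmat"
      have E: "?E = outer (axis k c) (axis l 1)" by (auto simp: outer_def axis_def vec_eq_iff)
      have L: "outer (?E *v eps i j) (eps i j) $ p $ q = c * (if p = k then eps i j $ l * eps i j $ q else 0)" for p q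
      proof -
        have "axis l 1 \<bullet> eps i j = eps i j $ l" by (simp add: inner_axis')
        then show ?thesis unfolding E outer_vec by (simp add: outer_def) (simp add: axis_def)
      qed
      have R: "outer (eps i j) (eps i j v* ?E) $ p $ q = c * (if q = l then eps i j $ k * eps i j $ p else 0)" for p q
      proof -
        have "eps i j \<bullet> axis k c = eps i j $ k * c" by (simp add: inner_axis)
        then show ?thesis unfolding E vec_outer by (simp add: outer_def) (simp add: axis_def)
      qed
      have "sigma_inv (c *\<^sub>R unit_vec b k l) = c *\<^sub>R unit_vec b k l \<longleftrightarrow>
        (\<forall>p q. c * (if p = k then eps i j $ l * eps i j $ q else 0) = c * (if q = l then eps i j $ k * eps i j $ p else 0))"
        unfolding sigma_fix_frame[OF n f] conj_by_scaleR conj_by_unit_vec[OF b(1)] by (simp only: vec_eq_iff L R)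
      also have "\<dots> \<longleftrightarrow> c = 0 \<or> (eps i j $ l = 0 \<and> eps i j $ k = 0)"
      proof
        assume A: "\<forall>p q. c * (if p = k then eps i j $ l * eps i j $ q else 0) = c * (if q = l then eps i j $ k * eps i j $ p else 0)"
        show "c = 0 \<or> (eps i j $ l = 0 \<and> eps i j $ k = 0)"
          \<comment> \<open>At \<open>k\<close>, \<open>l\<close> the two entries
            \<open>eps i j $ k\<close> and \<open>eps i j $ l\<close> are compared, and at
            \<open>k\<close>, \<open>k\<close> their product must vanish; together both are zero
            unless \<open>c = 0\<close>.\<close>
          using A[rule_format, of k l] A[rule_format, of k k] kl by (auto simp: eps_component split: if_splits)
      qed auto
      finally show ?thesis by (auto simp: eps_component)
    qed
    have "c *\<^sub>R unit_vec b k l \<in> h_alg \<longleftrightarrow> c = 0 \<or> (k \<notin> {i,j} \<and> l \<notin> {i,j})" for c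
    proof -
      have "c *\<^sub>R unit_vec b k l \<in> ?R" unfolding root_space_root_form[OF b(1) kl] by blast
      then show ?thesis using fixE[of c] by (auto simp: h_alg_def root_space_def)
    qed
    then have "?R \<inter> h_alg = {c *\<^sub>R unit_vec b k l | c. c = 0 \<or> (k \<notin> {i,j} \<and> l \<notin> {i,j})}"
      unfolding root_space_root_form[OF b(1) kl] by blast
    moreover have "{c *\<^sub>R unit_vec b k l | c. c = 0 \<or> (k \<notin> {i,j} \<and> l \<notin> {i,j})} \<noteq> {0} \<longleftrightarrow> (k \<notin> {i,j} \<and> l \<notin> {i,j})"
    proof (cases "k \<notin> {i,j} \<and> l \<notin> {i,j}")
      case True
      then have "1 *\<^sub>R unit_vec b k l \<in> {c *\<^sub>R unit_vec b k l | c. c = 0 \<or> (k \<notin> {i,j} \<and> l \<notin> {i,j})}" by blast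
      then show ?thesis using True unit_vec_nonzero[OF b(1), of k l] by auto
    next
      case False
      then have "{c *\<^sub>R unit_vec b k l | c. c = 0 \<or> (k \<notin> {i,j} \<and> l \<notin> {i,j})} = {0}" by auto
      then show ?thesis using False by simp
    qed
    ultimately show ?thesis by simp
  qed
  then show ?thesis
    unfolding roots_h_def roots_A_of[OF b(1)] by auto
qed

text \<open>The coefficient of the k-th diagonal entry in the half sum of the positive roots that
  avoid the positions \<open>i\<close> and \<open>j\<close>.\<close>

definition offset :: "'n::{finite,linorder} \<Rightarrow> 'n \<Rightarrow> 'n \<Rightarrow> real"
  where "offset i j k = (if k \<in> {i, j} then 0
    else (real (card {l. k < l \<and> l \<notin> {i, j}}) - real (card {l. l < k \<and> l \<notin> {i, j}})) / 2)"

text \<open>Collect the terms by entry: \<open>x $ k\<close> occurs positively once for each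
  admissible larger index and negatively once for each smaller one.\<close>

lemma sum_roots_h:
  fixes x :: "(real, 'n::{finite,linorder}) vec"
  shows "(\<Sum>(k, l)\<in>{(k, l). k < l \<and> k \<notin> {i, j} \<and> l \<notin> {i, j}}. x $ k - x $ l) / 2 = (\<Sum>k\<in>UNIV. offset i j k * x $ k)"
proof -
  let ?c = "\<lambda>k l. k < l \<and> k \<notin> {i, j} \<and> l \<notin> {i, j}"
  have "(\<Sum>(k, l)\<in>{(k, l). ?c k l}. x $ k - x $ l) = (\<Sum>k\<in>UNIV. \<Sum>l\<in>UNIV. if ?c k l then x $ k - x $ l else 0)"
    unfolding sum.cartesian_product by (intro sum.mono_neutral_cong_left) (auto split: if_splits)
  also have "\<dots> = (\<Sum>k\<in>UNIV. \<Sum>l\<in>UNIV. if ?c k l then x $ k else 0) - (\<Sum>k\<in>UNIV. \<Sum>l\<in>UNIV. if ?c k l then x $ l else 0)"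
    by (simp add: if_distrib flip: sum_subtractf cong: if_cong)
  also have "(\<Sum>k\<in>UNIV. \<Sum>l\<in>UNIV. if ?c k l then x $ l else 0) = (\<Sum>k\<in>UNIV. \<Sum>l\<in>UNIV. if ?c l k then x $ k else 0)"
    by (rule sum.swap)
  finally have "(\<Sum>(k, l)\<in>{(k, l). ?c k l}. x $ k - x $ l) =
      (\<Sum>k\<in>UNIV. (\<Sum>l\<in>UNIV. if ?c k l then x $ k else 0) - (\<Sum>l\<in>UNIV. if ?c l k then x $ k else 0))"
    by (simp add: sum_subtractf)
  also have "\<dots> = (\<Sum>k\<in>UNIV. 2 * (offset i j k * x $ k))"
  proof (intro sum.cong refl)
    fix k :: 'n
    have "(\<Sum>l\<in>UNIV. if P l then x $ k else 0) = real (card {l. P l}) * x $ k" for P :: "'n \<Rightarrow> bool"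
      by (simp add: sum.If_cases)
    then show "(\<Sum>l\<in>UNIV. if ?c k l then x $ k else 0) - (\<Sum>l\<in>UNIV. if ?c l k then x $ k else 0) = 2 * (offset i j k * x $ k)"
      by (cases "k \<in> {i, j}") (auto simp: offset_def algebra_simps)
  qed
  finally show ?thesis by (simp flip: sum_distrib_left)
qed

lemma sum_offset: "(\<Sum>k\<in>UNIV. offset i j k) = 0"
  using sum_roots_h[of "\<chi> k. 1" i j] by (simp add: case_prod_beta)

lemma rho_h_A_of:
  assumes n: "CARD('n::{finite,linorder}) \<ge> 2" and f: "frame b i j"
    and x: "(\<Sum>k\<in>UNIV. x $ k) = 0"
  shows "rho_h (lie_algebra (A_of b)) (P_of b) (diag_conj b x :: 'n sqmat) = (\<Sum>k\<in>UNIV. offset i j k * x $ k)"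
proof -
  note b = frameD(1)[OF f]
  let ?S = "{(k, l). k < l \<and> k \<notin> {i, j} \<and> l \<notin> {i, j}}"
  have "roots_of (lie_algebra (A_of b)) (P_of b) \<inter> roots_h (lie_algebra (A_of b)) = (\<lambda>(k, l). root_form b k l) ` ?S"
    unfolding roots_of_A_of[OF b] roots_h_A_of[OF n f]
  proof (intro equalityI subsetI)
    fix \<alpha> assume "\<alpha> \<in> {root_form b k l |k l. k < l} \<inter> {root_form b k l |k l. k \<noteq> l \<and> k \<notin> {i, j} \<and> l \<notin> {i, j}}"
    then obtain k l p q where kl: "\<alpha> = root_form b k l" "k < l" "\<alpha> = root_form b p q" "p \<noteq> q" "p \<notin> {i, j}" "q \<notin> {i, j}" by blast
    then have "k = p \<and> l = q" using root_form_inject[OF b, of p q k l] by auto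
    then show "\<alpha> \<in> (\<lambda>(k, l). root_form b k l) ` ?S" using kl by auto
  qed force
  then have "rho_h (lie_algebra (A_of b)) (P_of b) (diag_conj b x) = (\<Sum>\<alpha>\<in>(\<lambda>(k, l). root_form b k l) ` ?S. \<alpha> (diag_conj b x)) / 2"
    by (simp only: rho_h_def)
  moreover have "inj_on (\<lambda>(k, l). root_form b k l) ?S"
    by (auto simp: inj_on_def dest: root_form_inject[OF b, rotated])
  ultimately have "rho_h (lie_algebra (A_of b)) (P_of b) (diag_conj b x) = (\<Sum>(k, l)\<in>?S. root_form b k l (diag_conj b x)) / 2"
    by (simp only: sum.reindex o_def case_prod_unfold)
  also have "\<dots> = (\<Sum>(k, l)\<in>?S. x $ k - x $ l) / 2" by (simp add: root_form_diag_conj[OF b x])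
  finally show ?thesis unfolding sum_roots_h .
qed

text \<open>Uniqueness comes from definiteness: the difference of two representatives is itself an
  admissible test vector, so its sum of squares is zero.\<close>

lemma trace_form_dual_A_of:
  fixes b :: "'n::{finite,linorder} sqmat"
  assumes b: "invertible b" and r: "(\<Sum>k\<in>UNIV. r $ k) = 0"
    and \<alpha>: "\<And>x. (\<Sum>k\<in>UNIV. x $ k) = 0 \<Longrightarrow> \<alpha> (diag_conj b x) = (\<Sum>k\<in>UNIV. r $ k * x $ k)"
  shows "trace_form_dual (lie_algebra (A_of b)) \<alpha> = diag_conj b r"
proof -
  have tr: "trace (diag_conj b x ** diag_conj b y) = (\<Sum>k\<in>UNIV. y $ k * x $ k)" for x y :: "(real, 'n) vec"
    using trace_conj_by[OF b, of "diag_conj b x ** diag_conj b y"] b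
    by (simp add: conj_by_mult diag_mat_diag_mat trace_diag_mat mult.commute)
  show ?thesis
    unfolding trace_form_dual_def
  proof (rule the_equality)
    show "diag_conj b r \<in> lie_algebra (A_of b) \<and> (\<forall>X\<in>lie_algebra (A_of b). \<alpha> X = trace (X ** diag_conj b r))"
      using r \<alpha> unfolding Ball_def lie_algebra_A_of_diag_conj[OF b] by (auto simp: tr)
  next
    fix Y assume Y: "Y \<in> lie_algebra (A_of b) \<and> (\<forall>X\<in>lie_algebra (A_of b). \<alpha> X = trace (X ** Y))"
    then obtain y where y: "Y = diag_conj b y" "(\<Sum>k\<in>UNIV. y $ k) = 0" using lie_algebra_A_of_diag_conj[OF b] by blast
    define z where "z = y - r"
    have z0: "(\<Sum>k\<in>UNIV. z $ k) = 0" using y r by (simp add: z_def sum_subtractf)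
    then have "diag_conj b z \<in> lie_algebra (A_of b)" using lie_algebra_A_of_diag_conj[OF b] by blast
    then have "(\<Sum>k\<in>UNIV. r $ k * z $ k) = (\<Sum>k\<in>UNIV. y $ k * z $ k)"
      using Y \<alpha>[OF z0] by (simp add: y tr)
    then have "(\<Sum>k\<in>UNIV. z $ k * z $ k) = 0"
      by (simp add: z_def left_diff_distrib sum_subtractf)
    then have "z $ k = 0" for k by (simp add: sum_nonneg_eq_0_iff)
    then have "y = r" by (simp add: z_def vec_eq_iff)
    then show "Y = diag_conj b r" by (simp add: y)
  qed
qed

text \<open>The root is represented by \<open>axis k 1 - axis l 1\<close> and the half sum by its
  offsets. Compatibility thereby becomes monotonicity of \<open>offset i j\<close>, strict in rank
  0.\<close>

lemma dual_inner_rho_h: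
  assumes n: "CARD('n::{finite,linorder}) \<ge> 2" and f: "frame b i j" and kl: "k \<noteq> l"
  shows "dual_inner (lie_algebra (A_of b :: 'n sqmat set)) (root_form b k l) (rho_h (lie_algebra (A_of b)) (P_of b)) =
    offset i j k - offset i j l"
proof -
  note b = frameD(1)[OF f]
  let ?e = "axis k 1 - axis l 1 :: (real, 'n) vec"
  have "x $ k - x $ l = (\<Sum>m\<in>UNIV. ?e $ m * x $ m)" for x :: "(real, 'n) vec"
    by (simp add: left_diff_distrib sum_subtractf axis_def if_distrib[of "\<lambda>y. y * _"] cong: if_cong)
  then have 1: "trace_form_dual (lie_algebra (A_of b)) (root_form b k l) = diag_conj b ?e"
    by (intro trace_form_dual_A_of b sum_zero_diff) (simp add: root_form_diag_conj[OF b])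
  have 2: "trace_form_dual (lie_algebra (A_of b)) (rho_h (lie_algebra (A_of b)) (P_of b)) = diag_conj b (\<chi> k. offset i j k)"
    by (intro trace_form_dual_A_of b) (simp_all add: sum_offset rho_h_A_of[OF n f])
  have "trace (diag_conj b ?e ** diag_conj b (\<chi> k. offset i j k)) = (\<Sum>m\<in>UNIV. ?e $ m * offset i j m)"
    using trace_conj_by[OF b, of "diag_conj b ?e ** diag_conj b (\<chi> k. offset i j k)"] b
    by (simp add: conj_by_mult diag_mat_diag_mat trace_diag_mat)
  also have "\<dots> = offset i j k - offset i j l"
    by (simp add: left_diff_distrib sum_subtractf axis_def if_distrib[of "\<lambda>y. y * _"] cong: if_cong)
  finally show ?thesis by (simp add: dual_inner_def 1 2)
qed

section \<open>Monotonicity of the offsets\<close>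

lemma card_greater: "card {l. k < l} = CARD('n) - 1 - pos (k :: 'n::{finite,linorder})"
proof -
  have "UNIV = {l. l < k} \<union> {k} \<union> {l. k < l}" by auto
  then have "CARD('n) = card ({l. l < k} \<union> {k} \<union> {l. k < l})" by simp
  also have "\<dots> = pos k + 1 + card {l. k < l}"
    by (subst card_Un_disjoint; (subst card_Un_disjoint)?) (auto simp: pos_def)
  finally show ?thesis by simp
qed

lemma card_minus_two:
  fixes A :: "'n::finite set"
  shows "real (card {l \<in> A. l \<notin> {i, j}}) = real (card A) - (if i \<in> A then 1 else 0) - (if i \<noteq> j \<and> j \<in> A then 1 else 0)"
proof -
  have "{l \<in> A. l \<notin> {i, j}} = A - ({i, j} \<inter> A)" by auto
  then have "card {l \<in> A. l \<notin> {i, j}} = card A - card ({i, j} \<inter> A)" by (simp add: card_Diff_subset)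
  moreover have "card ({i, j} \<inter> A) \<le> card A" by (intro card_mono) auto
  moreover have "card ({i, j} \<inter> A) = (if i \<in> A then 1 else 0) + (if i \<noteq> j \<and> j \<in> A then 1 else 0)"
    by (auto simp: Int_insert_left)
  ultimately show ?thesis by (simp split: if_splits)
qed

lemma offset_value:
  fixes k :: "'n::{finite,linorder}"
  assumes "k \<notin> {i, j}"
  shows "2 * offset i j k = real CARD('n) - 1 - 2 * real (pos k)
    - (if k < i then 1 else - 1) - (if i = j then 0 else if k < j then 1 else - 1)"
proof -
  have g: "{l. k < l \<and> l \<notin> {i, j}} = {l \<in> {l. k < l}. l \<notin> {i, j}}"
    "{l. l < k \<and> l \<notin> {i, j}} = {l \<in> {l. l < k}. l \<notin> {i, j}}" by auto
  have "real (card {l. k < l}) = real CARD('n) - 1 - real (pos k)"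
    using pos_bound[of k] by (simp add: card_greater)
  then show ?thesis
    using assms unfolding offset_def g card_minus_two by (auto simp: pos_def[symmetric])
qed

lemma offset_zero: "k \<in> {i, j} \<Longrightarrow> offset i j k = 0" by (auto simp: offset_def)

text \<open>Away from \<open>i\<close> the offsets drop by 1 at each step, so only the neighbours of
  \<open>i\<close> have to be compared with the value 0 at \<open>i\<close>. Doubled, their offsets
  are n - 2 pos i before and n - 2 pos i - 2 after, which have to be positive and negative.\<close>

lemma offset_equal_iff:
  fixes i :: "'n::{finite,linorder}"
  shows "(\<forall>k l. k < l \<longrightarrow> offset i i k > offset i i l) \<longleftrightarrow> good i i"
proof
  assume A: "\<forall>k l. k < l \<longrightarrow> offset i i k > offset i i l"
  have n: "pos i < CARD('n)" by (rule pos_bound)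
  have 1: "2 * pos i < CARD('n)"
  proof (cases "pos i")
    case (Suc m)
    then have "m < CARD('n)" using n by simp
    then obtain k :: 'n where k: "pos k = m" by (rule pos_surj)
    then have "k < i" using Suc by (simp flip: pos_less_iff)
    then have "2 * offset i i k > 0" using A offset_zero[of i i i] by fastforce
    then show ?thesis using offset_value[of k i i] \<open>k < i\<close> k Suc by simp
  qed (use n in simp)
  have 2: "CARD('n) < 2 * pos i + 2"
  proof (cases "pos i + 1 < CARD('n)")
    case True
    then obtain k :: 'n where k: "pos k = pos i + 1" by (rule pos_surj)
    then have "i < k" by (simp flip: pos_less_iff)
    then have "2 * offset i i k < 0" "\<not> k < i" "k \<noteq> i" using A offset_zero[of i i i] by fastforce+
    then show ?thesis using offset_value[of k i i] k by simp
  qed (use n in simp)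
  show "good i i" using 1 2 by (simp add: good_def)
next
  assume "good i i"
  then have g: "real CARD('n) = 2 * real (pos i) + 1" by (simp add: good_def)
  have v: "k < i \<Longrightarrow> 2 * offset i i k = 2 * real (pos i) - 2 * real (pos k) - 1"
    "i < k \<Longrightarrow> 2 * offset i i k = 2 * real (pos i) - 2 * real (pos k) + 1" "offset i i i = 0" for k
    using offset_value[of k i i] g by (auto simp: offset_zero)
  have P: "x < y \<Longrightarrow> real (pos x) + 1 \<le> real (pos y)" for x y :: 'n
    using pos_less[of x y] by auto
  show "\<forall>k l. k < l \<longrightarrow> offset i i k > offset i i l"
  proof (intro allI impI)
    fix k l :: 'n assume kl: "k < l"
    consider "k < i" "l < i" | "k < i" "l = i" | "k < i" "i < l" | "k = i" "i < l" | "i < k" "i < l"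
      using kl by (metis less_trans linorder_less_linear)
    then show "offset i i k > offset i i l"
    proof cases
      case 1 then show ?thesis using v(1)[of k] v(1)[of l] P[OF kl] by linarith
    next
      case 2 then show ?thesis using v(1)[of k] v(3) P[OF kl] by simp
    next
      case 3 then show ?thesis using v(1)[of k] v(2)[of l] P[of k i] P[of i l] by linarith
    next
      case 4 then show ?thesis using v(2)[of l] v(3) P[OF kl] by simp
    next
      case 5 then show ?thesis using v(2)[of k] v(2)[of l] P[OF kl] by linarith
    qed
  qed
qed

text \<open>The offsets vanish at \<open>j\<close> and at \<open>i\<close>, so monotonicity forces
  them to vanish strictly in between, to be nonnegative before \<open>j\<close> and nonpositive
  after \<open>i\<close>.\<close>

lemma offset_less_iff:
  fixes i j :: "'n::{finite,linorder}"
  assumes ji: "j < i"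
  shows "(\<forall>k l. k < l \<longrightarrow> offset i j k \<ge> offset i j l) \<longleftrightarrow> good i j"
proof
  assume A: "\<forall>k l. k < l \<longrightarrow> offset i j k \<ge> offset i j l"
  have n: "pos i < CARD('n)" by (rule pos_bound)
  have pji: "pos j < pos i" using ji by (rule pos_less)
  have z: "offset i j i = 0" "offset i j j = 0" by (auto simp: offset_zero)
  have 1: "2 * pos j < CARD('n)"
  proof (cases "pos j")
    case (Suc m)
    then have "m < CARD('n)" using pos_bound[of j] by simp
    then obtain k :: 'n where k: "pos k = m" by (rule pos_surj)
    then have kj: "k < j" using Suc by (simp flip: pos_less_iff)
    then have ki: "k < i" using ji by simp
    have "2 * offset i j k \<ge> 0" using A kj z by fastforce
    moreover have "k \<noteq> i" "k \<noteq> j" "i \<noteq> j" using ki kj ji by auto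
    ultimately show ?thesis using offset_value[of k i j] ki kj k Suc by simp
  qed (use n in simp)
  have 2: "CARD('n) < 2 * pos i + 2"
  proof (cases "pos i + 1 < CARD('n)")
    case True
    then obtain k :: 'n where k: "pos k = pos i + 1" by (rule pos_surj)
    then have ik: "i < k" by (simp flip: pos_less_iff)
    then have jk: "j < k" using ji by simp
    have "2 * offset i j k \<le> 0" using A ik z by fastforce
    moreover have "k \<noteq> i" "k \<noteq> j" "i \<noteq> j" "\<not> k < i" "\<not> k < j" using ik jk ji by auto
    ultimately show ?thesis using offset_value[of k i j] k by simp
  qed (use n in simp)
  \<comment> \<open>A position between \<open>j\<close> and \<open>i\<close> has offset zero only at
    the centre of the index range, so there is at most one such position.\<close>
  have 3: "2 * m + 1 = CARD('n)" if m: "pos j < m" "m < pos i" for m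
  proof -
    have "m < CARD('n)" using m n by simp
    then obtain k :: 'n where k: "pos k = m" by (rule pos_surj)
    then have jk: "j < k" and ki: "k < i" using m by (simp_all flip: pos_less_iff)
    have "offset i j k \<ge> 0" "offset i j k \<le> 0" using A jk ki z by fastforce+
    then have "2 * offset i j k = 0" by simp
    moreover have "k \<noteq> i" "k \<noteq> j" "i \<noteq> j" "\<not> k < j" using ki jk ji by auto
    ultimately show ?thesis using offset_value[of k i j] ki k by simp
  qed
  show "good i j"
  proof (cases "pos i = pos j + 1")
    case True
    then show ?thesis using 1 2 ji by (simp add: good_def)
  next
    case False
    then have "2 * (pos j + 1) + 1 = CARD('n)" "2 * (pos i - 1) + 1 = CARD('n)"
      using 3[of "pos j + 1"] 3[of "pos i - 1"] pji by auto
    moreover have "i \<noteq> j" using ji by simp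
    ultimately show ?thesis using pji by (simp add: good_def)
  qed
next
  assume "good i j"
  then have "2 * pos i \<le> CARD('n) + 1" "CARD('n) \<le> 2 * pos j + 3"
    using ji by (simp_all add: good_def less_imp_neq[THEN not_sym])
  then have "real (2 * pos i) \<le> real (CARD('n) + 1)" "real CARD('n) \<le> real (2 * pos j + 3)"
    by (simp_all only: of_nat_le_iff)
  then have g: "2 * real (pos i) \<le> real CARD('n) + 1" "real CARD('n) \<le> 2 * real (pos j) + 3" by simp_all
  have v: "k < j \<Longrightarrow> 2 * offset i j k = real CARD('n) - 3 - 2 * real (pos k)"
    "j < k \<Longrightarrow> k < i \<Longrightarrow> 2 * offset i j k = real CARD('n) - 1 - 2 * real (pos k)"
    "i < k \<Longrightarrow> 2 * offset i j k = real CARD('n) + 1 - 2 * real (pos k)" for k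
  proof -
    show "2 * offset i j k = real CARD('n) - 3 - 2 * real (pos k)" if "k < j"
    proof -
      have "k \<noteq> i" "k \<noteq> j" "i \<noteq> j" "k < i" using ji that by auto
      then show ?thesis using offset_value[of k i j] that by simp
    qed
    show "2 * offset i j k = real CARD('n) - 1 - 2 * real (pos k)" if "j < k" "k < i"
    proof -
      have "k \<noteq> i" "k \<noteq> j" "i \<noteq> j" "\<not> k < j" using ji that by auto
      then show ?thesis using offset_value[of k i j] that by simp
    qed
    show "2 * offset i j k = real CARD('n) + 1 - 2 * real (pos k)" if "i < k"
    proof -
      have "k \<noteq> i" "k \<noteq> j" "i \<noteq> j" "\<not> k < j" "\<not> k < i" using ji that by auto
      then show ?thesis using offset_value[of k i j] that by simp
    qed
  qed
  have z: "offset i j i = 0" "offset i j j = 0" by (auto simp: offset_zero)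
  have P: "x < y \<Longrightarrow> real (pos x) + 1 \<le> real (pos y)" for x y :: 'n
    using pos_less[of x y] by auto
  have side: "k < j \<or> k = j \<or> (j < k \<and> k < i) \<or> k = i \<or> i < k" for k using ji by auto
  have nonneg: "offset i j k \<ge> 0" if "k < i" for k
    using side[of k]
  proof (elim disjE conjE)
    assume "k < j" then show ?thesis using v(1)[of k] P[of k j] g P[OF ji] by linarith
  next
    assume "j < k" "k < i" then show ?thesis using v(2)[of k] P[of k i] P[of j k] g by linarith
  qed (use z that in auto)
  have nonpos: "offset i j k \<le> 0" if "j < k" for k
    using side[of k]
  proof (elim disjE conjE)
    assume "i < k" then show ?thesis using v(3)[of k] P[of i k] g P[OF ji] by linarith
  next
    assume "j < k" "k < i" then show ?thesis using v(2)[of k] P[of k i] P[of j k] g by linarith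
  qed (use z that in auto)
  show "\<forall>k l. k < l \<longrightarrow> offset i j k \<ge> offset i j l"
  proof (intro allI impI)
    fix k l :: 'n assume kl: "k < l"
    consider "k < i" "j < l" | "l \<le> j" | "i \<le> k" using kl by (metis not_le)
    then show "offset i j k \<ge> offset i j l"
    proof cases
      case 1 then show ?thesis using nonneg[of k] nonpos[of l] by linarith
    next
      case 2
      then have "k < j" using kl by simp
      show ?thesis
      proof (cases "l = j")
        case True then show ?thesis using nonneg[of k] \<open>k < j\<close> ji z by simp
      next
        case False
        then have "l < j" using 2 by simp
        then show ?thesis using v(1)[of k] v(1)[of l] P[OF kl] \<open>k < j\<close> by linarith
      qed
    next
      case 3
      then have "i < l" using kl by simp
      show ?thesis
      proof (cases "k = i")
        case True then show ?thesis using nonpos[of l] \<open>i < l\<close> ji z by simp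
      next
        case False
        then have "i < k" using 3 by simp
        then show ?thesis using v(3)[of k] v(3)[of l] P[OF kl] \<open>i < l\<close> by linarith
      qed
    qed
  qed
qed

lemma compat_A_of:
  assumes n: "CARD('n::{finite,linorder}) \<ge> 2" and f: "frame b i j"
  shows "(let \<aa> = lie_algebra (A_of b :: 'n sqmat set) in
      (sigma_rank (A_of b) = 1 \<and> (\<forall>\<alpha>\<in>roots_of \<aa> (P_of b). dual_inner \<aa> \<alpha> (rho_h \<aa> (P_of b)) \<ge> 0)) \<or>
      (sigma_rank (A_of b) = 0 \<and> (\<forall>\<alpha>\<in>roots_of \<aa> (P_of b). dual_inner \<aa> \<alpha> (rho_h \<aa> (P_of b)) > 0)))
    \<longleftrightarrow> good i j"
proof -
  note b = frameD[OF f]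
  have ge: "(\<forall>\<alpha>\<in>roots_of (lie_algebra (A_of b)) (P_of b). Q (dual_inner (lie_algebra (A_of b)) \<alpha> (rho_h (lie_algebra (A_of b)) (P_of b))))
      \<longleftrightarrow> (\<forall>k l. k < l \<longrightarrow> Q (offset i j k - offset i j l))" for Q
  proof -
    have "dual_inner (lie_algebra (A_of b)) (root_form b k l) (rho_h (lie_algebra (A_of b)) (P_of b)) = offset i j k - offset i j l"
      if "k < l" for k l using that by (intro dual_inner_rho_h[OF n f]) simp
    moreover have "(\<forall>\<alpha>\<in>{root_form b k l | k l. k < l}. R \<alpha>) \<longleftrightarrow> (\<forall>k l. k < l \<longrightarrow> R (root_form b k l))" for R by blast
    ultimately show ?thesis unfolding roots_of_A_of[OF b(1)] by simp
  qed
  show ?thesis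
    unfolding Let_def sigma_rank_A_of[OF n f] ge
    using offset_equal_iff[of i] offset_less_iff[of j i] b(2) by (cases "i = j") auto
qed

lemma good_imp_h_compatible:
  fixes b :: "'n::{finite,linorder} sqmat"
  assumes n: "CARD('n) \<ge> 2" and f: "frame b i j" and g: "good i j"
  shows "h_compatible (P_of b)"
  unfolding h_compatible_def
  using split_component_A_of[OF frameD(1)[OF f]] sigma_stable_A_of[OF n f] compat_A_of[OF n f] g by blast

text \<open>The witness of compatibility is some stable split component, which yields a frame of its
  own. It defines the same parabolic subgroup but may differ from a frame chosen before.\<close>

lemma h_compatible_imp_good:
  fixes b :: "'n::{finite,linorder} sqmat"
  assumes n: "CARD('n) \<ge> 2" and b: "invertible b" and h: "h_compatible (P_of b)"
  obtains b' i j where "frame b' i j" "P_of b' = P_of b" "good i j"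
proof -
  obtain A where A: "split_component A (P_of b)" "sigma_inv ` A = A"
    "(let \<aa> = lie_algebra A in
      (sigma_rank A = 1 \<and> (\<forall>\<alpha>\<in>roots_of \<aa> (P_of b). dual_inner \<aa> \<alpha> (rho_h \<aa> (P_of b)) \<ge> 0)) \<or>
      (sigma_rank A = 0 \<and> (\<forall>\<alpha>\<in>roots_of \<aa> (P_of b). dual_inner \<aa> \<alpha> (rho_h \<aa> (P_of b)) > 0)))"
    using h unfolding h_compatible_def by blast
  obtain u where u: "unitri u" "A = A_of (b ** u)" using split_component_cases[OF b A(1)] by blast
  have ui: "invertible u" using u(1) by (rule unitri_invertible)
  have bu: "invertible (b ** u)" using b ui by (rule invertible_mult)
  obtain c i j where c: "\<And>k. c $ k \<noteq> 0" and f: "frame (b ** u ** diag_mat c) i j"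
    using sigma_stable_frame[OF n bu] A(2) u(2) by blast
  have ci: "invertible (diag_mat c)" using c by (simp add: invertible_det_nz det_diag_mat)
  have P: "P_of (b ** u ** diag_mat c) = P_of b"
    using P_of_upper[OF bu is_diag_upper[OF is_diag_diag_mat] ci] P_of_upper[OF b _ ui] u(1) by (simp add: unitri_def)
  have "A = A_of (b ** u ** diag_mat c)" using A_of_diag_mat[OF bu c] u(2) by simp
  then have "good i j" using compat_A_of[OF n f] A(3) by (simp add: P)
  then show ?thesis using that f P by blast
qed

section \<open>The symmetric space as an orbit of idempotents\<close>

definition proj :: "('n::{finite,linorder}) sqmat \<Rightarrow> 'n sqmat"
  where "proj g = (1 / 2) *\<^sub>R outer (g *v wvec) (wvec v* matrix_inv g)"

text \<open>On cosets of \<open>H_grp\<close> the chosen representative is immaterial, because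
  \<open>H_grp\<close> is the stabilizer of \<open>proj (mat 1)\<close>.\<close>

definition coset_proj :: "('n::{finite,linorder}) sqmat set \<Rightarrow> 'n sqmat"
  where "coset_proj c = proj (SOME g. g \<in> c)"

lemma proj_mult:
  assumes "invertible x" "invertible g" shows "proj (x ** g) = x ** proj g ** matrix_inv x"
  using assms by (simp add: proj_def matrix_inv_mult matrix_scaleR_left matrix_scaleR_right outer_left
      outer_right matrix_vector_mul_assoc vector_matrix_mul_assoc)

lemma proj_one: "proj (mat 1) = (1 / 2) *\<^sub>R outer wvec wvec"
  by (simp add: proj_def matrix_inv_one)

lemma proj_eq: "invertible g \<Longrightarrow> proj g = g ** proj (mat 1) ** matrix_inv g"
  using proj_mult[of g "mat 1"] by (simp add: invertible_det_nz)

lemma H_grp_iff: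
  assumes n: "CARD('n::{finite,linorder}) \<ge> 2" and h: "h \<in> carrier SL"
  shows "h \<in> H_grp \<longleftrightarrow> proj h = proj (mat 1 :: 'n sqmat)"
proof -
  have hi: "invertible h" using h by (rule SL_invertible)
  have "h \<in> H_grp \<longleftrightarrow> h ** proj (mat 1) = proj (mat 1) ** h"
    using h by (simp add: H_grp_def sigma_fix_iff_outer[OF n] proj_one matrix_scaleR_left matrix_scaleR_right outer_left outer_right)
  also have "\<dots> \<longleftrightarrow> proj h = proj (mat 1)"
  proof
    assume "h ** proj (mat 1) = proj (mat 1) ** h"
    then show "proj h = proj (mat 1)"
      unfolding proj_eq[OF hi] using hi by (simp add: matrix_inv_right flip: matrix_mul_assoc)
  next
    assume "proj h = proj (mat 1)"
    then have "proj (mat 1) ** h = h ** proj (mat 1) ** matrix_inv h ** h"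
      using proj_eq[OF hi] by simp
    also have "\<dots> = h ** proj (mat 1)" using hi by (simp add: matrix_inv_left flip: matrix_mul_assoc)
    finally show "h ** proj (mat 1) = proj (mat 1) ** h" by simp
  qed
  finally show ?thesis .
qed

lemma H_grp_subgroup:
  assumes n: "CARD('n::{finite,linorder}) \<ge> 2"
  shows "subgroup (H_grp :: 'n sqmat set) SL"
proof -
  have H: "h \<in> H_grp \<longleftrightarrow> det h = 1 \<and> S_mat ** h = h ** S_mat" for h :: "'n sqmat"
    by (simp add: H_grp_def SL_simps sigma_fix_iff[OF n])
  show ?thesis
  proof (rule subgroup_SLI)
    fix g h :: "'n sqmat" assume g: "g \<in> H_grp" "h \<in> H_grp"
    then have gh: "S_mat ** g = g ** S_mat" "S_mat ** h = h ** S_mat" by (simp_all add: H)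
    have "S_mat ** (g ** h) = g ** S_mat ** h" by (simp add: matrix_mul_assoc gh)
    also have "\<dots> = g ** h ** S_mat" by (simp add: gh flip: matrix_mul_assoc)
    finally have "S_mat ** (g ** h) = g ** h ** S_mat" .
    then show "g ** h \<in> H_grp" using g by (simp add: H det_mul)
  next
    fix g :: "'n sqmat" assume g: "g \<in> H_grp"
    then have gi: "invertible g" by (simp add: H invertible_det_nz)
    have "S_mat ** matrix_inv g = matrix_inv g ** (g ** S_mat) ** matrix_inv g"
      using gi by (simp add: matrix_mul_assoc matrix_inv_left)
    also have "g ** S_mat = S_mat ** g" using g H by simp
    also have "matrix_inv g ** (S_mat ** g) ** matrix_inv g = matrix_inv g ** S_mat"
      using gi by (simp add: matrix_inv_right flip: matrix_mul_assoc)
    finally show "matrix_inv g \<in> H_grp" using g gi by (simp add: H det_matrix_inv)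
  qed (simp_all add: H)
qed

lemma l_coset_SL: "g <#\<^bsub>SL\<^esub> A = (\<lambda>h. g ** h) ` A"
  by (auto simp: l_coset_def SL_simps)

lemma l_coset_SL_assoc: "x <#\<^bsub>SL\<^esub> (g <#\<^bsub>SL\<^esub> A) = (x ** g) <#\<^bsub>SL\<^esub> A"
  by (simp add: l_coset_SL image_image matrix_mul_assoc)

lemma coset_proj_coset:
  assumes n: "CARD('n::{finite,linorder}) \<ge> 2" and g: "invertible (g :: 'n sqmat)"
  shows "coset_proj (g <#\<^bsub>SL\<^esub> H_grp) = proj g"
proof -
  have "mat 1 \<in> (H_grp :: 'n sqmat set)" using subgroup_SLD(2)[OF H_grp_subgroup[OF n]] .
  then have "g \<in> g <#\<^bsub>SL\<^esub> H_grp" unfolding l_coset_SL by (intro image_eqI[of _ _ "mat 1"]) simp_all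
  then have "(SOME x. x \<in> g <#\<^bsub>SL\<^esub> H_grp) \<in> g <#\<^bsub>SL\<^esub> H_grp" by (rule someI)
  then obtain h where h: "(SOME x. x \<in> g <#\<^bsub>SL\<^esub> H_grp) = g ** h" "h \<in> H_grp" unfolding l_coset_SL by blast
  have hs: "h \<in> carrier SL" using h(2) by (simp add: H_grp_def)
  have "proj (g ** h) = proj g"
    using proj_mult[OF g SL_invertible[OF hs]] H_grp_iff[OF n hs] h(2) proj_eq[OF g] by simp
  then show ?thesis by (simp add: coset_proj_def h(1))
qed

lemma coset_eqI:
  assumes n: "CARD('n::{finite,linorder}) \<ge> 2" and x: "x \<in> carrier SL" "y \<in> carrier SL"
    and p: "proj x = proj (y :: 'n sqmat)"
  shows "x <#\<^bsub>SL\<^esub> H_grp = y <#\<^bsub>SL\<^esub> H_grp"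
proof -
  note i = SL_invertible[OF x(1)] SL_invertible[OF x(2)]
  have sub: "u <#\<^bsub>SL\<^esub> H_grp \<subseteq> v <#\<^bsub>SL\<^esub> H_grp"
    if u: "u \<in> carrier SL" "v \<in> carrier SL" "proj u = proj v" for u v :: "'n sqmat"
  proof -
    note i = SL_invertible[OF u(1)] SL_invertible[OF u(2)]
    have "matrix_inv v ** u \<in> carrier SL" using u i by (simp add: SL_simps det_mul det_matrix_inv)
    moreover have "proj (matrix_inv v ** u) = proj (mat 1)"
    proof -
      have "proj (matrix_inv v ** u) = proj (matrix_inv v ** v)"
        using i u(3) by (simp add: proj_mult invertible_matrix_inv)
      then show ?thesis using i by (simp add: matrix_inv_left)
    qed
    ultimately have h: "matrix_inv v ** u \<in> H_grp" using H_grp_iff[OF n] by blast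
    have "u ** k = v ** (matrix_inv v ** u ** k)" for k using i by (simp add: matrix_mul_assoc matrix_inv_right)
    then show ?thesis unfolding l_coset_SL
      using subgroup_SLD(3)[OF H_grp_subgroup[OF n] h] by blast
  qed
  show ?thesis using sub[OF x p] sub[OF x(2,1) p[symmetric]] by blast
qed

section \<open>Polar decomposition and the size of the idempotent\<close>

lemma inner_matrix: "(A :: 'n::finite sqmat) \<bullet> B = (\<Sum>i\<in>UNIV. \<Sum>j\<in>UNIV. A $ i $ j * B $ i $ j)"
  by (simp add: inner_vec_def)

lemma norm_outer: "norm (outer u v) = norm u * norm v"
proof -
  have "outer u v \<bullet> outer u v = (u \<bullet> u) * (v \<bullet> v)"
    by (simp add: inner_matrix outer_def inner_vec_def sum_product mult_ac)
  then show ?thesis by (simp add: norm_eq_sqrt_inner real_sqrt_mult)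
qed

definition householder :: "(real, 'n::finite) vec \<Rightarrow> (real, 'n) vec \<Rightarrow> (real, 'n) vec"
  where "householder a x = x - (2 * (a \<bullet> x) / (a \<bullet> a)) *\<^sub>R a"

lemma orthogonal_householder: "orthogonal_transformation (householder a)"
  unfolding orthogonal_transformation_def
proof (intro conjI allI)
  show "linear (householder a)"
    by (intro linearI) (simp_all add: householder_def inner_add_right algebra_simps add_divide_distrib)
  show "householder a v \<bullet> householder a w = v \<bullet> w" for v w
  proof (cases "a = 0")
    case False
    then have "a \<bullet> a \<noteq> 0" by simp
    then show ?thesis
      by (simp add: householder_def inner_diff_left inner_diff_right inner_commute[of v a] field_simps)
  qed (simp add: householder_def)
qed

lemma householder_swap:
  assumes "norm x = norm y" shows "householder (x - y) x = y"
proof (cases "x = y")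
  case False
  have xy: "x \<bullet> x = y \<bullet> y" using assms by (simp add: norm_eq_sqrt_inner)
  then have eq: "2 * ((x - y) \<bullet> x) = (x - y) \<bullet> (x - y)"
    by (simp add: inner_diff_left inner_diff_right inner_commute)
  have "(x - y) \<bullet> (x - y) \<noteq> 0" using False by simp
  then have "2 * ((x - y) \<bullet> x) / ((x - y) \<bullet> (x - y)) = 1" unfolding eq by (rule divide_self)
  then have "householder (x - y) x = x - 1 *\<^sub>R (x - y)" unfolding householder_def by (simp only:)
  then show ?thesis by simp
qed (simp add: householder_def)

text \<open>Two reflections suffice: the first moves \<open>a\<close> to \<open>c\<close>, the second fixes \<open>c\<close>.\<close>

lemma orthogonal_pair:
  fixes a b c d :: "(real, 'n::finite) vec"
  assumes "norm a = norm c" "norm b = norm d" "a \<bullet> b = c \<bullet> d"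
  obtains k :: "'n sqmat" where "orthogonal_matrix k" "k *v a = c" "k *v b = d"
proof -
  let ?f = "householder (a - c)"
  define b1 where "b1 = ?f b"
  note of = orthogonal_householder[of "a - c"]
  have fa: "?f a = c" using assms(1) by (rule householder_swap)
  have "norm b1 = norm d"
    using of assms(2) unfolding orthogonal_transformation b1_def by simp
  then have gb: "householder (b1 - d) b1 = d" by (rule householder_swap)
  have "?f a \<bullet> ?f b = a \<bullet> b"
    using of unfolding orthogonal_transformation_def by blast
  then have "c \<bullet> b1 = a \<bullet> b" unfolding fa b1_def[symmetric] .
  then have "(b1 - d) \<bullet> c = 0" using assms(3) by (simp add: inner_diff_left inner_diff_right inner_commute)
  then have gc: "householder (b1 - d) c = c" by (simp add: householder_def)
  define f where "f = householder (b1 - d) \<circ> ?f"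
  have "orthogonal_transformation f"
    unfolding f_def by (intro orthogonal_transformation_compose orthogonal_householder)
  then have k: "orthogonal_matrix (matrix f)" "linear f"
    using orthogonal_transformation_matrix by auto
  show ?thesis
    by (rule that[OF k(1)]) (use k(2) in \<open>simp_all add: f_def fa gc gb flip: b1_def\<close>)
qed

lemma a_elt_diag_mat: "a_elt t = diag_mat (\<chi> i. if i = first_idx then exp t else if i = last_idx then exp (- t) else 1)"
  by (auto simp: a_elt_def diag_mat_def vec_eq_iff)

text \<open>The image of \<open>wvec\<close> under \<open>a_elt t\<close>; the middle entries are 0
  because \<open>wvec\<close> has none there.\<close>

definition torus_vec :: "real \<Rightarrow> (real, 'n::{finite,linorder}) vec"
  where "torus_vec t = (\<chi> i. if i = first_idx then exp t else if i = last_idx then exp (- t) else 0)"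

lemma a_elt_props:
  assumes n: "CARD('n::{finite,linorder}) \<ge> 2"
  shows "det (a_elt t :: 'n sqmat) = 1" "a_elt t *v wvec = (torus_vec t :: (real,'n) vec)"
    "wvec v* matrix_inv (a_elt t) = (torus_vec (- t) :: (real,'n) vec)"
proof -
  note fl = first_last[OF n]
  have nz: "(\<chi> i. if i = first_idx then exp t else if i = last_idx then exp (- t) else (1 :: real)) $ k \<noteq> 0" for k :: 'n
    by simp
  show "a_elt t *v wvec = (torus_vec t :: (real,'n) vec)"
    by (simp add: a_elt_diag_mat diag_mat_vec wvec_component[OF n] torus_vec_def vec_eq_iff)
  show "wvec v* matrix_inv (a_elt t) = (torus_vec (- t) :: (real,'n) vec)"
    unfolding a_elt_diag_mat matrix_inv_diag_mat[OF nz]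
    by (simp add: vec_diag_mat wvec_component[OF n] torus_vec_def vec_eq_iff exp_minus)
  have "(\<Prod>k\<in>(UNIV::'n set). if k = first_idx then exp t else if k = last_idx then exp (- t) else 1) =
      (\<Prod>k\<in>{first_idx, last_idx :: 'n}. if k = first_idx then exp t else if k = last_idx then exp (- t) else 1)"
    by (intro prod.mono_neutral_right) auto
  then show "det (a_elt t :: 'n sqmat) = 1"
    using fl by (simp add: a_elt_diag_mat det_diag_mat exp_minus)
qed

lemma torus_vec_inner:
  assumes n: "CARD('n::{finite,linorder}) \<ge> 2"
  shows "(torus_vec s :: (real,'n) vec) \<bullet> torus_vec t = 2 * cosh (s + t)"
proof -
  have "(torus_vec s :: (real,'n) vec) \<bullet> torus_vec t = (\<Sum>k\<in>{first_idx, last_idx :: 'n}. torus_vec s $ k * torus_vec t $ k)"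
    unfolding inner_vec_def by (intro sum.mono_neutral_cong_right) (auto simp: torus_vec_def)
  also have "\<dots> = exp s * exp t + exp (- s) * exp (- t)" using first_last[OF n] by (simp add: torus_vec_def)
  also have "\<dots> = exp (s + t) + exp (- (s + t))" by (simp add: mult_exp_exp)
  finally show ?thesis by (simp add: cosh_def)
qed

lemma orthogonal_matrix_inv: "orthogonal_matrix k \<Longrightarrow> matrix_inv k = transpose (k :: 'n::finite sqmat)"
  by (intro matrix_inv_eqI) (simp add: orthogonal_matrix_def)

lemma SO_SL: "k \<in> SO \<Longrightarrow> k \<in> carrier SL"
  by (simp add: SO_def SL_simps)

lemma proj_ka:
  assumes n: "CARD('n::{finite,linorder}) \<ge> 2" and k: "orthogonal_matrix (k :: 'n sqmat)"
  shows "proj (k ** a_elt t) = (1 / 2) *\<^sub>R outer (k *v torus_vec t) (k *v torus_vec (- t))"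
proof -
  have a: "invertible (a_elt t :: 'n sqmat)" using a_elt_props(1)[OF n] by (simp add: invertible_det_nz)
  have ki: "invertible k" using k by (auto simp: orthogonal_matrix_def invertible_def)
  show ?thesis
    unfolding proj_mult[OF ki a] unfolding proj_def a_elt_props(2,3)[OF n] orthogonal_matrix_inv[OF k]
    by (simp add: matrix_scaleR_left matrix_scaleR_right outer_left outer_right)
qed

lemma orthogonal_matrix_norm: "orthogonal_matrix (k :: 'n::finite sqmat) \<Longrightarrow> norm (k *v x) = norm x"
  using orthogonal_transformation orthogonal_transformation_matrix[of "(*v) k"] by auto

lemma norm_proj_ka:
  assumes n: "CARD('n::{finite,linorder}) \<ge> 2" and k: "orthogonal_matrix (k :: 'n sqmat)"
  shows "norm (proj (k ** a_elt t)) = cosh (2 * t)"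
proof -
  have "norm (torus_vec t :: (real,'n) vec) * norm (torus_vec (- t) :: (real,'n) vec) = 2 * cosh (2 * t)"
    by (simp add: norm_eq_sqrt_inner torus_vec_inner[OF n])
  then show ?thesis by (simp add: proj_ka[OF n k] norm_outer orthogonal_matrix_norm k)
qed

text \<open>A point is determined by the product \<open>outer v x\<close> with
  \<open>x \<bullet> v = 2\<close>. Two vectors can be moved to two others by an orthogonal matrix
  as soon as norms and inner product agree, so it is enough to match them with those of
  \<open>torus_vec t\<close> and \<open>torus_vec (- t)\<close>.\<close>

lemma KAK:
  assumes n: "CARD('n::{finite,linorder}) \<ge> 3" and g: "g \<in> carrier (SL :: 'n sqmat monoid)"
  obtains k t where "k \<in> SO" "g <#\<^bsub>SL\<^esub> H_grp = (k ** a_elt t) <#\<^bsub>SL\<^esub> H_grp"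
    "norm (proj g) = cosh (2 * t)"
proof -
  have n2: "CARD('n) \<ge> 2" using n by simp
  have gi: "invertible g" using g by (rule SL_invertible)
  define v0 where "v0 = g *v wvec"
  define x0 where "x0 = wvec v* matrix_inv g"
  have dot: "x0 \<bullet> v0 = 2"
    using gi by (simp add: x0_def v0_def inner_vec_mat matrix_inv_mult_vec wvec_inner[OF n2])
  then have nz: "norm x0 > 0" "norm v0 > 0" by auto
  \<comment> \<open>Scaling one vector by \<open>s\<close> and the other by its inverse keeps the
    idempotent and makes the two norms equal, as they are for the torus vectors.\<close>
  define s where "s = sqrt (norm x0 / norm v0)"
  have s: "s > 0" using nz by (simp add: s_def)
  have s2: "s * s = norm x0 / norm v0" using nz by (simp add: s_def flip: power2_eq_square)
  define v where "v = s *\<^sub>R v0"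
  define x where "x = x0 /\<^sub>R s"
  have vx: "v \<bullet> x = 2" using dot s by (simp add: v_def x_def inner_commute)
  have nv: "norm v * norm v = norm x0 * norm v0" "norm x * norm x = norm x0 * norm v0"
    using s s2 nz by (simp_all add: v_def x_def field_simps)
  then have nvx: "norm v = norm x" by (metis norm_ge_zero power2_eq_iff_nonneg power2_eq_square)
  define r where "r = norm x0 * norm v0"
  have r2: "r \<ge> 2" using Cauchy_Schwarz_ineq2[of x0 v0] dot by (simp add: r_def)
  \<comment> \<open>Both torus vectors have squared norm 2 cosh (2 t), and this has to be
    \<open>r\<close>.\<close>
  define t where "t = arcosh (r / 2) / 2"
  have ct: "cosh (2 * t) = r / 2" using r2 by (simp add: t_def)
  have wn: "norm (torus_vec t :: (real,'n) vec) = norm v" "norm (torus_vec (- t) :: (real,'n) vec) = norm x"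
  proof -
    have "norm (torus_vec t :: (real,'n) vec) = sqrt r" "norm (torus_vec (- t) :: (real,'n) vec) = sqrt r"
      using ct by (simp_all add: norm_eq_sqrt_inner torus_vec_inner[OF n2])
    moreover have "norm v = sqrt r" "norm x = sqrt r" using nv real_sqrt_mult_self
      by (metis abs_norm_cancel r_def real_sqrt_abs2)+
    ultimately show "norm (torus_vec t :: (real,'n) vec) = norm v" "norm (torus_vec (- t) :: (real,'n) vec) = norm x" by simp_all
  qed
  have "(torus_vec t :: (real,'n) vec) \<bullet> torus_vec (- t) = v \<bullet> x" by (simp add: torus_vec_inner[OF n2] vx)
  then obtain k :: "'n sqmat" where k: "orthogonal_matrix k" "k *v torus_vec t = v" "k *v torus_vec (- t) = x"
    using orthogonal_pair[OF wn] by blast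
  \<comment> \<open>A third index exists since n is at least 3. The reflection in that axis fixes
    both torus vectors and repairs the sign of \<open>det k\<close>.\<close>
  have "\<exists>m :: 'n. m \<notin> {first_idx, last_idx}"
  proof (rule ccontr)
    assume "\<not> ?thesis"
    then have "(UNIV :: 'n set) \<subseteq> {first_idx, last_idx}" by blast
    then have "CARD('n) \<le> card {first_idx, last_idx :: 'n}" by (intro card_mono) auto
    also have "\<dots> \<le> 2" by (simp add: card_insert_if)
    finally show False using n by simp
  qed
  then obtain m :: 'n where m: "m \<noteq> first_idx" "m \<noteq> last_idx" by auto
  define D :: "'n sqmat" where "D = diag_mat (\<chi> i. if i = m then - 1 else 1)"
  have DD: "D ** D = mat 1" by (simp add: D_def diag_mat_diag_mat if_distrib flip: diag_mat_one cong: if_cong)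
  have "transpose D = D" by (auto simp: D_def transpose_def diag_mat_def vec_eq_iff)
  then have Do: "orthogonal_matrix D" by (simp add: orthogonal_matrix DD)
  have Dw: "D *v torus_vec t = torus_vec t" for t using m by (auto simp: D_def diag_mat_vec torus_vec_def vec_eq_iff)
  have dD: "det D = - 1"
    by (simp add: D_def det_diag_mat prod.If_cases)
  have "\<exists>k' :: 'n sqmat. k' \<in> SO \<and> k' *v torus_vec t = v \<and> k' *v torus_vec (- t) = x"
  proof (cases "det k = 1")
    case True
    then show ?thesis using k by (auto simp: SO_def)
  next
    case False
    then have "det k = - 1" using det_orthogonal_matrix[OF k(1)] by simp
    then have "k ** D \<in> SO" using k Do by (simp add: SO_def orthogonal_matrix_mul det_mul dD)
    then show ?thesis using k by (intro exI[of _ "k ** D"]) (simp add: Dw flip: matrix_vector_mul_assoc)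
  qed
  then obtain k' where k': "k' \<in> SO" "k' *v torus_vec t = v" "k' *v torus_vec (- t) = x" by blast
  have ok: "orthogonal_matrix k'" using k' by (simp add: SO_def)
  have "proj (k' ** a_elt t) = (1 / 2) *\<^sub>R outer v x" unfolding proj_ka[OF n2 ok] k' ..
  also have "\<dots> = proj g" using s by (simp add: proj_def outer_def v_def x_def vec_eq_iff flip: v0_def x0_def)
  finally have p: "proj (k' ** a_elt t) = proj g" .
  have "k' ** a_elt t \<in> carrier SL" using SO_SL[OF k'(1)] a_elt_props(1)[OF n2] by (simp add: SL_simps det_mul)
  then have "g <#\<^bsub>SL\<^esub> H_grp = (k' ** a_elt t) <#\<^bsub>SL\<^esub> H_grp"
    using coset_eqI[OF n2 g _ p[symmetric]] by blast
  moreover have "norm (proj g) = cosh (2 * t)" using norm_proj_ka[OF n2 ok, of t] p by simp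
  ultimately show ?thesis using that k'(1) by blast
qed

text \<open>The weights in \<open>t\<close> are rewritten in terms of the norm of the idempotent,
  which is cosh (2 t).\<close>

lemma schwartz_bound:
  fixes \<phi> :: "('n::{finite,linorder}) sqmat set \<Rightarrow> complex"
  assumes n: "CARD('n) \<ge> 3" and \<phi>: "schwartz \<phi>"
  obtains C where "\<And>g. g \<in> carrier SL \<Longrightarrow> norm (proj g) \<ge> 1 \<and>
    cmod (\<phi> (g <#\<^bsub>SL\<^esub> H_grp)) * sqrt (norm (proj g)) ^ (CARD('n) - 1) * (1 + ln (norm (proj g))) ^ m \<le> C"
proof -
  let ?d = "CARD('n) - 1"
  have "bdd_above ((\<lambda>(k, t). cosh t ^ ?d * (1 + \<bar>t\<bar>) ^ m *
          cmod (\<phi> ((k ** a_elt t) <#\<^bsub>SL\<^esub> H_grp))) ` (SO \<times> (UNIV :: real set)))"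
    using \<phi>[unfolded schwartz_def, THEN conjunct2, rule_format, OF U_action.one, of m] by simp
  then obtain C where C: "\<And>k t. k \<in> SO \<Longrightarrow> cosh t ^ ?d * (1 + \<bar>t\<bar>) ^ m *
          cmod (\<phi> ((k ** a_elt t) <#\<^bsub>SL\<^esub> H_grp)) \<le> C"
    unfolding bdd_above_def by (auto simp: image_def)
  show ?thesis
  \<comment> \<open>The power of \<open>sqrt 2\<close> comes from cosh (2 t) \<le> 2 (cosh t)^2, the
    power of 2 from 1 + ln (cosh (2 t)) \<le> 2 (1 + |t|).\<close>
  proof (rule that[of "sqrt 2 ^ ?d * 2 ^ m * C"])
    fix g :: "'n sqmat" assume g: "g \<in> carrier SL"
    then obtain k t where k: "k \<in> SO" "g <#\<^bsub>SL\<^esub> H_grp = (k ** a_elt t) <#\<^bsub>SL\<^esub> H_grp"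
      "norm (proj g) = cosh (2 * t)" using KAK[OF n g] by blast
    have p1: "norm (proj g) \<ge> 1" by (simp add: k(3) cosh_real_ge_1)
    have "norm (proj g) \<le> 2 * (cosh t)\<^sup>2" by (simp add: k(3) cosh_double_cosh)
    then have "sqrt (norm (proj g)) \<le> sqrt (2 * (cosh t)\<^sup>2)" by (rule real_sqrt_le_mono)
    also have "\<dots> = sqrt 2 * cosh t" by (simp add: real_sqrt_mult)
    finally have s: "sqrt (norm (proj g)) ^ ?d \<le> sqrt 2 ^ ?d * cosh t ^ ?d"
      unfolding power_mult_distrib[symmetric] by (intro power_mono) simp_all
    have "norm (proj g) \<le> exp (2 * \<bar>t\<bar>)"
    proof -
      have "exp (2 * t) \<le> exp (2 * \<bar>t\<bar>)" "exp (- (2 * t)) \<le> exp (2 * \<bar>t\<bar>)" by simp_all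
      moreover have "x \<le> z \<Longrightarrow> y \<le> z \<Longrightarrow> (x + y) / 2 \<le> z" for x y z :: real by simp
      ultimately show ?thesis unfolding k(3) cosh_field_def by blast
    qed
    then have "ln (norm (proj g)) \<le> 2 * \<bar>t\<bar>" using p1 by (metis exp_gt_zero ln_exp ln_mono less_le_trans zero_less_one)
    then have "(1 + ln (norm (proj g))) ^ m \<le> (2 * (1 + \<bar>t\<bar>)) ^ m"
      using p1 by (intro power_mono) (auto intro: add_nonneg_nonneg)
    then have l: "(1 + ln (norm (proj g))) ^ m \<le> 2 ^ m * (1 + \<bar>t\<bar>) ^ m" unfolding power_mult_distrib .
    have "cmod (\<phi> (g <#\<^bsub>SL\<^esub> H_grp)) * sqrt (norm (proj g)) ^ ?d * (1 + ln (norm (proj g))) ^ m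
      \<le> cmod (\<phi> (g <#\<^bsub>SL\<^esub> H_grp)) * (sqrt 2 ^ ?d * cosh t ^ ?d) * (2 ^ m * (1 + \<bar>t\<bar>) ^ m)"
      using p1 s l by (intro mult_mono) (auto intro!: mult_nonneg_nonneg add_nonneg_nonneg)
    also have "\<dots> = sqrt 2 ^ ?d * 2 ^ m * (cosh t ^ ?d * (1 + \<bar>t\<bar>) ^ m * cmod (\<phi> ((k ** a_elt t) <#\<^bsub>SL\<^esub> H_grp)))"
      by (simp add: k(2) mult_ac)
    also have "\<dots> \<le> sqrt 2 ^ ?d * 2 ^ m * C" by (intro mult_left_mono C k) simp
    finally show "norm (proj g) \<ge> 1 \<and>
      cmod (\<phi> (g <#\<^bsub>SL\<^esub> H_grp)) * sqrt (norm (proj g)) ^ ?d * (1 + ln (norm (proj g))) ^ m \<le> sqrt 2 ^ ?d * 2 ^ m * C"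
      using p1 by simp
  qed
qed

section \<open>Powers of the norm as Schwartz functions\<close>

inductive poly_fun :: "(('n::finite) sqmat \<Rightarrow> real) \<Rightarrow> bool" where
  const: "poly_fun (\<lambda>_. c)"
| coord: "poly_fun (\<lambda>x. x $ i $ j)"
| add: "poly_fun f \<Longrightarrow> poly_fun g \<Longrightarrow> poly_fun (\<lambda>x. f x + g x)"
| mult: "poly_fun f \<Longrightarrow> poly_fun g \<Longrightarrow> poly_fun (\<lambda>x. f x * g x)"

text \<open>A class closed under directional derivatives wherever \<open>Q\<close> is positive, so
  that smoothness follows by induction on the order.\<close>

inductive powr_fun :: "(('n::finite) sqmat \<Rightarrow> real) \<Rightarrow> ('n sqmat \<Rightarrow> real) \<Rightarrow> bool" for Q where
  poly: "poly_fun f \<Longrightarrow> powr_fun Q f"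
| powr: "powr_fun Q (\<lambda>x. Q x powr r)"
| add: "powr_fun Q f \<Longrightarrow> powr_fun Q g \<Longrightarrow> powr_fun Q (\<lambda>x. f x + g x)"
| mult: "powr_fun Q f \<Longrightarrow> powr_fun Q g \<Longrightarrow> powr_fun Q (\<lambda>x. f x * g x)"

lemma poly_fun_sum: "finite A \<Longrightarrow> (\<And>a. a \<in> A \<Longrightarrow> poly_fun (f a)) \<Longrightarrow> poly_fun (\<lambda>x. \<Sum>a\<in>A. f a x)"
  by (induction A rule: finite_induct) (auto intro: poly_fun.intros)

lemma poly_fun_prod: "finite A \<Longrightarrow> (\<And>a. a \<in> A \<Longrightarrow> poly_fun (f a)) \<Longrightarrow> poly_fun (\<lambda>x. \<Prod>a\<in>A. f a x)"
  by (induction A rule: finite_induct) (auto intro: poly_fun.intros)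

lemma poly_fun_det: "(\<And>i j. poly_fun (\<lambda>x. M x $ i $ j)) \<Longrightarrow> poly_fun (\<lambda>x. det (M x))"
  unfolding det_def
  by (intro poly_fun_sum poly_fun.mult poly_fun.const poly_fun_prod finite_permutations) auto

lemma poly_fun_derivative:
  assumes "poly_fun f"
  obtains D where "\<And>x. (f has_derivative D x) (at x)" "\<And>v. poly_fun (\<lambda>x. D x v)"
proof -
  from assms have "\<exists>D. (\<forall>x. (f has_derivative D x) (at x)) \<and> (\<forall>v. poly_fun (\<lambda>x. D x v))"
  proof induction
    case (const c)
    then show ?case by (intro exI[of _ "\<lambda>x v. 0"]) (auto intro: poly_fun.const)
  next
    case (coord i j)
    have "bounded_linear (\<lambda>x :: 'a sqmat. x $ i $ j)"
      by (intro bounded_linear_compose[OF bounded_linear_vec_nth bounded_linear_vec_nth])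
    then show ?case
      by (intro exI[of _ "\<lambda>x v. v $ i $ j"]) (auto intro: poly_fun.const bounded_linear_imp_has_derivative)
  next
    case (add f g)
    then obtain D E where "\<forall>x. (f has_derivative D x) (at x)" "\<forall>v. poly_fun (\<lambda>x. D x v)"
      "\<forall>x. (g has_derivative E x) (at x)" "\<forall>v. poly_fun (\<lambda>x. E x v)" by blast
    then show ?case
      by (intro exI[of _ "\<lambda>x v. D x v + E x v"]) (auto intro: poly_fun.add has_derivative_add)
  next
    case (mult f g)
    then obtain D E where "\<forall>x. (f has_derivative D x) (at x)" "\<forall>v. poly_fun (\<lambda>x. D x v)"
      "\<forall>x. (g has_derivative E x) (at x)" "\<forall>v. poly_fun (\<lambda>x. E x v)" by blast
    then show ?case using mult
      by (intro exI[of _ "\<lambda>x v. f x * E x v + D x v * g x"])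
        (auto intro!: poly_fun.add poly_fun.mult has_derivative_mult)
  qed
  then show ?thesis using that by blast
qed

lemma powr_fun_derivative:
  assumes Q: "poly_fun Q" and f: "powr_fun Q f"
  obtains D where "\<And>x. Q x > 0 \<Longrightarrow> (f has_derivative D x) (at x)" "\<And>v. powr_fun Q (\<lambda>x. D x v)"
proof -
  from f have "\<exists>D. (\<forall>x. Q x > 0 \<longrightarrow> (f has_derivative D x) (at x)) \<and> (\<forall>v. powr_fun Q (\<lambda>x. D x v))"
  proof induction
    case (poly f)
    then obtain D where "\<And>x. (f has_derivative D x) (at x)" "\<And>v. poly_fun (\<lambda>x. D x v)"
      by (rule poly_fun_derivative) blast
    then show ?case by (intro exI[of _ D]) (auto intro: powr_fun.poly)
  next
    case (powr r)
    obtain D where D: "\<And>x. (Q has_derivative D x) (at x)" "\<And>v. poly_fun (\<lambda>x. D x v)"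
      using poly_fun_derivative[OF Q] by blast
    have "((\<lambda>x. Q x powr r) has_derivative (\<lambda>v. r * Q x powr (r - 1) * D x v)) (at x)" if "Q x > 0" for x
    proof -
      have "((\<lambda>x. Q x powr r) has_derivative (\<lambda>v. Q x powr r * (0 * ln (Q x) + D x v * r / Q x))) (at x)"
        by (rule has_derivative_powr[OF D(1) has_derivative_const that]) simp
      moreover have "Q x powr (r - 1) = Q x powr r / Q x" using that by (simp add: powr_diff)
      ultimately show ?thesis by (simp add: mult_ac)
    qed
    then show ?case
      by (intro exI[of _ "\<lambda>x v. r * Q x powr (r - 1) * D x v"])
        (auto intro!: powr_fun.mult powr_fun.powr intro: powr_fun.poly poly_fun.const D)
  next
    case (add f g)
    then obtain D E where "\<forall>x. Q x > 0 \<longrightarrow> (f has_derivative D x) (at x)" "\<forall>v. powr_fun Q (\<lambda>x. D x v)"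
      "\<forall>x. Q x > 0 \<longrightarrow> (g has_derivative E x) (at x)" "\<forall>v. powr_fun Q (\<lambda>x. E x v)" by blast
    then show ?case
      by (intro exI[of _ "\<lambda>x v. D x v + E x v"]) (auto intro: powr_fun.add has_derivative_add)
  next
    case (mult f g)
    then obtain D E where "\<forall>x. Q x > 0 \<longrightarrow> (f has_derivative D x) (at x)" "\<forall>v. powr_fun Q (\<lambda>x. D x v)"
      "\<forall>x. Q x > 0 \<longrightarrow> (g has_derivative E x) (at x)" "\<forall>v. powr_fun Q (\<lambda>x. E x v)" by blast
    then show ?case using mult
      by (intro exI[of _ "\<lambda>x v. f x * E x v + D x v * g x"])
        (auto intro!: powr_fun.add powr_fun.mult has_derivative_mult)
  qed
  then show ?thesis using that by blast
qed

text \<open>\<open>C_k_on\<close> differentiates total functions; on an open set equal values give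
  equal derivatives, which allows a derivative to be replaced by its formula.\<close>

lemma C_k_on_cong:
  "open U \<Longrightarrow> (\<And>x. x \<in> U \<Longrightarrow> f x = g x) \<Longrightarrow> C_k_on k f U \<Longrightarrow> C_k_on k g U"
proof (induction k arbitrary: f g)
  case 0
  then show ?case using continuous_on_cong by fastforce
next
  case (Suc k)
  have d: "(g has_derivative frechet_derivative f (at x)) (at x)" if x: "x \<in> U" for x
  proof -
    have "(f has_derivative frechet_derivative f (at x)) (at x)"
      using Suc.prems(3) x frechet_derivative_works by auto
    then show ?thesis using has_derivative_transform_within_open[OF _ Suc.prems(1) x] Suc.prems(2) by blast
  qed
  have "C_k_on k (\<lambda>x. frechet_derivative g (at x) v) U" for v
  proof (rule Suc.IH[OF Suc.prems(1)])
    show "C_k_on k (\<lambda>x. frechet_derivative f (at x) v) U" using Suc.prems(3) by simp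
    show "frechet_derivative f (at x) v = frechet_derivative g (at x) v" if "x \<in> U" for x
      using frechet_derivative_at[OF d[OF that]] by simp
  qed
  then show ?case using d by (auto simp: differentiable_def)
qed

lemma powr_fun_C_k_on:
  assumes Q: "poly_fun Q" and U: "open U" "\<And>x. x \<in> U \<Longrightarrow> Q x > 0"
  shows "powr_fun Q f \<Longrightarrow> C_k_on k (\<lambda>x. complex_of_real (f x)) U"
proof (induction k arbitrary: f)
  case 0
  obtain D where "\<And>x. Q x > 0 \<Longrightarrow> (f has_derivative D x) (at x)" using powr_fun_derivative[OF Q 0] by blast
  then have "continuous (at x) f" if "x \<in> U" for x using U(2)[OF that] has_derivative_continuous by blast
  then have "continuous_on U f" by (simp add: continuous_at_imp_continuous_on)
  then show ?case by (simp add: continuous_on_of_real)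
next
  case (Suc k)
  obtain D where D: "\<And>x. Q x > 0 \<Longrightarrow> (f has_derivative D x) (at x)" "\<And>v. powr_fun Q (\<lambda>x. D x v)"
    using powr_fun_derivative[OF Q Suc.prems] by blast
  have d: "((\<lambda>x. complex_of_real (f x)) has_derivative (\<lambda>v. complex_of_real (D x v))) (at x)" if "x \<in> U" for x
    using D(1)[OF U(2)[OF that]] by (rule has_derivative_of_real)
  have "C_k_on k (\<lambda>x. frechet_derivative (\<lambda>x. complex_of_real (f x)) (at x) v) U" for v
  proof (rule C_k_on_cong[OF U(1)])
    show "C_k_on k (\<lambda>x. complex_of_real (D x v)) U" using Suc.IH D(2) by blast
    show "complex_of_real (D x v) = frechet_derivative (\<lambda>x. complex_of_real (f x)) (at x) v" if "x \<in> U" for x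
      using frechet_derivative_at[OF d[OF that]] by metis
  qed
  then show ?case using d by (auto simp: differentiable_def)
qed

section \<open>Powers of the norm and their derivatives\<close>

definition bump :: "real \<Rightarrow> ('n::{finite,linorder}) sqmat set \<Rightarrow> complex"
  where "bump s c = complex_of_real (norm (coset_proj c) powr (- s))"

lemma proj_norm_pos:
  assumes n: "CARD('n::{finite,linorder}) \<ge> 2" and g: "invertible (g :: 'n sqmat)"
  shows "norm (proj g) > 0" "proj g \<noteq> 0"
proof -
  have "(wvec v* matrix_inv g) \<bullet> (g *v wvec) = 2"
    using g by (simp add: inner_vec_mat matrix_inv_mult_vec wvec_inner[OF n])
  then have "norm (wvec v* matrix_inv g) \<noteq> 0" "norm (g *v wvec) \<noteq> 0" by auto
  then have "norm (proj g) \<noteq> 0" by (simp add: proj_def norm_outer)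
  then show "norm (proj g) > 0" "proj g \<noteq> 0" by auto
qed

text \<open>The adjugate by Cramer's rule: polynomial in the entries on all matrices and equal to
  the inverse when the determinant is 1.\<close>

definition cofactor :: "('n::finite) sqmat \<Rightarrow> 'n sqmat"
  where "cofactor g = (\<chi> k l. det (\<chi> i j. if j = k then axis l 1 $ i else g $ i $ j))"

lemma cofactor_SL:
  assumes "det g = 1" shows "cofactor g = matrix_inv g"
proof -
  have "column l (matrix_inv g) = (\<chi> k. cofactor g $ k $ l)" for l
  proof -
    have "g *v column l (matrix_inv g) = axis l 1"
      using assms by (simp add: matrix_inv_mult_vec invertible_det_nz flip: matrix_vector_mult_basis)
    then show ?thesis using assms by (subst (asm) cramer) (auto simp: cofactor_def)
  qed
  then show ?thesis by (auto simp: vec_eq_iff column_def)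
qed

text \<open>Replacing the inverse by the adjugate extends the squared norm of the idempotent to a
  polynomial \<open>Q\<close> on the matrix space; \<open>Q\<close> is positive on an open
  neighbourhood of the group.\<close>

lemma smooth_bump:
  assumes n: "CARD('n::{finite,linorder}) \<ge> 2"
  shows "smooth_on_X (bump s :: 'n sqmat set \<Rightarrow> complex)"
  unfolding smooth_on_X_def smooth_on_SL_def
proof
  fix g :: "'n sqmat" assume g: "g \<in> carrier SL"
  define G where "G x = (1 / 2) *\<^sub>R outer (x *v wvec) (wvec v* cofactor x)" for x :: "'n sqmat"
  define Q where "Q x = G x \<bullet> G x" for x
  have cof: "poly_fun (\<lambda>x. cofactor x $ k $ l)" for k l :: 'n
  proof -
    have "poly_fun (\<lambda>x. (\<chi> i j. if j = k then axis l 1 $ i else x $ i $ j) $ i $ j)" for i j :: 'n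
      by (cases "j = k") (auto intro: poly_fun.const poly_fun.coord)
    then show ?thesis by (simp add: cofactor_def poly_fun_det)
  qed
  have "poly_fun (\<lambda>x. G x $ k $ l)" for k l
    unfolding G_def outer_def mat_vec_component vec_mat_component vector_scaleR_component vec_lambda_beta real_scaleR_def
    by (intro poly_fun.mult poly_fun_sum poly_fun.const poly_fun.coord cof) auto
  then have Q: "poly_fun Q"
    unfolding Q_def inner_matrix by (intro poly_fun.mult poly_fun_sum) auto
  define U where "U = {x. Q x > 0}"
  have cQ: "continuous_on UNIV Q"
  proof -
    obtain D where D: "\<And>x. (Q has_derivative D x) (at x)" "\<And>v. poly_fun (\<lambda>x. D x v)"
      using poly_fun_derivative[OF Q] by blast
    from D(1) have "continuous (at x) Q" for x by (rule has_derivative_continuous)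
    then show ?thesis by (simp add: continuous_at_imp_continuous_on)
  qed
  have U: "open U" unfolding U_def by (intro open_Collect_less continuous_on_const cQ)
  have GQ: "Q x = (norm (proj x))\<^sup>2" if "x \<in> carrier SL" for x
  proof -
    have "G x = proj x" using that by (simp add: G_def proj_def cofactor_SL SL_simps)
    then show ?thesis by (simp add: Q_def power2_norm_eq_inner)
  qed
  show "\<exists>U F. open U \<and> g \<in> U \<and> (\<forall>k. C_k_on k F U) \<and>
    (\<forall>x\<in>U \<inter> carrier SL. F x = bump s (x <#\<^bsub>SL\<^esub> H_grp))"
  proof (intro exI conjI allI ballI)
    show "open U" by (rule U)
    show "g \<in> U" using GQ[OF g] proj_norm_pos(1)[OF n SL_invertible[OF g]] by (simp add: U_def)
    \<comment> \<open>The exponent is halved because \<open>Q\<close> is the square of the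
      norm.\<close>
    show "C_k_on k (\<lambda>x. complex_of_real (Q x powr (- s / 2))) U" for k
      by (intro powr_fun_C_k_on[OF Q U] powr_fun.powr) (simp add: U_def)
    fix x assume x: "x \<in> U \<inter> carrier SL"
    have "Q x powr (- s / 2) = norm (proj x) powr (- s)"
    proof -
      have p: "norm (proj x) > 0" using proj_norm_pos(1)[OF n] x SL_invertible by blast
      then have "Q x powr (- s / 2) = (norm (proj x) powr 2) powr (- s / 2)" using x by (simp add: GQ)
      then show ?thesis unfolding powr_powr by simp
    qed
    then show "complex_of_real (Q x powr (- s / 2)) = bump s (x <#\<^bsub>SL\<^esub> H_grp)"
      using x by (simp add: bump_def coset_proj_coset[OF n] SL_invertible)
  qed
qed

text \<open>Polynomials in the normalised entries of the idempotent. They are bounded and stable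
  under differentiation along conjugation, so derivatives of a power of the norm decay no worse than
  the power itself.\<close>

inductive bdd_fun :: "(('n::finite) sqmat \<Rightarrow> complex) \<Rightarrow> bool" where
  const: "bdd_fun (\<lambda>_. c)"
| coord: "bdd_fun (\<lambda>q. complex_of_real (q $ i $ j / norm q))"
| add: "bdd_fun f \<Longrightarrow> bdd_fun g \<Longrightarrow> bdd_fun (\<lambda>q. f q + g q)"
| mult: "bdd_fun f \<Longrightarrow> bdd_fun g \<Longrightarrow> bdd_fun (\<lambda>q. f q * g q)"

text \<open>An entry is at most the norm; at the zero matrix the quotient is 0 by convention, so no
  exception arises.\<close>

lemma bdd_fun_bounded: "bdd_fun f \<Longrightarrow> \<exists>B\<ge>0. \<forall>q. cmod (f q) \<le> B"
proof (induction rule: bdd_fun.induct)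
  case (const c)
  then show ?case by (intro exI[of _ "cmod c"]) auto
next
  case (coord i j)
  have "\<bar>q $ i $ j / norm q\<bar> \<le> 1" for q :: "'a sqmat"
  proof -
    have "\<bar>q $ i $ j\<bar> \<le> norm (q $ i)" by (rule component_le_norm_cart)
    also have "\<dots> \<le> norm q" by (rule Finite_Cartesian_Product.norm_nth_le)
    finally show ?thesis by (simp add: divide_le_eq_1)
  qed
  then show ?case by (intro exI[of _ 1]) (simp only: norm_of_real, simp)
next
  case (add f g)
  then obtain A B where "A \<ge> 0" "B \<ge> 0" "\<forall>q. cmod (f q) \<le> A" "\<forall>q. cmod (g q) \<le> B" by blast
  then show ?case by (intro exI[of _ "A + B"]) (auto intro: norm_triangle_mono)
next
  case (mult f g)
  then obtain A B where "A \<ge> 0" "B \<ge> 0" "\<forall>q. cmod (f q) \<le> A" "\<forall>q. cmod (g q) \<le> B" by blast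
  then show ?case by (intro exI[of _ "A * B"]) (auto simp: norm_mult intro: mult_mono)
qed

lemma bdd_fun_sum: "finite A \<Longrightarrow> (\<And>a. a \<in> A \<Longrightarrow> bdd_fun (f a)) \<Longrightarrow> bdd_fun (\<lambda>x. \<Sum>a\<in>A. f a x)"
  by (induction A rule: finite_induct) (auto intro: bdd_fun.intros)

lemma bdd_fun_bracket:
  "bdd_fun (\<lambda>q. complex_of_real ((q ** X - X ** q) $ i $ j / norm q))"
proof -
  have "(\<lambda>q. complex_of_real ((q ** X - X ** q) $ i $ j / norm q)) =
    (\<lambda>q. (\<Sum>k\<in>UNIV. complex_of_real (q $ i $ k / norm q) * complex_of_real (X $ k $ j)) +
       (\<Sum>k\<in>UNIV. complex_of_real (- X $ i $ k) * complex_of_real (q $ k $ j / norm q)))"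
    by (rule ext) (simp add: mat_mul_component diff_divide_distrib sum_divide_distrib sum_negf)
  then show ?thesis by (simp only:) (intro bdd_fun.add bdd_fun_sum bdd_fun.mult bdd_fun.const bdd_fun.coord finite)
qed

lemma bdd_fun_radial:
  "bdd_fun (\<lambda>q. complex_of_real ((q \<bullet> (q ** X - X ** q)) / (norm q)\<^sup>2))"
proof -
  have "(\<lambda>q. complex_of_real ((q \<bullet> (q ** X - X ** q)) / (norm q)\<^sup>2)) =
    (\<lambda>q. \<Sum>i\<in>UNIV. \<Sum>j\<in>UNIV. complex_of_real (q $ i $ j / norm q) * complex_of_real ((q ** X - X ** q) $ i $ j / norm q))"
    by (rule ext) (simp add: inner_matrix sum_divide_distrib power2_eq_square)
  then show ?thesis by (simp only:) (intro bdd_fun_sum bdd_fun.mult bdd_fun_bracket bdd_fun.coord finite)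
qed

lemma norm_curve_derivative:
  fixes \<gamma> :: "real \<Rightarrow> 'n::finite sqmat"
  assumes "(\<gamma> has_vector_derivative d) (at 0)" "\<gamma> 0 = q" "q \<noteq> 0"
  shows "((\<lambda>t. norm (\<gamma> t)) has_real_derivative (q \<bullet> d) / norm q) (at 0)"
proof -
  have "((\<lambda>t. norm (\<gamma> t)) has_derivative (\<lambda>h. (h *\<^sub>R d) \<bullet> sgn (\<gamma> 0))) (at 0)"
    using assms(1) unfolding has_vector_derivative_def
    by (rule has_derivative_compose) (use assms in \<open>simp add: has_derivative_norm\<close>)
  then show ?thesis
    unfolding has_field_derivative_def
    by (rule has_derivative_eq_rhs) (simp add: fun_eq_iff assms sgn_div_norm inner_commute divide_inverse)
qed

text \<open>The derivative depends on the point alone, not on the curve, because the velocity is the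
  linear expression \<open>q ** X - X ** q\<close>; this allows iteration.\<close>

lemma bdd_fun_curve:
  fixes X :: "'n::finite sqmat"
  shows "bdd_fun e \<Longrightarrow> \<exists>e'. bdd_fun e' \<and> (\<forall>\<gamma> q. \<gamma> 0 = q \<longrightarrow> q \<noteq> 0 \<longrightarrow>
    (\<gamma> has_vector_derivative (q ** X - X ** q)) (at 0) \<longrightarrow> ((\<lambda>t. e (\<gamma> t)) has_vector_derivative e' q) (at 0))"
proof (induction rule: bdd_fun.induct)
  case (const c)
  then show ?case by (intro exI[of _ "\<lambda>q. 0"]) (auto intro: bdd_fun.const)
next
  case (coord i j)
  let ?e = "\<lambda>q. complex_of_real ((q ** X - X ** q) $ i $ j / norm q) +
    complex_of_real (- 1) * (complex_of_real (q $ i $ j / norm q) * complex_of_real ((q \<bullet> (q ** X - X ** q)) / (norm q)\<^sup>2))"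
  show ?case
  proof (intro exI[of _ ?e] conjI allI impI)
    show "bdd_fun ?e"
      by (intro bdd_fun.add bdd_fun.mult bdd_fun_bracket bdd_fun_radial bdd_fun.coord bdd_fun.const)
    fix \<gamma> :: "real \<Rightarrow> 'n sqmat" and q
    assume \<gamma>: "\<gamma> 0 = q" "q \<noteq> 0" "(\<gamma> has_vector_derivative (q ** X - X ** q)) (at 0)"
    have "bounded_linear (\<lambda>x :: 'n sqmat. x $ i $ j)"
      by (intro bounded_linear_compose[OF bounded_linear_vec_nth bounded_linear_vec_nth])
    from bounded_linear.has_vector_derivative[OF this \<gamma>(3)]
    have 1: "((\<lambda>t. \<gamma> t $ i $ j) has_real_derivative (q ** X - X ** q) $ i $ j) (at 0)"
      by (simp add: has_real_derivative_iff_has_vector_derivative)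
    have 2: "((\<lambda>t. norm (\<gamma> t)) has_real_derivative (q \<bullet> (q ** X - X ** q)) / norm q) (at 0)"
      by (rule norm_curve_derivative[OF \<gamma>(3,1,2)])
    have "((\<lambda>t. \<gamma> t $ i $ j / norm (\<gamma> t)) has_real_derivative
        (((q ** X - X ** q) $ i $ j * norm (\<gamma> 0) - \<gamma> 0 $ i $ j * ((q \<bullet> (q ** X - X ** q)) / norm q)) / (norm (\<gamma> 0) * norm (\<gamma> 0)))) (at 0)"
      by (rule DERIV_divide[OF 1 2]) (use \<gamma> in simp)
    moreover have "(((q ** X - X ** q) $ i $ j * norm (\<gamma> 0) - \<gamma> 0 $ i $ j * ((q \<bullet> (q ** X - X ** q)) / norm q)) / (norm (\<gamma> 0) * norm (\<gamma> 0)))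
       = (q ** X - X ** q) $ i $ j / norm q + (- 1) * (q $ i $ j / norm q * ((q \<bullet> (q ** X - X ** q)) / (norm q)\<^sup>2))"
      using \<gamma>(2) unfolding \<gamma>(1) by (simp add: field_simps power2_eq_square)
    ultimately have "((\<lambda>t. \<gamma> t $ i $ j / norm (\<gamma> t)) has_real_derivative
        (q ** X - X ** q) $ i $ j / norm q + (- 1) * (q $ i $ j / norm q * ((q \<bullet> (q ** X - X ** q)) / (norm q)\<^sup>2))) (at 0)"
      by (simp only:)
    from has_vector_derivative_of_real[OF this, where 'a = complex]
    show "((\<lambda>t. complex_of_real (\<gamma> t $ i $ j / norm (\<gamma> t))) has_vector_derivative ?e q) (at 0)"
      by (simp only: of_real_add of_real_mult)
  qed
next
  case (add f g)
  then obtain D E where D: "bdd_fun D" "\<forall>\<gamma> q. \<gamma> 0 = q \<longrightarrow> q \<noteq> 0 \<longrightarrow>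
    (\<gamma> has_vector_derivative (q ** X - X ** q)) (at 0) \<longrightarrow> ((\<lambda>t. f (\<gamma> t)) has_vector_derivative D q) (at 0)"
    and E: "bdd_fun E" "\<forall>\<gamma> q. \<gamma> 0 = q \<longrightarrow> q \<noteq> 0 \<longrightarrow>
    (\<gamma> has_vector_derivative (q ** X - X ** q)) (at 0) \<longrightarrow> ((\<lambda>t. g (\<gamma> t)) has_vector_derivative E q) (at 0)" by blast
  show ?case
  proof (intro exI[of _ "\<lambda>q. D q + E q"] conjI allI impI)
    fix \<gamma> :: "real \<Rightarrow> 'n sqmat" and q
    assume \<gamma>: "\<gamma> 0 = q" "q \<noteq> 0" "(\<gamma> has_vector_derivative (q ** X - X ** q)) (at 0)"
    show "((\<lambda>t. f (\<gamma> t) + g (\<gamma> t)) has_vector_derivative D q + E q) (at 0)"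
      by (intro has_vector_derivative_add D(2)[rule_format] E(2)[rule_format] \<gamma>)
  qed (intro bdd_fun.add D E)
next
  case (mult f g)
  then obtain D E where D: "bdd_fun D" "\<forall>\<gamma> q. \<gamma> 0 = q \<longrightarrow> q \<noteq> 0 \<longrightarrow>
    (\<gamma> has_vector_derivative (q ** X - X ** q)) (at 0) \<longrightarrow> ((\<lambda>t. f (\<gamma> t)) has_vector_derivative D q) (at 0)"
    and E: "bdd_fun E" "\<forall>\<gamma> q. \<gamma> 0 = q \<longrightarrow> q \<noteq> 0 \<longrightarrow>
    (\<gamma> has_vector_derivative (q ** X - X ** q)) (at 0) \<longrightarrow> ((\<lambda>t. g (\<gamma> t)) has_vector_derivative E q) (at 0)" by blast
  show ?case
  proof (intro exI[of _ "\<lambda>q. f q * E q + D q * g q"] conjI allI impI)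
    fix \<gamma> :: "real \<Rightarrow> 'n sqmat" and q
    assume \<gamma>: "\<gamma> 0 = q" "q \<noteq> 0" "(\<gamma> has_vector_derivative (q ** X - X ** q)) (at 0)"
    have "((\<lambda>t. f (\<gamma> t) * g (\<gamma> t)) has_vector_derivative f (\<gamma> 0) * E q + D q * g (\<gamma> 0)) (at 0)"
      by (intro has_vector_derivative_mult D(2)[rule_format] E(2)[rule_format] \<gamma>)
    then show "((\<lambda>t. f (\<gamma> t) * g (\<gamma> t)) has_vector_derivative f q * E q + D q * g q) (at 0)"
      by (simp add: \<gamma>)
  qed (intro bdd_fun.add bdd_fun.mult D E mult)
qed

lemma bounded_bilinear_matrix_mult: "bounded_bilinear ((**) :: 'n::finite sqmat \<Rightarrow> 'n sqmat \<Rightarrow> 'n sqmat)"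
  unfolding bilinear_conv_bounded_bilinear[symmetric] bilinear_def
  by (auto intro!: linearI simp: matrix_add_distribs matrix_scaleR_left matrix_scaleR_right)

text \<open>Left translation by the exponential of \<open>- t X\<close> conjugates the idempotent,
  and this is the velocity of that motion.\<close>

lemma curve_derivative:
  fixes X q :: "'n::finite sqmat"
  shows "((\<lambda>t. mat_exp (- t *\<^sub>R X) ** q ** matrix_inv (mat_exp (- t *\<^sub>R X))) has_vector_derivative (q ** X - X ** q)) (at 0)"
proof -
  have E: "((\<lambda>t. mat_exp (- t *\<^sub>R X)) has_vector_derivative - X) (at 0)"
    using mat_exp_has_vector_derivative[of "- X"] by simp
  have I: "((\<lambda>t. matrix_inv (mat_exp (- t *\<^sub>R X))) has_vector_derivative X) (at 0)"
    using mat_exp_inv_has_vector_derivative(1)[of "- X"] by simp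
  note mm = bounded_bilinear.has_vector_derivative[OF bounded_bilinear_matrix_mult]
  from mm[OF mm[OF E has_vector_derivative_const[of q]] I]
  show ?thesis
    by (rule back_subst[of "\<lambda>d. (_ has_vector_derivative d) _"])
      (simp add: mat_exp_zero matrix_inv_one matrix_add_distribs vec_eq_iff mat_mul_component sum_negf)
qed

text \<open>Every left invariant operation multiplies the power by a bounded function: the
  derivative of the power contributes the radial factor, that of the bounded factor stays in the
  class.\<close>

lemma U_action_bump:
  fixes s :: real and u :: "(('n::{finite,linorder}) sqmat set \<Rightarrow> complex) \<Rightarrow> 'n sqmat set \<Rightarrow> complex"
  assumes n: "CARD('n) \<ge> 2"
  shows "u \<in> U_action \<Longrightarrow> \<exists>e. bdd_fun e \<and> (\<forall>g. invertible g \<longrightarrow>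
    u (bump s) (g <#\<^bsub>SL\<^esub> H_grp) = complex_of_real (norm (proj g) powr (- s)) * e (proj g))"
proof (induction rule: U_action.induct)
  case one
  show ?case
    by (intro exI[of _ "\<lambda>_. 1"]) (auto simp: bump_def coset_proj_coset[OF n] intro: bdd_fun.const)
next
  case (mult X u)
  then obtain e where e: "bdd_fun e" "\<And>g. invertible g \<Longrightarrow>
    u (bump s) (g <#\<^bsub>SL\<^esub> H_grp) = complex_of_real (norm (proj g) powr (- s)) * e (proj g)" by blast
  obtain e' where e': "bdd_fun e'" "\<And>\<gamma> q. \<gamma> 0 = q \<Longrightarrow> q \<noteq> 0 \<Longrightarrow>
    (\<gamma> has_vector_derivative (q ** X - X ** q)) (at 0) \<Longrightarrow> ((\<lambda>t. e (\<gamma> t)) has_vector_derivative e' q) (at 0)"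
    using bdd_fun_curve[OF e(1), of X] by blast
  let ?r = "\<lambda>q. complex_of_real ((q \<bullet> (q ** X - X ** q)) / (norm q)\<^sup>2)"
  let ?e = "\<lambda>q. e' q + complex_of_real (- s) * ?r q * e q"
  show ?case
  proof (intro exI[of _ ?e] conjI allI impI)
    show "bdd_fun ?e"
      by (intro bdd_fun.add bdd_fun.mult bdd_fun_radial bdd_fun.const e e')
    fix g :: "'n sqmat" assume g: "invertible g"
    define q where "q = proj g"
    have q0: "q \<noteq> 0" "norm q > 0" using proj_norm_pos[OF n g] by (simp_all add: q_def)
    define E where "E t = mat_exp (- t *\<^sub>R X)" for t :: real
    define \<gamma> where "\<gamma> t = E t ** q ** matrix_inv (E t)" for t
    have \<gamma>: "(\<gamma> has_vector_derivative (q ** X - X ** q)) (at 0)"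
      using curve_derivative[of X q] unfolding \<gamma>_def E_def .
    have \<gamma>0: "\<gamma> 0 = q" by (simp add: \<gamma>_def E_def mat_exp_zero matrix_inv_one)
    have "\<forall>\<^sub>F t in at 0. invertible (E t)"
      using mat_exp_inv_has_vector_derivative(2)[of "- X"] by (simp add: E_def)
    then have ev0: "\<forall>\<^sub>F t in nhds 0. t \<noteq> 0 \<longrightarrow> t \<in> UNIV \<longrightarrow> invertible (E t)"
      by (simp only: eventually_at_filter)
    have "invertible (E 0)" by (simp add: E_def mat_exp_zero invertible_det_nz)
    then have inv: "\<forall>\<^sub>F t in nhds 0. invertible (E t)"
      by (intro eventually_mono[OF ev0]) (metis UNIV_I)
    \<comment> \<open>The formula for \<open>u\<close> covers invertible translates only;
      \<open>E t\<close> is invertible for \<open>t\<close> near 0, which is all that a derivative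
      at 0 sees.\<close>
    have ev: "\<forall>\<^sub>F t in nhds 0. t \<in> UNIV \<longrightarrow> u (bump s) (E t <#\<^bsub>SL\<^esub> (g <#\<^bsub>SL\<^esub> H_grp)) =
        complex_of_real (norm (\<gamma> t) powr (- s)) * e (\<gamma> t)"
      using inv
    proof eventually_elim
      case (elim t)
      then show ?case
        by (simp add: l_coset_SL_assoc e(2) invertible_mult g proj_mult \<gamma>_def q_def)
    qed
    have nd: "((\<lambda>t. norm (\<gamma> t)) has_real_derivative (q \<bullet> (q ** X - X ** q)) / norm q) (at 0)"
      by (rule norm_curve_derivative[OF \<gamma> \<gamma>0 q0(1)])
    have "((\<lambda>t. norm (\<gamma> t) powr (- s)) has_real_derivative
        (- s) * norm (\<gamma> 0) powr (- s - 1) * ((q \<bullet> (q ** X - X ** q)) / norm q)) (at 0)"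
      using q0 \<gamma>0 DERIV_fun_powr[OF nd, of "- s"] by simp
    moreover have "norm q powr (- s - 1) = norm q powr (- s) / norm q" using q0 by (simp add: powr_diff)
    ultimately have "((\<lambda>t. norm (\<gamma> t) powr (- s)) has_real_derivative
        norm q powr (- s) * (- s * ((q \<bullet> (q ** X - X ** q)) / (norm q)\<^sup>2))) (at 0)"
      unfolding \<gamma>0 by (simp add: power2_eq_square mult_ac)
    from has_vector_derivative_of_real[OF this, where 'a = complex]
    have "((\<lambda>t. complex_of_real (norm (\<gamma> t) powr (- s)) * e (\<gamma> t)) has_vector_derivative
        complex_of_real (norm (\<gamma> 0) powr (- s)) * e' q +
        complex_of_real (norm q powr (- s) * (- s * ((q \<bullet> (q ** X - X ** q)) / (norm q)\<^sup>2))) * e (\<gamma> 0)) (at 0)"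
      by (intro has_vector_derivative_mult e'(2)[OF \<gamma>0 q0(1) \<gamma>])
    then have d: "((\<lambda>t. complex_of_real (norm (\<gamma> t) powr (- s)) * e (\<gamma> t)) has_vector_derivative
        complex_of_real (norm q powr (- s)) * ?e q) (at 0)"
      by (simp add: \<gamma>0 algebra_simps)
    have "((\<lambda>t. u (bump s) (E t <#\<^bsub>SL\<^esub> (g <#\<^bsub>SL\<^esub> H_grp))) has_vector_derivative
        complex_of_real (norm q powr (- s)) * ?e q) (at 0)"
      using d has_vector_derivative_cong_ev[OF ev] eventually_nhds_x_imp_x[OF ev] by simp
    then show "left_deriv X (u (bump s)) (g <#\<^bsub>SL\<^esub> H_grp) = complex_of_real (norm (proj g) powr (- s)) * ?e (proj g)"
      unfolding left_deriv_def E_def q_def by (rule vector_derivative_at)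
  qed
next
  case (add u v)
  then obtain e f where "bdd_fun e" "\<And>g. invertible g \<Longrightarrow>
    u (bump s) (g <#\<^bsub>SL\<^esub> H_grp) = complex_of_real (norm (proj g) powr (- s)) * e (proj g)"
    "bdd_fun f" "\<And>g. invertible g \<Longrightarrow>
    v (bump s) (g <#\<^bsub>SL\<^esub> H_grp) = complex_of_real (norm (proj g) powr (- s)) * f (proj g)" by blast
  then show ?case by (intro exI[of _ "\<lambda>q. e q + f q"]) (auto simp: distrib_left intro: bdd_fun.add)
next
  case (scale u z)
  then obtain e where "bdd_fun e" "\<And>g. invertible g \<Longrightarrow>
    u (bump s) (g <#\<^bsub>SL\<^esub> H_grp) = complex_of_real (norm (proj g) powr (- s)) * e (proj g)" by blast
  then show ?case by (intro exI[of _ "\<lambda>q. z * e q"]) (auto intro: bdd_fun.mult bdd_fun.const)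
qed

text \<open>With y = (1 + x) / 2, the bound (1 + y / m)^m \<le> exp y dominates the m-th power of y
  / m, and \<open>?c ^ m\<close> restores the scale.\<close>

lemma power_le_exp: "\<exists>C\<ge>0. \<forall>x\<ge>0. (1 + x) ^ m \<le> C * exp ((x :: real) / 2)"
proof (cases "m = 0")
  case True
  then show ?thesis by (intro exI[of _ 1]) auto
next
  case False
  let ?c = "2 * real m"
  have "(1 + x) ^ m \<le> ?c ^ m * exp 1 * exp (x / 2)" if x: "x \<ge> 0" for x :: real
  proof -
    have "(1 + x) / ?c \<le> 1 + ((1 + x) / 2) / real m" by (simp add: field_simps)
    then have "((1 + x) / ?c) ^ m \<le> (1 + ((1 + x) / 2) / real m) ^ m"
      using x by (intro power_mono) auto
    also have "\<dots> \<le> exp ((1 + x) / 2)" using False x by (intro exp_ge_one_plus_x_over_n_power_n) auto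
    also have "\<dots> \<le> exp (1 + x / 2)" by simp
    finally have "((1 + x) / ?c) ^ m * ?c ^ m \<le> exp (1 + x / 2) * ?c ^ m" by (intro mult_right_mono) auto
    then show ?thesis using False by (simp add: power_divide exp_add mult_ac)
  qed
  then show ?thesis by (intro exI[of _ "?c ^ m * exp 1"]) auto
qed

text \<open>As cosh (2 t) \<ge> (cosh t)^2, the function decays like (cosh t)^(-2 s). Against the
  weight (cosh t)^(n - 1) a factor (cosh t)^(-1/2) is left, which absorbs every power of 1 +
  |t|.\<close>

lemma schwartz_bump:
  assumes n: "CARD('n::{finite,linorder}) \<ge> 2" and s: "2 * s = real CARD('n) - 1 / 2"
  shows "schwartz (bump s :: 'n sqmat set \<Rightarrow> complex)"
  unfolding schwartz_def
proof (intro conjI ballI allI)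
  show "smooth_on_X (bump s :: 'n sqmat set \<Rightarrow> complex)" using n by (rule smooth_bump)
  fix u :: "('n sqmat set \<Rightarrow> complex) \<Rightarrow> 'n sqmat set \<Rightarrow> complex" and m :: nat
  assume "u \<in> U_action"
  then obtain e where e: "bdd_fun e" "\<And>g. invertible g \<Longrightarrow>
    u (bump s) (g <#\<^bsub>SL\<^esub> H_grp) = complex_of_real (norm (proj g) powr (- s)) * e (proj g)"
    using U_action_bump[OF n] by blast
  obtain B where B: "B \<ge> 0" "\<And>q. cmod (e q) \<le> B" using bdd_fun_bounded[OF e(1)] by blast
  obtain C :: real where C: "C \<ge> 0" "\<And>x :: real. x \<ge> 0 \<Longrightarrow> (1 + x) ^ (2 * m) \<le> C * exp (x / 2)"
    using power_le_exp[of "2 * m"] by blast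
  let ?d = "CARD('n) - 1"
  have "cosh t ^ ?d * (1 + \<bar>t\<bar>) ^ m * cmod (u (bump s) ((k ** a_elt t) <#\<^bsub>SL\<^esub> H_grp)) \<le> sqrt (C * 2) * B"
    if k: "k \<in> SO" for k t
  proof -
    have ok: "orthogonal_matrix k" using k by (simp add: SO_def)
    have "k ** a_elt t \<in> carrier SL" using SO_SL[OF k] a_elt_props(1)[OF n] by (simp add: SL_simps det_mul)
    then have ki: "invertible (k ** a_elt t)" by (rule SL_invertible)
    have c1: "cosh t \<ge> 1" by (rule cosh_real_ge_1)
    have s0: "s \<ge> 0" using s n by simp
    have "cosh (2 * t) powr (- s) \<le> (cosh t)\<^sup>2 powr (- s)"
    proof (rule powr_mono2')
      have "(cosh t)\<^sup>2 \<ge> 1" using c1 by (simp add: one_le_power)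
      then show "(cosh t)\<^sup>2 \<le> cosh (2 * t)" by (simp add: cosh_double_cosh)
    qed (use s0 c1 in auto)
    also have "(cosh t)\<^sup>2 = cosh t powr 2" using c1 by simp
    also have "(cosh t powr 2) powr (- s) = cosh t powr (- (real CARD('n) - 1 / 2))"
      unfolding powr_powr using s by simp
    finally have p: "norm (proj (k ** a_elt t)) powr (- s) \<le> cosh t powr (- (real CARD('n) - 1 / 2))"
      by (simp add: norm_proj_ka[OF n ok])
    have "cosh t ^ ?d = cosh t powr (real ?d)" by (rule powr_realpow[symmetric]) (use c1 in linarith)
    then have d: "cosh t ^ ?d * cosh t powr (- (real CARD('n) - 1 / 2)) = cosh t powr (- (1 / 2))"
      using n by (simp add: of_nat_diff flip: powr_add)
    have "exp \<bar>t\<bar> \<le> 2 * cosh t" unfolding cosh_field_def by (cases "t \<ge> 0") simp_all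
    \<comment> \<open>Squaring turns the exponent -1/2 into -1 and \<open>m\<close> into
      \<open>2 * m\<close>, the exponent for which \<open>C\<close> was chosen.\<close>
    have "(1 + \<bar>t\<bar>) ^ m * cosh t powr (- (1 / 2)) \<le> sqrt (C * 2)"
    proof (rule real_le_rsqrt)
      have "((1 + \<bar>t\<bar>) ^ m * cosh t powr (- (1 / 2)))\<^sup>2 = (1 + \<bar>t\<bar>) ^ (2 * m) / cosh t"
      proof -
        have "(cosh t powr (- (1 / 2)))\<^sup>2 = cosh t powr (- 1)"
          by (simp add: power2_eq_square flip: powr_add)
        also have "\<dots> = 1 / cosh t" using c1 by (simp add: powr_minus_divide)
        finally show ?thesis by (simp add: power_mult_distrib power_mult[symmetric] mult.commute)
      qed
      also have "\<dots> \<le> C * exp (\<bar>t\<bar> / 2) / cosh t" using c1 C(2)[of "\<bar>t\<bar>"] by (intro divide_right_mono) auto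
      also have "\<dots> \<le> C * (2 * cosh t) / cosh t"
      proof -
        have "exp (\<bar>t\<bar> / 2) \<le> exp \<bar>t\<bar>" by simp
        then have "exp (\<bar>t\<bar> / 2) \<le> 2 * cosh t" using \<open>exp \<bar>t\<bar> \<le> 2 * cosh t\<close> by (rule order_trans)
        then show ?thesis using c1 C(1) by (intro divide_right_mono mult_left_mono) auto
      qed
      also have "\<dots> = C * 2" using c1 by simp
      finally show "((1 + \<bar>t\<bar>) ^ m * cosh t powr (- (1 / 2)))\<^sup>2 \<le> C * 2" .
    qed
    note bound = this
    have "cosh t ^ ?d * (1 + \<bar>t\<bar>) ^ m * cmod (u (bump s) ((k ** a_elt t) <#\<^bsub>SL\<^esub> H_grp)) =
        cosh t ^ ?d * (1 + \<bar>t\<bar>) ^ m * (norm (proj (k ** a_elt t)) powr (- s) * cmod (e (proj (k ** a_elt t))))"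
      by (simp add: e(2)[OF ki] norm_mult)
    also have "\<dots> \<le> cosh t ^ ?d * (1 + \<bar>t\<bar>) ^ m * (cosh t powr (- (real CARD('n) - 1 / 2)) * B)"
      using p B c1 by (intro mult_left_mono mult_mono) auto
    also have "\<dots> = (1 + \<bar>t\<bar>) ^ m * cosh t powr (- (1 / 2)) * B" unfolding d[symmetric] by simp
    also have "\<dots> \<le> sqrt (C * 2) * B" using bound B(1) by (rule mult_right_mono)
    finally show ?thesis .
  qed
  then show "bdd_above ((\<lambda>(k, t). cosh t ^ ?d * (1 + \<bar>t\<bar>) ^ m *
      cmod (u (bump s) ((k ** a_elt t) <#\<^bsub>SL\<^esub> H_grp))) ` (SO \<times> (UNIV :: real set)))"
    by (intro bdd_aboveI[of _ "sqrt (C * 2) * B"]) auto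
qed

section \<open>The orbit of the unipotent radical and its invariant measure\<close>

locale orbit =
  fixes b :: "('n::{finite,linorder}) sqmat" and i j :: 'n and dx :: "'n sqmat set measure"
  assumes n3: "3 \<le> CARD('n)" and fr: "frame b i j"
    and radon: "radon_measure_on (coset_topology (N_of b) (N_of b \<inter> H_grp)) dx"
    and invm: "invariant_measure (N_of b) dx"
    and nz: "emeasure dx (space dx) \<noteq> 0"
begin

lemma n2: "2 \<le> CARD('n)" using n3 by simp

lemma b: "invertible b" "j \<le> i" "matrix_inv b *v wvec = eps i j" "wvec v* b = frame_scale i j *\<^sub>R eps i j"
  using frameD[OF fr] by auto

definition NH :: "'n sqmat set" where "NH = N_of b \<inter> H_grp"

definition N_coset :: "'n sqmat \<Rightarrow> 'n sqmat set" where "N_coset x = x <#\<^bsub>SL\<^esub> NH"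

text \<open>\<open>V\<close> and \<open>X\<close> are the column and the row of the idempotent in
  the basis \<open>b\<close>, which is half of \<open>outer (V c) (X c)\<close>. On cosets of
  \<open>NH\<close> neither depends on the representative, since \<open>NH\<close> fixes both the
  vector and the row \<open>wvec\<close>.\<close>

definition V :: "'n sqmat set \<Rightarrow> (real, 'n) vec"
  where "V c = matrix_inv b *v ((SOME x. x \<in> c) *v wvec)"

definition X :: "'n sqmat set \<Rightarrow> (real, 'n) vec"
  where "X c = (wvec v* matrix_inv (SOME x. x \<in> c)) v* b"

lemma NH_subgroup: "subgroup NH SL"
  unfolding NH_def using group.subgroups_Inter_pair[OF group_SL] N_of_subgroup[OF b(1)] H_grp_subgroup[OF n2] by blast

lemma N_invertible: "x \<in> N_of b \<Longrightarrow> invertible x" using N_of_det[OF b(1)] by (simp add: invertible_det_nz)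

lemma N_SL: "x \<in> N_of b \<Longrightarrow> x \<in> carrier SL" using N_of_det[OF b(1)] by (simp add: SL_simps)

lemma N_mult: "x \<in> N_of b \<Longrightarrow> y \<in> N_of b \<Longrightarrow> x ** y \<in> N_of b"
  and N_inv: "x \<in> N_of b \<Longrightarrow> matrix_inv x \<in> N_of b"
  and N_one: "mat 1 \<in> N_of b"
  using subgroup_SLD[OF N_of_subgroup[OF b(1)]] by auto

lemma topspace_T: "topspace (coset_topology (N_of b) NH) = N_coset ` N_of b"
proof -
  have cs: "coset_space (N_of b) NH = N_coset ` N_of b"
    by (auto simp: coset_space_def LCOSETS_def l_coset_def SL_def N_coset_def)
  have "openin (coset_topology (N_of b) NH) (N_coset ` N_of b)"
    unfolding openin_coset_topology cs
    by (auto simp: N_coset_def[symmetric] intro: back_subst[of "openin (top_of_set (N_of b))", OF openin_subtopology_self])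
  moreover have "topspace (coset_topology (N_of b) NH) \<subseteq> N_coset ` N_of b"
    unfolding topspace_def using openin_coset_topology[of "N_of b" NH] cs by auto
  ultimately show ?thesis by (meson openin_subset subset_antisym)
qed

lemma coset_space_N_coset: "coset_space (N_of b) NH = N_coset ` N_of b"
  by (auto simp: coset_space_def LCOSETS_def l_coset_def SL_def N_coset_def)

lemma space_dx: "space dx = N_coset ` N_of b"
  using radon by (simp add: radon_measure_on_def topspace_T flip: NH_def)

lemma openin_T: "openin (coset_topology (N_of b) NH) U \<longleftrightarrow>
    U \<subseteq> N_coset ` N_of b \<and> openin (top_of_set (N_of b)) {x \<in> N_of b. N_coset x \<in> U}"
  by (simp add: openin_coset_topology coset_space_N_coset N_coset_def)

lemma open_sets: "openin (coset_topology (N_of b) NH) U \<Longrightarrow> U \<in> sets dx"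
  using radon by (auto simp: radon_measure_on_def NH_def)

text \<open>In the quotient topology a function is continuous once its lift to the group is, and the
  measure is defined on the Borel sets of that topology.\<close>

lemma measurable_N_coset:
  fixes F :: "'n sqmat set \<Rightarrow> 'a::topological_space"
  assumes "continuous_on (N_of b) (\<lambda>x. F (N_coset x))"
  shows "F \<in> borel_measurable dx"
proof (rule borel_measurableI)
  fix S :: "'a set" assume "open S"
  have "{x \<in> N_of b. N_coset x \<in> F -` S \<inter> space dx} = N_of b \<inter> (\<lambda>x. F (N_coset x)) -` S"
    by (auto simp: space_dx)
  moreover have "openin (top_of_set (N_of b)) (N_of b \<inter> (\<lambda>x. F (N_coset x)) -` S)"
    using assms \<open>open S\<close> by (rule continuous_openin_preimage_gen)
  ultimately have "openin (coset_topology (N_of b) NH) (F -` S \<inter> space dx)"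
    unfolding openin_T by (auto simp: space_dx)
  then show "F -` S \<inter> space dx \<in> sets dx" by (rule open_sets)
qed

section \<open>Coordinates of an orbit point\<close>

lemma coset_rep:
  assumes "x \<in> N_of b"
  obtains h where "(SOME y. y \<in> N_coset x) = x ** h" "h \<in> NH"
proof -
  have "mat 1 \<in> NH" using subgroup_SLD(2)[OF NH_subgroup] .
  then have "x \<in> N_coset x" unfolding N_coset_def l_coset_SL by (intro image_eqI[of _ _ "mat 1"]) simp_all
  then have "(SOME y. y \<in> N_coset x) \<in> N_coset x" by (rule someI)
  then show ?thesis using that unfolding N_coset_def l_coset_SL by blast
qed

lemma frame_coordinates:
  assumes "x \<in> N_of b"
  shows "matrix_inv b *v (x *v wvec) = conj_by b x *v eps i j"
    "(wvec v* matrix_inv x) v* b = frame_scale i j *\<^sub>R (eps i j v* matrix_inv (conj_by b x))"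
proof -
  have bw: "b *v eps i j = wvec" using fr by (simp add: frame_def)
  show "matrix_inv b *v (x *v wvec) = conj_by b x *v eps i j"
    by (simp add: conj_by_def bw flip: matrix_vector_mul_assoc)
  have "wvec v* matrix_inv x = ((wvec v* b) v* matrix_inv b) v* matrix_inv x"
    using b(1) by (simp add: vec_mult_matrix_inv)
  then have "(wvec v* matrix_inv x) v* b = (wvec v* b) v* conj_by b (matrix_inv x)"
    by (simp only: conj_by_def vector_matrix_mul_assoc matrix_mul_assoc)
  then show "(wvec v* matrix_inv x) v* b = frame_scale i j *\<^sub>R (eps i j v* matrix_inv (conj_by b x))"
    by (simp add: b conj_by_matrix_inv N_invertible[OF assms] scaleR_vector_matrix_assoc)
qed

lemma unitri_eps:
  assumes u: "unitri u"
  shows "(u *v eps i j) $ i = 1" "i < k \<Longrightarrow> (u *v eps i j) $ k = 0"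
    "(eps i j v* u) $ j = 1" "k < j \<Longrightarrow> (eps i j v* u) $ k = 0"
proof -
  have up: "upper u" "\<And>k. u $ k $ k = 1" using u by (auto simp: unitri_def)
  have e: "eps i j $ l = 0" if "i < l" for l using that b(2) by (auto simp: eps_component)
  show "(u *v eps i j) $ i = 1" using upper_mult_last[OF up(1) e] up by (simp add: eps_component)
  show "(u *v eps i j) $ k = 0" if "i < k" using upper_mult_beyond[OF up(1) e that] .
  have z: "u $ l $ k * eps i j $ l = 0" if "k < l \<or> k < j \<or> (k = j \<and> l \<noteq> j)" for k l
    using that up(1) b(2) by (cases "k < l") (auto simp: upper_def eps_component)
  have "(eps i j v* u) $ j = (\<Sum>l\<in>{j}. u $ l $ j * eps i j $ l)"
    unfolding vec_mat_component using z[of j] by (intro sum.mono_neutral_right) auto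
  then show "(eps i j v* u) $ j = 1" by (simp add: up eps_component)
  show "(eps i j v* u) $ k = 0" if "k < j"
    unfolding vec_mat_component using z that by (intro sum.neutral) blast
qed

text \<open>Elements of \<open>H_grp\<close> preserve the line of \<open>wvec\<close>; a unipotent
  element keeps the entry at \<open>i\<close> equal to 1, so the scalar is 1.\<close>

lemma NH_fix:
  assumes h: "h \<in> NH" shows "h *v wvec = wvec" "wvec v* matrix_inv h = wvec"
proof -
  have hN: "h \<in> N_of b" and hH: "h \<in> H_grp" using h by (auto simp: NH_def)
  have p: "proj h = proj (mat 1)" using H_grp_iff[OF n2 N_SL[OF hN]] hH by simp
  have p': "(h *v wvec) $ k * (wvec v* matrix_inv h) $ l = wvec $ k * wvec $ l" for k l
    using arg_cong[OF p, of "\<lambda>A. A $ k $ l"] by (simp add: proj_def outer_def matrix_inv_one)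
  define k where "k = (first_idx :: 'n)"
  have wk: "wvec $ k = 1" by (simp add: wvec_component[OF n2] k_def)
  define c where "c = (wvec v* matrix_inv h) $ k"
  have e1: "c * (h *v wvec) $ l = wvec $ l" for l using p'[of l k] wk by (simp add: c_def mult.commute)
  have cnz: "c \<noteq> 0" using e1[of k] wk by auto
  have hw: "h *v wvec = (1 / c) *\<^sub>R wvec" using e1 cnz by (simp add: vec_eq_iff field_simps)
  have "(matrix_inv b *v (h *v wvec)) $ i = 1"
    unfolding frame_coordinates(1)[OF hN] using hN by (intro unitri_eps(1)) (simp add: N_of_def)
  then have "(1 / c) * eps i j $ i = 1" unfolding hw by (simp add: matrix_vector_mult_scaleR b)
  then have "c = 1" by (simp add: eps_component)
  then show hw1: "h *v wvec = wvec" using hw by simp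
  have "(wvec v* matrix_inv h) $ l = wvec $ l" for l using p'[of k l] hw1 wk by simp
  then show "wvec v* matrix_inv h = wvec" by (simp add: vec_eq_iff)
qed

lemma V_N_coset: "x \<in> N_of b \<Longrightarrow> V (N_coset x) = matrix_inv b *v (x *v wvec)"
  and X_N_coset: "x \<in> N_of b \<Longrightarrow> X (N_coset x) = (wvec v* matrix_inv x) v* b"
proof -
  assume x: "x \<in> N_of b"
  obtain h where h: "(SOME y. y \<in> N_coset x) = x ** h" "h \<in> NH" using coset_rep[OF x] .
  have hi: "invertible h" using h(2) N_invertible by (auto simp: NH_def)
  show "V (N_coset x) = matrix_inv b *v (x *v wvec)"
    unfolding V_def h by (simp add: NH_fix(1)[OF h(2)] flip: matrix_vector_mul_assoc)
  have "wvec v* matrix_inv (x ** h) = wvec v* matrix_inv x"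
    unfolding matrix_inv_mult[OF N_invertible[OF x] hi] vector_matrix_mul_assoc[symmetric] NH_fix(2)[OF h(2)] ..
  then show "X (N_coset x) = (wvec v* matrix_inv x) v* b" by (simp add: X_def h)
qed

lemma continuous_V: "continuous_on (N_of b) (\<lambda>x. V (N_coset x))"
  by (simp cong: continuous_on_cong add: V_N_coset) (intro continuous_intros)

lemma continuous_X: "continuous_on (N_of b) (\<lambda>x. X (N_coset x))"
  by (simp cong: continuous_on_cong add: X_N_coset) (intro continuous_intros continuous_on_matrix_inv N_invertible)

lemma V_measurable [measurable]: "(\<lambda>c. V c $ k) \<in> borel_measurable dx"
  by (intro measurable_N_coset continuous_on_component continuous_V)

lemma X_measurable [measurable]: "(\<lambda>c. X c $ k) \<in> borel_measurable dx"
  by (intro measurable_N_coset continuous_on_component continuous_X)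

text \<open>Unitriangularity fixes one entry of each vector and kills those beyond it; the last
  relation transports \<open>wvec \<bullet> wvec = 2\<close>. What stays free is \<open>V\<close> on
  \<open>I1\<close>, \<open>X\<close> on \<open>I2\<close> and, for \<open>i \<noteq> j\<close>, one
  of \<open>V c $ j\<close> and \<open>X c $ i\<close>.\<close>

lemma coordinates:
  assumes c: "c \<in> space dx"
  shows "V c $ i = 1" "i < k \<Longrightarrow> V c $ k = 0" "X c $ j = frame_scale i j" "k < j \<Longrightarrow> X c $ k = 0"
    "(\<Sum>k\<in>UNIV. X c $ k * V c $ k) = 2"
proof -
  obtain x where x: "x \<in> N_of b" "c = N_coset x" using c by (auto simp: space_dx)
  have u: "unitri (conj_by b x)" "unitri (matrix_inv (conj_by b x))" using x by (auto simp: N_of_def unitri_matrix_inv)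
  note V = V_N_coset[OF x(1)] X_N_coset[OF x(1)]
  show "V c $ i = 1" "i < k \<Longrightarrow> V c $ k = 0" "X c $ j = frame_scale i j" "k < j \<Longrightarrow> X c $ k = 0"
    using unitri_eps[OF u(1)] unitri_eps[OF u(2)] by (simp_all add: x(2) V frame_coordinates[OF x(1)])
  have "X c \<bullet> V c = (wvec :: (real, 'n) vec) \<bullet> wvec"
    using N_invertible[OF x(1)] b(1) by (simp add: x(2) V inner_vec_mat matrix_inv_mult_vec)
  then show "(\<Sum>k\<in>UNIV. X c $ k * V c $ k) = 2" unfolding wvec_inner[OF n2] by (simp add: inner_vec_def)
qed

lemma axis_nth: "axis k t $ l = (if l = k then t else 0)"
  by (simp add: axis_def)

definition act :: "(real, 'n) vec \<Rightarrow> (real, 'n) vec \<Rightarrow> 'n sqmat set \<Rightarrow> 'n sqmat set"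
  where "act u v c = (b ** shear u v ** matrix_inv b) <#\<^bsub>SL\<^esub> c"

text \<open>The equivalence says that \<open>E'\<close> is the translate of \<open>E\<close>: a
  point of \<open>E'\<close> is reached from its translate by the inverse of
  \<open>y\<close>.\<close>

lemma shift_general:
  assumes y: "y \<in> N_of b" and E: "E \<in> sets dx" "E' \<in> sets dx"
    and eq: "\<And>c. c \<in> space dx \<Longrightarrow> y <#\<^bsub>SL\<^esub> c \<in> E' \<longleftrightarrow> c \<in> E"
  shows "emeasure dx E' = emeasure dx E"
proof -
  have "(\<lambda>c. y <#\<^bsub>SL\<^esub> c) ` E = E'"
  proof (intro equalityI subsetI)
    fix c assume "c \<in> (\<lambda>c. y <#\<^bsub>SL\<^esub> c) ` E"
    then show "c \<in> E'" using eq sets.sets_into_space[OF E(1)] by blast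
  next
    fix c assume c: "c \<in> E'"
    then obtain x where x: "x \<in> N_of b" "c = N_coset x" using sets.sets_into_space[OF E(2)] by (auto simp: space_dx)
    define c' where "c' = N_coset (matrix_inv y ** x)"
    have "y <#\<^bsub>SL\<^esub> c' = c"
      using N_invertible[OF y] by (simp add: c'_def N_coset_def l_coset_SL_assoc x(2) matrix_mul_assoc matrix_inv_right)
    moreover have "c' \<in> space dx" unfolding space_dx c'_def using N_mult[OF N_inv[OF y] x(1)] by blast
    ultimately show "c \<in> (\<lambda>c. y <#\<^bsub>SL\<^esub> c) ` E" using eq c by (metis image_eqI)
  qed
  moreover have "emeasure dx ((\<lambda>c. y <#\<^bsub>SL\<^esub> c) ` E) = emeasure dx E"
    using invm y E(1) by (simp add: invariant_measure_def)
  ultimately show ?thesis by simp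
qed

lemma shear_N: "unitri (shear u v) \<Longrightarrow> b ** shear u v ** matrix_inv b \<in> N_of b"
  using b(1) by (simp add: N_of_def conj_by_cancel)

lemma act_coordinates:
  assumes u: "unitri (shear u v)" "v \<bullet> u = 0" and c: "c \<in> space dx"
  shows "V (act u v c) = V c + (v \<bullet> V c) *\<^sub>R u" "X (act u v c) = X c - (X c \<bullet> u) *\<^sub>R v"
    "act u v c \<in> space dx"
proof -
  obtain x where x: "x \<in> N_of b" "c = N_coset x" using c by (auto simp: space_dx)
  let ?y = "b ** shear u v ** matrix_inv b"
  have y: "?y \<in> N_of b" using shear_N[OF u(1)] .
  have yx: "?y ** x \<in> N_of b" using N_mult[OF y x(1)] .
  have ac: "act u v c = N_coset (?y ** x)" by (simp add: act_def x(2) N_coset_def l_coset_SL_assoc)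
  show "act u v c \<in> space dx" using yx by (auto simp: ac space_dx)
  have "matrix_inv b *v ((?y ** x) *v wvec) = shear u v *v (matrix_inv b *v (x *v wvec))"
    using b(1) by (simp add: matrix_inv_mult_vec flip: matrix_vector_mul_assoc)
  then show "V (act u v c) = V c + (v \<bullet> V c) *\<^sub>R u"
    unfolding ac V_N_coset[OF yx] by (simp add: x(2) V_N_coset[OF x(1)] shear_vec)
  have "matrix_inv ?y = b ** shear (- u) v ** matrix_inv b"
    using b(1) unitri_invertible[OF u(1)]
    by (simp add: matrix_inv_mult invertible_mult invertible_matrix_inv matrix_inv_matrix_inv matrix_inv_shear u(2) matrix_mul_assoc)
  then have "(wvec v* matrix_inv (?y ** x)) v* b = ((wvec v* matrix_inv x) v* b) v* shear (- u) v"
    using matrix_inv_mult[OF N_invertible[OF y] N_invertible[OF x(1)]] b(1)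
    by (simp add: vector_matrix_mul_assoc matrix_mul_assoc) (metis matrix_inv_left matrix_mul_assoc matrix_mul_rid)
  then show "X (act u v c) = X c - (X c \<bullet> u) *\<^sub>R v"
    unfolding ac X_N_coset[OF yx] by (simp add: x(2) X_N_coset[OF x(1)] vec_shear)
qed

lemma shift:
  assumes u: "unitri (shear u v)" and E: "E \<in> sets dx" "E' \<in> sets dx"
    and eq: "\<And>c. c \<in> space dx \<Longrightarrow> act u v c \<in> E' \<longleftrightarrow> c \<in> E"
  shows "emeasure dx E' = emeasure dx E"
  using shift_general[OF shear_N[OF u] E] eq by (simp add: act_def)

text \<open>The entry of \<open>V\<close> at \<open>i\<close> is 1, so this shear translates a
  single entry of \<open>V\<close>; on the other side only the entry of \<open>X\<close> at
  \<open>i\<close> changes.\<close>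

lemma act_V:
  fixes t :: real
  assumes k: "k < i" and c: "c \<in> space dx"
  defines "c' \<equiv> act (axis k t) (axis i 1) c"
  shows "c' \<in> space dx" "V c' $ l = (if l = k then V c $ l + t else V c $ l)"
    "X c' $ l = (if l = i then X c $ l - t * X c $ k else X c $ l)"
    "unitri (shear (axis k t) (axis i 1))"
proof -
  show u: "unitri (shear (axis k t) (axis i 1))"
    using k by (intro unitri_shear) (auto simp: axis_def split: if_splits)
  have "axis i 1 \<bullet> (axis k t :: (real, 'n) vec) = 0" using k by (auto simp: inner_axis_axis)
  note a = act_coordinates[OF u this c]
  show "c' \<in> space dx" using a by (simp add: c'_def)
  show "V c' $ l = (if l = k then V c $ l + t else V c $ l)"
    using coordinates(1)[OF c] by (simp add: c'_def a inner_axis' axis_nth)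
  have "X c \<bullet> axis k t = t * X c $ k" by (simp add: inner_axis mult.commute)
  then show "X c' $ l = (if l = i then X c $ l - t * X c $ k else X c $ l)"
    by (simp add: c'_def a axis_nth)
qed

text \<open>The entry of \<open>X\<close> at \<open>j\<close> is \<open>frame_scale i j\<close>,
  which explains the divisor: a single entry of \<open>X\<close> is translated by \<open>t\<close>,
  and only the entry of \<open>V\<close> at \<open>j\<close> changes besides.\<close>

lemma act_X:
  fixes t :: real
  assumes k: "j < k" and c: "c \<in> space dx"
  defines "c' \<equiv> act (axis j (- (t / frame_scale i j))) (axis k 1) c"
  shows "c' \<in> space dx" "V c' $ l = (if l = j then V c $ l - t / frame_scale i j * V c $ k else V c $ l)"
    "X c' $ l = (if l = k then X c $ l + t else X c $ l)"
    "unitri (shear (axis j (- (t / frame_scale i j))) (axis k 1))"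
proof -
  show u: "unitri (shear (axis j (- (t / frame_scale i j))) (axis k 1))"
    using k by (intro unitri_shear) (auto simp: axis_def split: if_splits)
  have "axis k 1 \<bullet> (axis j (- (t / frame_scale i j)) :: (real, 'n) vec) = 0" using k by (auto simp: inner_axis_axis)
  note a = act_coordinates[OF u this c]
  show "c' \<in> space dx" using a by (simp add: c'_def)
  have "axis k 1 \<bullet> V c = V c $ k" by (simp add: inner_axis')
  then show "V c' $ l = (if l = j then V c $ l - t / frame_scale i j * V c $ k else V c $ l)"
    by (simp add: c'_def a axis_nth)
  have "X c \<bullet> axis j (- (t / frame_scale i j)) = - t"
    using coordinates(3)[OF c] frame_scale_pos[of i j] by (simp add: inner_axis)
  then show "X c' $ l = (if l = k then X c $ l + t else X c $ l)"
    by (simp add: c'_def a axis_nth)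
qed

text \<open>\<open>V\<close> at \<open>j\<close> is left out here, and \<open>X\<close> at
  \<open>i\<close> in \<open>I2\<close>, because the shears translating the other entries disturb
  these two.\<close>

definition I1 :: "'n set" where "I1 = {k. k < i \<and> k \<noteq> j}"

definition I2 :: "'n set" where "I2 = {k. j < k \<and> k \<noteq> i}"

definition cell :: "('n \<Rightarrow> int) \<Rightarrow> ('n \<Rightarrow> int) \<Rightarrow> 'n sqmat set set"
  where "cell \<alpha> \<beta> = {c \<in> space dx. (\<forall>k\<in>I1. \<lfloor>V c $ k\<rfloor> = \<alpha> k) \<and> (\<forall>l\<in>I2. \<lfloor>X c $ l\<rfloor> = \<beta> l)}"

text \<open>For \<open>i = j\<close> the strip is the whole space, so that both cases share one
  argument.\<close>

definition strip :: "('n sqmat set \<Rightarrow> real) \<Rightarrow> int \<Rightarrow> 'n sqmat set set"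
  where "strip \<zeta> m = {c \<in> space dx. i = j \<or> \<lfloor>\<zeta> c\<rfloor> = m}"

lemma cell_sets [measurable]: "cell \<alpha> \<beta> \<in> sets dx"
proof -
  have [simp]: "finite I1" "finite I2" by auto
  show ?thesis unfolding cell_def by measurable
qed

lemma strip_sets: "\<zeta> \<in> borel_measurable dx \<Longrightarrow> strip \<zeta> m \<in> sets dx"
  unfolding strip_def by measurable

definition shear_act :: "real \<Rightarrow> 'n sqmat set \<Rightarrow> 'n sqmat set"
  where "shear_act t = act (axis j t) (axis i 1)"

text \<open>A coordinate along the one remaining direction. Besides \<open>V\<close> at
  \<open>j\<close> and minus \<open>X\<close> at \<open>i\<close>, corrected versions of
  \<open>V\<close> at \<open>j\<close> qualify.\<close>

definition equivariant :: "('n sqmat set \<Rightarrow> real) \<Rightarrow> bool"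
  where "equivariant \<zeta> \<longleftrightarrow> \<zeta> \<in> borel_measurable dx \<and>
    (\<forall>c\<in>space dx. \<forall>t::int. i \<noteq> j \<longrightarrow> \<zeta> (shear_act (real_of_int t) c) = \<zeta> c + real_of_int t)"

lemma shear_act:
  assumes "i \<noteq> j" "c \<in> space dx"
  shows "shear_act t c \<in> space dx" "V (shear_act t c) $ l = (if l = j then V c $ l + t else V c $ l)"
    "X (shear_act t c) $ l = (if l = i then X c $ l - t else X c $ l)" "unitri (shear (axis j t) (axis i 1))"
proof -
  have "j < i" using assms(1) b(2) by auto
  note a = act_V[OF this assms(2), of t]
  show "shear_act t c \<in> space dx" "V (shear_act t c) $ l = (if l = j then V c $ l + t else V c $ l)"
    "unitri (shear (axis j t) (axis i 1))" using a by (auto simp: shear_act_def)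
  show "X (shear_act t c) $ l = (if l = i then X c $ l - t else X c $ l)"
    using a(3)[of l] coordinates(3)[OF assms(2)] assms(1) by (simp add: shear_act_def frame_scale_def)
qed

lemma equivariant_V: "equivariant (\<lambda>c. V c $ j)" and equi_X: "equivariant (\<lambda>c. - X c $ i)"
  unfolding equivariant_def by (auto simp: shear_act)

definition shear_invariant :: "'n sqmat set set \<Rightarrow> bool"
  where "shear_invariant D \<longleftrightarrow> D \<in> sets dx \<and> (\<forall>c\<in>space dx. \<forall>t::int. i \<noteq> j \<longrightarrow> shear_act (real_of_int t) c \<in> D \<longleftrightarrow> c \<in> D)"

lemma shear_invariant_cell: "shear_invariant (cell \<alpha> \<beta>)"
proof -
  have "shear_act (real_of_int t) c \<in> cell \<alpha> \<beta> \<longleftrightarrow> c \<in> cell \<alpha> \<beta>" if "c \<in> space dx" "i \<noteq> j" for c t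
    using shear_act[OF that(2,1), of "real_of_int t"] that by (auto simp: cell_def I1_def I2_def)
  then show ?thesis by (auto simp: shear_invariant_def cell_sets)
qed

lemma strip_shift:
  assumes D: "shear_invariant D" and \<zeta>: "equivariant \<zeta>"
  shows "emeasure dx (D \<inter> strip \<zeta> m) = emeasure dx (D \<inter> strip \<zeta> 0)"
proof (cases "i = j")
  case True
  show ?thesis unfolding strip_def using True by simp
next
  case False
  have D': "D \<in> sets dx" "\<zeta> \<in> borel_measurable dx" using D \<zeta> by (auto simp: shear_invariant_def equivariant_def)
  obtain c0 where "c0 \<in> space dx" using nz by fastforce
  have u: "unitri (shear (axis j (real_of_int m)) (axis i 1))" using shear_act(4)[OF False \<open>c0 \<in> space dx\<close>] .
  show ?thesis
  proof (rule shift[OF u])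
    show "D \<inter> strip \<zeta> 0 \<in> sets dx" "D \<inter> strip \<zeta> m \<in> sets dx"
      using strip_sets[OF D'(2)] D'(1) by auto
    fix c assume c: "c \<in> space dx"
    have "shear_act (real_of_int m) c \<in> D \<longleftrightarrow> c \<in> D" "\<zeta> (shear_act (real_of_int m) c) = \<zeta> c + real_of_int m"
      using D \<zeta> c False by (auto simp: shear_invariant_def equivariant_def)
    then show "act (axis j (real_of_int m)) (axis i 1) c \<in> D \<inter> strip \<zeta> m \<longleftrightarrow> c \<in> D \<inter> strip \<zeta> 0"
      using c False shear_act(1)[OF False c, of "real_of_int m"] by (auto simp: strip_def simp flip: shear_act_def)
  qed
qed

lemma strip_decompose:
  assumes E: "E \<in> sets dx" and \<zeta>: "\<zeta> \<in> borel_measurable dx" and ij: "i \<noteq> j"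
  shows "emeasure dx E = (\<integral>\<^sup>+m. emeasure dx (E \<inter> strip \<zeta> m) \<partial>count_space UNIV)"
proof -
  have "E = (\<Union>m. E \<inter> strip \<zeta> m)"
    using sets.sets_into_space[OF E] by (auto simp: strip_def)
  then have "emeasure dx E = emeasure dx (\<Union>m. E \<inter> strip \<zeta> m)" by simp
  also have "\<dots> = (\<integral>\<^sup>+m. emeasure dx (E \<inter> strip \<zeta> m) \<partial>count_space UNIV)"
    using E strip_sets[OF \<zeta>] ij
    by (intro emeasure_UN_countable) (auto simp: disjoint_family_on_def strip_def)
  finally show ?thesis .
qed

text \<open>Both strips are fundamental domains for the translations by integers in the direction of \<open>V j\<close>.\<close>

lemma strip_exchange:
  assumes D: "shear_invariant D" and \<zeta>: "equivariant \<zeta>" "equivariant \<xi>"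
  shows "emeasure dx (D \<inter> strip \<zeta> 0) = emeasure dx (D \<inter> strip \<xi> 0)"
proof (cases "i = j")
  case True
  show ?thesis unfolding strip_def using True by simp
next
  case False
  have D': "D \<in> sets dx" "\<zeta> \<in> borel_measurable dx" "\<xi> \<in> borel_measurable dx" using D \<zeta> by (auto simp: shear_invariant_def equivariant_def)
  obtain c0 where "c0 \<in> space dx" using nz by fastforce
  \<comment> \<open>Translation by \<open>m\<close> matches the pieces into which each fundamental
    domain cuts the other.\<close>
  have sh: "emeasure dx (D \<inter> strip \<zeta> 0 \<inter> strip \<xi> m) = emeasure dx (D \<inter> strip \<xi> 0 \<inter> strip \<zeta> (- m))" for m
  proof (rule shift[OF shear_act(4)[OF False \<open>c0 \<in> space dx\<close>]])
    show "D \<inter> strip \<xi> 0 \<inter> strip \<zeta> (- m) \<in> sets dx" "D \<inter> strip \<zeta> 0 \<inter> strip \<xi> m \<in> sets dx"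
      using strip_sets D' by auto
    fix c assume c: "c \<in> space dx"
    have "shear_act (real_of_int m) c \<in> D \<longleftrightarrow> c \<in> D" "\<zeta> (shear_act (real_of_int m) c) = \<zeta> c + real_of_int m"
      "\<xi> (shear_act (real_of_int m) c) = \<xi> c + real_of_int m"
      using D \<zeta> c False by (auto simp: shear_invariant_def equivariant_def)
    then show "act (axis j (real_of_int m)) (axis i 1) c \<in> D \<inter> strip \<zeta> 0 \<inter> strip \<xi> m \<longleftrightarrow> c \<in> D \<inter> strip \<xi> 0 \<inter> strip \<zeta> (- m)"
      using c False shear_act(1)[OF False c, of "real_of_int m"] by (auto simp: strip_def simp flip: shear_act_def)
  qed
  have "emeasure dx (D \<inter> strip \<zeta> 0) = (\<integral>\<^sup>+m. emeasure dx (D \<inter> strip \<zeta> 0 \<inter> strip \<xi> m) \<partial>count_space UNIV)"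
    using D' strip_sets by (intro strip_decompose False) auto
  also have "\<dots> = (\<integral>\<^sup>+m. emeasure dx (D \<inter> strip \<xi> 0 \<inter> strip \<zeta> (- m)) \<partial>count_space UNIV)"
    by (simp add: sh)
  also have "\<dots> = (\<integral>\<^sup>+m. emeasure dx (D \<inter> strip \<xi> 0 \<inter> strip \<zeta> m) \<partial>count_space UNIV)"
    by (rule nn_integral_bij_count_space[of uminus UNIV UNIV "\<lambda>m. emeasure dx (D \<inter> strip \<xi> 0 \<inter> strip \<zeta> m)"])
      (auto intro!: bij_betwI[of _ _ _ uminus])
  also have "\<dots> = emeasure dx (D \<inter> strip \<xi> 0)"
    using D' strip_sets by (intro strip_decompose[symmetric] False) auto
  finally show ?thesis .
qed

definition kappa :: ennreal where "kappa = emeasure dx (cell (\<lambda>_. 0) (\<lambda>_. 0) \<inter> strip (\<lambda>c. V c $ j) 0)"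

text \<open>Besides the entry at \<open>k\<close>, the shear changes only \<open>X\<close> at
  \<open>i\<close>, on which neither the cell nor the strip depends.\<close>

lemma cell_V_step:
  assumes k: "k \<in> I1"
  shows "emeasure dx (cell (\<alpha>(k := m)) \<beta> \<inter> strip (\<lambda>c. V c $ j) 0) = emeasure dx (cell (\<alpha>(k := 0)) \<beta> \<inter> strip (\<lambda>c. V c $ j) 0)"
proof -
  obtain c0 where "c0 \<in> space dx" using nz by fastforce
  have ki: "k < i" "k \<noteq> j" using k by (auto simp: I1_def)
  note S = strip_sets[of "\<lambda>c. V c $ j", OF V_measurable]
  show ?thesis
  proof (rule shift[OF act_V(4)[OF ki(1) \<open>c0 \<in> space dx\<close>]])
    show "cell (\<alpha>(k := 0)) \<beta> \<inter> strip (\<lambda>c. V c $ j) 0 \<in> sets dx"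
      "cell (\<alpha>(k := m)) \<beta> \<inter> strip (\<lambda>c. V c $ j) 0 \<in> sets dx" using S cell_sets by auto
    fix c assume c: "c \<in> space dx"
    show "act (axis k (real_of_int m)) (axis i 1) c \<in> cell (\<alpha>(k := m)) \<beta> \<inter> strip (\<lambda>c. V c $ j) 0 \<longleftrightarrow>
        c \<in> cell (\<alpha>(k := 0)) \<beta> \<inter> strip (\<lambda>c. V c $ j) 0"
      using act_V[OF ki(1) c, of "real_of_int m"] c ki by (auto simp: cell_def strip_def I2_def)
  qed
qed

text \<open>The shear also moves \<open>V\<close> at \<open>j\<close> by a multiple of
  \<open>V\<close> at \<open>k\<close>, so the strip is pulled back to that of the corrected
  coordinate \<open>\<zeta>\<close>. This is still equivariant, and exchanging strips leads back to
  \<open>V\<close> at \<open>j\<close>.\<close>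

lemma cell_X_step:
  assumes k: "k \<in> I2"
  shows "emeasure dx (cell \<alpha> (\<beta>(k := m)) \<inter> strip (\<lambda>c. V c $ j) 0) = emeasure dx (cell \<alpha> (\<beta>(k := 0)) \<inter> strip (\<lambda>c. V c $ j) 0)"
proof -
  obtain c0 where "c0 \<in> space dx" using nz by fastforce
  have ki: "j < k" "k \<noteq> i" using k by (auto simp: I2_def)
  define \<zeta> where "\<zeta> c = V c $ j - real_of_int m / frame_scale i j * V c $ k" for c
  have "\<zeta> \<in> borel_measurable dx" unfolding \<zeta>_def[abs_def] by measurable
  then have \<zeta>: "equivariant \<zeta>"
    unfolding equivariant_def using ki by (auto simp: \<zeta>_def shear_act)
  note S = strip_sets[of "\<lambda>c. V c $ j", OF V_measurable]
  have S': "strip \<zeta> 0 \<in> sets dx" using \<zeta> by (intro strip_sets) (simp add: equivariant_def)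
  have "emeasure dx (cell \<alpha> (\<beta>(k := m)) \<inter> strip (\<lambda>c. V c $ j) 0) = emeasure dx (cell \<alpha> (\<beta>(k := 0)) \<inter> strip \<zeta> 0)"
  proof (rule shift[OF act_X(4)[OF ki(1) \<open>c0 \<in> space dx\<close>]])
    show "cell \<alpha> (\<beta>(k := 0)) \<inter> strip \<zeta> 0 \<in> sets dx"
      "cell \<alpha> (\<beta>(k := m)) \<inter> strip (\<lambda>c. V c $ j) 0 \<in> sets dx" using S S' cell_sets by auto
    fix c assume c: "c \<in> space dx"
    show "act (axis j (- (real_of_int m / frame_scale i j))) (axis k 1) c \<in> cell \<alpha> (\<beta>(k := m)) \<inter> strip (\<lambda>c. V c $ j) 0 \<longleftrightarrow>
        c \<in> cell \<alpha> (\<beta>(k := 0)) \<inter> strip \<zeta> 0"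
      using act_X[OF ki(1) c, of "real_of_int m"] c ki by (auto simp: cell_def strip_def I1_def \<zeta>_def)
  qed
  also have "\<dots> = emeasure dx (cell \<alpha> (\<beta>(k := 0)) \<inter> strip (\<lambda>c. V c $ j) 0)"
    by (rule strip_exchange[OF shear_invariant_cell \<zeta> equivariant_V])
  finally show ?thesis .
qed

lemma cell_cong: "(\<And>k. k \<in> I1 \<Longrightarrow> \<alpha> k = \<alpha>' k) \<Longrightarrow> (\<And>k. k \<in> I2 \<Longrightarrow> \<beta> k = \<beta>' k) \<Longrightarrow> cell \<alpha> \<beta> = cell \<alpha>' \<beta>'"
  by (auto simp: cell_def)

text \<open>A cell depends on finitely many integers, which are reset to 0 one at a time; strips are
  shifted to 0 and exchanged for the standard one.\<close>

lemma cell_measure: "equivariant \<zeta> \<Longrightarrow> emeasure dx (cell \<alpha> \<beta> \<inter> strip \<zeta> m) = kappa"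
proof -
  assume \<zeta>: "equivariant \<zeta>"
  have 1: "emeasure dx (cell (\<lambda>k. if k \<in> A then \<alpha> k else 0) \<beta> \<inter> strip (\<lambda>c. V c $ j) 0) =
      emeasure dx (cell (\<lambda>_. 0) \<beta> \<inter> strip (\<lambda>c. V c $ j) 0)" if "finite A" "A \<subseteq> I1" for A \<alpha> \<beta>
    using that
  proof (induction A rule: finite_induct)
    case (insert k A)
    have "(\<lambda>l. if l \<in> insert k A then \<alpha> l else 0) = (\<lambda>l. if l \<in> A then \<alpha> l else 0)(k := \<alpha> k)"
      "(\<lambda>l. if l \<in> A then \<alpha> l else 0)(k := 0) = (\<lambda>l. if l \<in> A then \<alpha> l else 0)" using insert by auto
    then show ?case using cell_V_step[of k "\<lambda>l. if l \<in> A then \<alpha> l else 0" "\<alpha> k" \<beta>] insert by simp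
  qed simp
  have 2: "emeasure dx (cell (\<lambda>_. 0) (\<lambda>k. if k \<in> A then \<beta> k else 0) \<inter> strip (\<lambda>c. V c $ j) 0) = kappa"
    if "finite A" "A \<subseteq> I2" for A \<beta>
    using that
  proof (induction A rule: finite_induct)
    case (insert k A)
    have "(\<lambda>l. if l \<in> insert k A then \<beta> l else 0) = (\<lambda>l. if l \<in> A then \<beta> l else 0)(k := \<beta> k)"
      "(\<lambda>l. if l \<in> A then \<beta> l else 0)(k := 0) = (\<lambda>l. if l \<in> A then \<beta> l else 0)" using insert by auto
    then show ?case using cell_X_step[of k "\<lambda>_. 0" "\<lambda>l. if l \<in> A then \<beta> l else 0" "\<beta> k"] insert by simp
  qed (simp add: kappa_def)
  have "emeasure dx (cell \<alpha> \<beta> \<inter> strip \<zeta> m) = emeasure dx (cell \<alpha> \<beta> \<inter> strip (\<lambda>c. V c $ j) 0)"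
    using strip_shift[OF shear_invariant_cell \<zeta>] strip_exchange[OF shear_invariant_cell \<zeta> equivariant_V] by simp
  also have "\<dots> = emeasure dx (cell (\<lambda>k. if k \<in> I1 then \<alpha> k else 0) \<beta> \<inter> strip (\<lambda>c. V c $ j) 0)"
    by (simp cong: cell_cong)
  also have "\<dots> = emeasure dx (cell (\<lambda>_. 0) \<beta> \<inter> strip (\<lambda>c. V c $ j) 0)"
    by (rule 1) auto
  also have "\<dots> = emeasure dx (cell (\<lambda>_. 0) (\<lambda>k. if k \<in> I2 then \<beta> k else 0) \<inter> strip (\<lambda>c. V c $ j) 0)"
    by (simp cong: cell_cong)
  also have "\<dots> = kappa" by (rule 2) auto
  finally show ?thesis .
qed

text \<open>Otherwise countably many null sets would cover the space.\<close>

lemma kappa_pos: "kappa \<noteq> 0"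
proof
  assume k0: "kappa = 0"
  have "space dx = (\<Union>(\<alpha>, \<beta>, m) \<in> (UNIV :: (('n \<Rightarrow> int) \<times> ('n \<Rightarrow> int) \<times> int) set). cell \<alpha> \<beta> \<inter> strip (\<lambda>c. V c $ j) m)"
  proof (intro equalityI subsetI)
    fix c assume c: "c \<in> space dx"
    show "c \<in> (\<Union>(\<alpha>, \<beta>, m) \<in> (UNIV :: (('n \<Rightarrow> int) \<times> ('n \<Rightarrow> int) \<times> int) set). cell \<alpha> \<beta> \<inter> strip (\<lambda>c. V c $ j) m)"
      by (rule UN_I[of "(\<lambda>k. \<lfloor>V c $ k\<rfloor>, \<lambda>k. \<lfloor>X c $ k\<rfloor>, \<lfloor>V c $ j\<rfloor>)"]) (use c in \<open>auto simp: cell_def strip_def\<close>)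
  qed (auto simp: cell_def)
  moreover have "(\<Union>(\<alpha>, \<beta>, m) \<in> (UNIV :: (('n \<Rightarrow> int) \<times> ('n \<Rightarrow> int) \<times> int) set). cell \<alpha> \<beta> \<inter> strip (\<lambda>c. V c $ j) m) \<in> null_sets dx"
    using cell_measure[OF equivariant_V] k0 strip_sets[of "\<lambda>c. V c $ j", OF V_measurable]
    by (intro null_sets_UN') (auto simp: null_sets_def countableI_type)
  ultimately show False using nz by (simp add: null_setsD1)
qed

text \<open>Since \<open>V\<close> is 1 at \<open>i\<close>, the relation between \<open>X\<close>
  and \<open>V\<close> can be solved for this entry.\<close>

lemma X_i_bound:
  assumes c: "c \<in> space dx"
  shows "\<bar>X c $ i\<bar> \<le> 2 + (\<Sum>k\<in>UNIV - {i}. \<bar>X c $ k\<bar> * \<bar>V c $ k\<bar>)"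
proof -
  have "X c $ i = 2 - (\<Sum>k\<in>UNIV - {i}. X c $ k * V c $ k)"
    using coordinates(5)[OF c] coordinates(1)[OF c] by (simp add: sum.remove[of UNIV i])
  moreover have "\<bar>\<Sum>k\<in>UNIV - {i}. X c $ k * V c $ k\<bar> \<le> (\<Sum>k\<in>UNIV - {i}. \<bar>X c $ k * V c $ k\<bar>)"
    by (rule sum_abs)
  ultimately show ?thesis by (simp add: abs_mult)
qed

lemma V_j_bound:
  assumes c: "c \<in> space dx" and ij: "i \<noteq> j"
  shows "\<bar>V c $ j\<bar> \<le> 2 + (\<Sum>k\<in>UNIV - {j}. \<bar>X c $ k\<bar> * \<bar>V c $ k\<bar>)"
proof -
  have "V c $ j = 2 - (\<Sum>k\<in>UNIV - {j}. X c $ k * V c $ k)"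
    using coordinates(5)[OF c] coordinates(3)[OF c] ij by (simp add: sum.remove[of UNIV j] frame_scale_def)
  moreover have "\<bar>\<Sum>k\<in>UNIV - {j}. X c $ k * V c $ k\<bar> \<le> (\<Sum>k\<in>UNIV - {j}. \<bar>X c $ k * V c $ k\<bar>)"
    by (rule sum_abs)
  ultimately show ?thesis by (simp add: abs_mult)
qed

lemma index_cases:
  "k \<in> I1 \<or> k = i \<or> (k = j \<and> i \<noteq> j) \<or> i < k" "k \<in> I2 \<or> k = j \<or> (k = i \<and> i \<noteq> j) \<or> k < j"
  using linorder_less_linear[of k i] linorder_less_linear[of k j] by (auto simp: I1_def I2_def)

lemma V_bound:
  assumes c: "c \<in> space dx" and A: "1 \<le> A" "\<And>k. k \<in> I1 \<Longrightarrow> \<bar>V c $ k\<bar> \<le> A" "i \<noteq> j \<Longrightarrow> \<bar>V c $ j\<bar> \<le> A"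
  shows "\<bar>V c $ k\<bar> \<le> A"
proof -
  consider "k \<in> I1" | "k = i" | "k = j" "i \<noteq> j" | "i < k" using index_cases(1)[of k] by blast
  then show ?thesis using A coordinates(1,2)[OF c] by cases auto
qed

lemma X_bound:
  assumes c: "c \<in> space dx" and A: "2 \<le> A" "\<And>k. k \<in> I2 \<Longrightarrow> \<bar>X c $ k\<bar> \<le> A" "i \<noteq> j \<Longrightarrow> \<bar>X c $ i\<bar> \<le> A"
  shows "\<bar>X c $ k\<bar> \<le> A"
proof -
  consider "k \<in> I2" | "k = j" | "k = i" "i \<noteq> j" | "k < j" using index_cases(2)[of k] by blast
  then show ?thesis using A coordinates(3,4)[OF c] by cases (auto simp: frame_scale_def)
qed

definition pI1 :: "(real, 'n) vec \<Rightarrow> (real, 'n) vec" where "pI1 v = (\<chi> k. if k \<in> I1 then v $ k else 0)"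

definition pI2 :: "(real, 'n) vec \<Rightarrow> (real, 'n) vec" where "pI2 v = (\<chi> k. if k \<in> I2 then v $ k else 0)"

text \<open>A product of shears carrying the base coset to the point with prescribed free
  coordinates. It depends continuously on them, so bounded sets of cosets lie in images of compact
  sets.\<close>

definition cell_section :: "(real, 'n) vec \<Rightarrow> (real, 'n) vec \<Rightarrow> 'n sqmat"
  where "cell_section v x = b ** shear (pI1 v) (axis i 1) ** matrix_inv b **
    (b ** shear (axis j (- (1 / frame_scale i j))) (pI2 x) ** matrix_inv b **
    (b ** shear (axis j (if i = j then 0 else v $ j - 1)) (axis i 1) ** matrix_inv b))"

lemma cell_section_unitri:
  "unitri (shear (pI1 v) (axis i 1))" "axis i 1 \<bullet> pI1 v = 0"
  "unitri (shear (axis j s) (pI2 x))" "pI2 x \<bullet> axis j s = 0"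
  "unitri (shear (axis j (if i = j then 0 else t)) (axis i 1))"
  "axis i 1 \<bullet> (axis j (if i = j then 0 else t) :: (real, 'n) vec) = 0"
proof -
  show "unitri (shear (pI1 v) (axis i 1))"
    by (intro unitri_shear) (auto simp: pI1_def I1_def axis_nth split: if_splits)
  show "unitri (shear (axis j s) (pI2 x))"
    by (intro unitri_shear) (auto simp: pI2_def I2_def axis_nth split: if_splits)
  show "unitri (shear (axis j (if i = j then 0 else t)) (axis i 1))"
    using b(2) by (intro unitri_shear) (auto simp: axis_nth split: if_splits)
  show "axis i 1 \<bullet> pI1 v = 0" by (simp add: inner_axis' pI1_def I1_def)
  show "pI2 x \<bullet> axis j s = 0" by (simp add: inner_axis pI2_def I2_def)
  show "axis i 1 \<bullet> (axis j (if i = j then 0 else t) :: (real, 'n) vec) = 0" by (auto simp: inner_axis_axis)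
qed

lemma cell_section_N: "cell_section v x \<in> N_of b"
  unfolding cell_section_def by (intro N_mult shear_N cell_section_unitri)

lemma N_coset_NH: "y \<in> NH \<Longrightarrow> N_coset y = NH"
proof -
  assume y: "y \<in> NH"
  note S = subgroup_SLD[OF NH_subgroup]
  have "invertible y" using y N_invertible by (auto simp: NH_def)
  then have "h = y ** (matrix_inv y ** h)" for h by (simp add: matrix_mul_assoc matrix_inv_right)
  then show ?thesis using S(3)[OF y] S(3)[OF S(4)[OF y]] unfolding N_coset_def l_coset_SL by blast
qed

lemma base_point:
  assumes c: "c \<in> space dx" "V c = eps i j" "X c = frame_scale i j *\<^sub>R eps i j" shows "c = NH"
proof -
  obtain y where y: "y \<in> N_of b" "c = N_coset y" using c by (auto simp: space_dx)
  have bw: "b *v eps i j = wvec" using fr by (simp add: frame_def)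
  have "b *v (matrix_inv b *v (y *v wvec)) = b *v eps i j" using c(2) y by (simp add: V_N_coset)
  then have 1: "y *v wvec = wvec" using b(1) bw by (simp add: matrix_inv_mult_vec)
  have "((wvec v* matrix_inv y) v* b) v* matrix_inv b = (wvec v* b) v* matrix_inv b"
    using c(3) y by (simp add: X_N_coset b)
  then have 2: "wvec v* matrix_inv y = wvec" using b(1) by (simp add: vec_mult_matrix_inv)
  have "proj y = proj (mat 1)" by (simp add: proj_def 1 2 matrix_inv_one)
  then have "y \<in> NH" using H_grp_iff[OF n2 N_SL[OF y(1)]] y(1) by (simp add: NH_def)
  then show ?thesis using N_coset_NH y by simp
qed

lemma act_inverse:
  assumes "v \<bullet> u = 0" shows "c = (b ** shear u v ** matrix_inv b) <#\<^bsub>SL\<^esub> act (- u) v c"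
proof -
  have "b ** shear u v ** matrix_inv b ** (b ** shear (- u) v ** matrix_inv b) =
      b ** (shear u v ** ((matrix_inv b ** b) ** shear (- u) v)) ** matrix_inv b"
    by (simp only: matrix_mul_assoc)
  also have "\<dots> = mat 1" using b(1) by (simp add: matrix_inv_left shear_inverse[OF assms] matrix_inv_right)
  finally show ?thesis by (simp add: act_def l_coset_SL image_image matrix_mul_assoc)
qed

text \<open>Undo the three shears in turn: the first clears \<open>V\<close> on \<open>I1\<close>,
  the second clears \<open>X\<close> on \<open>I2\<close>, the third sets \<open>V\<close> at
  \<open>j\<close> to 1. The result has the coordinates of the base coset.\<close>

lemma N_coset_cell_section:
  assumes c: "c \<in> space dx" shows "c = N_coset (cell_section (V c) (X c))"
proof -
  note co = coordinates[OF c]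
  define t where "t = (if i = j then 0 else V c $ j - 1)"
  define c1 where "c1 = act (- pI1 (V c)) (axis i 1) c"
  define c2 where "c2 = act (- axis j (- (1 / frame_scale i j))) (pI2 (X c)) c1"
  define c3 where "c3 = act (- axis j t) (axis i 1) c2"
  have neg: "- axis j s = (axis j (- s) :: (real, 'n) vec)" for s by (auto simp: axis_def vec_eq_iff)
  have pneg: "- pI1 v = pI1 (- v)" for v by (auto simp: pI1_def vec_eq_iff)
  have u1: "unitri (shear (- pI1 (V c)) (axis i 1))" "axis i 1 \<bullet> - pI1 (V c) = 0"
    unfolding pneg using cell_section_unitri by auto
  have u2: "unitri (shear (- axis j (- (1 / frame_scale i j))) (pI2 (X c)))" "pI2 (X c) \<bullet> - axis j (- (1 / frame_scale i j)) = 0"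
    unfolding neg using cell_section_unitri by auto
  have tn: "- axis j t = (axis j (if i = j then 0 else 1 - V c $ j) :: (real, 'n) vec)"
    by (auto simp: t_def axis_def vec_eq_iff)
  have u3: "unitri (shear (- axis j t) (axis i 1))" "axis i 1 \<bullet> - axis j t = 0"
    unfolding tn using cell_section_unitri by auto
  have s1: "c1 \<in> space dx" unfolding c1_def using act_coordinates[OF u1 c] by simp
  have s2: "c2 \<in> space dx" unfolding c2_def using act_coordinates[OF u2 s1] by simp
  have s3: "c3 \<in> space dx" unfolding c3_def using act_coordinates[OF u3 s2] by simp
  have "axis i 1 \<bullet> V c = 1" using co(1) by (simp add: inner_axis')
  then have V1: "V c1 = V c - pI1 (V c)" using act_coordinates(1)[OF u1 c] by (simp add: c1_def)
  have X1: "X c1 $ l = X c $ l" if "l \<noteq> i" for l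
    using act_coordinates(2)[OF u1 c] that by (simp add: c1_def axis_nth)
  \<comment> \<open>After the first step \<open>V\<close> is supported on \<open>i\<close> and
    \<open>j\<close>, and \<open>I2\<close> contains neither; so the second shear leaves
    \<open>V\<close> alone.\<close>
  have "pI2 (X c) \<bullet> V c1 = 0"
    unfolding inner_vec_def
  proof (rule sum.neutral, rule)
    fix k show "pI2 (X c) $ k \<bullet> V c1 $ k = 0"
      using co(2)[of k] by (cases "i < k") (auto simp: pI2_def V1 pI1_def I1_def I2_def)
  qed
  then have V2: "V c2 = V c1" using act_coordinates(1)[OF u2 s1] by (simp add: c2_def)
  have "X c1 \<bullet> - axis j (- (1 / frame_scale i j)) = 1"
    unfolding neg using coordinates(3)[OF s1] frame_scale_pos[of i j] by (simp add: inner_axis)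
  then have X2: "X c2 = X c1 - pI2 (X c)" using act_coordinates(2)[OF u2 s1] by (simp add: c2_def)
  have "axis i 1 \<bullet> V c2 = 1" using coordinates(1)[OF s2] by (simp add: inner_axis')
  then have V3: "V c3 = V c2 - axis j t" using act_coordinates(1)[OF u3 s2] by (simp add: c3_def)
  have "X c2 \<bullet> - axis j t = - (frame_scale i j * t)"
    using coordinates(3)[OF s2] by (simp add: inner_axis)
  then have X3: "X c3 = X c2 + (frame_scale i j * t) *\<^sub>R axis i 1"
    using act_coordinates(2)[OF u3 s2] by (simp add: c3_def)
  have Ve: "V c3 = eps i j"
    unfolding vec_eq_iff
  proof
    fix k
    consider "k \<in> I1" | "k = i" | "k = j" "i \<noteq> j" | "i < k" using index_cases(1)[of k] by blast
    then show "V c3 $ k = eps i j $ k"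
      using co(1,2) b(2) by cases (auto simp: V3 V2 V1 pI1_def I1_def t_def axis_nth eps_component)
  qed
  have Xk: "X c3 $ k = frame_scale i j * eps i j $ k" if ki: "k \<noteq> i \<or> i = j" for k
  proof -
    consider "k \<in> I2" | "k = j" | "k < j" using ki index_cases(2)[of k] by blast
    then show ?thesis
    proof cases
      case 1
      then have "k \<noteq> i" "k \<noteq> j" by (auto simp: I2_def)
      then show ?thesis using 1 X1[of k] by (simp add: X3 X2 pI2_def axis_nth eps_component)
    next
      case 2
      then show ?thesis using coordinates(3)[OF s3] by (simp add: eps_component)
    next
      case 3
      then show ?thesis using coordinates(4)[OF s3, of k] b(2) by (auto simp: eps_component)
    qed
  qed
  \<comment> \<open>No shear prescribes this entry; with \<open>V\<close> already equal to
    \<open>eps i j\<close>, the relation between \<open>X\<close> and \<open>V\<close> determines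
    it.\<close>
  have "X c3 $ i = frame_scale i j * eps i j $ i"
  proof (cases "i = j")
    case False
    have "2 = (\<Sum>k\<in>{i, j}. X c3 $ k * eps i j $ k)"
      unfolding coordinates(5)[OF s3, symmetric] Ve
      by (intro sum.mono_neutral_right) (auto simp: eps_component)
    then show ?thesis using False coordinates(3)[OF s3] by (simp add: eps_component frame_scale_def)
  qed (use Xk in auto)
  then have "X c3 = frame_scale i j *\<^sub>R eps i j" using Xk by (auto simp: vec_eq_iff) metis
  then have "c3 = NH" using base_point s3 Ve by blast
  then have "c2 = N_coset (b ** shear (axis j t) (axis i 1) ** matrix_inv b)"
    using act_inverse[of "axis i 1" "axis j t" c2] u3(2) by (simp add: N_coset_def c3_def)
  then have "c1 = N_coset (b ** shear (axis j (- (1 / frame_scale i j))) (pI2 (X c)) ** matrix_inv b **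
     (b ** shear (axis j t) (axis i 1) ** matrix_inv b))"
    using act_inverse[of "pI2 (X c)" "axis j (- (1 / frame_scale i j))" c1] u2(2)
    by (simp add: N_coset_def c2_def l_coset_SL_assoc)
  then show ?thesis
    using act_inverse[of "axis i 1" "pI1 (V c)" c] u1(2)
    by (simp add: N_coset_def c1_def l_coset_SL_assoc cell_section_def t_def)
qed

lemma continuous_on_shear:
  fixes u v :: "'z::topological_space \<Rightarrow> (real, 'n) vec"
  assumes "continuous_on T u" "continuous_on T v"
  shows "continuous_on T (\<lambda>z. shear (u z) (v z))"
  unfolding shear_def outer_def
  by (intro continuous_on_add continuous_on_const continuous_on_vec_lambda continuous_on_mult
      continuous_on_component assms)

lemma continuous_cell_section: "continuous_on T (\<lambda>z. cell_section (fst z) (snd z))"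
proof -
  have p: "continuous_on T (\<lambda>z. pI1 (fst z))" "continuous_on T (\<lambda>z. pI2 (snd z))"
  proof -
    have "continuous_on T (\<lambda>z. if k \<in> A then fst z $ k else 0)" "continuous_on T (\<lambda>z. if k \<in> A then snd z $ k else 0)"
      for k :: 'n and A by (cases "k \<in> A"; auto intro!: continuous_intros)+
    then show "continuous_on T (\<lambda>z. pI1 (fst z))" "continuous_on T (\<lambda>z. pI2 (snd z))"
      unfolding pI1_def pI2_def by (auto intro!: continuous_on_vec_lambda)
  qed
  have a: "continuous_on T (\<lambda>z. axis j (if i = j then 0 else fst z $ j - 1))"
  proof -
    have "continuous_on T (\<lambda>z. if l = j then if i = j then 0 else fst z $ j - 1 else 0)" for l
      by (cases "l = j"; cases "i = j") (auto intro!: continuous_intros)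
    then show ?thesis unfolding axis_def by (intro continuous_on_vec_lambda)
  qed
  show ?thesis
    unfolding cell_section_def by (intro continuous_on_matrix_mult continuous_on_const continuous_on_shear p a)
qed

text \<open>The cell lies in a set of bounded coordinates, which is closed and contained in the
  image of a compact set under the section. A Radon measure is finite on compact sets.\<close>

lemma kappa_finite: "kappa < \<infinity>"
proof -
  let ?T = "coset_topology (N_of b) NH"
  \<comment> \<open>On the base cell and strip all entries of \<open>V\<close> are at most 1 and
    those of \<open>X\<close> at most 2 in size, except \<open>X\<close> at \<open>i\<close>, which
    is at most 2 + n; the value chosen leaves room.\<close>
  define R where "R = real CARD('n) + 4"
  define K where "K = {c \<in> space dx. \<forall>k. \<bar>V c $ k\<bar> \<le> R \<and> \<bar>X c $ k\<bar> \<le> R}"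
  have "closedin ?T K"
    unfolding closedin_def topspace_T
  proof
    show "K \<subseteq> N_coset ` N_of b" by (auto simp: K_def space_dx)
    define W where "W = {z :: (real, 'n) vec \<times> (real, 'n) vec. \<not> (\<forall>k. \<bar>fst z $ k\<bar> \<le> R \<and> \<bar>snd z $ k\<bar> \<le> R)}"
    have "open W"
    proof -
      have "W = (\<Union>k. {z. R < \<bar>fst z $ k\<bar>} \<union> {z. R < \<bar>snd z $ k\<bar>})" by (auto simp: W_def not_le)
      moreover have "open {z :: (real, 'n) vec \<times> (real, 'n) vec. R < \<bar>fst z $ k\<bar>}"
        "open {z :: (real, 'n) vec \<times> (real, 'n) vec. R < \<bar>snd z $ k\<bar>}" for k
        by (intro open_Collect_less continuous_intros)+
      ultimately show ?thesis by auto
    qed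
    then have "openin (top_of_set (N_of b)) (N_of b \<inter> (\<lambda>x. (V (N_coset x), X (N_coset x))) -` W)"
      by (intro continuous_openin_preimage_gen continuous_on_Pair continuous_V continuous_X)
    moreover have "{x \<in> N_of b. N_coset x \<in> N_coset ` N_of b - K} = N_of b \<inter> (\<lambda>x. (V (N_coset x), X (N_coset x))) -` W"
      by (auto simp: K_def W_def space_dx)
    ultimately show "openin ?T (N_coset ` N_of b - K)" unfolding openin_T by auto
  qed
  define \<rho> where "\<rho> = real CARD('n) * R"
  define S where "S = (cball 0 \<rho> \<times> cball 0 \<rho> :: ((real, 'n) vec \<times> (real, 'n) vec) set)"
  have "compact ((\<lambda>z. cell_section (fst z) (snd z)) ` S)"
    unfolding S_def by (intro compact_continuous_image continuous_cell_section compact_Times compact_cball)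
  then have "compactin (top_of_set (N_of b)) ((\<lambda>z. cell_section (fst z) (snd z)) ` S)"
    using cell_section_N by (auto simp: compactin_subtopology)
  moreover have "continuous_map (top_of_set (N_of b)) ?T N_coset"
    unfolding continuous_map topspace_T using openin_T by auto
  ultimately have "compactin ?T (N_coset ` (\<lambda>z. cell_section (fst z) (snd z)) ` S)" by (rule image_compactin)
  moreover have "K \<subseteq> N_coset ` (\<lambda>z. cell_section (fst z) (snd z)) ` S"
  proof
    fix c assume c: "c \<in> K"
    then have cs: "c \<in> space dx" by (simp add: K_def)
    have nb: "norm y \<le> \<rho>" if "\<And>k. \<bar>y $ k\<bar> \<le> R" for y :: "(real, 'n) vec"
    proof -
      have "norm y \<le> (\<Sum>k\<in>UNIV. \<bar>y $ k\<bar>)" by (rule norm_le_l1_cart)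
      also have "\<dots> \<le> (\<Sum>k\<in>(UNIV::'n set). R)" by (intro sum_mono that)
      finally show ?thesis by (simp add: \<rho>_def)
    qed
    have "(V c, X c) \<in> S" using c nb by (simp add: S_def K_def)
    then show "c \<in> N_coset ` (\<lambda>z. cell_section (fst z) (snd z)) ` S"
      using N_coset_cell_section[OF cs] by (intro image_eqI[of _ _ "cell_section (V c) (X c)"] image_eqI[of _ _ "(V c, X c)"]) auto
  qed
  ultimately have "compactin ?T K" using \<open>closedin ?T K\<close> by (rule closed_compactin)
  then have "emeasure dx K < \<infinity>" using radon by (simp add: radon_measure_on_def flip: NH_def)
  moreover have "K \<in> sets dx"
    unfolding K_def by measurable
  moreover have "cell (\<lambda>_. 0) (\<lambda>_. 0) \<inter> strip (\<lambda>c. V c $ j) 0 \<subseteq> K"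
  proof
    fix c assume c: "c \<in> cell (\<lambda>_. 0) (\<lambda>_. 0) \<inter> strip (\<lambda>c. V c $ j) 0"
    then have cs: "c \<in> space dx" by (simp add: cell_def)
    have fl: "\<bar>x\<bar> \<le> 1" if "\<lfloor>x\<rfloor> = 0" for x :: real using that by linarith
    have V1: "\<bar>V c $ k\<bar> \<le> 1" for k
      by (rule V_bound[OF cs]) (use c in \<open>auto simp: cell_def strip_def intro!: fl\<close>)
    have X1: "\<bar>X c $ k\<bar> \<le> 1" if ki: "k \<noteq> i" "i \<noteq> j" for k
    proof -
      consider "k \<in> I2" | "k = j" | "k < j" using ki index_cases(2)[of k] by blast
      then show ?thesis
        using c coordinates(3,4)[OF cs] ki by cases (auto simp: cell_def frame_scale_def intro!: fl)
    qed
    have "\<bar>X c $ i\<bar> \<le> R" if "i \<noteq> j"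
    proof -
      have "(\<Sum>k\<in>UNIV - {i}. \<bar>X c $ k\<bar> * \<bar>V c $ k\<bar>) \<le> (\<Sum>k\<in>UNIV - {i}. 1)"
        using V1 X1 that by (intro sum_mono) (auto intro: mult_le_one)
      also have "\<dots> \<le> real CARD('n)" by simp
      finally show ?thesis using X_i_bound[OF cs] by (simp add: R_def)
    qed
    moreover have "\<bar>X c $ k\<bar> \<le> R" if "k \<in> I2" for k
      using c that fl[of "X c $ k"] by (auto simp: cell_def R_def)
    ultimately have "\<bar>X c $ k\<bar> \<le> R" for k by (rule_tac X_bound[OF cs]) (simp_all add: R_def)
    moreover have "\<bar>V c $ k\<bar> \<le> R" for k using V1[of k] by (simp add: R_def)
    ultimately show "c \<in> K" using cs by (simp add: K_def)
  qed
  ultimately show ?thesis unfolding kappa_def using emeasure_mono by (metis infinity_ennreal_def le_less_trans)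
qed

end

section \<open>Lattice points under a hyperbola\<close>

text \<open>For fixed nonzero \<open>a\<close> there are at most 14 T / |a| + 1 values of
  \<open>c\<close>, and the harmonic sum gives the factor 1 + x. The constant 33 collects 3 for
  \<open>a = 0\<close>, 28 from both signs of \<open>a\<close>, and 2 for the summands 1, of which
  there are at most 2 T.\<close>

lemma card_hyperbola_aux:
  fixes T x :: nat
  assumes T: "2 ^ x \<le> T"
  shows "real (card {(a :: int, c :: int). \<bar>a\<bar> \<le> 2 ^ x \<and> \<bar>c\<bar> \<le> int T \<and> \<bar>a * c\<bar> \<le> 7 * int T}) \<le> 33 * real T * (1 + real x)"
proof -
  let ?R = "2 ^ x :: nat"
  let ?H = "{(a :: int, c :: int). \<bar>a\<bar> \<le> 2 ^ x \<and> \<bar>c\<bar> \<le> int T \<and> \<bar>a * c\<bar> \<le> 7 * int T}"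
  have T1: "T \<ge> 1" using T by (metis le_trans one_le_numeral one_le_power)
  \<comment> \<open>Each dyadic block of denominators contributes at most 1.\<close>
  have harm: "(\<Sum>a\<in>{1..2 ^ x}. 1 / real a) \<le> 1 + real x" for x
  proof (induction x)
    case (Suc x)
    have "{1..2 ^ Suc x} = {1..2 ^ x} \<union> {2 ^ x + 1..2 ^ Suc x :: nat}" by auto
    then have "(\<Sum>a\<in>{1..2 ^ Suc x}. 1 / real a) = (\<Sum>a\<in>{1..2 ^ x}. 1 / real a) + (\<Sum>a\<in>{2 ^ x + 1..2 ^ Suc x}. 1 / real a)"
      by (simp only:) (intro sum.union_disjoint, auto)
    also have "(\<Sum>a\<in>{2 ^ x + 1..2 ^ Suc x}. 1 / real a) \<le> (\<Sum>a\<in>{2 ^ x + 1..2 ^ Suc x :: nat}. 1 / 2 ^ x)"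
    proof (intro sum_mono divide_left_mono)
      fix a assume "a \<in> {2 ^ x + 1..2 ^ Suc x :: nat}"
      then have "2 ^ x \<le> a" by simp
      then have "real (2 ^ x) \<le> real a" by (rule of_nat_mono)
      then show "2 ^ x \<le> real a" by simp
    qed auto
    also have "\<dots> = 1" by simp
    finally show ?case using Suc by simp
  qed simp
  define P where "P a = (if a = 0 then {- int T..int T} else {- (7 * int T div \<bar>a\<bar>)..7 * int T div \<bar>a\<bar>})" for a
  have sub: "?H \<subseteq> Sigma {- int ?R..int ?R} P"
  proof
    fix z assume "z \<in> ?H"
    then obtain a c where z: "z = (a, c)" "\<bar>a\<bar> \<le> 2 ^ x" "\<bar>c\<bar> \<le> int T" "\<bar>a * c\<bar> \<le> 7 * int T" by blast
    have "\<bar>c\<bar> \<le> 7 * int T div \<bar>a\<bar>" if "a \<noteq> 0"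
    proof -
      have "\<bar>c\<bar> * \<bar>a\<bar> \<le> 7 * int T" using z by (simp add: abs_mult mult.commute)
      then show ?thesis using that by (simp add: zdiv_mono1 [of "\<bar>c\<bar> * \<bar>a\<bar>" "7 * int T" "\<bar>a\<bar>", simplified])
    qed
    then have "c \<in> P a" using z by (auto simp: P_def)
    moreover have "a \<in> {- int ?R..int ?R}" using z by auto
    ultimately show "z \<in> Sigma {- int ?R..int ?R} P" using z by blast
  qed
  have finP: "finite (P a)" for a by (simp add: P_def)
  have "card ?H \<le> card (Sigma {- int ?R..int ?R} P)" by (rule card_mono[OF _ sub]) (simp add: finP)
  also have "\<dots> = (\<Sum>a\<in>{- int ?R..int ?R}. card (P a))" by (simp add: finP)
  finally have "real (card ?H) \<le> (\<Sum>a\<in>{- int ?R..int ?R}. real (card (P a)))" by (simp flip: of_nat_sum)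
  also have "\<dots> \<le> (\<Sum>a\<in>{- int ?R..int ?R}. (if a = 0 then 3 * real T else 14 * real T / \<bar>real_of_int a\<bar> + 1))"
  proof (intro sum_mono)
    fix a :: int
    show "real (card (P a)) \<le> (if a = 0 then 3 * real T else 14 * real T / \<bar>real_of_int a\<bar> + 1)"
    proof (cases "a = 0")
      case True then show ?thesis using T1 by (simp add: P_def)
    next
      case False
      have q0: "7 * int T div \<bar>a\<bar> \<ge> 0" using False by (simp add: pos_imp_zdiv_nonneg_iff)
      have "real_of_int (7 * int T div \<bar>a\<bar>) \<le> real_of_int (7 * int T) / real_of_int \<bar>a\<bar>" by (rule real_of_int_div4)
      moreover have "real (card (P a)) = 2 * real_of_int (7 * int T div \<bar>a\<bar>) + 1" using False q0 by (simp add: P_def)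
      ultimately show ?thesis using False by simp
    qed
  qed
  also have "\<dots> = 3 * real T + 2 * (\<Sum>a\<in>{1..?R}. 14 * real T / real a + 1)"
  proof -
    let ?f = "\<lambda>a. (if a = 0 then 3 * real T else 14 * real T / \<bar>real_of_int a\<bar> + 1)"
    have s: "{- int ?R..int ?R} = {0} \<union> (int ` {1..?R} \<union> (\<lambda>a. - int a) ` {1..?R})"
    proof (intro equalityI subsetI)
      fix a assume a: "a \<in> {- int ?R..int ?R}"
      consider "a = 0" | "a > 0" | "a < 0" by linarith
      then show "a \<in> {0} \<union> (int ` {1..?R} \<union> (\<lambda>a. - int a) ` {1..?R})"
      proof cases
        case 2
        then have "a = int (nat a)" "nat a \<in> {1..?R}" using a by (auto simp: nat_le_iff le_nat_iff)
        then show ?thesis by blast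
      next
        case 3
        then have "a = - int (nat (- a))" "nat (- a) \<in> {1..?R}" using a by (auto simp: nat_le_iff le_nat_iff)
        then show ?thesis by blast
      qed auto
    next
      have key: "int n \<le> 2 ^ x" if "n \<le> 2 ^ x" for n
      proof -
        have "int n \<le> int (2 ^ x)" using that by (simp only: of_nat_le_iff)
        then show ?thesis by simp
      qed
      fix a assume "a \<in> {0} \<union> (int ` {1..?R} \<union> (\<lambda>a. - int a) ` {1..?R})"
      then have "\<bar>a\<bar> \<le> 2 ^ x" using key by auto
      then show "a \<in> {- int ?R..int ?R}" by auto
    qed
    have "sum ?f {- int ?R..int ?R} = sum ?f {0} + (sum ?f (int ` {1..?R}) + sum ?f ((\<lambda>a. - int a) ` {1..?R}))"
      unfolding s by (subst sum.union_disjoint; (subst sum.union_disjoint)?) auto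
    also have "sum ?f (int ` {1..?R}) = (\<Sum>a\<in>{1..?R}. 14 * real T / real a + 1)"
      by (subst sum.reindex) (auto simp: inj_on_def)
    also have "sum ?f ((\<lambda>a. - int a) ` {1..?R}) = (\<Sum>a\<in>{1..?R}. 14 * real T / real a + 1)"
      by (subst sum.reindex) (auto simp: inj_on_def)
    finally show ?thesis by simp
  qed
  also have "(\<Sum>a\<in>{1..?R}. 14 * real T / real a + 1) = 14 * real T * (\<Sum>a\<in>{1..?R}. 1 / real a) + real ?R"
    by (simp add: sum.distrib sum_distrib_left)
  also have "\<dots> \<le> 14 * real T * (1 + real x) + real T"
    using harm[of x] T by (intro add_mono mult_left_mono of_nat_mono) auto
  finally have "real (card ?H) \<le> 3 * real T + 2 * (14 * real T * (1 + real x) + real T)" by simp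
  also have "\<dots> \<le> 33 * real T * (1 + real x)" by (simp add: algebra_simps)
  finally show ?thesis .
qed

lemma card_hyperbola:
  fixes x y :: nat
  shows "real (card {(a :: int, c :: int). \<bar>a\<bar> \<le> 2 ^ x \<and> \<bar>c\<bar> \<le> 2 ^ y \<and> \<bar>a * c\<bar> \<le> 7 * max (2 ^ x) (2 ^ y)})
    \<le> 33 * max (2 ^ x) (2 ^ y) * (1 + real x + real y)"
proof (cases "x \<le> y")
  case True
  then have m: "max (2 ^ x) (2 ^ y) = (2 ^ y :: int)" "max (2 ^ x) (2 ^ y) = (2 ^ y :: real)" by (auto simp: max_def)
  have "real (card {(a :: int, c :: int). \<bar>a\<bar> \<le> 2 ^ x \<and> \<bar>c\<bar> \<le> int (2 ^ y) \<and> \<bar>a * c\<bar> \<le> 7 * int (2 ^ y)}) \<le> 33 * real (2 ^ y) * (1 + real x)"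
    using True by (intro card_hyperbola_aux) simp
  also have "\<dots> \<le> 33 * real (2 ^ y) * (1 + real x + real y)" by (intro mult_left_mono) auto
  finally show ?thesis unfolding m by simp
next
  case False
  then have m: "max (2 ^ x) (2 ^ y) = (2 ^ x :: int)" "max (2 ^ x) (2 ^ y) = (2 ^ x :: real)" by (auto simp: max_def)
  have "bij_betw prod.swap {(a :: int, c :: int). \<bar>a\<bar> \<le> 2 ^ x \<and> \<bar>c\<bar> \<le> 2 ^ y \<and> \<bar>a * c\<bar> \<le> 7 * 2 ^ x}
      {(a :: int, c :: int). \<bar>a\<bar> \<le> 2 ^ y \<and> \<bar>c\<bar> \<le> 2 ^ x \<and> \<bar>a * c\<bar> \<le> 7 * 2 ^ x}"
    by (intro bij_betwI[of _ _ _ prod.swap]) (auto simp: mult.commute)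
  then have "card {(a :: int, c :: int). \<bar>a\<bar> \<le> 2 ^ x \<and> \<bar>c\<bar> \<le> 2 ^ y \<and> \<bar>a * c\<bar> \<le> 7 * 2 ^ x} =
      card {(a :: int, c :: int). \<bar>a\<bar> \<le> 2 ^ y \<and> \<bar>c\<bar> \<le> 2 ^ x \<and> \<bar>a * c\<bar> \<le> 7 * 2 ^ x}" by (rule bij_betw_same_card)
  moreover have "real (card {(a :: int, c :: int). \<bar>a\<bar> \<le> 2 ^ y \<and> \<bar>c\<bar> \<le> int (2 ^ x) \<and> \<bar>a * c\<bar> \<le> 7 * int (2 ^ x)}) \<le> 33 * real (2 ^ x) * (1 + real x + real y)"
  proof (rule order_trans)
    show "real (card {(a :: int, c :: int). \<bar>a\<bar> \<le> 2 ^ y \<and> \<bar>c\<bar> \<le> int (2 ^ x) \<and> \<bar>a * c\<bar> \<le> 7 * int (2 ^ x)}) \<le> 33 * real (2 ^ x) * (1 + real y)"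
      using False by (intro card_hyperbola_aux) simp
  qed (intro mult_left_mono, auto)
  ultimately show ?thesis unfolding m by simp
qed

text \<open>The minimum is at most R, T and the root of R T; it supplies whichever factor makes the
  two exponents equal.\<close>

lemma power_balance:
  fixes R T :: real
  assumes RT: "R \<ge> 0" "T \<ge> 0" and ac: "a \<le> c + 1" "c \<le> a + 1"
  shows "R ^ a * T ^ c * min R T \<le> sqrt (R * T) ^ (a + c + 1)"
proof -
  have sq: "sqrt (R * T) ^ (2 * k) = R ^ k * T ^ k" for k
    using RT by (simp add: power_mult power_mult_distrib)
  consider "a = c" | "a = c + 1" | "c = a + 1" using ac by linarith
  then show ?thesis
  proof cases
    case 1
    have "min R T * min R T \<le> R * T" using RT by (intro mult_mono) auto
    then have "min R T \<le> sqrt (R * T)" using RT by (intro real_le_rsqrt) (simp add: power2_eq_square)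
    then have "R ^ a * T ^ a * min R T \<le> R ^ a * T ^ a * sqrt (R * T)" using RT by (intro mult_left_mono) auto
    also have "\<dots> = sqrt (R * T) ^ (2 * a + 1)" by (simp add: sq)
    finally show ?thesis using 1 by (simp add: mult_2)
  next
    case 2
    have "R ^ a * T ^ c * min R T \<le> R ^ a * T ^ c * T" using RT by (intro mult_left_mono) auto
    also have "\<dots> = sqrt (R * T) ^ (2 * a)" unfolding sq by (simp add: 2)
    finally show ?thesis using 2 by (simp add: mult_2)
  next
    case 3
    have "R ^ a * T ^ c * min R T \<le> R ^ a * T ^ c * R" using RT by (intro mult_left_mono) auto
    also have "\<dots> = sqrt (R * T) ^ (2 * c)" unfolding sq by (simp add: 3)
    finally show ?thesis using 3 by (simp add: mult_2)
  qed
qed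

section \<open>Volume estimates\<close>

context orbit
begin

text \<open>The norm of a rank one matrix is the product of the norms of its factors, and these
  differ from \<open>V\<close> and \<open>X\<close> by the fixed change of basis.\<close>

lemma norm_proj_bounds:
  obtains K where "K \<ge> 1" "\<And>x. x \<in> N_of b \<Longrightarrow> norm (V (N_coset x)) * norm (X (N_coset x)) \<le> K * norm (proj x)"
    "\<And>x. x \<in> N_of b \<Longrightarrow> norm (proj x) \<le> K * (norm (V (N_coset x)) * norm (X (N_coset x)))"
proof -
  have bnd: "\<exists>K>0. \<forall>y. norm (A *v y) \<le> K * norm y" for A :: "'n sqmat"
    using bounded_linear.pos_bounded[OF matrix_vector_mul_bounded_linear[of A]] by (metis mult.commute)
  have bnd': "\<exists>K>0. \<forall>y. norm (y v* A) \<le> K * norm y" for A :: "'n sqmat"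
    using bnd[of "transpose A"] by simp
  obtain K1 where K1: "K1 > 0" "\<And>y. norm (b *v y) \<le> K1 * norm y" using bnd by blast
  obtain K2 where K2: "K2 > 0" "\<And>y. norm (matrix_inv b *v y) \<le> K2 * norm y" using bnd by blast
  obtain K3 where K3: "K3 > 0" "\<And>y. norm (y v* matrix_inv b) \<le> K3 * norm y" using bnd' by blast
  obtain K4 where K4: "K4 > 0" "\<And>y. norm (y v* b) \<le> K4 * norm y" using bnd' by blast
  let ?K = "1 + 2 * (K2 * K4) + K1 * K3"
  have p: "K2 * K4 > 0" "K1 * K3 > 0" using K1 K2 K3 K4 by auto
  show ?thesis
  proof (rule that[of ?K])
    show "?K \<ge> 1" using p by simp
    fix x assume x: "x \<in> N_of b"
    have n: "norm (proj x) = norm (x *v wvec) * norm (wvec v* matrix_inv x) / 2"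
      by (simp add: proj_def norm_outer)
    have v: "norm (V (N_coset x)) \<le> K2 * norm (x *v wvec)" "norm (X (N_coset x)) \<le> K4 * norm (wvec v* matrix_inv x)"
      using K2(2) K4(2) x by (simp_all add: V_N_coset X_N_coset)
    have "norm (V (N_coset x)) * norm (X (N_coset x)) \<le> (K2 * norm (x *v wvec)) * (K4 * norm (wvec v* matrix_inv x))"
      using v K2(1) by (intro mult_mono) auto
    also have "\<dots> = 2 * (K2 * K4) * norm (proj x)" by (simp add: n)
    also have "\<dots> \<le> ?K * norm (proj x)" using p by (intro mult_right_mono) auto
    finally show "norm (V (N_coset x)) * norm (X (N_coset x)) \<le> ?K * norm (proj x)" .
    have "x *v wvec = b *v V (N_coset x)" "wvec v* matrix_inv x = X (N_coset x) v* matrix_inv b"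
      using b(1) x by (simp_all add: V_N_coset X_N_coset matrix_inv_mult_vec vec_mult_matrix_inv)
    then have w: "norm (x *v wvec) \<le> K1 * norm (V (N_coset x))" "norm (wvec v* matrix_inv x) \<le> K3 * norm (X (N_coset x))"
      using K1(2) K3(2) by auto
    have "norm (proj x) \<le> norm (x *v wvec) * norm (wvec v* matrix_inv x)" by (simp add: n)
    also have "\<dots> \<le> (K1 * norm (V (N_coset x))) * (K3 * norm (X (N_coset x)))" using w K1(1) by (intro mult_mono) auto
    also have "\<dots> = K1 * K3 * (norm (V (N_coset x)) * norm (X (N_coset x)))" by simp
    also have "\<dots> \<le> ?K * (norm (V (N_coset x)) * norm (X (N_coset x)))" using p by (intro mult_right_mono) auto
    finally show "norm (proj x) \<le> ?K * (norm (V (N_coset x)) * norm (X (N_coset x)))" .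
  qed
qed

section \<open>Counting the cells that meet a box\<close>

definition floor_V :: "'n sqmat set \<Rightarrow> 'n \<Rightarrow> int" where "floor_V c = restrict (\<lambda>k. \<lfloor>V c $ k\<rfloor>) I1"

definition floor_X :: "'n sqmat set \<Rightarrow> 'n \<Rightarrow> int" where "floor_X c = restrict (\<lambda>k. \<lfloor>X c $ k\<rfloor>) I2"

lemma in_cell: "c \<in> space dx \<Longrightarrow> c \<in> cell (floor_V c) (floor_X c)"
  by (auto simp: cell_def floor_V_def floor_X_def)

lemma volume_cover:
  fixes q :: nat
  assumes D: "D \<in> sets dx" and S: "finite S" "\<And>c. c \<in> D \<Longrightarrow> (floor_V c, floor_X c) \<in> S"
    and q: "\<And>\<alpha> \<beta>. emeasure dx (D \<inter> cell \<alpha> \<beta>) \<le> of_nat q * kappa"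
  shows "emeasure dx D \<le> of_nat (card S * q) * kappa"
proof -
  let ?F = "\<lambda>z. D \<inter> cell (fst z) (snd z)"
  have "D \<subseteq> (\<Union>z\<in>S. ?F z)"
  proof
    fix c assume c: "c \<in> D"
    then have "c \<in> space dx" using sets.sets_into_space[OF D] by blast
    then show "c \<in> (\<Union>z\<in>S. ?F z)" using S(2)[OF c] in_cell c by (intro UN_I[of "(floor_V c, floor_X c)"]) auto
  qed
  then have "emeasure dx D \<le> emeasure dx (\<Union>z\<in>S. ?F z)"
    using D cell_sets S(1) by (intro emeasure_mono) auto
  also have "\<dots> \<le> (\<Sum>z\<in>S. emeasure dx (?F z))"
    using D cell_sets S(1) by (intro emeasure_subadditive_finite) auto
  also have "\<dots> \<le> (\<Sum>z\<in>S. of_nat q * kappa)" by (intro sum_mono q)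
  finally show ?thesis by (simp add: mult.assoc)
qed

text \<open>Over one cell, a set on which the equivariant coordinate is at most \<open>R\<close> in
  size meets at most 2 R + 1 unit strips.\<close>

lemma volume_strip:
  assumes D: "D \<in> sets dx" and \<zeta>: "equivariant \<zeta>" "\<And>c. c \<in> D \<Longrightarrow> \<bar>\<zeta> c\<bar> \<le> real R"
  shows "emeasure dx (D \<inter> cell \<alpha> \<beta>) \<le> of_nat (2 * R + 1) * kappa"
proof -
  have m: "\<zeta> \<in> borel_measurable dx" using \<zeta>(1) by (simp add: equivariant_def)
  let ?I = "{- int R..int R}"
  have "D \<inter> cell \<alpha> \<beta> \<subseteq> (\<Union>m\<in>?I. cell \<alpha> \<beta> \<inter> strip \<zeta> m)"
  proof
    fix c assume c: "c \<in> D \<inter> cell \<alpha> \<beta>"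
    then have "c \<in> space dx" by (simp add: cell_def)
    moreover have "- real R \<le> \<zeta> c" "\<zeta> c \<le> real R" using \<zeta>(2)[of c] c by auto
    then have "\<lfloor>\<zeta> c\<rfloor> \<in> ?I" by (simp add: le_floor_iff floor_le_iff)
    ultimately show "c \<in> (\<Union>m\<in>?I. cell \<alpha> \<beta> \<inter> strip \<zeta> m)"
      using c by (intro UN_I[of "\<lfloor>\<zeta> c\<rfloor>"]) (auto simp: strip_def)
  qed
  then have "emeasure dx (D \<inter> cell \<alpha> \<beta>) \<le> emeasure dx (\<Union>m\<in>?I. cell \<alpha> \<beta> \<inter> strip \<zeta> m)"
    using cell_sets strip_sets[OF m] by (intro emeasure_mono) auto
  also have "\<dots> \<le> (\<Sum>m\<in>?I. emeasure dx (cell \<alpha> \<beta> \<inter> strip \<zeta> m))"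
    using cell_sets strip_sets[OF m] by (intro emeasure_subadditive_finite) auto
  also have "\<dots> = of_nat (card ?I) * kappa" by (simp add: cell_measure[OF \<zeta>(1)])
  also have "card ?I = 2 * R + 1" by simp
  finally show ?thesis .
qed

definition box :: "nat \<Rightarrow> nat \<Rightarrow> 'n sqmat set set"
  where "box R T = {c \<in> space dx. (\<forall>k. \<bar>V c $ k\<bar> \<le> real R) \<and> (\<forall>k. \<bar>X c $ k\<bar> \<le> real T)}"

lemma box_sets: "box R T \<in> sets dx"
  unfolding box_def by measurable

lemma floor_bound: "\<bar>x\<bar> \<le> real R \<Longrightarrow> \<lfloor>x\<rfloor> \<in> {- int R..int R}"
  by (simp add: le_floor_iff floor_le_iff) linarith

definition grid :: "nat \<Rightarrow> nat \<Rightarrow> (('n \<Rightarrow> int) \<times> ('n \<Rightarrow> int)) set"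
  where "grid R T = (PiE I1 (\<lambda>_. {- int R..int R})) \<times> (PiE I2 (\<lambda>_. {- int T..int T}))"

lemma box_grid: "c \<in> box R T \<Longrightarrow> (floor_V c, floor_X c) \<in> grid R T"
  using floor_bound by (auto simp: box_def grid_def floor_V_def floor_X_def)

lemma finite_grid: "finite (grid R T)"
  unfolding grid_def by (intro finite_cartesian_product finite_PiE) auto

lemma card_grid: "card (grid R T) = (2 * R + 1) ^ card I1 * (2 * T + 1) ^ card I2"
  unfolding grid_def by (simp add: card_cartesian_product card_PiE nat_add_distrib nat_mult_distrib)

lemma volume_equal:
  assumes ij: "i = j"
  shows "emeasure dx (box R T) \<le> of_nat ((2 * R + 1) ^ card I1 * (2 * T + 1) ^ card I2) * kappa"
proof -
  have "emeasure dx (box R T \<inter> cell \<alpha> \<beta>) \<le> of_nat 1 * kappa" for \<alpha> \<beta>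
  proof -
    have "emeasure dx (box R T \<inter> cell \<alpha> \<beta>) \<le> emeasure dx (cell \<alpha> \<beta> \<inter> strip (\<lambda>c. V c $ j) 0)"
      unfolding strip_def using ij cell_sets[of \<alpha> \<beta>]
      by (intro emeasure_mono) (auto simp: box_def intro: sets.Int)
    then show ?thesis by (simp add: cell_measure[OF equivariant_V])
  qed
  from volume_cover[OF box_sets finite_grid box_grid this] show ?thesis by (simp add: card_grid)
qed

text \<open>The extra direction can be measured by \<open>V\<close> at \<open>j\<close> or by
  \<open>X\<close> at \<open>i\<close>, so the smaller of the two radii bounds the number of
  strips.\<close>

lemma volume_strip_box: "emeasure dx (box R T \<inter> cell \<alpha> \<beta>) \<le> of_nat (2 * min R T + 1) * kappa"
proof (cases "R \<le> T")
  case True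
  then show ?thesis
    using volume_strip[OF box_sets equivariant_V, of R T R \<alpha> \<beta>] by (simp add: box_def min_def)
next
  case False
  then show ?thesis
    using volume_strip[OF box_sets equi_X, of R T T \<alpha> \<beta>] by (simp add: box_def min_def)
qed

lemma volume_general:
  "emeasure dx (box R T) \<le> of_nat ((2 * R + 1) ^ card I1 * (2 * T + 1) ^ card I2 * (2 * min R T + 1)) * kappa"
  using volume_cover[OF box_sets finite_grid box_grid volume_strip_box] by (simp add: card_grid)

text \<open>With one position \<open>m\<close> strictly between \<open>j\<close> and
  \<open>i\<close>, the plain count is too large. The relation between \<open>X\<close> and
  \<open>V\<close> bounds the product of the entries at \<open>m\<close> linearly in the radii, so
  that pair contributes lattice points under a hyperbola.\<close>

lemma volume_hyperbola:
  assumes m: "I1 \<inter> I2 = {m}" and ij: "i \<noteq> j" and R: "R \<ge> 1" "T \<ge> 1"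
  shows "emeasure dx (box R T) \<le> of_nat ((2 * R + 1) ^ (card I1 - 1) * (2 * T + 1) ^ (card I2 - 1) *
    card {(a :: int, c :: int). \<bar>a\<bar> \<le> int R \<and> \<bar>c\<bar> \<le> int T \<and> \<bar>a * c\<bar> \<le> 7 * max (int R) (int T)} * (2 * min R T + 1)) * kappa"
proof -
  let ?H = "{(a :: int, c :: int). \<bar>a\<bar> \<le> int R \<and> \<bar>c\<bar> \<le> int T \<and> \<bar>a * c\<bar> \<le> 7 * max (int R) (int T)}"
  let ?S = "{z \<in> grid R T. \<bar>fst z m * snd z m\<bar> \<le> 7 * max (int R) (int T)}"
  let ?G = "(PiE (I1 - {m}) (\<lambda>_. {- int R..int R})) \<times> (PiE (I2 - {m}) (\<lambda>_. {- int T..int T})) \<times> ?H"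
  let ?f = "\<lambda>z. (restrict (fst z) (I1 - {m}), restrict (snd z) (I2 - {m}), (fst z m, snd z m))"
  have mI: "m \<in> I1" "m \<in> I2" using m by auto
  have finH: "finite ?H" by (rule finite_subset[of _ "{- int R..int R} \<times> {- int T..int T}"]) auto
  have "card ?S \<le> card ?G"
  proof (rule card_inj_on_le)
    show "inj_on ?f ?S"
    proof (rule inj_onI)
      fix z z' assume z: "z \<in> ?S" "z' \<in> ?S" and eq: "?f z = ?f z'"
      have e: "fst z k = fst z' k" if "k \<in> I1" for k
        using eq that by (cases "k = m") (auto dest: fun_cong[of _ _ k])
      have e': "snd z k = snd z' k" if "k \<in> I2" for k
        using eq that by (cases "k = m") (auto dest: fun_cong[of _ _ k])
      have "fst z = fst z'" by (rule PiE_ext[of _ I1 "\<lambda>_. {- int R..int R}"]) (use z e in \<open>auto simp: grid_def\<close>)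
      moreover have "snd z = snd z'" by (rule PiE_ext[of _ I2 "\<lambda>_. {- int T..int T}"]) (use z e' in \<open>auto simp: grid_def\<close>)
      ultimately show "z = z'" by (simp add: prod_eq_iff)
    qed
    show "?f ` ?S \<subseteq> ?G"
    proof (rule image_subsetI)
      fix z assume z: "z \<in> ?S"
      then have a: "\<And>k. k \<in> I1 \<Longrightarrow> fst z k \<in> {- int R..int R}" "\<And>k. k \<in> I2 \<Longrightarrow> snd z k \<in> {- int T..int T}"
        by (auto simp: grid_def)
      have "(fst z m, snd z m) \<in> ?H" using a(1)[OF mI(1)] a(2)[OF mI(2)] z by auto
      then show "?f z \<in> ?G" using a by auto
    qed
    show "finite ?G" using finH by (intro finite_cartesian_product finite_PiE) auto
  qed
  also have "card ?G = (2 * R + 1) ^ (card I1 - 1) * (2 * T + 1) ^ (card I2 - 1) * card ?H"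
    using mI by (simp add: card_cartesian_product card_PiE nat_add_distrib nat_mult_distrib)
  finally have cS: "card ?S \<le> (2 * R + 1) ^ (card I1 - 1) * (2 * T + 1) ^ (card I2 - 1) * card ?H" .
  have mem: "(floor_V c, floor_X c) \<in> ?S" if c: "c \<in> box R T" for c
  proof -
    have cs: "c \<in> space dx" using c by (simp add: box_def)
    have bd: "\<bar>V c $ k\<bar> \<le> real R" "\<bar>X c $ k\<bar> \<le> real T" for k using c by (auto simp: box_def)
    have mij: "m \<noteq> i" "m \<noteq> j" using mI by (auto simp: I1_def I2_def)
    \<comment> \<open>At every other index \<open>V\<close> or \<open>X\<close> vanishes, so the
      relation reads X_i + V_j + X_m V_m = 2.\<close>
    have "2 = (\<Sum>k\<in>{i, j, m}. X c $ k * V c $ k)"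
      unfolding coordinates(5)[OF cs, symmetric]
    proof (rule sum.mono_neutral_right)
      show "\<forall>k\<in>UNIV - {i, j, m}. X c $ k * V c $ k = 0"
      proof
        fix k assume k: "k \<in> UNIV - {i, j, m}"
        then have "\<not> (k \<in> I1 \<and> k \<in> I2)" using m by blast
        then have "i < k \<or> k < j" using k by (auto simp: I1_def I2_def)
        then show "X c $ k * V c $ k = 0" using coordinates(2,4)[OF cs] by auto
      qed
    qed auto
    also have "\<dots> = X c $ i + V c $ j + X c $ m * V c $ m"
      using mij ij coordinates(1,3)[OF cs] by (simp add: frame_scale_def)
    finally have "\<bar>V c $ m * X c $ m\<bar> \<le> 2 + real R + real T" using bd(1)[of j] bd(2)[of i] by (simp add: mult.commute)
    \<comment> \<open>Passing to integer parts adds |V_m| + |X_m| + 1, so the product is at most 3 +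
      2 R + 2 T; as both radii are at least 1, this is at most 7 times their maximum.\<close>
    moreover have "\<bar>real_of_int (\<lfloor>V c $ m\<rfloor> * \<lfloor>X c $ m\<rfloor>)\<bar> \<le> (\<bar>V c $ m\<bar> + 1) * (\<bar>X c $ m\<bar> + 1)"
    proof -
      have "\<bar>real_of_int \<lfloor>y\<rfloor>\<bar> \<le> \<bar>y\<bar> + 1" for y :: real by linarith
      then show ?thesis by (simp add: abs_mult) (intro mult_mono, auto)
    qed
    moreover have "(\<bar>V c $ m\<bar> + 1) * (\<bar>X c $ m\<bar> + 1) = \<bar>V c $ m * X c $ m\<bar> + \<bar>V c $ m\<bar> + \<bar>X c $ m\<bar> + 1"
      by (simp add: abs_mult algebra_simps)
    ultimately have "\<bar>real_of_int (\<lfloor>V c $ m\<rfloor> * \<lfloor>X c $ m\<rfloor>)\<bar> \<le> 7 * max (real R) (real T)"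
      using bd(1)[of m] bd(2)[of m] R by (simp add: max_def)
    also have "\<dots> = real_of_int (7 * max (int R) (int T))" by (simp add: max_def)
    finally have "\<bar>\<lfloor>V c $ m\<rfloor> * \<lfloor>X c $ m\<rfloor>\<bar> \<le> 7 * max (int R) (int T)"
      by (simp only: of_int_abs[symmetric] of_int_le_iff)
    then show ?thesis using box_grid[OF c] mI by (simp add: floor_V_def floor_X_def)
  qed
  have "emeasure dx (box R T) \<le> of_nat (card ?S * (2 * min R T + 1)) * kappa"
    by (rule volume_cover[OF box_sets _ mem volume_strip_box]) (simp add: finite_grid)
  also have "\<dots> \<le> of_nat ((2 * R + 1) ^ (card I1 - 1) * (2 * T + 1) ^ (card I2 - 1) * card ?H * (2 * min R T + 1)) * kappa"
    using cS by (intro mult_right_mono of_nat_mono mult_le_mono) auto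
  finally show ?thesis .
qed

lemma card_I1: "card I1 = (if i = j then pos i else pos i - 1)"
proof -
  have "I1 = {k. k < i} - (if i = j then {} else {j})" by (auto simp: I1_def)
  then show ?thesis using b(2) by (auto simp: pos_def)
qed

lemma card_I2: "card I2 = (if i = j then CARD('n) - 1 - pos i else CARD('n) - 1 - pos j - 1)"
proof -
  have "I2 = {k. j < k} - (if i = j then {} else {i})" by (auto simp: I2_def)
  then show ?thesis using b(2) by (auto simp: card_greater)
qed

text \<open>Three shapes satisfy \<open>good\<close>: equal positions at the centre, adjacent
  positions, and positions two apart around the centre. Each yields the power (n - 1) / 2 of the
  product of the radii; only the last produces the logarithmic factor.\<close>

lemma volume_good:
  assumes g: "good i j"
  obtains C where "C \<ge> 0" "\<And>x y. emeasure dx (box (2 ^ x) (2 ^ y)) \<le>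
    ennreal (C * sqrt (2 ^ x * 2 ^ y) ^ (CARD('n) - 1) * (1 + real x + real y))"
proof -
  define \<kappa> where "\<kappa> = enn2real kappa"
  have \<kappa>: "kappa = ennreal \<kappa>" "\<kappa> \<ge> 0" using kappa_finite by (auto simp: \<kappa>_def)
  have conv: "of_nat q * kappa \<le> ennreal (C * \<kappa>)" if "real q \<le> C" for q C
  proof -
    have "of_nat q * kappa = ennreal (real q * \<kappa>)"
      unfolding \<kappa>(1) ennreal_of_nat_eq_real_of_nat using \<kappa>(2) by (simp add: ennreal_mult)
    then show ?thesis using that \<kappa>(2) by (simp add: ennreal_leI mult_right_mono)
  qed
  have three: "real (2 * R + 1) ^ k \<le> 3 ^ k * real R ^ k" if "R \<ge> 1" for R k
    unfolding power_mult_distrib[symmetric] using that by (intro power_mono) auto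
  have p2: "1 \<le> (2::nat) ^ x" for x by simp
  have rp: "real (2 ^ x) = 2 ^ x" for x by simp
  let ?s = "\<lambda>x y. sqrt (2 ^ x * 2 ^ y :: real) ^ (CARD('n) - 1)"
  have s0: "0 \<le> ?s x y" for x y by simp
  have "\<exists>C\<ge>0. \<forall>x y. emeasure dx (box (2 ^ x) (2 ^ y)) \<le> ennreal (C * ?s x y * (1 + real x + real y))"
  proof (cases "i = j")
    case True
    then have p: "card I1 = pos i" "card I2 = pos i" "CARD('n) - 1 = 2 * pos i"
      using g unfolding card_I1 card_I2 good_def by simp_all
    show ?thesis
    proof (intro exI[of _ "9 ^ pos i * \<kappa>"] conjI allI)
      fix x y :: nat
      let ?q = "(2 * 2 ^ x + 1) ^ card I1 * (2 * 2 ^ y + 1) ^ card I2 :: nat"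
      have "real ?q \<le> (3 ^ pos i * real (2 ^ x) ^ pos i) * (3 ^ pos i * real (2 ^ y) ^ pos i)"
        unfolding p of_nat_mult[of "_ ^ _" "_ ^ _"] of_nat_power[of _ "pos i"] by (intro mult_mono three p2) auto
      also have "\<dots> = 9 ^ pos i * ?s x y"
        unfolding p(3) power_mult by (simp add: power_mult_distrib flip: power_mult_distrib[of 3 3])
      also have "\<dots> \<le> 9 ^ pos i * ?s x y * (1 + real x + real y)"
        using mult_left_mono[of 1 "1 + real x + real y" "9 ^ pos i * ?s x y"] s0[of x y] by simp
      finally have "of_nat ?q * kappa \<le> ennreal (9 ^ pos i * ?s x y * (1 + real x + real y) * \<kappa>)" by (rule conv)
      then show "emeasure dx (box (2 ^ x) (2 ^ y)) \<le> ennreal (9 ^ pos i * \<kappa> * ?s x y * (1 + real x + real y))"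
        using volume_equal[OF True, of "2 ^ x" "2 ^ y"] by (simp add: mult_ac)
    qed (use \<kappa> in auto)
  next
    case False
    then have ji: "pos j < pos i" using b(2) by (simp add: pos_less_iff)
    have gg: "2 * pos i \<le> CARD('n) + 1" "CARD('n) \<le> 2 * pos j + 3" using g False by (auto simp: good_def)
    have pn: "pos i < CARD('n)" by (rule pos_bound)
    show ?thesis
    proof (cases "pos i = pos j + 1")
      case True
      \<comment> \<open>For adjacent positions the extra direction brings the number of coordinates
        to n - 1, and compatibility bounds the difference of the two exponents by 1.\<close>
      define a c where "a = card I1" and "c = card I2"
      have ac: "a = pos j" "c = CARD('n) - 1 - pos i" using True False pn by (auto simp: a_def c_def card_I1 card_I2)
      have bal: "a \<le> c + 1" "c \<le> a + 1" "a + c + 1 = CARD('n) - 1" using ac gg pn True by auto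
      show ?thesis
      proof (intro exI[of _ "3 ^ a * 3 ^ c * 3 * \<kappa>"] conjI allI)
        fix x y :: nat
        let ?q = "(2 * 2 ^ x + 1) ^ card I1 * (2 * 2 ^ y + 1) ^ card I2 * (2 * min (2 ^ x) (2 ^ y) + 1) :: nat"
        have m: "real (2 * min (2 ^ x) (2 ^ y) + 1) \<le> 3 * min (real (2 ^ x)) (real (2 ^ y))"
          using p2[of x] p2[of y] by (auto simp: min_def)
        have "real ?q \<le> (3 ^ a * real (2 ^ x) ^ a) * (3 ^ c * real (2 ^ y) ^ c) * (3 * min (real (2 ^ x)) (real (2 ^ y)))"
          unfolding a_def[symmetric] c_def[symmetric] of_nat_mult[of "_ * _"] of_nat_mult[of "_ ^ _"]  of_nat_power[of _ a] of_nat_power[of _ c]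
          by (intro mult_mono three p2 m) auto
        also have "\<dots> = 3 ^ a * 3 ^ c * 3 * (real (2 ^ x) ^ a * real (2 ^ y) ^ c * min (real (2 ^ x)) (real (2 ^ y)))" by simp
        also have "\<dots> \<le> 3 ^ a * 3 ^ c * 3 * sqrt (real (2 ^ x) * real (2 ^ y)) ^ (a + c + 1)"
          by (intro mult_left_mono power_balance bal) auto
        also have "\<dots> = 3 ^ a * 3 ^ c * 3 * ?s x y" unfolding bal(3) by simp
        also have "\<dots> \<le> 3 ^ a * 3 ^ c * 3 * ?s x y * (1 + real x + real y)"
          using mult_left_mono[of 1 "1 + real x + real y" "3 ^ a * 3 ^ c * 3 * ?s x y"] s0[of x y] by simp
        finally have "of_nat ?q * kappa \<le> ennreal (3 ^ a * 3 ^ c * 3 * ?s x y * (1 + real x + real y) * \<kappa>)" by (rule conv)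
        moreover have "emeasure dx (box (2 ^ x) (2 ^ y)) \<le> of_nat ?q * kappa" by (rule volume_general)
        ultimately have "emeasure dx (box (2 ^ x) (2 ^ y)) \<le> ennreal (3 ^ a * 3 ^ c * 3 * ?s x y * (1 + real x + real y) * \<kappa>)"
          by (rule order_trans[rotated])
        then show "emeasure dx (box (2 ^ x) (2 ^ y)) \<le> ennreal (3 ^ a * 3 ^ c * 3 * \<kappa> * ?s x y * (1 + real x + real y))"
          by (simp add: mult_ac)
      qed (use \<kappa> in auto)
    next
      case ne: False
      then have pij: "pos i = pos j + 2" "CARD('n) = 2 * pos j + 3" using gg ji by auto
      \<comment> \<open>Without the middle position \<open>q\<close> coordinates remain on each
        side; the maximum from the hyperbola and the minimum from the strips multiply to one further
        R T.\<close>
      define q where "q = pos j"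
      have I: "card I1 - 1 = q" "card I2 - 1 = q" "CARD('n) - 1 = 2 * Suc q"
        using pij False by (auto simp: card_I1 card_I2 q_def)
      have "pos j + 1 < CARD('n)" using pij by simp
      then obtain m :: 'n where m: "pos m = pos j + 1" by (rule pos_surj)
      have "I1 \<inter> I2 = {m}"
      proof (intro equalityI subsetI)
        fix k assume "k \<in> I1 \<inter> I2"
        then have "pos j < pos k" "pos k < pos i" by (auto simp: I1_def I2_def pos_less_iff)
        then have "pos k = pos m" using m pij by simp
        then show "k \<in> {m}" by (simp add: pos_eq_iff)
      next
        fix k assume "k \<in> {m}"
        then have "j < k" "k < i" using m pij by (simp_all flip: pos_less_iff)
        then show "k \<in> I1 \<inter> I2" by (auto simp: I1_def I2_def)
      qed
      note vol = volume_hyperbola[OF this False]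
      show ?thesis
      proof (intro exI[of _ "9 ^ q * 99 * \<kappa>"] conjI allI)
        fix x y :: nat
        let ?h = "card {(a :: int, c :: int). \<bar>a\<bar> \<le> int (2 ^ x) \<and> \<bar>c\<bar> \<le> int (2 ^ y) \<and> \<bar>a * c\<bar> \<le> 7 * max (int (2 ^ x)) (int (2 ^ y))}"
        let ?q = "(2 * 2 ^ x + 1) ^ (card I1 - 1) * (2 * 2 ^ y + 1) ^ (card I2 - 1) * ?h * (2 * min (2 ^ x) (2 ^ y) + 1) :: nat"
        have m: "real (2 * min (2 ^ x) (2 ^ y) + 1) \<le> 3 * min (real (2 ^ x)) (real (2 ^ y))"
          using p2[of x] p2[of y] by (auto simp: min_def)
        have h: "real ?h \<le> 33 * max (real (2 ^ x)) (real (2 ^ y)) * (1 + real x + real y)"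
          using card_hyperbola[of x y] by simp
        have "real ?q \<le> (3 ^ q * real (2 ^ x) ^ q) * (3 ^ q * real (2 ^ y) ^ q) *
            (33 * max (real (2 ^ x)) (real (2 ^ y)) * (1 + real x + real y)) * (3 * min (real (2 ^ x)) (real (2 ^ y)))"
          unfolding I of_nat_mult[of "_ * _"] of_nat_mult[of "_ ^ _"] of_nat_power[of _ q]
          by (intro mult_mono three p2 m h) (auto intro!: mult_nonneg_nonneg simp: le_max_iff_disj)
        also have "\<dots> = 3 ^ q * 3 ^ q * 99 * (real (2 ^ x) ^ q * real (2 ^ y) ^ q * (max (real (2 ^ x)) (real (2 ^ y)) * min (real (2 ^ x)) (real (2 ^ y)))) * (1 + real x + real y)"
          by simp
        also have "max (real (2 ^ x)) (real (2 ^ y)) * min (real (2 ^ x)) (real (2 ^ y)) = real (2 ^ x) * real (2 ^ y)"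
          by (simp add: max_def min_def)
        also have "real (2 ^ x) ^ q * real (2 ^ y) ^ q * (real (2 ^ x) * real (2 ^ y)) = (real (2 ^ x) * real (2 ^ y)) ^ Suc q"
          by (simp add: power_mult_distrib)
        also have "\<dots> = ?s x y" unfolding I(3) power_mult by simp
        also have "3 ^ q * 3 ^ q = (9 ^ q :: real)" by (simp flip: power_mult_distrib)
        finally have "of_nat ?q * kappa \<le> ennreal (9 ^ q * 99 * ?s x y * (1 + real x + real y) * \<kappa>)" by (rule conv)
        moreover have "emeasure dx (box (2 ^ x) (2 ^ y)) \<le> of_nat ?q * kappa" by (rule vol) auto
        ultimately have "emeasure dx (box (2 ^ x) (2 ^ y)) \<le> ennreal (9 ^ q * 99 * ?s x y * (1 + real x + real y) * \<kappa>)"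
          by (rule order_trans[rotated])
        then show "emeasure dx (box (2 ^ x) (2 ^ y)) \<le> ennreal (9 ^ q * 99 * \<kappa> * ?s x y * (1 + real x + real y))"
          by (simp add: mult_ac)
      qed (use \<kappa> in auto)
    qed
  qed
  then show ?thesis using that by blast
qed

end

section \<open>Convergence and divergence\<close>

lemma continuous_on_smooth_SL:
  fixes f :: "'n::finite sqmat \<Rightarrow> complex"
  assumes "smooth_on_SL f" shows "continuous_on (carrier SL) f"
  unfolding continuous_on_eq_continuous_within
proof
  fix g :: "'n sqmat" assume g: "g \<in> carrier SL"
  obtain U F where U: "open U" "g \<in> U" "\<forall>k. C_k_on k F U" "\<forall>x\<in>U \<inter> carrier SL. F x = f x"
    using assms g unfolding smooth_on_SL_def by blast
  have "C_k_on 0 F U" using U(3) by blast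
  then have "continuous_on U F" by simp
  then have "isCont F g" using U(1,2) continuous_on_eq_continuous_at by blast
  then have "(F \<longlongrightarrow> f g) (at g within carrier SL)"
    using U(2,4) g by (simp add: isCont_def) (metis IntI Lim_at_imp_Lim_at_within)
  moreover have "\<forall>\<^sub>F x in at g within carrier SL. F x = f x"
    using U by (auto simp: eventually_at_topological)
  ultimately show "continuous (at g within carrier SL) f"
    unfolding continuous_within using Lim_transform_eventually by blast
qed

context orbit
begin

text \<open>This identifies the integrand at the coset of \<open>x\<close> with the value at the
  point x H.\<close>

lemma N_coset_set_mult: "x \<in> N_of b \<Longrightarrow> N_coset x <#>\<^bsub>SL\<^esub> H_grp = x <#\<^bsub>SL\<^esub> H_grp"
proof -
  note H = subgroup_SLD[OF H_grp_subgroup[OF n2]]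
  have NH: "h \<in> NH \<Longrightarrow> h \<in> H_grp" for h by (simp add: NH_def)
  have 1: "mat 1 \<in> NH" using subgroup_SLD(2)[OF NH_subgroup] .
  show ?thesis
    unfolding N_coset_def l_coset_SL
  proof (intro equalityI subsetI)
    fix g assume "g \<in> (\<lambda>h. x ** h) ` NH <#>\<^bsub>SL\<^esub> H_grp"
    then obtain h k where "h \<in> NH" "k \<in> H_grp" "g = x ** (h ** k)"
      unfolding mem_set_mult_SL by (auto simp: matrix_mul_assoc)
    then show "g \<in> (\<lambda>h. x ** h) ` H_grp" using H(3) NH by blast
  next
    fix g assume "g \<in> (\<lambda>h. x ** h) ` H_grp"
    then obtain k where "k \<in> H_grp" "g = x ** mat 1 ** k" by auto
    then show "g \<in> (\<lambda>h. x ** h) ` NH <#>\<^bsub>SL\<^esub> H_grp"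
      unfolding mem_set_mult_SL using 1 by blast
  qed
qed

lemma schwartz_measurable:
  assumes "schwartz \<phi>" shows "(\<lambda>c. \<phi> (c <#>\<^bsub>SL\<^esub> H_grp)) \<in> borel_measurable dx"
proof (rule measurable_N_coset)
  have "continuous_on (carrier SL) (\<lambda>g. \<phi> (g <#\<^bsub>SL\<^esub> H_grp))"
    using assms by (intro continuous_on_smooth_SL) (simp add: schwartz_def smooth_on_X_def)
  then have "continuous_on (N_of b) (\<lambda>g. \<phi> (g <#\<^bsub>SL\<^esub> H_grp))"
    using N_SL by (meson continuous_on_subset subsetI)
  then show "continuous_on (N_of b) (\<lambda>x. \<phi> (N_coset x <#>\<^bsub>SL\<^esub> H_grp))"
    by (simp add: N_coset_set_mult cong: continuous_on_cong)
qed

lemma norm_V_measurable [measurable]: "(\<lambda>c. norm (V c)) \<in> borel_measurable dx"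
  by (intro measurable_N_coset continuous_on_norm continuous_V)

lemma norm_X_measurable [measurable]: "(\<lambda>c. norm (X c)) \<in> borel_measurable dx"
  by (intro measurable_N_coset continuous_on_norm continuous_X)

text \<open>The two norms are cut dyadically and independently, since the volume bound treats them
  separately while the decay sees only their product.\<close>

definition shell :: "nat \<Rightarrow> nat \<Rightarrow> 'n sqmat set set"
  where "shell x y = {c \<in> space dx. 2 ^ x \<le> norm (V c) \<and> norm (V c) < 2 ^ (x + 1) \<and>
    2 ^ y \<le> norm (X c) \<and> norm (X c) < 2 ^ (y + 1)}"

lemma shell_sets: "shell x y \<in> sets dx"
  unfolding shell_def by measurable

lemma dyadic: "1 \<le> (r :: real) \<Longrightarrow> \<exists>x::nat. 2 ^ x \<le> r \<and> r < 2 ^ (x + 1)"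
proof -
  assume r: "1 \<le> r"
  obtain m where "r < 2 ^ m" using real_arch_pow[of 2 r] by auto
  define k where "k = (LEAST m. r < 2 ^ m)"
  have k: "r < 2 ^ k" unfolding k_def using \<open>r < 2 ^ m\<close> by (rule LeastI)
  then obtain x where x: "k = Suc x" using r by (cases k) auto
  have "\<not> r < 2 ^ x" using not_less_Least[of x "\<lambda>m. r < 2 ^ m"] x by (simp add: k_def)
  then show ?thesis using k x by (intro exI[of _ x]) auto
qed

lemma norm_ge_1:
  assumes c: "c \<in> space dx" shows "norm (V c) \<ge> 1" "norm (X c) \<ge> 1"
proof -
  have "\<bar>V c $ i\<bar> \<le> norm (V c)" "\<bar>X c $ j\<bar> \<le> norm (X c)" by (rule component_le_norm_cart)+
  then show "norm (V c) \<ge> 1" "norm (X c) \<ge> 1"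
    using coordinates(1,3)[OF c] by (auto simp: frame_scale_def split: if_splits)
qed

lemma in_shell: "c \<in> space dx \<Longrightarrow> \<exists>x y. c \<in> shell x y"
  using dyadic norm_ge_1 by (fastforce simp: shell_def)

lemma shell_box: "shell x y \<subseteq> box (2 ^ (x + 1)) (2 ^ (y + 1))"
proof
  fix c assume c: "c \<in> shell x y"
  have "norm (V c) \<le> 2 ^ (x + 1)" "norm (X c) \<le> 2 ^ (y + 1)" using c by (simp_all add: shell_def)
  then have "\<bar>V c $ k\<bar> \<le> 2 ^ (x + 1)" "\<bar>X c $ k\<bar> \<le> 2 ^ (y + 1)" for k
    using component_le_norm_cart[of "V c" k] component_le_norm_cart[of "X c" k] by (blast intro: order_trans)+
  then show "c \<in> box (2 ^ (x + 1)) (2 ^ (y + 1))" using c by (simp add: box_def shell_def)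
qed

text \<open>The logarithmic power 5 is chosen with the volume in view: one factor cancels against
  the volume, and the remaining four make the double sum over shells converge.\<close>

lemma schwartz_shell_bound:
  assumes \<phi>: "schwartz \<phi>"
  obtains C where "C \<ge> 0" "\<And>x y c. c \<in> shell x y \<Longrightarrow>
    cmod (\<phi> (c <#>\<^bsub>SL\<^esub> H_grp)) \<le> C / (sqrt (2 ^ x * 2 ^ y) ^ (CARD('n) - 1) * (1 + real x + real y) ^ 5)"
proof -
  let ?d = "CARD('n) - 1"
  obtain K where K: "K \<ge> 1" "\<And>x. x \<in> N_of b \<Longrightarrow> norm (V (N_coset x)) * norm (X (N_coset x)) \<le> K * norm (proj x)"
    using norm_proj_bounds by metis
  obtain C where C: "\<And>g. g \<in> carrier SL \<Longrightarrow> norm (proj g) \<ge> 1 \<and>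
    cmod (\<phi> (g <#\<^bsub>SL\<^esub> H_grp)) * sqrt (norm (proj g)) ^ ?d * (1 + ln (norm (proj g))) ^ 5 \<le> C"
    using schwartz_bound[OF n3 \<phi>, of 5] by blast
  have C0: "C \<ge> 0"
  proof -
    have 1: "mat 1 \<in> carrier (SL :: 'n sqmat monoid)" by (simp add: SL_simps)
    have "0 \<le> cmod (\<phi> (mat 1 <#\<^bsub>SL\<^esub> H_grp)) * sqrt (norm (proj (mat 1 :: 'n sqmat))) ^ ?d * (1 + ln (norm (proj (mat 1 :: 'n sqmat)))) ^ 5"
    proof -
      have "ln (norm (proj (mat 1 :: 'n sqmat))) \<ge> 0" using C[OF 1] by simp
      then show ?thesis by (intro mult_nonneg_nonneg zero_le_power) auto
    qed
    then show ?thesis using C[OF 1] by linarith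
  qed
  define A where "A = ln K"
  have A: "A \<ge> 0" using K(1) by (simp add: A_def)
  define B where "B = 2 * (1 + A)"
  have B: "B > 0" using A by (simp add: B_def)
  show ?thesis
  proof (rule that[of "C * sqrt K ^ ?d * B ^ 5"])
    show "C * sqrt K ^ ?d * B ^ 5 \<ge> 0" using C0 K(1) B by simp
    fix x y c assume c: "c \<in> shell x y"
    then obtain u where u: "u \<in> N_of b" "c = N_coset u" by (auto simp: shell_def space_dx)
    let ?p = "norm (proj u)"
    let ?S = "2 ^ x * 2 ^ y :: real"
    have p1: "?p \<ge> 1" using C[OF N_SL[OF u(1)]] by blast
    have "?S \<le> norm (V c) * norm (X c)" using c by (intro mult_mono) (auto simp: shell_def)
    then have SK: "?S \<le> K * ?p" using K(2)[OF u(1)] u(2) by simp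
    then have "sqrt ?S \<le> sqrt K * sqrt ?p" by (simp flip: real_sqrt_mult)
    then have s: "sqrt ?S ^ ?d \<le> sqrt K ^ ?d * sqrt ?p ^ ?d"
      unfolding power_mult_distrib[symmetric] by (intro power_mono) auto
    \<comment> \<open>Since ln 2 is at least 1/2, the logarithm of \<open>?S\<close> controls the
      indices: 1 + x + y \<le> 2 (1 + z).\<close>
    define z where "z = ln ?S"
    have "z = (real x + real y) * ln 2" by (simp add: z_def ln_mult ln_realpow algebra_simps)
    moreover have "1 / 2 \<le> ln (2 :: real)" using ln2_ge_two_thirds by linarith
    ultimately have z: "z \<ge> (real x + real y) / 2"
      using mult_left_mono[of "1 / 2" "ln 2" "real x + real y"] by simp
    have "z \<le> ln (K * ?p)" unfolding z_def using SK K(1) p1 by (intro ln_mono) auto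
    moreover have "proj u \<noteq> 0" using p1 by auto
    ultimately have zA: "z \<le> A + ln ?p" using K(1) by (simp add: A_def ln_mult)
    have l0: "ln ?p \<ge> 0" using p1 by simp
    have "1 + real x + real y \<le> 2 * (1 + z)" using z by simp
    also have "\<dots> \<le> 2 * (1 + (A + ln ?p + A * ln ?p))"
      by (intro mult_left_mono add_left_mono order_trans[OF zA]) (simp_all add: mult_nonneg_nonneg[OF A l0])
    also have "\<dots> = B * (1 + ln ?p)" by (simp add: B_def algebra_simps)
    finally have l: "(1 + real x + real y) ^ 5 \<le> B ^ 5 * (1 + ln ?p) ^ 5"
      unfolding power_mult_distrib[symmetric] by (intro power_mono) auto
    let ?f = "cmod (\<phi> (c <#>\<^bsub>SL\<^esub> H_grp))"
    have "?f * (sqrt ?S ^ ?d * (1 + real x + real y) ^ 5) \<le> ?f * ((sqrt K ^ ?d * sqrt ?p ^ ?d) * (B ^ 5 * (1 + ln ?p) ^ 5))"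
      using s l K(1) by (intro mult_left_mono mult_mono) auto
    also have "\<dots> = (?f * sqrt ?p ^ ?d * (1 + ln ?p) ^ 5) * (sqrt K ^ ?d * B ^ 5)" by simp
    also have "\<dots> \<le> C * (sqrt K ^ ?d * B ^ 5)"
      using C[OF N_SL[OF u(1)]] B K(1) by (intro mult_right_mono) (auto simp: u(2) N_coset_set_mult[OF u(1)])
    finally show "?f \<le> C * sqrt K ^ ?d * B ^ 5 / (sqrt ?S ^ ?d * (1 + real x + real y) ^ 5)"
      by (subst pos_le_divide_eq) (auto simp: mult_ac intro!: mult_pos_pos)
  qed
qed

text \<open>On each shell the decay cancels the power in the volume bound exactly, and only
  logarithmic factors in the radii have to be summed.\<close>

lemma good_imp_integrable:
  assumes g: "good i j" and \<phi>: "schwartz \<phi>"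
  shows "integrable dx (\<lambda>c. \<phi> (c <#>\<^bsub>SL\<^esub> H_grp))"
proof (rule integrableI_bounded)
  show "(\<lambda>c. \<phi> (c <#>\<^bsub>SL\<^esub> H_grp)) \<in> borel_measurable dx" using \<phi> by (rule schwartz_measurable)
  let ?d = "CARD('n) - 1"
  obtain C where C: "C \<ge> 0" "\<And>x y c. c \<in> shell x y \<Longrightarrow>
    cmod (\<phi> (c <#>\<^bsub>SL\<^esub> H_grp)) \<le> C / (sqrt (2 ^ x * 2 ^ y) ^ ?d * (1 + real x + real y) ^ 5)"
    using schwartz_shell_bound[OF \<phi>] by blast
  obtain D where D: "D \<ge> 0" "\<And>x y. emeasure dx (box (2 ^ x) (2 ^ y)) \<le>
    ennreal (D * sqrt (2 ^ x * 2 ^ y) ^ ?d * (1 + real x + real y))"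
    using volume_good[OF g] by blast
  define w where "w x y = C / (sqrt (2 ^ x * 2 ^ y) ^ ?d * (1 + real x + real y) ^ 5)" for x y :: nat
  have w0: "w x y \<ge> 0" for x y using C(1) by (simp add: w_def)
  \<comment> \<open>A shell lies in a box with doubled radii: this costs \<open>sqrt 4 ^ ?d\<close>
    in the power and a factor 3 in the linear term.\<close>
  define E where "E = C * D * sqrt 4 ^ ?d * 3"
  have E0: "E \<ge> 0" using C D by (simp add: E_def)
  have shell_vol: "ennreal (w x y) * emeasure dx (shell x y) \<le> ennreal (E * (1 / (1 + real x)\<^sup>2 * (1 / (1 + real y)\<^sup>2)))" for x y
  proof -
    let ?S = "sqrt (2 ^ x * 2 ^ y :: real) ^ ?d"
    let ?t = "1 + real x + real y"
    have S: "?S > 0" "?t > 0" by (auto intro!: zero_less_power)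
    have "emeasure dx (shell x y) \<le> emeasure dx (box (2 ^ (x + 1)) (2 ^ (y + 1)))"
      by (intro emeasure_mono shell_box box_sets)
    also have "\<dots> \<le> ennreal (D * sqrt (2 ^ (x + 1) * 2 ^ (y + 1)) ^ ?d * (1 + real (x + 1) + real (y + 1)))" by (rule D(2))
    also have "\<dots> \<le> ennreal (D * (sqrt 4 ^ ?d * ?S) * (3 * ?t))"
    proof (rule ennreal_leI)
      have "sqrt (2 ^ (x + 1) * 2 ^ (y + 1)) = sqrt 4 * sqrt (2 ^ x * 2 ^ y :: real)"
        by (simp only: real_sqrt_mult[symmetric]) (simp add: mult_ac)
      then have "sqrt (2 ^ (x + 1) * 2 ^ (y + 1)) ^ ?d = sqrt 4 ^ ?d * ?S" by (simp only: power_mult_distrib)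
      then show "D * sqrt (2 ^ (x + 1) * 2 ^ (y + 1)) ^ ?d * (1 + real (x + 1) + real (y + 1)) \<le> D * (sqrt 4 ^ ?d * ?S) * (3 * ?t)"
        using D(1) by (simp only:) (intro mult_left_mono, auto)
    qed
    finally have "ennreal (w x y) * emeasure dx (shell x y) \<le> ennreal (w x y) * ennreal (D * (sqrt 4 ^ ?d * ?S) * (3 * ?t))"
      by (intro mult_left_mono) auto
    also have "\<dots> = ennreal (w x y * (D * (sqrt 4 ^ ?d * ?S) * (3 * ?t)))" using w0 by (simp add: ennreal_mult')
    also have "w x y * (D * (sqrt 4 ^ ?d * ?S) * (3 * ?t)) = E * (1 / ?t ^ 4)"
    proof -
      have t5: "?t ^ 5 = ?t ^ 4 * ?t" by (simp only: power_add[of _ 4 1, simplified])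
      have "w x y * (D * (sqrt 4 ^ ?d * ?S) * (3 * ?t)) = (C * D * sqrt 4 ^ ?d * 3 * (?S * ?t)) / (?t ^ 4 * (?S * ?t))"
        unfolding w_def t5 by (simp only: times_divide_eq_left times_divide_eq_right mult_ac)
      also have "\<dots> = E / ?t ^ 4" using S unfolding E_def by (intro mult_divide_mult_cancel_right) auto
      finally show ?thesis by simp
    qed
    \<comment> \<open>The fourth power of 1 + x + y dominates a square in each index, which makes
      the double sum a product.\<close>
    also have "ennreal (E * (1 / ?t ^ 4)) \<le> ennreal (E * (1 / (1 + real x)\<^sup>2 * (1 / (1 + real y)\<^sup>2)))"
    proof (intro ennreal_leI mult_left_mono E0)
      have "(1 + real x)\<^sup>2 * (1 + real y)\<^sup>2 \<le> ?t\<^sup>2 * ?t\<^sup>2" by (intro mult_mono power_mono) auto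
      also have "\<dots> = ?t ^ 4" by (simp flip: power_add)
      finally show "1 / ?t ^ 4 \<le> 1 / (1 + real x)\<^sup>2 * (1 / (1 + real y)\<^sup>2)"
        using S by (simp add: divide_left_mono)
    qed
    finally show ?thesis .
  qed
  have "(\<integral>\<^sup>+c. ennreal (cmod (\<phi> (c <#>\<^bsub>SL\<^esub> H_grp))) \<partial>dx) \<le>
      (\<integral>\<^sup>+c. (\<Sum>x. \<Sum>y. ennreal (w x y) * indicator (shell x y) c) \<partial>dx)"
  proof (rule nn_integral_mono)
    have le: "h k \<le> suminf h" for h :: "nat \<Rightarrow> ennreal" and k
      using sum_le_suminf[of h "{k}"] by (simp add: summableI)
    fix c assume "c \<in> space dx"
    then obtain x y where c: "c \<in> shell x y" using in_shell by blast
    have "ennreal (cmod (\<phi> (c <#>\<^bsub>SL\<^esub> H_grp))) \<le> ennreal (w x y) * indicator (shell x y) c"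
      using C(2)[OF c] c by (simp add: w_def ennreal_leI)
    also have "\<dots> \<le> (\<Sum>y. ennreal (w x y) * indicator (shell x y) c)"
      by (rule le[of "\<lambda>y. ennreal (w x y) * indicator (shell x y) c" y])
    also have "\<dots> \<le> (\<Sum>x. \<Sum>y. ennreal (w x y) * indicator (shell x y) c)"
      by (rule le[of "\<lambda>x. \<Sum>y. ennreal (w x y) * indicator (shell x y) c" x])
    finally show "ennreal (cmod (\<phi> (c <#>\<^bsub>SL\<^esub> H_grp))) \<le> (\<Sum>x. \<Sum>y. ennreal (w x y) * indicator (shell x y) c)" .
  qed
  also have "\<dots> = (\<Sum>x. \<integral>\<^sup>+c. (\<Sum>y. ennreal (w x y) * indicator (shell x y) c) \<partial>dx)"
    using shell_sets by (intro nn_integral_suminf) auto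
  also have "\<dots> = (\<Sum>x. \<Sum>y. \<integral>\<^sup>+c. ennreal (w x y) * indicator (shell x y) c \<partial>dx)"
    using shell_sets by (intro suminf_cong nn_integral_suminf) auto
  also have "\<dots> = (\<Sum>x. \<Sum>y. ennreal (w x y) * emeasure dx (shell x y))"
    using shell_sets by (intro suminf_cong) (simp add: nn_integral_cmult_indicator)
  also have "\<dots> \<le> (\<Sum>x. \<Sum>y. ennreal (E * (1 / (1 + real x)\<^sup>2 * (1 / (1 + real y)\<^sup>2))))"
    by (intro suminf_le summableI shell_vol)
  also have "\<dots> < \<infinity>"
  proof -
    have sm: "summable (\<lambda>x. 1 / (1 + real x)\<^sup>2)"
      using inverse_squares_sums by (simp add: sums_iff add.commute)
    define Z where "Z = (\<Sum>y. 1 / (1 + real y)\<^sup>2)"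
    have Z0: "Z \<ge> 0" unfolding Z_def by (intro suminf_nonneg sm) auto
    have "(\<Sum>y. ennreal (E * (1 / (1 + real x)\<^sup>2 * (1 / (1 + real y)\<^sup>2)))) = ennreal (E * (1 / (1 + real x)\<^sup>2) * Z)" for x
    proof -
      have "(\<Sum>y. ennreal (E * (1 / (1 + real x)\<^sup>2) * (1 / (1 + real y)\<^sup>2))) = ennreal (\<Sum>y. E * (1 / (1 + real x)\<^sup>2) * (1 / (1 + real y)\<^sup>2))"
        using E0 by (intro suminf_ennreal2 summable_mult sm) auto
      also have "(\<Sum>y. E * (1 / (1 + real x)\<^sup>2) * (1 / (1 + real y)\<^sup>2)) = E * (1 / (1 + real x)\<^sup>2) * Z"
        unfolding Z_def by (rule suminf_mult[OF sm])
      finally show ?thesis by (simp only: mult.assoc)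
    qed
    then have "(\<Sum>x. \<Sum>y. ennreal (E * (1 / (1 + real x)\<^sup>2 * (1 / (1 + real y)\<^sup>2)))) = (\<Sum>x. ennreal (E * (1 / (1 + real x)\<^sup>2) * Z))"
      by (simp only:)
    also have "\<dots> = ennreal (\<Sum>x. E * (1 / (1 + real x)\<^sup>2) * Z)"
      using E0 Z0 by (intro suminf_ennreal2 summable_mult2 summable_mult sm) auto
    finally show ?thesis by simp
  qed
  finally show "(\<integral>\<^sup>+c. ennreal (cmod (\<phi> (c <#>\<^bsub>SL\<^esub> H_grp))) \<partial>dx) < \<infinity>" .
qed

section \<open>Divergence for incompatible positions\<close>

lemma norm_le_card:
  fixes y :: "(real, 'n) vec"
  assumes "\<And>k. \<bar>y $ k\<bar> \<le> A" shows "norm y \<le> real CARD('n) * A"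
proof -
  have "norm y \<le> (\<Sum>k\<in>UNIV. \<bar>y $ k\<bar>)" by (rule norm_le_l1_cart)
  also have "\<dots> \<le> (\<Sum>k\<in>(UNIV::'n set). A)" by (intro sum_mono assms)
  finally show ?thesis by simp
qed

lemma floor_less_bound: "\<lfloor>x\<rfloor> \<in> {0..<int R} \<Longrightarrow> \<bar>x\<bar> \<le> real R" for x :: real
  by (simp add: floor_less_iff le_floor_iff)

lemma volume_union:
  assumes S: "finite S" and \<zeta>: "equivariant \<zeta>"
    and disj: "\<And>z z'. z \<in> S \<Longrightarrow> z' \<in> S \<Longrightarrow> z \<noteq> z' \<Longrightarrow> cell (f z) (g z) \<inter> cell (f z') (g z') = {}"
  shows "emeasure dx (\<Union>z\<in>S. cell (f z) (g z) \<inter> strip \<zeta> 0) = of_nat (card S) * kappa"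
    "(\<Union>z\<in>S. cell (f z) (g z) \<inter> strip \<zeta> 0) \<in> sets dx"
proof -
  have m: "\<zeta> \<in> borel_measurable dx" using \<zeta> by (simp add: equivariant_def)
  have s: "cell (f z) (g z) \<inter> strip \<zeta> 0 \<in> sets dx" for z using cell_sets strip_sets[OF m] by auto
  show "(\<Union>z\<in>S. cell (f z) (g z) \<inter> strip \<zeta> 0) \<in> sets dx" by (intro sets.finite_UN S s)
  have "(\<Sum>z\<in>S. emeasure dx (cell (f z) (g z) \<inter> strip \<zeta> 0)) = emeasure dx (\<Union>z\<in>S. cell (f z) (g z) \<inter> strip \<zeta> 0)"
    using s S disj by (intro sum_emeasure) (auto simp: disjoint_family_on_def)
  then show "emeasure dx (\<Union>z\<in>S. cell (f z) (g z) \<inter> strip \<zeta> 0) = of_nat (card S) * kappa"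
    by (simp add: cell_measure[OF \<zeta>])
qed

text \<open>Let \<open>V\<close> range over many cells while \<open>X\<close> stays in the unit
  cell. The strip is taken in \<open>X\<close> at \<open>i\<close> so that all of \<open>X\<close>
  is bounded; the dependent entry of \<open>V\<close> is then at most (n + 2) R by the relation
  between the two.\<close>

lemma large_V:
  assumes R: "R \<ge> 1"
  obtains W where "W \<in> sets dx" "emeasure dx W = of_nat (R ^ card I1) * kappa"
    "\<And>c. c \<in> W \<Longrightarrow> norm (V c) * norm (X c) \<le> 2 * (real CARD('n) + 2) ^ 3 * real R"
proof -
  let ?S = "PiE I1 (\<lambda>_. {0..<int R})"
  let ?\<zeta> = "\<lambda>c. - X c $ i"
  let ?W = "\<Union>\<alpha>\<in>?S. cell \<alpha> (\<lambda>_. 0) \<inter> strip ?\<zeta> 0"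
  have disj: "cell \<alpha> (\<lambda>_. 0) \<inter> cell \<alpha>' (\<lambda>_. 0) = {}" if "\<alpha> \<in> ?S" "\<alpha>' \<in> ?S" "\<alpha> \<noteq> \<alpha>'" for \<alpha> \<alpha>'
  proof -
    have "\<exists>k\<in>I1. \<alpha> k \<noteq> \<alpha>' k" using PiE_ext[OF that(1,2)] that(3) by blast
    then show ?thesis by (auto simp: cell_def)
  qed
  have fin: "finite ?S" by (intro finite_PiE) auto
  have vol: "emeasure dx ?W = of_nat (card ?S) * kappa" "?W \<in> sets dx"
    by (rule volume_union[where f = "\<lambda>z. z" and g = "\<lambda>_ _. 0", OF fin equi_X]; rule disj; assumption)+
  show ?thesis
  proof (rule that[of ?W])
    show "?W \<in> sets dx" by (rule vol(2))
    have "card ?S = R ^ card I1" by (simp add: card_PiE)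
    then show "emeasure dx ?W = of_nat (R ^ card I1) * kappa" using vol(1) by (simp only:)
    fix c assume "c \<in> ?W"
    then obtain \<alpha> where \<alpha>: "\<alpha> \<in> ?S" "c \<in> cell \<alpha> (\<lambda>_. 0)" "c \<in> strip ?\<zeta> 0" by blast
    have cs: "c \<in> space dx" using \<alpha>(2) by (simp add: cell_def)
    have VI: "\<bar>V c $ k\<bar> \<le> real R" if "k \<in> I1" for k
    proof (rule floor_less_bound)
      show "\<lfloor>V c $ k\<rfloor> \<in> {0..<int R}" using \<alpha>(1,2) that by (auto simp: cell_def)
    qed
    have fl: "\<bar>y\<bar> \<le> 1" if "\<lfloor>y\<rfloor> = 0" for y :: real using that by linarith
    have XI: "\<bar>X c $ k\<bar> \<le> 1" if "k \<in> I2" for k using \<alpha>(2) that by (intro fl) (auto simp: cell_def)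
    have Xi: "\<bar>X c $ i\<bar> \<le> 1" if "i \<noteq> j" using \<alpha>(3) that fl[of "- X c $ i"] by (auto simp: strip_def)
    have X2: "\<bar>X c $ k\<bar> \<le> 2" for k
      by (rule X_bound[OF cs]) (use XI Xi in \<open>force+\<close>)
    \<comment> \<open>This entry is prescribed neither by the cell nor by the strip; solving the
      relation bounds it by 2 plus n terms of size at most R.\<close>
    have Vj: "\<bar>V c $ j\<bar> \<le> (real CARD('n) + 2) * real R" if ij: "i \<noteq> j"
    proof -
      have X1: "\<bar>X c $ k\<bar> \<le> 1" for k
        using index_cases(2)[of k] XI[of k] Xi coordinates(3,4)[OF cs] ij by (auto simp: frame_scale_def)
      have "\<bar>X c $ k\<bar> * \<bar>V c $ k\<bar> \<le> 1 * real R" if "k \<noteq> j" for k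
        using index_cases(1)[of k] VI[of k] X1[of k] coordinates(1,2)[OF cs] R that
        by (intro mult_mono) auto
      then have "(\<Sum>k\<in>UNIV - {j}. \<bar>X c $ k\<bar> * \<bar>V c $ k\<bar>) \<le> (\<Sum>k\<in>UNIV - {j}. 1 * real R)"
        by (intro sum_mono) auto
      also have "\<dots> \<le> real CARD('n) * real R" by (simp add: mult_right_mono)
      finally have "\<bar>V c $ j\<bar> \<le> 2 + real CARD('n) * real R" using V_j_bound[OF cs ij] by linarith
      also have "\<dots> \<le> (real CARD('n) + 2) * real R" using R by (simp add: algebra_simps)
      finally show ?thesis .
    qed
    have V2: "\<bar>V c $ k\<bar> \<le> (real CARD('n) + 2) * real R" for k
    proof (rule V_bound[OF cs _ _ Vj])
      have "1 * 1 \<le> (real CARD('n) + 2) * real R" using R by (intro mult_mono) auto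
      then show "1 \<le> (real CARD('n) + 2) * real R" by simp
      have "1 * real R \<le> (real CARD('n) + 2) * real R" by (intro mult_right_mono) auto
      then show "\<bar>V c $ k\<bar> \<le> (real CARD('n) + 2) * real R" if "k \<in> I1" for k using VI[OF that] by linarith
    qed
    have "norm (V c) * norm (X c) \<le> (real CARD('n) * ((real CARD('n) + 2) * real R)) * (real CARD('n) * 2)"
      by (intro mult_mono norm_le_card V2 X2) auto
    also have "\<dots> = 2 * (real CARD('n) * real CARD('n) * (real CARD('n) + 2)) * real R" by simp
    also have "\<dots> \<le> 2 * ((real CARD('n) + 2) * (real CARD('n) + 2) * (real CARD('n) + 2)) * real R"
      by (intro mult_left_mono mult_right_mono mult_mono) auto
    finally show "norm (V c) * norm (X c) \<le> 2 * (real CARD('n) + 2) ^ 3 * real R" by (simp add: power3_eq_cube)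
  qed
qed

text \<open>The roles of \<open>V\<close> and \<open>X\<close> are exchanged, so the strip is taken
  in \<open>V\<close> at \<open>j\<close> and the dependent entry is \<open>X\<close> at
  \<open>i\<close>.\<close>

lemma large_X:
  assumes R: "R \<ge> 1"
  obtains W where "W \<in> sets dx" "emeasure dx W = of_nat (R ^ card I2) * kappa"
    "\<And>c. c \<in> W \<Longrightarrow> norm (V c) * norm (X c) \<le> 2 * (real CARD('n) + 2) ^ 3 * real R"
proof -
  let ?S = "PiE I2 (\<lambda>_. {0..<int R})"
  let ?\<zeta> = "\<lambda>c. V c $ j"
  let ?W = "\<Union>\<beta>\<in>?S. cell (\<lambda>_. 0) \<beta> \<inter> strip ?\<zeta> 0"
  have disj: "cell (\<lambda>_. 0) \<alpha> \<inter> cell (\<lambda>_. 0) \<alpha>' = {}" if "\<alpha> \<in> ?S" "\<alpha>' \<in> ?S" "\<alpha> \<noteq> \<alpha>'" for \<alpha> \<alpha>'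
  proof -
    have "\<exists>k\<in>I2. \<alpha> k \<noteq> \<alpha>' k" using PiE_ext[OF that(1,2)] that(3) by blast
    then show ?thesis by (auto simp: cell_def)
  qed
  have fin: "finite ?S" by (intro finite_PiE) auto
  have vol: "emeasure dx ?W = of_nat (card ?S) * kappa" "?W \<in> sets dx"
    by (rule volume_union[where f = "\<lambda>_ _. 0" and g = "\<lambda>z. z", OF fin equivariant_V]; rule disj; assumption)+
  show ?thesis
  proof (rule that[of ?W])
    show "?W \<in> sets dx" by (rule vol(2))
    have "card ?S = R ^ card I2" by (simp add: card_PiE)
    then show "emeasure dx ?W = of_nat (R ^ card I2) * kappa" using vol(1) by (simp only:)
    fix c assume "c \<in> ?W"
    then obtain \<beta> where \<beta>: "\<beta> \<in> ?S" "c \<in> cell (\<lambda>_. 0) \<beta>" "c \<in> strip ?\<zeta> 0" by blast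
    have cs: "c \<in> space dx" using \<beta>(2) by (simp add: cell_def)
    have XI: "\<bar>X c $ k\<bar> \<le> real R" if "k \<in> I2" for k
    proof (rule floor_less_bound)
      show "\<lfloor>X c $ k\<rfloor> \<in> {0..<int R}" using \<beta>(1,2) that by (auto simp: cell_def)
    qed
    have fl: "\<bar>y\<bar> \<le> 1" if "\<lfloor>y\<rfloor> = 0" for y :: real using that by linarith
    have V1: "\<bar>V c $ k\<bar> \<le> 1" for k
      by (rule V_bound[OF cs]) (use \<beta>(2,3) in \<open>auto simp: cell_def strip_def intro!: fl\<close>)
    have nR: "2 * 1 \<le> (real CARD('n) + 2) * real R" "1 * real R \<le> (real CARD('n) + 2) * real R"
      using R by (intro mult_mono, auto)+
    have Xi: "\<bar>X c $ i\<bar> \<le> (real CARD('n) + 2) * real R" if ij: "i \<noteq> j"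
    proof -
      have "\<bar>X c $ k\<bar> * \<bar>V c $ k\<bar> \<le> real R * 1" if "k \<noteq> i" for k
        using index_cases(2)[of k] XI[of k] V1[of k] coordinates(3,4)[OF cs] R that ij
        by (intro mult_mono) (auto simp: frame_scale_def)
      then have "(\<Sum>k\<in>UNIV - {i}. \<bar>X c $ k\<bar> * \<bar>V c $ k\<bar>) \<le> (\<Sum>k\<in>UNIV - {i}. real R * 1)"
        by (intro sum_mono) auto
      also have "\<dots> \<le> real CARD('n) * real R" by (simp add: mult_right_mono)
      finally have "\<bar>X c $ i\<bar> \<le> 2 + real CARD('n) * real R" using X_i_bound[OF cs] by linarith
      also have "\<dots> \<le> (real CARD('n) + 2) * real R" using R by (simp add: algebra_simps)
      finally show ?thesis .
    qed
    have X2: "\<bar>X c $ k\<bar> \<le> (real CARD('n) + 2) * real R" for k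
    proof (rule X_bound[OF cs _ _ Xi])
      show "2 \<le> (real CARD('n) + 2) * real R" using nR by simp
      show "\<bar>X c $ k\<bar> \<le> (real CARD('n) + 2) * real R" if "k \<in> I2" for k using XI[OF that] nR by linarith
    qed
    have "norm (V c) * norm (X c) \<le> (real CARD('n) * 1) * (real CARD('n) * ((real CARD('n) + 2) * real R))"
      by (intro mult_mono norm_le_card V1 X2) auto
    also have "\<dots> = 1 * (real CARD('n) * real CARD('n) * (real CARD('n) + 2)) * real R" by simp
    also have "\<dots> \<le> 2 * ((real CARD('n) + 2) * (real CARD('n) + 2) * (real CARD('n) + 2)) * real R"
      by (intro mult_right_mono mult_mono) auto
    finally show "norm (V c) * norm (X c) \<le> 2 * (real CARD('n) + 2) ^ 3 * real R" by (simp add: power3_eq_cube)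
  qed
qed

text \<open>For \<open>i = j\<close> the two cardinalities add up to n - 1 and are unequal, so one
  reaches n / 2. For \<open>i \<noteq> j\<close> each violated inequality makes one of them that
  large by itself.\<close>

lemma not_good_dimension:
  assumes "\<not> good i j" shows "CARD('n) \<le> 2 * card I1 \<or> CARD('n) \<le> 2 * card I2"
proof (cases "i = j")
  case True
  then have "2 * pos i + 1 \<noteq> CARD('n)" using assms by (simp add: good_def)
  then show ?thesis unfolding card_I1 card_I2 using True pos_bound[of i] by simp arith
next
  case False
  then have "CARD('n) + 1 < 2 * pos i \<or> 2 * pos j + 3 < CARD('n)" using assms by (auto simp: good_def)
  then show ?thesis unfolding card_I1 card_I2 using False by simp arith
qed

text \<open>The family of sets provides volume of order R^D with D \<ge> n / 2, on which the test
  function is at least of order R^(-s). As D - s is at least 1/4, the integral exceeds every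
  bound.\<close>

lemma not_good_imp_not_integrable:
  assumes ng: "\<not> good i j"
  obtains \<phi> where "schwartz \<phi>" "\<not> integrable dx (\<lambda>c. \<phi> (c <#>\<^bsub>SL\<^esub> H_grp))"
proof -
  define s where "s = (real CARD('n) - 1 / 2) / 2"
  have s: "2 * s = real CARD('n) - 1 / 2" "s > 0" using n3 by (auto simp: s_def)
  have sch: "schwartz (bump s :: 'n sqmat set \<Rightarrow> complex)" by (rule schwartz_bump[OF n2 s(1)])
  have "\<not> integrable dx (\<lambda>c. bump s (c <#>\<^bsub>SL\<^esub> H_grp))"
  proof
    assume int: "integrable dx (\<lambda>c. bump s (c <#>\<^bsub>SL\<^esub> H_grp))"
    define J where "J = (\<integral>\<^sup>+c. ennreal (cmod (bump s (c <#>\<^bsub>SL\<^esub> H_grp))) \<partial>dx)"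
    have J: "J < \<infinity>" using int unfolding integrable_iff_bounded J_def by simp
    define Q where "Q = enn2real J"
    have JQ: "J = ennreal Q" "Q \<ge> 0" using J by (auto simp: Q_def)
    define \<kappa> where "\<kappa> = enn2real kappa"
    have \<kappa>: "kappa = ennreal \<kappa>" "\<kappa> > 0"
      using kappa_finite kappa_pos by (auto simp: \<kappa>_def enn2real_positive_iff zero_less_iff_neq_zero)
    obtain K where K: "K \<ge> 1" "\<And>x. x \<in> N_of b \<Longrightarrow> norm (proj x) \<le> K * (norm (V (N_coset x)) * norm (X (N_coset x)))"
      using norm_proj_bounds by metis
    define L where "L = K * (2 * (real CARD('n) + 2) ^ 3)"
    have L: "L > 0" using K(1) by (simp add: L_def)
    obtain D where D: "CARD('n) \<le> 2 * D" and W: "\<And>R. R \<ge> 1 \<Longrightarrow> \<exists>W. W \<in> sets dx \<and> emeasure dx W = of_nat (R ^ D) * kappa \<and>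
      (\<forall>c\<in>W. norm (V c) * norm (X c) \<le> 2 * (real CARD('n) + 2) ^ 3 * real R)"
    proof -
      consider "CARD('n) \<le> 2 * card I1" | "CARD('n) \<le> 2 * card I2" using not_good_dimension[OF ng] by blast
      then show ?thesis
      proof cases
        case 1 show ?thesis by (rule that[OF 1]) (metis large_V)
      next
        case 2 show ?thesis by (rule that[OF 2]) (metis large_X)
      qed
    qed
    \<comment> \<open>Markov's inequality on \<open>W\<close>, with the surplus exponent weakened to
      1/4.\<close>
    have key: "L powr (- s) * \<kappa> * real R powr (1 / 4) \<le> Q" if R: "R \<ge> 1" for R :: nat
    proof -
      obtain W where W: "W \<in> sets dx" "emeasure dx W = of_nat (R ^ D) * kappa"
        "\<And>c. c \<in> W \<Longrightarrow> norm (V c) * norm (X c) \<le> 2 * (real CARD('n) + 2) ^ 3 * real R"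
        using W[OF R] by blast
      let ?m = "(L * real R) powr (- s)"
      have low: "?m \<le> cmod (bump s (c <#>\<^bsub>SL\<^esub> H_grp))" if c: "c \<in> W" for c
      proof -
        obtain x where x: "x \<in> N_of b" "c = N_coset x" using c sets.sets_into_space[OF W(1)] by (auto simp: space_dx)
        have "norm (proj x) \<le> K * (norm (V c) * norm (X c))" using K(2)[OF x(1)] x(2) by simp
        also have "\<dots> \<le> K * (2 * (real CARD('n) + 2) ^ 3 * real R)" using W(3)[OF c] K(1) by (intro mult_left_mono) auto
        finally have "norm (proj x) \<le> L * real R" by (simp add: L_def mult_ac)
        then have "?m \<le> norm (proj x) powr (- s)"
          using proj_norm_pos(1)[OF n2 N_invertible[OF x(1)]] s(2) by (intro powr_mono2') auto
        also have "\<dots> = cmod (bump s (c <#>\<^bsub>SL\<^esub> H_grp))"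
          using x by (simp add: N_coset_set_mult bump_def coset_proj_coset[OF n2 N_invertible[OF x(1)]])
        finally show ?thesis .
      qed
      have "ennreal ?m * emeasure dx W = (\<integral>\<^sup>+c. ennreal ?m * indicator W c \<partial>dx)"
        using W(1) by (simp add: nn_integral_cmult_indicator)
      also have "\<dots> \<le> J"
        unfolding J_def by (intro nn_integral_mono) (auto simp: indicator_def intro!: ennreal_leI low)
      finally have "ennreal (?m * (real (R ^ D) * \<kappa>)) \<le> ennreal Q"
        using \<kappa>(2) unfolding W(2) \<kappa>(1) JQ(1) ennreal_of_nat_eq_real_of_nat by (simp add: ennreal_mult)
      then have le: "?m * (real (R ^ D) * \<kappa>) \<le> Q" using JQ(2) by (simp add: ennreal_le_iff)
      have "real R powr (1 / 4) \<le> real R powr (real D - s)"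
      proof (rule powr_mono)
        have "real CARD('n) \<le> 2 * real D" using D by (metis of_nat_le_iff of_nat_mult of_nat_numeral)
        then show "1 / 4 \<le> real D - s" using s(1) by linarith
      qed (use R in simp)
      also have "\<dots> = real R powr (- s) * real (R ^ D)"
        using R by (simp add: powr_realpow flip: powr_add)
          (simp add: powr_diff powr_minus_divide powr_realpow)
      finally have "L powr (- s) * \<kappa> * real R powr (1 / 4) \<le> L powr (- s) * \<kappa> * (real R powr (- s) * real (R ^ D))"
        using \<kappa>(2) by (intro mult_left_mono) auto
      also have "\<dots> = ?m * (real (R ^ D) * \<kappa>)" using L by (simp add: powr_mult)
      finally show ?thesis using le by linarith
    qed
    \<comment> \<open>With \<open>R\<close> at least the fourth power of \<open>q\<close>, the left
      side of \<open>key\<close> would be at least \<open>Q\<close> plus a positive amount.\<close>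
    define q where "q = Q / (L powr (- s) * \<kappa>) + 1"
    have c0: "L powr (- s) * \<kappa> > 0" using L \<kappa>(2) by simp
    have q0: "q \<ge> 1" using JQ(2) c0 by (simp add: q_def)
    obtain R :: nat where R: "q powr 4 \<le> real R" using real_arch_simple by blast
    have "1 \<le> q powr 4" using q0 by (simp add: ge_one_powr_ge_zero)
    then have R1: "R \<ge> 1" using R by linarith
    have "q = (q powr 4) powr (1 / 4)" unfolding powr_powr using q0 by simp
    also have "\<dots> \<le> real R powr (1 / 4)" using R by (intro powr_mono2) auto
    finally have "L powr (- s) * \<kappa> * q \<le> L powr (- s) * \<kappa> * real R powr (1 / 4)" using c0 by (intro mult_left_mono) auto
    also have "\<dots> \<le> Q" by (rule key[OF R1])
    finally have "L powr (- s) * \<kappa> * q \<le> Q" .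
    moreover have "a * (Q / a + 1) = Q + a" if "a > 0" for a using that by (simp add: distrib_left)
    then have "L powr (- s) * \<kappa> * q = Q + L powr (- s) * \<kappa>" unfolding q_def using c0 by blast
    ultimately show False using c0 by linarith
  qed
  then show ?thesis using that sch by blast
qed

lemma integrable_iff_good:
  "(\<forall>\<phi>. schwartz \<phi> \<longrightarrow> integrable dx (\<lambda>c. \<phi> (c <#>\<^bsub>SL\<^esub> H_grp))) \<longleftrightarrow> good i j"
  using good_imp_integrable not_good_imp_not_integrable by metis

end

theorem theorem3p1:
  fixes P N :: "('n::{finite,linorder}) sqmat set"
    and dx :: "'n sqmat set measure"
  assumes "CARD('n) \<ge> 3"
    and "minimal_parabolic P"
    and "N = unipotent_radical P"
    and "radon_measure_on (coset_topology N (N \<inter> H_grp)) dx"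
    and "invariant_measure N dx"
    and "emeasure dx (space dx) \<noteq> 0"
  shows "(\<forall>\<phi>. schwartz \<phi> \<longrightarrow> integrable dx (\<lambda>c. \<phi> (c <#>\<^bsub>SL\<^esub> H_grp))) \<longleftrightarrow> h_compatible P"
proof -
  have n2: "CARD('n) \<ge> 2" using assms(1) by simp
  obtain b i j where f: "frame b i j" and P: "P = P_of b"
    using minimal_parabolic_frame[OF n2 assms(2)] .
  \<comment> \<open>Stated for every frame of \<open>P\<close>: one direction applies it to the
    frame of the flag, the other to the frame supplied by the stable split component that witnesses
    compatibility.\<close>
  have crit: "(\<forall>\<phi>. schwartz \<phi> \<longrightarrow> integrable dx (\<lambda>c. \<phi> (c <#>\<^bsub>SL\<^esub> H_grp))) \<longleftrightarrow> good k l"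
    if f': "frame b' k l" "P = P_of b'" for b' k l
  proof -
    have "N = N_of b'" using assms(3) unipotent_radical_P_of[OF frameD(1)[OF f'(1)]] f'(2) by simp
    then interpret orbit b' k l dx using assms f' by unfold_locales auto
    show ?thesis by (rule integrable_iff_good)
  qed
  show ?thesis
  proof
    assume "\<forall>\<phi>. schwartz \<phi> \<longrightarrow> integrable dx (\<lambda>c. \<phi> (c <#>\<^bsub>SL\<^esub> H_grp))"
    then have "good i j" using crit[OF f P] by blast
    then show "h_compatible P" using good_imp_h_compatible[OF n2 f] P by simp
  next
    assume "h_compatible P"
    then obtain b' k l where "frame b' k l" "P_of b' = P_of b" "good k l"
      using h_compatible_imp_good[OF n2 frameD(1)[OF f]] P by metis
    then show "\<forall>\<phi>. schwartz \<phi> \<longrightarrow> integrable dx (\<lambda>c. \<phi> (c <#>\<^bsub>SL\<^esub> H_grp))"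
      using crit[of b' k l] P by simp
  qed
qed

end
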